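(* Let $\alpha,\alpha',\beta,\beta',\gamma,\rho,a\in\mathbb{C}$ with $\operatorname{Re}(\gamma)>0$ and $a\ne0$, put $N=[\operatorname{Re}(\gamma)]+1$, and let $\mu$ be a real number, such that $\mu>0$ and $\operatorname{Re}(\rho)+N>\max\{\operatorname{Re}(-\beta'),\operatorname{Re}(\alpha'+\beta-\gamma),\operatorname{Re}(\alpha+\alpha'-\gamma)+N\}$. Then for every $x>0$, $$\left({}^{c}\mathcal{D}_{-}^{\alpha,\alpha',\beta,\beta',\gamma}\left(t^{-\rho}I^{m,n}_{p,q}\left[at^{-\mu}\,\middle|\begin{matrix}(a_i,A_i,\alpha_i)_{1,p}\\(b_j,B_j,\beta_j)_{1,q}\end{matrix}\right]\right)\right)(x)=x^{\alpha+\alpha'-\gamma-\rho}\,I^{m,n+3}_{p+3,q+3}\left[ax^{-\mu}\,\middle|\begin{matrix}U\\L\end{matrix}\right],$$ where the list of upper triples is $$U=(1-\beta'-\rho-N,\mu,1),\ (1+\alpha+\alpha'-\gamma-\rho,\mu,1),\ (1+\alpha'+\beta-\gamma-\rho-N,\mu,1),\ (a_i,A_i,\alpha_i)_{1,p}$$ and the list of lower triples is $$L=(b_j,B_j,\beta_j)_{1,q},\ (1-\rho,\mu,1),\ (1+\alpha'-\beta'-\rho-N,\mu,1),\ (1+\alpha+\alpha'+\beta-\gamma-\rho-N,\mu,1).$$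
   Context: **$I$-function.** Let $m,n,p,q$ be integers with $0\le m\le q$, $0\le n\le p$; let $a_i\in\mathbb{C}$, $A_i,\alpha_i>0$ $(1\le i\le p)$ and $b_j\in\mathbb{C}$, $B_j,\beta_j>0$ $(1\le j\le q)$. For $z\neq0$ (with a chosen value of $\arg z$; $z^{-s}=e^{-s(\log|z|+i\arg z)}$), $$I^{m,n}_{p,q}\left[z\,\middle|\begin{matrix}(a_i,A_i,\alpha_i)_{1,p}\\(b_j,B_j,\beta_j)_{1,q}\end{matrix}\right]=\frac{1}{2\pi i}\int_{C}\chi(s)z^{-s}\,ds,\qquad \chi(s)=\frac{\prod_{j=1}^{m}\Gamma^{\beta_j}(b_j+B_js)\prod_{i=1}^{n}\Gamma^{\alpha_i}(1-a_i-A_is)}{\prod_{j=m+1}^{q}\Gamma^{\beta_j}(1-b_j-B_js)\prod_{i=n+1}^{p}\Gamma^{\alpha_i}(a_i+A_is)}.$$ Here $(a_i,A_i,\alpha_i)_{1,p}$ is the ordered list of triples for $i=1,\dots,p$ (the first $n$ upper triples and the first $m$ lower triples enter the numerator), $\Gamma^{\kappa}(w)=(\Gamma(w))^{\kappa}$, with the branch of non-integer powers fixed along $C$ and the same for the same triple in all $I$-functions considered; empty products equal $1$. The singularities of $\Gamma^{\beta_j}(b_j+B_js)$, $j\le m$, lie to the left of $C$ and those of $\Gamma^{\alpha_i}(1-a_i-A_is)$, $i\le n$, to the right. **Standing assumptions.** The contour $C$ is the imaginary axis $\operatorname{Re}(s)=0$, traversed upwards, and for each $I$-function occurring the following conditions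 for absolute convergence hold: with (computed from the parameters of that $I$-function) $\mu^*=\sum_{j=1}^q\beta_jB_j-\sum_{i=1}^p\alpha_iA_i$, $\Omega=\sum_{i=1}^p(\frac12-\operatorname{Re}(a_i))\alpha_i-\sum_{j=1}^q(\frac12-\operatorname{Re}(b_j))\beta_j$, $\Delta=\sum_{j=1}^m\beta_jB_j-\sum_{j=m+1}^q\beta_jB_j+\sum_{i=1}^n\alpha_iA_i-\sum_{i=n+1}^p\alpha_iA_i$, either $\Delta>0$ and $|\arg z|<\frac{\pi}{2}\Delta$, or $\Delta\ge0$, $|\arg z|=\frac{\pi}{2}\Delta$ and one of: $\mu^*=0$ and $\Omega<-1$; or $\mu^*\ne0$ and $\Omega+\sigma\mu^*<-1$ where $\sigma=\operatorname{Re}(s)$ on $C$ (so $\sigma=0$). For $t>0$, $\arg(at^{\pm\mu})=\arg a$. **Operators.** For $\operatorname{Re}(\gamma)>0$, $x>0$, the right-sided Marichev–Saigo–Maeda (MSM) fractional integral is $$\left(\mathcal{I}_{-}^{\alpha,\alpha',\beta,\beta',\gamma}f\right)(x)=\frac{x^{-\alpha'}}{\Gamma(\gamma)}\int_x^{\infty}(t-x)^{\gamma-1}t^{-\alpha}F_3\left(\alpha,\alpha',\beta,\beta';\gamma;1-\tfrac{x}{t},1-\tfrac{t}{x}\right)f(t)\,dt ,$$ and the right-sided Caputo-type MSM fractional derivative, applied to functions $f$ that are $N$ times differentiable on $(0,\infty)$, is $$\left({}^{c}\mathcal{D}_{-}^{\alpha,\alpha',\beta,\beta',\gamma}f\right)(x)=(-1)^N\left(\mathcal{I}_{-}^{-\alpha',-\alpha,-\beta',-\beta+N,-\gamma+N}f^{(N)}\right)(x),\qquad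 N=[\operatorname{Re}(\gamma)]+1,$$ with $[\cdot]$ the integer part and $f^{(N)}$ the $N$-th derivative. $F_3(\alpha,\alpha',\beta,\beta';\gamma;u,v)=\sum_{k,l\ge0}\frac{(\alpha)_k(\alpha')_l(\beta)_k(\beta')_l}{(\gamma)_{k+l}}\frac{u^kv^l}{k!\,l!}$ for $\max\{|u|,|v|\}<1$ (third Appell function, $(\cdot)_k$ the Pochhammer symbol), and for $u\in[0,1)$, $v\le0$ it denotes the analytic continuation $\sum_{k\ge0}\frac{(\alpha)_k(\beta)_k}{(\gamma)_k}\frac{u^k}{k!}\,{}_2F_1(\alpha',\beta';\gamma+k;v)$. *)

theory Defs
  imports "HOL-Complex_Analysis.Complex_Analysis"
begin

section \<open>Hypergeometric functions\<close>

definition hyp2F1_series :: "complex \<Rightarrow> complex \<Rightarrow> complex \<Rightarrow> complex \<Rightarrow> complex" where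
  "hyp2F1_series a b c z =
     (\<Sum>k. pochhammer a k * pochhammer b k / pochhammer c k * z ^ k / fact k)"

text \<open>
  Gauss' function on the complex plane cut along the real half-line from 1 to infinity, as the
  analytic continuation of its power series along the segment from 0 to z. By the identity theorem
  the value does not depend on the open convex set S, and every z off the cut lies in some S to
  which the series extends.
\<close>
definition hyp2F1 :: "complex \<Rightarrow> complex \<Rightarrow> complex \<Rightarrow> complex \<Rightarrow> complex" where
  "hyp2F1 a b c z = (THE y. \<exists>S F. open S \<and> convex S \<and> 0 \<in> S \<and> z \<in> S \<and> F holomorphic_on S \<and>
      (\<forall>w\<in>S \<inter> ball 0 1. F w = hyp2F1_series a b c w) \<and> y = F z)"

text \<open>
  The third Appell function. The first branch is its analytic continuation to real u in [0,1) and
  real v at most 0; the second is the double series, meant for norm u < 1 and norm v < 1. They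
  agree where both apply.
\<close>
definition appell_F3 ::
  "complex \<Rightarrow> complex \<Rightarrow> complex \<Rightarrow> complex \<Rightarrow> complex \<Rightarrow> complex \<Rightarrow> complex \<Rightarrow> complex" where
  "appell_F3 \<alpha> \<alpha>' \<beta> \<beta>' \<gamma> u v =
     (if u \<in> \<real> \<and> 0 \<le> Re u \<and> Re u < 1 \<and> v \<in> \<real> \<and> Re v \<le> 0
      then \<Sum>k. pochhammer \<alpha> k * pochhammer \<beta> k / pochhammer \<gamma> k * u ^ k / fact k
                * hyp2F1 \<alpha>' \<beta>' (\<gamma> + of_nat k) v
      else \<Sum>\<^sub>\<infinity>(k, l)\<in>UNIV. pochhammer \<alpha> k * pochhammer \<alpha>' l * pochhammer \<beta> k * pochhammer \<beta>' l
                / pochhammer \<gamma> (k + l) * u ^ k * v ^ l / (fact k * fact l))"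


section \<open>Marichev--Saigo--Maeda operators\<close>

text \<open>
  The integral is the Henstock--Kurzweil integral: it equals the Lebesgue integral whenever the
  latter exists, and it also covers integrals that converge only conditionally at x or at infinity.
\<close>
definition MSM_right_integral ::
  "complex \<Rightarrow> complex \<Rightarrow> complex \<Rightarrow> complex \<Rightarrow> complex \<Rightarrow> (real \<Rightarrow> complex) \<Rightarrow> real \<Rightarrow> complex" where
  "MSM_right_integral \<alpha> \<alpha>' \<beta> \<beta>' \<gamma> f x =
     of_real x powr (-\<alpha>') / Gamma \<gamma> *
     integral {x<..} (\<lambda>t. of_real (t - x) powr (\<gamma> - 1) * of_real t powr (-\<alpha>) *
        appell_F3 \<alpha> \<alpha>' \<beta> \<beta>' \<gamma> (of_real (1 - x / t)) (of_real (1 - t / x)) * f t)"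

definition nth_derivative :: "nat \<Rightarrow> (real \<Rightarrow> complex) \<Rightarrow> real \<Rightarrow> complex" where
  "nth_derivative k = (\<lambda>g t. vector_derivative g (at t)) ^^ k"

definition times_differentiable :: "nat \<Rightarrow> (real \<Rightarrow> complex) \<Rightarrow> bool" where
  "times_differentiable N f \<longleftrightarrow> (\<forall>k<N. \<forall>t>0. nth_derivative k f differentiable (at t))"

definition Caputo_order :: "complex \<Rightarrow> nat" where
  "Caputo_order \<gamma> = nat \<lfloor>Re \<gamma>\<rfloor> + 1"

text \<open>The operator is meant for Re \<gamma> > 0 and times_differentiable (Caputo_order \<gamma>) f.\<close>
definition MSM_Caputo_right_derivative ::
  "complex \<Rightarrow> complex \<Rightarrow> complex \<Rightarrow> complex \<Rightarrow> complex \<Rightarrow> (real \<Rightarrow> complex) \<Rightarrow> real \<Rightarrow> complex" where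
  "MSM_Caputo_right_derivative \<alpha> \<alpha>' \<beta> \<beta>' \<gamma> f x =
     (let N = Caputo_order \<gamma> in
      (-1) ^ N * MSM_right_integral (-\<alpha>') (-\<alpha>) (-\<beta>') (-\<beta> + of_nat N) (-\<gamma> + of_nat N)
                   (nth_derivative N f) x)"


section \<open>The I-function\<close>

text \<open>
  A triple (a, A, \<kappa>) is an entry of a parameter list; p and q are the lengths of the upper and the
  lower list. The contour is the imaginary axis.

  A branch selector G chooses the powers of the Gamma function along the contour: G c D \<kappa> s is the
  value of Gamma(c + D s) to the power \<kappa>, with D = B or -B for a lower and D = A or -A for an upper
  triple, so that it depends only on the triple and on its role. Away from the poles of the Gamma
  factor it is exp (\<kappa> l(s)) for a continuous logarithm l. A pole can lie on the contour only for a
  factor of the denominator; the value 0 there makes the reciprocal, and with it the integrand, 0,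
  since division by 0 yields 0.
\<close>
type_synonym triple = "complex \<times> real \<times> real"
type_synonym branch_selector = "complex \<Rightarrow> real \<Rightarrow> real \<Rightarrow> complex \<Rightarrow> complex"

definition gamma_power_branch :: "branch_selector \<Rightarrow> bool" where
  "gamma_power_branch G \<longleftrightarrow> (\<forall>c D \<kappa>. D \<noteq> 0 \<and> \<kappa> > 0 \<longrightarrow>
     (\<exists>l. continuous_on {s. Re s = 0 \<and> c + of_real D * s \<notin> \<int>\<^sub>\<le>\<^sub>0} l \<and>
        (\<forall>s. Re s = 0 \<longrightarrow>
           (if c + of_real D * s \<notin> \<int>\<^sub>\<le>\<^sub>0
            then exp (l s) = Gamma (c + of_real D * s) \<and> G c D \<kappa> s = exp (of_real \<kappa> * l s)
            else G c D \<kappa> s = 0))))"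

definition I_kernel ::
  "branch_selector \<Rightarrow> nat \<Rightarrow> nat \<Rightarrow> triple list \<Rightarrow> triple list \<Rightarrow> complex \<Rightarrow> complex" where
  "I_kernel G m n up lo s =
     ((\<Prod>(b, B, \<kappa>)\<leftarrow>take m lo. G b B \<kappa> s) * (\<Prod>(a, A, \<kappa>)\<leftarrow>take n up. G (1 - a) (-A) \<kappa> s)) /
     ((\<Prod>(b, B, \<kappa>)\<leftarrow>drop m lo. G (1 - b) (-B) \<kappa> s) * (\<Prod>(a, A, \<kappa>)\<leftarrow>drop n up. G a A \<kappa> s))"

text \<open>
  The argument \<theta> is the chosen value of arg z. The contour is parametrised by s = \<i> \<tau>.
\<close>
definition I_function ::
  "branch_selector \<Rightarrow> nat \<Rightarrow> nat \<Rightarrow> triple list \<Rightarrow> triple list \<Rightarrow> real \<Rightarrow> complex \<Rightarrow> complex" where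
  "I_function G m n up lo \<theta> z =
     1 / (2 * of_real pi * \<i>) *
     (LINT \<tau>|lborel. I_kernel G m n up lo (\<i> * of_real \<tau>) *
        exp (- (\<i> * of_real \<tau>) * (of_real (ln (norm z)) + \<i> * of_real \<theta>)) * \<i>)"

text \<open>The last two conjuncts say on which side of the contour the singularities of the factors of
  the numerator lie.\<close>
definition I_parameters :: "nat \<Rightarrow> nat \<Rightarrow> triple list \<Rightarrow> triple list \<Rightarrow> bool" where
  "I_parameters m n up lo \<longleftrightarrow>
     m \<le> length lo \<and> n \<le> length up \<and>
     (\<forall>(a, A, \<kappa>)\<in>set up. A > 0 \<and> \<kappa> > 0) \<and> (\<forall>(b, B, \<kappa>)\<in>set lo. B > 0 \<and> \<kappa> > 0) \<and>
     (\<forall>(b, B, \<kappa>)\<in>set (take m lo). \<forall>s. b + of_real B * s \<in> \<int>\<^sub>\<le>\<^sub>0 \<longrightarrow> Re s < 0) \<and>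
     (\<forall>(a, A, \<kappa>)\<in>set (take n up). \<forall>s. 1 - a - of_real A * s \<in> \<int>\<^sub>\<le>\<^sub>0 \<longrightarrow> Re s > 0)"

definition I_mu_star :: "triple list \<Rightarrow> triple list \<Rightarrow> real" where
  "I_mu_star up lo = (\<Sum>(b, B, \<kappa>)\<leftarrow>lo. \<kappa> * B) - (\<Sum>(a, A, \<kappa>)\<leftarrow>up. \<kappa> * A)"

definition I_Omega :: "triple list \<Rightarrow> triple list \<Rightarrow> real" where
  "I_Omega up lo = (\<Sum>(a, A, \<kappa>)\<leftarrow>up. (1/2 - Re a) * \<kappa>) - (\<Sum>(b, B, \<kappa>)\<leftarrow>lo. (1/2 - Re b) * \<kappa>)"

definition I_Delta :: "nat \<Rightarrow> nat \<Rightarrow> triple list \<Rightarrow> triple list \<Rightarrow> real" where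
  "I_Delta m n up lo =
     (\<Sum>(b, B, \<kappa>)\<leftarrow>take m lo. \<kappa> * B) - (\<Sum>(b, B, \<kappa>)\<leftarrow>drop m lo. \<kappa> * B) +
     (\<Sum>(a, A, \<kappa>)\<leftarrow>take n up. \<kappa> * A) - (\<Sum>(a, A, \<kappa>)\<leftarrow>drop n up. \<kappa> * A)"

text \<open>
  Absolute convergence. The general condition for a nonzero I_mu_star is
  I_Omega + \<sigma> I_mu_star < -1 on the contour Re s = \<sigma>; here \<sigma> = 0, so it reads like the condition for
  I_mu_star = 0.
\<close>
definition I_convergent :: "nat \<Rightarrow> nat \<Rightarrow> triple list \<Rightarrow> triple list \<Rightarrow> real \<Rightarrow> bool" where
  "I_convergent m n up lo \<theta> \<longleftrightarrow>
     I_Delta m n up lo > 0 \<and> \<bar>\<theta>\<bar> < pi / 2 * I_Delta m n up lo \<or>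
     I_Delta m n up lo \<ge> 0 \<and> \<bar>\<theta>\<bar> = pi / 2 * I_Delta m n up lo \<and>
       (let \<sigma> = 0 in
        I_mu_star up lo = 0 \<and> I_Omega up lo < -1 \<or>
        I_mu_star up lo \<noteq> 0 \<and> I_Omega up lo + \<sigma> * I_mu_star up lo < -1)"

end

theory Submission
  imports Defs "HOL-Real_Asymp.Real_Asymp"
begin

text \<open>
  Put C = N - \<gamma>, A = -\<alpha>', A' = -\<alpha>, B = -\<beta>', B' = N - \<beta>; then 0 < Re C \<le> 1. On the contour s = \<i>\<tau> the
  function to be differentiated is a superposition of the powers t powr (-\<rho> + \<i>\<mu>\<tau>). Differentiating
  N times multiplies such a power by (-1)^N times the Pochhammer symbol of \<rho> - \<i>\<mu>\<tau> of length N and by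
  t powr (-N), and the fractional integral sends a power to a multiple of a power. The theorem says that the
  product of these multipliers is the quotient of the six additional Gamma factors of the larger
  I-function (I_kernel_extend). Two things need proof: the value of the multiplier of the fractional
  integral, and the exchange of the fractional integral with the contour integral.

  The multiplier. In the kernel the arguments of the third Appell function are u = 1 - 1/t and v = 1 - t,
  after scaling x to 1, and v / (v - 1) = u. Pfaff's transformation (hyp2F1_Pfaff) of the inner
  Gauss functions therefore turns the iterated series into a power of t times a single power series in
  1 - 1/t (appell_F3_eq). The substitution t = x / (1 - w) makes the multiplier the integral over
  the unit interval of this series in w against w^(C-1) (1-w)^(z-1). Integrating termwise gives a double
  series, which two applications of Gauss' summation theorem (Gauss_summation) evaluate
  (F3_moment_pos). This series converges absolutely if Re A' > 0; a contiguous relation raising A',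
  satisfied by the power series and by the product of Gamma functions, yields the general case (F3_moment).

  The exchange. By Stirling's formula (Stirling_vertical) the integrand of the I-function is bounded by
  a multiple of (1 + |\<tau>|)^\<Omega> exp(-\<delta>|\<tau>|) with \<delta> = \<pi>\<Delta>/2 - |\<theta>| (I_kernel_growth, I_integrand_bound).
  If \<delta> > 0, everything converges. On the boundary \<delta> = 0 only the power remains. The larger I-function
  has the same \<Delta>, and its \<Omega> is larger by Re \<gamma>, so that its convergence provides \<Omega> < -1 - Re \<gamma>. This
  allows N - 1 differentiations under the contour integral, but after the N-th one the contour integral need
  not converge absolutely. So let g be the derivative of order N - 1, write each power of exponent e as
  the derivative of the power of exponent e + 1 divided by e + 1, and integrate by parts against the
  kernel K. Since K behaves like (t - x)^(C-1) near x, the oscillation in \<tau> gains a factor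
  (1 + |\<tau>|)^(-\<eta>) for every \<eta> < Re C, uniformly in the upper limit t of the integral
  (J_oscillation_bound). This is just enough to make the superposition Phi of the integrals over
  (x, t) converge absolutely and to make it continuous up to t = x and t = \<infinity>. Its derivative is K times
  the derivative of g, and the fundamental theorem of calculus for the Henstock--Kurzweil integral
  identifies the fractional integral with Phi at infinity (has_integral_superposition).
\<close>


section \<open>Double series and growth of Pochhammer symbols\<close>

lemma double_series_diagonal_has_sum:
  fixes c :: "nat \<Rightarrow> nat \<Rightarrow> complex"
  assumes "summable (\<lambda>n. \<Sum>k\<le>n. norm (c k (n - k)))"
  shows "((\<lambda>(k, j). c k j) has_sum (\<Sum>n. \<Sum>k\<le>n. c k (n - k))) UNIV"
    and "(\<lambda>x. norm (case x of (k, j) \<Rightarrow> c k j)) summable_on UNIV"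
proof -
  define D where "D = (SIGMA n:UNIV. {..n::nat})"
  define h where "h = (\<lambda>(n::nat, k::nat). (k, n - k))"
  have bij: "bij_betw h D UNIV"
    by (rule bij_betw_byWitness[where f' = "\<lambda>(k, j). (k + j, k)"]) (auto simp: D_def h_def)
  have "(\<lambda>x. norm (case x of (n, k) \<Rightarrow> c k (n - k))) summable_on D"
    unfolding D_def
  proof (rule iffD2[OF Infinite_Sum.abs_summable_on_Sigma_iff], intro conjI ballI)
    show "(\<lambda>n. norm (infsum (\<lambda>k. norm (case (n, k) of (n, k) \<Rightarrow> c k (n - k))) {..n})) summable_on UNIV"
      using assms by (intro norm_summable_imp_summable_on) (simp add: sum_nonneg abs_of_nonneg)
  qed auto
  then have abs_D: "(\<lambda>x. norm (case h x of (k, j) \<Rightarrow> c k j)) summable_on D"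
    by (simp add: h_def case_prod_unfold)
  have eq: "(\<lambda>(n, k). c k (n - k)) = (\<lambda>x. (\<lambda>(k, j). c k j) (h x))"
    by (auto simp: h_def)
  show abs: "(\<lambda>x. norm (case x of (k, j) \<Rightarrow> c k j)) summable_on UNIV"
    using summable_on_reindex_bij_betw[OF bij, of "\<lambda>x. norm (case x of (k, j) \<Rightarrow> c k j)"] abs_D
    by blast
  have "(\<lambda>(k, j). c k j) summable_on UNIV"
    using abs by (rule Infinite_Sum.abs_summable_summable)
  then obtain S where S: "((\<lambda>(k, j). c k j) has_sum S) UNIV"
    by (auto simp: summable_on_def)
  then have "((\<lambda>(n, k). c k (n - k)) has_sum S) D"
    unfolding eq using has_sum_reindex_bij_betw[OF bij] by blast
  then have "((\<lambda>n. \<Sum>k\<le>n. c k (n - k)) has_sum S) UNIV"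
    unfolding D_def by (rule has_sum_SigmaD) (auto intro!: has_sum_finite)
  then have "(\<lambda>n. \<Sum>k\<le>n. c k (n - k)) sums S"
    by (rule has_sum_imp_sums)
  with S show "((\<lambda>(k, j). c k j) has_sum (\<Sum>n. \<Sum>k\<le>n. c k (n - k))) UNIV"
    by (simp add: sums_iff)
qed

lemma double_series_diagonal:
  fixes c :: "nat \<Rightarrow> nat \<Rightarrow> complex"
  assumes "summable (\<lambda>n. \<Sum>k\<le>n. norm (c k (n - k)))"
  shows "summable (\<lambda>j. c k j)"
    and "(\<lambda>k. \<Sum>j. c k j) sums (\<Sum>n. \<Sum>k\<le>n. c k (n - k))"
proof -
  note hs = double_series_diagonal_has_sum[OF assms]
  have abs: "(\<lambda>j. norm (c k j)) summable_on UNIV" for k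
    using hs(2) Infinite_Sum.abs_summable_on_Sigma_iff[of "\<lambda>(k, j). c k j" UNIV "\<lambda>_. UNIV"] by simp
  have sm: "(\<lambda>j. c k j) summable_on UNIV" for k
    using abs by (rule Infinite_Sum.abs_summable_summable)
  then show "summable (\<lambda>j. c k j)"
    by (rule summable_on_imp_summable)
  have row: "((\<lambda>j. c k j) has_sum (\<Sum>j. c k j)) UNIV" for k
    using has_sum_infsum[OF sm[of k]] sums_unique[OF has_sum_imp_sums[OF has_sum_infsum[OF sm[of k]]]]
    by simp
  have "((\<lambda>k. \<Sum>j. c k j) has_sum (\<Sum>n. \<Sum>k\<le>n. c k (n - k))) UNIV"
    by (rule has_sum_SigmaD[where B = "\<lambda>_. UNIV" and f = "\<lambda>(k, j). c k j"])
       (use hs(1) row in simp_all)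
  then show "(\<lambda>k. \<Sum>j. c k j) sums (\<Sum>n. \<Sum>k\<le>n. c k (n - k))"
    by (rule has_sum_imp_sums)
qed

text \<open>
  Euler's limit formula for the Gamma function, in a form that also covers the poles of Gamma, where the
  Pochhammer symbols are eventually 0. The shift n + 1 makes the power positive for every n.
\<close>
lemma pochhammer_growth_limit:
  fixes z :: complex
  shows "(\<lambda>n. norm (pochhammer z n) * real (n + 1) powr (1 - Re z) / fact n) \<longlonglongrightarrow> norm (rGamma z)"
proof (cases "z \<in> \<int>\<^sub>\<le>\<^sub>0")
  case True
  then obtain m where m: "z = - of_nat m" by (auto elim!: nonpos_Ints_cases')
  have "\<forall>\<^sub>F n in sequentially. norm (pochhammer z n) * real (n + 1) powr (1 - Re z) / fact n = 0"
    using eventually_gt_at_top[of m] by eventually_elim (auto simp: m pochhammer_of_nat_eq_0_iff)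
  from tendsto_eventually[OF this] show ?thesis using True by (simp add: rGamma_eq_zero_iff[THEN iffD2])
next
  case False
  have "(\<lambda>n. inverse (norm (Gamma_series' z n))) \<longlonglongrightarrow> inverse (norm (Gamma z))"
    using False by (intro tendsto_intros Gamma_series'_LIMSEQ) (auto simp: Gamma_eq_zero_iff)
  moreover have "(\<lambda>n. (real (n + 1) / real n) powr (1 - Re z)) \<longlonglongrightarrow> 1"
    by real_asymp
  ultimately have "(\<lambda>n. inverse (norm (Gamma_series' z n)) * (real (n + 1) / real n) powr (1 - Re z))
      \<longlonglongrightarrow> inverse (norm (Gamma z)) * 1" by (rule tendsto_mult)
  also have "inverse (norm (Gamma z)) * 1 = norm (rGamma z)"
    by (simp add: rGamma_inverse_Gamma norm_inverse)
  finally show ?thesis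
  proof (rule Lim_transform_eventually)
    show "\<forall>\<^sub>F n in sequentially. inverse (norm (Gamma_series' z n)) * (real (n + 1) / real n) powr (1 - Re z)
        = norm (pochhammer z n) * real (n + 1) powr (1 - Re z) / fact n"
      using eventually_gt_at_top[of 0]
    proof eventually_elim
      case (elim n)
      have "fact n = real n * fact (n - 1)" using elim by (rule fact_reduce)
      moreover have "real n powr Re z * real n powr (1 - Re z) = real n"
        using elim by (simp flip: powr_add)
      ultimately show ?case using elim
        by (simp add: Gamma_series'_def norm_mult norm_divide powr_divide norm_exp_eq_Re
            field_simps powr_def[of "real n"])
    qed
  qed
qed

lemma pochhammer_upper_bound:
  fixes z :: complex
  obtains M where "M > 0" "\<And>n. norm (pochhammer z n) \<le> M * fact n * real (n + 1) powr (Re z - 1)"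
proof -
  have "Bseq (\<lambda>n. norm (pochhammer z n) * real (n + 1) powr (1 - Re z) / fact n)"
    using pochhammer_growth_limit[of z] by (intro convergent_imp_Bseq) (auto simp: convergent_def)
  then obtain M where M: "M > 0"
      "\<And>n. norm (norm (pochhammer z n) * real (n + 1) powr (1 - Re z) / fact n) \<le> M"
    by (auto simp: Bseq_def)
  have "norm (pochhammer z n) \<le> M * fact n * real (n + 1) powr (Re z - 1)" for n
  proof -
    have "norm (pochhammer z n) * real (n + 1) powr (1 - Re z) / fact n \<le> M"
      using M(2)[of n] by simp
    then have "norm (pochhammer z n) * real (n + 1) powr (1 - Re z) \<le> M * fact n"
      by (simp add: field_simps)
    then have "norm (pochhammer z n) * real (n + 1) powr (1 - Re z) * real (n + 1) powr (Re z - 1)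
        \<le> M * fact n * real (n + 1) powr (Re z - 1)" by (rule mult_right_mono) simp
    also have "norm (pochhammer z n) * real (n + 1) powr (1 - Re z) * real (n + 1) powr (Re z - 1)
        = norm (pochhammer z n)" by (simp add: mult.assoc flip: powr_add)
    finally show ?thesis .
  qed
  with M(1) that show thesis by blast
qed

lemma pochhammer_lower_bound:
  fixes z :: complex
  assumes z: "z \<notin> \<int>\<^sub>\<le>\<^sub>0"
  obtains m where "m > 0" "\<And>n. m * fact n * real (n + 1) powr (Re z - 1) \<le> norm (pochhammer z n)"
proof -
  define r where "r = (\<lambda>n. norm (pochhammer z n) * real (n + 1) powr (1 - Re z) / fact n)"
  have pos: "r n > 0" for n
    using pochhammer_eq_0_imp_nonpos_Int[of z n] z by (auto simp: r_def intro!: mult_pos_pos divide_pos_pos)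
  have "(\<lambda>n. inverse (r n)) \<longlonglongrightarrow> inverse (norm (rGamma z))"
    unfolding r_def using z by (intro tendsto_inverse pochhammer_growth_limit) (auto simp: rGamma_eq_zero_iff)
  then have "Bseq (\<lambda>n. inverse (r n))" by (intro convergent_imp_Bseq) (auto simp: convergent_def)
  then obtain M where M: "M > 0" "\<And>n. norm (inverse (r n)) \<le> M" by (auto simp: Bseq_def)
  have "inverse M * fact n * real (n + 1) powr (Re z - 1) \<le> norm (pochhammer z n)" for n
  proof -
    have "inverse (r n) \<le> M" using M(2)[of n] pos[of n] by simp
    then have "inverse M \<le> r n" using pos[of n] M(1) by (simp add: field_simps)
    then have "inverse M * fact n \<le> norm (pochhammer z n) * real (n + 1) powr (1 - Re z)"
      by (simp add: r_def field_simps)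
    then have "inverse M * fact n * real (n + 1) powr (Re z - 1)
        \<le> norm (pochhammer z n) * real (n + 1) powr (1 - Re z) * real (n + 1) powr (Re z - 1)"
      by (rule mult_right_mono) simp
    also have "norm (pochhammer z n) * real (n + 1) powr (1 - Re z) * real (n + 1) powr (Re z - 1)
        = norm (pochhammer z n)" by (simp add: mult.assoc flip: powr_add)
    finally show ?thesis .
  qed
  with M(1) that[of "inverse M"] show thesis by simp
qed

text \<open>
  The symbol is the quotient of pochhammer z n and pochhammer z k, but the latter may vanish, while the bound
  has to be uniform in k and n.
\<close>
lemma pochhammer_shift_upper_bound:
  fixes z :: complex
  obtains M where "M > 0" "\<And>k n. k \<le> n \<Longrightarrow> norm (pochhammer (z + of_nat k) (n - k)) \<le>
      M * (fact n / fact k) * (real (n + 1) powr (Re z - 1) * real (k + 1) powr (1 - Re z))"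
proof -
  \<comment> \<open>Moving a real z up by \<i> increases the absolute value of every factor and makes the symbols of w nonzero.\<close>
  define w where "w = (if Im z = 0 then z + \<i> else z)"
  have Im: "Im w \<noteq> 0" and Re: "Re w = Re z" by (auto simp: w_def)
  have wZ: "w \<notin> \<int>\<^sub>\<le>\<^sub>0" using Im by (auto elim!: nonpos_Ints_cases)
  have le: "norm (z + of_nat i) \<le> norm (w + of_nat i)" for i
    by (auto simp: w_def cmod_def intro!: real_sqrt_le_mono)
  obtain M where M: "M > 0" "\<And>n. norm (pochhammer w n) \<le> M * fact n * real (n + 1) powr (Re w - 1)"
    using pochhammer_upper_bound by blast
  obtain m where m: "m > 0" "\<And>n. m * fact n * real (n + 1) powr (Re w - 1) \<le> norm (pochhammer w n)"
    using pochhammer_lower_bound[OF wZ] by blast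
  have "norm (pochhammer (z + of_nat k) (n - k)) \<le>
      (M / m) * (fact n / fact k) * (real (n + 1) powr (Re z - 1) * real (k + 1) powr (1 - Re z))"
    if "k \<le> n" for k n
  proof -
    have "norm (pochhammer (z + of_nat k) (n - k)) \<le> norm (pochhammer (w + of_nat k) (n - k))"
      using le[of "k + _"] by (auto intro!: prod_mono simp: pochhammer_prod add.assoc simp flip: prod_norm)
    also have "\<dots> = norm (pochhammer w n) / norm (pochhammer w k)"
      using pochhammer_product[OF that, of w] wZ
      by (auto simp: norm_mult pochhammer_eq_0_iff)
    also have "\<dots> \<le> (M * fact n * real (n + 1) powr (Re w - 1)) / (m * fact k * real (k + 1) powr (Re w - 1))"
      using M m by (intro frac_le) auto
    also have "\<dots> = (M / m) * (fact n / fact k) * (real (n + 1) powr (Re z - 1) * real (k + 1) powr (1 - Re z))"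
      by (simp add: Re powr_diff field_simps)
    finally show ?thesis .
  qed
  with M m that[of "M / m"] show thesis by simp
qed

lemma Re_pos_not_nonpos_Int: "Re z > 0 \<Longrightarrow> z \<notin> \<int>\<^sub>\<le>\<^sub>0"
  by (auto elim!: nonpos_Ints_cases)

lemma binomial_series_complex:
  fixes a z :: complex
  assumes "norm z < 1"
  shows "(\<lambda>n. pochhammer a n / fact n * z ^ n) sums (1 - z) powr (-a)"
proof -
  have "(\<lambda>n. ((-a) gchoose n) * (- z) ^ n) sums (1 + (- z)) powr (-a)"
    using assms by (intro gen_binomial_complex) simp
  moreover have "((-a) gchoose n) * (- z) ^ n = pochhammer a n / fact n * z ^ n" for n
    by (simp add: gbinomial_pochhammer power_minus[of z])
  ultimately show ?thesis by simp
qed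

lemma binomial_series_real:
  fixes s w :: real
  assumes "\<bar>w\<bar> < 1"
  shows "(\<lambda>n. pochhammer s n / fact n * w ^ n) sums (1 - w) powr (-s)"
proof -
  have "(\<lambda>n. ((-s) gchoose n) * (- w) ^ n) sums (1 + (- w)) powr (-s)"
    using assms by (intro gen_binomial_real) simp
  moreover have "((-s) gchoose n) * (- w) ^ n = pochhammer s n / fact n * w ^ n" for n
    by (simp add: gbinomial_pochhammer power_minus[of w])
  ultimately show ?thesis by simp
qed

text \<open>
  This and its converse exchange powers of n for the coefficients of the binomial series of (1 - w)^(-s), for which sums
  and convolutions are known exactly.
\<close>
lemma power_le_pochhammer:
  fixes s :: real
  assumes "s > 0"
  obtains M where "M > 0" "\<And>n. real (n + 1) powr (s - 1) \<le> M * (pochhammer s n / fact n)"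
proof -
  have "complex_of_real s \<notin> \<int>\<^sub>\<le>\<^sub>0" using assms by (auto elim!: nonpos_Ints_cases simp: complex_eq_iff)
  from pochhammer_lower_bound[OF this] obtain m
    where m: "m > 0" "\<And>n. m * fact n * real (n + 1) powr (s - 1) \<le> norm (pochhammer (complex_of_real s) n)"
    by auto
  have "real (n + 1) powr (s - 1) \<le> 1 / m * (pochhammer s n / fact n)" for n
    using m(2)[of n] m(1) pochhammer_pos[OF assms, of n]
    by (simp add: field_simps pochhammer_of_real)
  with m that[of "1 / m"] show thesis by simp
qed

lemma pochhammer_le_power:
  fixes s :: real
  assumes "s > 0"
  obtains M where "M > 0" "\<And>n. pochhammer s n / fact n \<le> M * real (n + 1) powr (s - 1)"
proof -
  obtain M where M: "M > 0" "\<And>n. norm (pochhammer (complex_of_real s) n) \<le> M * fact n * real (n + 1) powr (s - 1)"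
    using pochhammer_upper_bound[of "complex_of_real s"] by auto
  have "pochhammer s n / fact n \<le> M * real (n + 1) powr (s - 1)" for n
    using M(2)[of n] pochhammer_pos[OF assms, of n]
    by (simp add: field_simps pochhammer_of_real)
  with M that show thesis by blast
qed

lemma summable_polynomial_growth:
  fixes d :: "nat \<Rightarrow> 'a::real_normed_vector" and w p M :: real
  assumes "\<And>n. norm (d n) \<le> M * real (n + 1) powr p" "0 \<le> w" "w < 1"
  shows "summable (\<lambda>n. norm (d n) * w ^ n)"
proof -
  define s where "s = max 1 (p + 1)"
  have s: "s > 0" "p \<le> s - 1" by (auto simp: s_def)
  obtain K where K: "K > 0" "\<And>n. real (n + 1) powr (s - 1) \<le> K * (pochhammer s n / fact n)"
    using power_le_pochhammer[OF s(1)] by blast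
  have M: "M \<ge> 0" using order_trans[OF norm_ge_zero assms(1)[of 0]] by simp
  have "summable (\<lambda>n. (M * K) * (pochhammer s n / fact n * w ^ n))"
    using binomial_series_real[of w s] assms(2,3) by (intro summable_mult) (auto simp: sums_iff)
  then show ?thesis
  proof (rule summable_comparison_test'[where N = 0])
    fix n
    have "norm (d n) \<le> M * real (n + 1) powr p" by fact
    also have "\<dots> \<le> M * real (n + 1) powr (s - 1)"
      using M s(2) by (intro mult_left_mono powr_mono) auto
    also have "\<dots> \<le> M * (K * (pochhammer s n / fact n))"
      using M K(2) by (intro mult_left_mono) auto
    finally have "norm (d n) * w ^ n \<le> M * (K * (pochhammer s n / fact n)) * w ^ n"
      using assms(2) by (intro mult_right_mono) auto
    then show "norm (norm (d n) * w ^ n) \<le> M * K * (pochhammer s n / fact n * w ^ n)"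
      using assms(2) by (simp add: mult_ac)
  qed
qed

text \<open>
  Once c + m has left the poles the bound is the lower bound for Pochhammer symbols; the first m factors
  contribute at most the power m of k.
\<close>
lemma rGamma_shift_upper_bound:
  fixes c :: complex
  obtains M where "M > 0" "\<And>k. norm (rGamma (c + of_nat k)) \<le> M * real (k + 1) powr (1 - Re c) / fact k"
proof -
  obtain m :: nat where m: "- Re c < real m" using reals_Archimedean2 by blast
  define K where "K = norm c + real m + 1"
  have K: "K > 0" by (simp add: K_def add_nonneg_pos)
  have p: "norm (pochhammer (c + of_nat k) m) \<le> K ^ m * real (k + 1) powr (real m)" for k
  proof -
    have "norm (pochhammer (c + of_nat k) m) = (\<Prod>i<m. norm (c + of_nat k + of_nat i))"
      by (simp add: pochhammer_prod prod_norm atLeast0LessThan)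
    also have "\<dots> \<le> (\<Prod>i<m. K * real (k + 1))"
    proof (intro prod_mono conjI)
      fix i assume "i \<in> {..<m}"
      then have "norm (c + of_nat k + of_nat i) \<le> norm c + real k + real m"
        using norm_triangle_ineq[of "c + of_nat k" "of_nat i"] norm_triangle_ineq[of c "of_nat k"] by simp
      also have "\<dots> \<le> K * real (k + 1)"
        using mult_nonneg_nonneg[of "norm c" "real k"] mult_nonneg_nonneg[of "real m" "real k"]
        by (simp add: K_def algebra_simps)
      finally show "norm (c + of_nat k + of_nat i) \<le> K * real (k + 1)" .
    qed auto
    also have "\<dots> = K ^ m * real (k + 1) powr (real m)"
      by (simp add: power_mult_distrib powr_realpow)
    finally show ?thesis .
  qed
  have cm: "c + of_nat m \<notin> \<int>\<^sub>\<le>\<^sub>0" using m by (auto elim!: nonpos_Ints_cases simp: complex_eq_iff)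
  obtain q where q: "q > 0" "\<And>n. q * fact n * real (n + 1) powr (Re (c + of_nat m) - 1) \<le> norm (pochhammer (c + of_nat m) n)"
    using pochhammer_lower_bound[OF cm] by blast
  define M where "M = K ^ m * norm (rGamma (c + of_nat m)) / q"
  have "norm (rGamma (c + of_nat k)) \<le> M * real (k + 1) powr (1 - Re c) / fact k" for k
  proof -
    have nz: "pochhammer (c + of_nat m) k \<noteq> 0"
      using pochhammer_eq_0_imp_nonpos_Int cm by blast
    have "rGamma (c + of_nat k) = pochhammer (c + of_nat k) m * rGamma (c + of_nat m + of_nat k)"
      using pochhammer_rGamma[of "c + of_nat k" m] by (simp add: add_ac)
    also have "rGamma (c + of_nat m + of_nat k) = rGamma (c + of_nat m) / pochhammer (c + of_nat m) k"
      using pochhammer_rGamma[of "c + of_nat m" k] nz by (simp add: field_simps)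
    finally have "norm (rGamma (c + of_nat k)) =
        norm (pochhammer (c + of_nat k) m) * norm (rGamma (c + of_nat m)) / norm (pochhammer (c + of_nat m) k)"
      by (simp add: norm_mult norm_divide)
    also have "\<dots> \<le> (K ^ m * real (k + 1) powr real m) * norm (rGamma (c + of_nat m)) /
        (q * fact k * real (k + 1) powr (Re (c + of_nat m) - 1))"
      using p q K by (intro frac_le mult_mono) auto
    also have "\<dots> = M * real (k + 1) powr (1 - Re c) / fact k"
    proof -
      have "real (k + 1) powr real m / real (k + 1) powr (Re (c + of_nat m) - 1) = real (k + 1) powr (1 - Re c)"
        by (simp flip: powr_diff)
      then show ?thesis by (simp add: M_def field_simps)
    qed
    finally show ?thesis .
  qed
  moreover have "M \<ge> 0" using K q by (simp add: M_def)
  ultimately have "norm (rGamma (c + of_nat k)) \<le> (M + 1) * real (k + 1) powr (1 - Re c) / fact k" for k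
    by (smt (verit) divide_right_mono fact_ge_zero mult_right_mono powr_ge_zero)
  with \<open>M \<ge> 0\<close> that[of "M + 1"] show thesis by simp
qed


section \<open>Gauss' summation theorem\<close>

lemma summable_powr_shift:
  fixes p :: real
  assumes "p < -1"
  shows "summable (\<lambda>n. real (n + 1) powr p)"
proof -
  have "summable (\<lambda>n. real n powr p)" using assms by (simp add: summable_real_powr_iff)
  then have "summable (\<lambda>n. real (Suc n) powr p)" by (subst summable_Suc_iff)
  then show ?thesis by simp
qed

lemma Gauss_term_bound:
  fixes a b c :: complex
  obtains M where "M > 0" "\<And>k. norm (pochhammer a k * pochhammer b k * rGamma (c + of_nat k) / fact k)
      \<le> M * real (k + 1) powr (Re (a + b - c) - 1)"
proof -
  obtain Ma where Ma: "Ma > 0" "\<And>n. norm (pochhammer a n) \<le> Ma * fact n * real (n + 1) powr (Re a - 1)"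
    using pochhammer_upper_bound by blast
  obtain Mb where Mb: "Mb > 0" "\<And>n. norm (pochhammer b n) \<le> Mb * fact n * real (n + 1) powr (Re b - 1)"
    using pochhammer_upper_bound by blast
  obtain Mc where Mc: "Mc > 0" "\<And>k. norm (rGamma (c + of_nat k)) \<le> Mc * real (k + 1) powr (1 - Re c) / fact k"
    using rGamma_shift_upper_bound by blast
  have "norm (pochhammer a k * pochhammer b k * rGamma (c + of_nat k) / fact k)
      \<le> (Ma * Mb * Mc) * real (k + 1) powr (Re (a + b - c) - 1)" for k
  proof -
    have "norm (pochhammer a k * pochhammer b k * rGamma (c + of_nat k) / fact k)
        \<le> (Ma * fact k * real (k + 1) powr (Re a - 1)) * (Mb * fact k * real (k + 1) powr (Re b - 1)) *
           (Mc * real (k + 1) powr (1 - Re c) / fact k) / fact k"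
      unfolding norm_mult norm_divide norm_fact
      using Ma Mb Mc by (intro divide_right_mono mult_mono) (auto intro!: mult_nonneg_nonneg)
    also have "\<dots> = (Ma * Mb * Mc) * (real (k + 1) powr (Re a - 1) * real (k + 1) powr (Re b - 1) * real (k + 1) powr (1 - Re c))"
      by (simp add: field_simps)
    also have "real (k + 1) powr (Re a - 1) * real (k + 1) powr (Re b - 1) * real (k + 1) powr (1 - Re c)
        = real (k + 1) powr (Re (a + b - c) - 1)"
      by (simp add: algebra_simps flip: powr_add)
    finally show ?thesis .
  qed
  with Ma Mb Mc that[of "Ma * Mb * Mc"] show thesis by simp
qed

lemma Gauss_summable:
  fixes a b c :: complex
  assumes "Re (c - a - b) > 0"
  shows "summable (\<lambda>k. norm (pochhammer a k * pochhammer b k * rGamma (c + of_nat k) / fact k))"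
proof -
  obtain M where M: "\<And>k. norm (pochhammer a k * pochhammer b k * rGamma (c + of_nat k) / fact k)
      \<le> M * real (k + 1) powr (Re (a + b - c) - 1)" using Gauss_term_bound by blast
  have "Re (a + b - c) - 1 < -1" using assms by simp
  note sm = summable_mult[OF summable_powr_shift[OF this], of M]
  show ?thesis
    by (rule summable_comparison_test'[OF sm, of 0]) (use M in \<open>simp only: real_norm_def abs_norm_cancel\<close>)
qed

text \<open>
  Gauss' hypergeometric series at 1, divided by Gamma c. In this normalisation it makes sense for every c
  and its value needs no case distinction.
\<close>
definition Gauss_sum :: "complex \<Rightarrow> complex \<Rightarrow> complex \<Rightarrow> complex" where
  "Gauss_sum a b c = (\<Sum>k. pochhammer a k * pochhammer b k * rGamma (c + of_nat k) / fact k)"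

definition Gauss_value :: "complex \<Rightarrow> complex \<Rightarrow> complex \<Rightarrow> complex" where
  "Gauss_value a b c = Gamma (c - a - b) * rGamma (c - a) * rGamma (c - b)"

text \<open>
  Termwise, the difference of the two sides telescopes, and k times the k-th term tends to 0.
\<close>
lemma Gauss_sum_shift:
  assumes "Re (c - a - b) > 0"
  shows "(c - a - b) * Gauss_sum a b c = (c - a) * (c - b) * Gauss_sum a b (c + 1)"
proof -
  define u where "u = (\<lambda>c k. pochhammer a k * pochhammer b k * rGamma (c + of_nat k) / fact k)"
  have sm: "summable (u c)" "summable (u (c + 1))"
    unfolding u_def using assms by (auto intro!: summable_norm_cancel[OF Gauss_summable])
  obtain M where M: "\<And>k. norm (u c k) \<le> M * real (k + 1) powr (Re (a + b - c) - 1)"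
    unfolding u_def using Gauss_term_bound by blast
  have step: "(c - a) * (c - b) * u (c + 1) k - (c - a - b) * u c k =
      of_nat (Suc k) * u c (Suc k) - of_nat k * u c k" for k
  proof -
    define w where "w = pochhammer a k * pochhammer b k * rGamma (c + 1 + of_nat k) / fact k"
    have 1: "u (c + 1) k = w" by (simp add: u_def w_def)
    have 2: "u c k = (c + of_nat k) * w"
      using rGamma_plus1[of "c + of_nat k"] by (simp add: u_def w_def add_ac)
    have "u c (Suc k) = (a + of_nat k) * (b + of_nat k) * (pochhammer a k * pochhammer b k * rGamma (c + 1 + of_nat k)) / fact (Suc k)"
      by (simp add: u_def pochhammer_Suc add_ac mult_ac)
    then have 3: "of_nat (Suc k) * u c (Suc k) = (a + of_nat k) * (b + of_nat k) * w"
      by (simp add: w_def field_simps del: of_nat_Suc)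
    show ?thesis unfolding 1 2 3 by (simp add: algebra_simps)
  qed
  have "(\<lambda>k. of_nat k * u c k) \<longlonglongrightarrow> 0"
  proof (rule Lim_null_comparison)
    show "\<forall>\<^sub>F k in sequentially. norm (of_nat k * u c k) \<le> M * real (k + 1) powr (Re (a + b - c))"
    proof (intro always_eventually allI)
      fix k
      have "norm (of_nat k * u c k) \<le> real (k + 1) * (M * real (k + 1) powr (Re (a + b - c) - 1))"
        unfolding norm_mult using M[of k] by (intro mult_mono) auto
      also have "\<dots> = M * real (k + 1) powr (Re (a + b - c))"
        by (simp add: powr_diff)
      finally show "norm (of_nat k * u c k) \<le> M * real (k + 1) powr (Re (a + b - c))" .
    qed
    have "(\<lambda>k. real (k + 1) powr Re (a + b - c)) \<longlonglongrightarrow> 0"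
      using assms by (intro tendsto_neg_powr) (auto intro!: filterlim_tendsto_add_at_top[of "\<lambda>_. 1"] simp: filterlim_real_sequentially add.commute)
    then show "(\<lambda>k. M * real (k + 1) powr Re (a + b - c)) \<longlonglongrightarrow> 0"
      using tendsto_mult_right_zero by blast
  qed
  then have "(\<lambda>k. of_nat (Suc k) * u c (Suc k) - of_nat k * u c k) sums (0 - of_nat 0 * u c 0)"
    by (rule telescope_sums)
  then have "(\<lambda>k. (c - a) * (c - b) * u (c + 1) k - (c - a - b) * u c k) sums 0"
    unfolding step by simp
  moreover have "(\<lambda>k. (c - a) * (c - b) * u (c + 1) k - (c - a - b) * u c k) sums
      ((c - a) * (c - b) * (\<Sum>k. u (c + 1) k) - (c - a - b) * (\<Sum>k. u c k))"
    using sm by (intro sums_diff sums_mult summable_sums)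
  ultimately have "0 = (c - a) * (c - b) * (\<Sum>k. u (c + 1) k) - (c - a - b) * (\<Sum>k. u c k)"
    by (rule sums_unique2)
  then show ?thesis by (simp add: Gauss_sum_def u_def)
qed

lemma Gauss_value_shift:
  assumes "Re (c - a - b) > 0"
  shows "(c - a - b) * Gauss_value a b c = (c - a) * (c - b) * Gauss_value a b (c + 1)"
proof -
  have "Gamma (c + 1 - a - b) = (c - a - b) * Gamma (c - a - b)"
    using Gamma_plus1[OF Re_pos_not_nonpos_Int[OF assms]] by (simp add: algebra_simps)
  moreover have "rGamma (c - a) = (c - a) * rGamma (c + 1 - a)" "rGamma (c - b) = (c - b) * rGamma (c + 1 - b)"
    using rGamma_plus1[of "c - a"] rGamma_plus1[of "c - b"] by (auto simp: algebra_simps)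
  ultimately show ?thesis by (simp add: Gauss_value_def)
qed

lemma Gamma_shift_asymptotic:
  fixes z :: complex
  assumes "Re z > 0"
  shows "(\<lambda>m. Gamma (z + of_nat m) / (fact (m - 1) * exp (z * of_real (ln (of_nat m))))) \<longlonglongrightarrow> 1"
proof -
  have z: "z \<notin> \<int>\<^sub>\<le>\<^sub>0" using assms by (rule Re_pos_not_nonpos_Int)
  have "(\<lambda>m. Gamma z / Gamma_series' z m) \<longlonglongrightarrow> Gamma z / Gamma z"
    using z by (intro tendsto_intros Gamma_series'_LIMSEQ) (auto simp: Gamma_eq_zero_iff)
  moreover have "Gamma z / Gamma_series' z m =
      Gamma (z + of_nat m) / (fact (m - 1) * exp (z * of_real (ln (of_nat m))))" for m
    using pochhammer_Gamma[OF z, of m] z by (simp add: Gamma_series'_def Gamma_eq_zero_iff)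
  ultimately show ?thesis using z by (simp add: Gamma_eq_zero_iff)
qed

text \<open>
  By Euler's limit formula each Gamma factor is asymptotic to an explicit function, and the exponents
  c + (c - a - b) and (c - a) + (c - b) agree.
\<close>
lemma Gauss_value_asymptotic:
  assumes "Re c > 0" "Re (c - a - b) > 0" "Re (c - a) > 0" "Re (c - b) > 0"
  shows "(\<lambda>m. Gamma (c + of_nat m) * Gauss_value a b (c + of_nat m)) \<longlonglongrightarrow> 1"
proof -
  define E where "E = (\<lambda>z m. fact (m - 1) * exp (z * of_real (ln (of_nat m))) :: complex)"
  define g where "g = (\<lambda>z m. Gamma (z + of_nat m) / E z m)"
  have E: "E z m \<noteq> 0" for z m by (simp add: E_def)
  have g: "(\<lambda>m. g z m) \<longlonglongrightarrow> 1" if "Re z > 0" for z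
    using Gamma_shift_asymptotic[OF that] by (simp add: g_def E_def)
  have EE: "E c m * E (c - a - b) m = E (c - a) m * E (c - b) m" for m
    by (simp add: E_def algebra_simps flip: exp_add)
  have "(\<lambda>m. g c m * g (c - a - b) m / (g (c - a) m * g (c - b) m)) \<longlonglongrightarrow> 1 * 1 / (1 * 1)"
    using assms by (intro tendsto_intros g) auto
  moreover have "g c m * g (c - a - b) m / (g (c - a) m * g (c - b) m) =
      Gamma (c + of_nat m) * Gauss_value a b (c + of_nat m)" for m
  proof -
    have "g c m * g (c - a - b) m / (g (c - a) m * g (c - b) m) =
      (Gamma (c + of_nat m) * Gamma (c - a - b + of_nat m)) / (E c m * E (c - a - b) m) *
      ((E (c - a) m * E (c - b) m) / (Gamma (c - a + of_nat m) * Gamma (c - b + of_nat m)))"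
      by (simp add: g_def field_simps)
    also have "\<dots> = Gamma (c + of_nat m) * Gamma (c - a - b + of_nat m) / (Gamma (c - a + of_nat m) * Gamma (c - b + of_nat m))"
      unfolding EE using E by simp
    finally show ?thesis by (simp add: Gauss_value_def rGamma_inverse_Gamma field_simps algebra_simps)
  qed
  ultimately show ?thesis by simp
qed

lemma norm_pochhammer_ge: "Re z > 0 \<Longrightarrow> pochhammer (Re z) n \<le> norm (pochhammer z n)"
  unfolding pochhammer_prod prod_norm[symmetric]
  by (intro prod_mono) (auto intro: order_trans[OF _ complex_Re_le_cmod])

text \<open>
  Multiplied by Gamma (c + m), the term of index 0 is 1 and every other one tends to 0; dominated convergence for series
  applies because the Pochhammer symbols of c + m are at least those of Re c.
\<close>
lemma Gauss_sum_asymptotic: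
  assumes c: "Re c > 0" and abc: "Re (c - a - b) > 0"
  shows "(\<lambda>m. Gamma (c + of_nat m) * Gauss_sum a b (c + of_nat m)) \<longlonglongrightarrow> 1"
proof -
  define q where "q = (\<lambda>k. pochhammer a k * pochhammer b k / fact k)"
  have norm_le: "norm (q k / pochhammer (c + of_nat m) k) \<le> norm (q k) / pochhammer (Re c) k" for k m
  proof -
    have "pochhammer (Re c) k \<le> pochhammer (Re (c + of_nat m)) k"
      unfolding pochhammer_prod using c by (intro prod_mono) auto
    also have "\<dots> \<le> norm (pochhammer (c + of_nat m) k)" using c by (intro norm_pochhammer_ge) simp
    finally show ?thesis
      using pochhammer_pos[OF c, of k] by (auto simp: norm_divide intro!: divide_left_mono mult_pos_pos)
  qed
  have c': "c + of_nat m \<notin> \<int>\<^sub>\<le>\<^sub>0" for m using c by (intro Re_pos_not_nonpos_Int) simp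
  have eq: "Gamma (c + of_nat m) * Gauss_sum a b (c + of_nat m) = (\<Sum>k. q k / pochhammer (c + of_nat m) k)" for m
  proof -
    have "summable (\<lambda>k. norm (pochhammer a k * pochhammer b k * rGamma (c + of_nat m + of_nat k) / fact k))"
      using abc by (intro Gauss_summable[where c = "c + of_nat m"]) simp
    then have "Gamma (c + of_nat m) * Gauss_sum a b (c + of_nat m) =
        (\<Sum>k. Gamma (c + of_nat m) * (pochhammer a k * pochhammer b k * rGamma (c + of_nat m + of_nat k) / fact k))"
      unfolding Gauss_sum_def by (rule suminf_mult[OF summable_norm_cancel, symmetric])
    also have "\<dots> = (\<Sum>k. q k / pochhammer (c + of_nat m) k)"
    proof (intro suminf_cong)
      fix k
      have "Gamma (c + of_nat m) * rGamma (c + of_nat m + of_nat k) = 1 / pochhammer (c + of_nat m) k"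
        using c'[of m] pochhammer_Gamma[OF c'[of m], of k]
        by (simp add: rGamma_inverse_Gamma field_simps)
      then show "Gamma (c + of_nat m) * (pochhammer a k * pochhammer b k * rGamma (c + of_nat m + of_nat k) / fact k)
          = q k / pochhammer (c + of_nat m) k" by (simp add: q_def mult_ac)
    qed
    finally show ?thesis .
  qed
  have sm: "summable (\<lambda>k. norm (q k) / pochhammer (Re c) k)"
  proof -
    have rc: "complex_of_real (Re c) \<notin> \<int>\<^sub>\<le>\<^sub>0" using c by (intro Re_pos_not_nonpos_Int) simp
    have "summable (\<lambda>k. norm (pochhammer a k * pochhammer b k * rGamma (of_real (Re c) + of_nat k) / fact k))"
      using abc by (intro Gauss_summable[where c = "of_real (Re c)"]) simp
    then have "summable (\<lambda>k. norm (Gamma (complex_of_real (Re c))) *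
        norm (pochhammer a k * pochhammer b k * rGamma (of_real (Re c) + of_nat k) / fact k))"
      by (rule summable_mult[where c = "norm (Gamma (complex_of_real (Re c)))"])
    moreover have "norm (Gamma (complex_of_real (Re c))) *
        norm (pochhammer a k * pochhammer b k * rGamma (of_real (Re c) + of_nat k) / fact k)
        = norm (q k) / pochhammer (Re c) k" for k
    proof -
      have "Gamma (complex_of_real (Re c)) * rGamma (of_real (Re c) + of_nat k) = 1 / pochhammer (of_real (Re c)) k"
        using rc pochhammer_Gamma[OF rc, of k] by (simp add: rGamma_inverse_Gamma field_simps)
      then have "norm (Gamma (complex_of_real (Re c))) * norm (rGamma (complex_of_real (Re c) + of_nat k)) = 1 / pochhammer (Re c) k"
        using pochhammer_pos[OF c, of k] by (simp add: pochhammer_of_real norm_divide flip: norm_mult)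
      then show ?thesis by (simp add: q_def norm_mult norm_divide field_simps)
    qed
    ultimately show ?thesis by simp
  qed
  have lim: "(\<lambda>m. q k / pochhammer (c + of_nat m) k) \<longlonglongrightarrow> (if k = 0 then 1 else 0)" for k
  proof (cases k)
    case (Suc j)
    have "filterlim (\<lambda>m. c + of_nat i + of_nat m) at_infinity sequentially" for i
      by (intro tendsto_add_filterlim_at_infinity[OF tendsto_const]) (rule tendsto_of_nat)
    then have "(\<lambda>m. inverse (c + of_nat i + of_nat m)) \<longlonglongrightarrow> 0" for i
      by (rule filterlim_compose[OF tendsto_inverse_0])
    then have "(\<lambda>m. q k * (\<Prod>i<k. inverse (c + of_nat i + of_nat m))) \<longlonglongrightarrow> q k * (\<Prod>i<k. 0)"
      by (intro tendsto_intros)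
    then show ?thesis
      by (simp add: Suc pochhammer_prod atLeast0LessThan divide_inverse prod_inversef add_ac flip: prod_inversef)
  qed (simp add: q_def)
  have "(\<lambda>m. \<Sum>k. q k / pochhammer (c + of_nat m) k) \<longlonglongrightarrow> (\<Sum>k. if k = 0 then 1 else 0)"
    using tannerys_theorem[where F = sequentially and a = "\<lambda>k m. q k / pochhammer (c + of_nat m) k"
        and M = "\<lambda>k. norm (q k) / pochhammer (Re c) k", OF lim _ sm] norm_le
    by (simp add: case_prod_unfold)
  moreover have "(\<Sum>k. if k = 0 then 1 else (0::complex)) = 1"
    using sums_single[of 0 "\<lambda>_. 1::complex"] by (simp add: sums_iff)
  ultimately show ?thesis by (simp add: eq)
qed

text \<open>
  Both sides satisfy the same recurrence in c and, multiplied by Gamma c, tend to 1 as c moves to the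
  right. This proves equality as long as the recurrence never multiplies by 0, hence far to the right, and the
  recurrence read backwards carries it to every c in the region of convergence.
\<close>
theorem Gauss_summation:
  assumes "Re (c - a - b) > 0"
  shows "Gauss_sum a b c = Gauss_value a b c"
proof -
  have large: "Gauss_sum a b c = Gauss_value a b c"
    if c: "Re c > 0" "Re (c - a - b) > 0" "Re (c - a) > 0" "Re (c - b) > 0" for c
  proof -
    have S: "pochhammer (c - a - b) m * Gauss_sum a b c = pochhammer (c - a) m * pochhammer (c - b) m * Gauss_sum a b (c + of_nat m)" for m
    proof (induction m)
      case (Suc m)
      have "pochhammer (c - a - b) (Suc m) * Gauss_sum a b c = (c - a - b + of_nat m) * (pochhammer (c - a - b) m * Gauss_sum a b c)"
        by (simp add: pochhammer_Suc)
      also have "\<dots> = pochhammer (c - a) m * pochhammer (c - b) m * ((c + of_nat m - a - b) * Gauss_sum a b (c + of_nat m))"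
        unfolding Suc by (simp add: algebra_simps)
      also have "\<dots> = pochhammer (c - a) m * pochhammer (c - b) m * ((c + of_nat m - a) * (c + of_nat m - b) * Gauss_sum a b (c + of_nat m + 1))"
        using c by (subst Gauss_sum_shift) auto
      finally show ?case by (simp add: pochhammer_Suc algebra_simps)
    qed simp
    have V: "pochhammer (c - a - b) m * Gauss_value a b c = pochhammer (c - a) m * pochhammer (c - b) m * Gauss_value a b (c + of_nat m)" for m
    proof (induction m)
      case (Suc m)
      have "pochhammer (c - a - b) (Suc m) * Gauss_value a b c = (c - a - b + of_nat m) * (pochhammer (c - a - b) m * Gauss_value a b c)"
        by (simp add: pochhammer_Suc)
      also have "\<dots> = pochhammer (c - a) m * pochhammer (c - b) m * ((c + of_nat m - a - b) * Gauss_value a b (c + of_nat m))"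
        unfolding Suc by (simp add: algebra_simps)
      also have "\<dots> = pochhammer (c - a) m * pochhammer (c - b) m * ((c + of_nat m - a) * (c + of_nat m - b) * Gauss_value a b (c + of_nat m + 1))"
        using c by (subst Gauss_value_shift) auto
      finally show ?case by (simp add: pochhammer_Suc algebra_simps)
    qed simp
    have nz: "pochhammer (c - a) m * pochhammer (c - b) m \<noteq> 0" for m
      using pochhammer_eq_0_imp_nonpos_Int Re_pos_not_nonpos_Int c(3,4) by (metis mult_eq_0_iff)
    have "Gauss_sum a b c * Gauss_value a b (c + of_nat m) = Gauss_value a b c * Gauss_sum a b (c + of_nat m)" for m
    proof -
      have "(pochhammer (c - a) m * pochhammer (c - b) m) * (Gauss_sum a b c * Gauss_value a b (c + of_nat m)) =
          Gauss_sum a b c * (pochhammer (c - a - b) m * Gauss_value a b c)" unfolding V by simp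
      also have "\<dots> = Gauss_value a b c * (pochhammer (c - a - b) m * Gauss_sum a b c)" by simp
      also have "\<dots> = (pochhammer (c - a) m * pochhammer (c - b) m) * (Gauss_value a b c * Gauss_sum a b (c + of_nat m))"
        unfolding S by simp
      finally show ?thesis by (rule mult_left_cancel[OF nz, THEN iffD1])
    qed
    then have "Gauss_sum a b c * (Gamma (c + of_nat m) * Gauss_value a b (c + of_nat m)) =
        Gauss_value a b c * (Gamma (c + of_nat m) * Gauss_sum a b (c + of_nat m))" for m
      by (metis mult.left_commute)
    then have "(\<lambda>m. Gauss_sum a b c * (Gamma (c + of_nat m) * Gauss_value a b (c + of_nat m))) =
        (\<lambda>m. Gauss_value a b c * (Gamma (c + of_nat m) * Gauss_sum a b (c + of_nat m)))" by (rule ext)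
    moreover have "(\<lambda>m. Gauss_sum a b c * (Gamma (c + of_nat m) * Gauss_value a b (c + of_nat m))) \<longlonglongrightarrow> Gauss_sum a b c * 1"
      using c by (intro tendsto_intros Gauss_value_asymptotic)
    moreover have "(\<lambda>m. Gauss_value a b c * (Gamma (c + of_nat m) * Gauss_sum a b (c + of_nat m))) \<longlonglongrightarrow> Gauss_value a b c * 1"
      using c by (intro tendsto_intros Gauss_sum_asymptotic)
    ultimately have "Gauss_sum a b c * 1 = Gauss_value a b c * 1"
      by (intro LIMSEQ_unique) simp_all
    then show ?thesis by simp
  qed
  obtain n where n: "\<bar>Re c\<bar> + \<bar>Re a\<bar> + \<bar>Re b\<bar> < real n" using reals_Archimedean2 by blast
  have "Gauss_sum a b (c + of_nat (n - i)) = Gauss_value a b (c + of_nat (n - i))" if "i \<le> n" for i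
    using that
  proof (induction i)
    case 0
    then show ?case using n assms by (intro large) auto
  next
    case (Suc i)
    define d where "d = c + of_nat (n - Suc i)"
    have d1: "d + 1 = c + of_nat (n - i)" using Suc.prems by (simp add: d_def of_nat_diff)
    have pos: "Re (d - a - b) > 0" using assms by (simp add: d_def add_pos_nonneg)
    then have "d - a - b \<noteq> 0" by auto
    moreover have "(d - a - b) * Gauss_sum a b d = (d - a - b) * Gauss_value a b d"
      using Suc.IH Suc.prems unfolding Gauss_sum_shift[OF pos] Gauss_value_shift[OF pos] d1 by simp
    ultimately show ?case by (simp add: d_def)
  qed
  from this[of n] show ?thesis by simp
qed


section \<open>Moments of power series with respect to Beta weights\<close>

lemma continuous_on_Beta_integrand:
  "continuous_on {0<..<1} (\<lambda>t. complex_of_real t powr p * complex_of_real (1 - t) powr q)"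
  by (intro continuous_intros) auto

lemma norm_Beta_integrand:
  assumes "t \<in> {0<..<1}"
  shows "norm (complex_of_real t powr p * complex_of_real (1 - t) powr q) = t powr Re p * (1 - t) powr Re q"
  using assms by (simp add: norm_mult norm_powr_real_powr del: of_real_diff)

lemma Beta_real_integrable:
  fixes a b :: real
  assumes "a > 0" "b > 0"
  shows "(\<lambda>t. t powr (a - 1) * (1 - t) powr (b - 1)) integrable_on {0<..<1}"
  using integrable_Beta'[OF assms] by (simp add: integrable_on_Icc_iff_Ioo)

lemma Beta_weighted_integrable:
  fixes F :: "real \<Rightarrow> complex" and a b :: complex and r :: real
  assumes "Re a > 0" "r < Re b" and cont: "continuous_on {0<..<1} F"
    and bound: "\<And>w. w \<in> {0<..<1} \<Longrightarrow> norm (F w) \<le> M * (1 - w) powr (- r)"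
  shows "(\<lambda>w. of_real w powr (a - 1) * of_real (1 - w) powr (b - 1) * F w) absolutely_integrable_on {0<..<1}"
proof (rule measurable_bounded_by_integrable_imp_absolutely_integrable)
  show "(\<lambda>w. of_real w powr (a - 1) * of_real (1 - w) powr (b - 1) * F w) \<in> borel_measurable (lebesgue_on {0<..<1})"
    by (intro continuous_imp_measurable_on_sets_lebesgue continuous_on_mult continuous_on_Beta_integrand cont) auto
  show "(\<lambda>w. M * (w powr (Re a - 1) * (1 - w) powr ((Re b - r) - 1))) integrable_on {0<..<1}"
    by (rule integrable_on_mult_right[OF Beta_real_integrable]) (use assms in auto)
  fix w :: real assume w: "w \<in> {0<..<1}"
  have "norm (of_real w powr (a - 1) * of_real (1 - w) powr (b - 1) * F w)
      \<le> (w powr (Re a - 1) * (1 - w) powr (Re b - 1)) * (M * (1 - w) powr (- r))"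
    unfolding norm_mult[of _ "F w"] norm_Beta_integrand[OF w]
    using bound[OF w] by (intro mult_mono) auto
  also have "\<dots> = M * (w powr (Re a - 1) * ((1 - w) powr (Re b - 1) * (1 - w) powr (- r)))"
    by (simp add: mult_ac)
  also have "(1 - w) powr (Re b - 1) * (1 - w) powr (- r) = (1 - w) powr ((Re b - r) - 1)"
    by (simp add: algebra_simps flip: powr_add)
  finally show "norm (of_real w powr (a - 1) * of_real (1 - w) powr (b - 1) * F w)
      \<le> M * (w powr (Re a - 1) * (1 - w) powr ((Re b - r) - 1))" .
qed auto

definition Beta_moment :: "complex \<Rightarrow> complex \<Rightarrow> (real \<Rightarrow> complex) \<Rightarrow> complex" where
  "Beta_moment a b F = integral {0<..<1} (\<lambda>w. of_real w powr (a - 1) * of_real (1 - w) powr (b - 1) * F w)"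

lemma power_series_has_derivative:
  fixes d :: "nat \<Rightarrow> complex"
  assumes "\<And>w. 0 \<le> w \<Longrightarrow> w < 1 \<Longrightarrow> summable (\<lambda>n. norm (d n) * w ^ n)" and "norm w < 1"
  shows "((\<lambda>w. \<Sum>n. d n * w ^ n) has_field_derivative (\<Sum>n. diffs d n * w ^ n)) (at w)"
proof -
  have sm: "summable (\<lambda>n. d n * w ^ n)" if "norm w < 1" for w
    using assms(1)[of "norm w"] that by (intro summable_norm_cancel[of "\<lambda>n. d n * w ^ n"]) (simp add: norm_mult norm_power)
  obtain r where r: "norm w < r" "r < 1" using dense assms(2) by blast
  have "r > 0" using r norm_ge_zero[of w] by linarith
  then have nr: "norm (complex_of_real r) = r" by simp
  show ?thesis
    by (rule termdiffs_strong[of d "complex_of_real r"]) (use sm[of "complex_of_real r"] nr r in auto)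
qed

lemma power_series_bound:
  fixes d :: "nat \<Rightarrow> complex" and s :: real
  assumes s: "s > 0" and d: "\<And>n. norm (d n) \<le> M * (pochhammer s n / fact n)"
    and w: "0 \<le> w" "w < 1"
  shows "summable (\<lambda>n. norm (d n) * w ^ n)"
    and "(\<Sum>n. norm (d n) * w ^ n) \<le> M * (1 - w) powr (- s)"
proof -
  have B: "(\<lambda>n. M * (pochhammer s n / fact n * w ^ n)) sums (M * (1 - w) powr (- s))"
    using binomial_series_real[of w s] w by (intro sums_mult) auto
  have le: "norm (d n) * w ^ n \<le> M * (pochhammer s n / fact n * w ^ n)" for n
    using mult_right_mono[OF d[of n], of "w ^ n"] w by (simp add: mult_ac)
  show sm: "summable (\<lambda>n. norm (d n) * w ^ n)"
    by (rule summable_comparison_test'[OF sums_summable[OF B], of 0]) (use le w in \<open>simp add: abs_mult\<close>)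
  show "(\<Sum>n. norm (d n) * w ^ n) \<le> M * (1 - w) powr (- s)"
    using suminf_le[OF le sm sums_summable[OF B]] sums_unique[OF B] by simp
qed

text \<open>
  The bound on the coefficients is that of the binomial series of (1 - w)^(-s). Hence all partial sums are
  dominated by a multiple of (1 - w)^(-s), which is integrable against the weight as s < Re b.
\<close>
lemma power_series_Beta_moment:
  fixes d :: "nat \<Rightarrow> complex" and s :: real
  assumes a: "Re a > 0" and s: "s > 0" "s < Re b"
    and d: "\<And>n. norm (d n) \<le> M * (pochhammer s n / fact n)"
  shows "(\<lambda>n. d n * Beta_moment (a + of_nat n) b (\<lambda>_. 1)) sums Beta_moment a b (\<lambda>w. \<Sum>n. d n * of_real w ^ n)"
proof -
  define W where "W = (\<lambda>w. complex_of_real w powr (a - 1) * complex_of_real (1 - w) powr (b - 1))"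
  have sm: "summable (\<lambda>n. norm (d n) * w ^ n)" if "0 \<le> w" "w < 1" for w
    using power_series_bound[OF s(1) d that] by blast
  have mono: "((\<lambda>w. W w * (d n * of_real w ^ n)) has_integral d n * Beta_moment (a + of_nat n) b (\<lambda>_. 1)) {0<..<1}" for n
  proof -
    have "(\<lambda>w. complex_of_real w powr (a + of_nat n - 1) * complex_of_real (1 - w) powr (b - 1) * 1) absolutely_integrable_on {0<..<1}"
      using a s by (intro Beta_weighted_integrable[where M = 1 and r = 0]) (auto simp: add_pos_nonneg)
    then have "((\<lambda>w. complex_of_real w powr (a + of_nat n - 1) * complex_of_real (1 - w) powr (b - 1) * 1)
        has_integral Beta_moment (a + of_nat n) b (\<lambda>_. 1)) {0<..<1}"
      unfolding Beta_moment_def using set_lebesgue_integral_eq_integral(1) integrable_integral by blast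
    then have "((\<lambda>w. d n * (complex_of_real w powr (a + of_nat n - 1) * complex_of_real (1 - w) powr (b - 1) * 1))
        has_integral d n * Beta_moment (a + of_nat n) b (\<lambda>_. 1)) {0<..<1}"
      by (rule has_integral_mult_right)
    then show ?thesis
    proof (rule has_integral_eq[rotated])
      show "d n * (complex_of_real w powr (a + of_nat n - 1) * complex_of_real (1 - w) powr (b - 1) * 1) =
        W w * (d n * of_real w ^ n)" if "w \<in> {0<..<1}" for w
      proof -
      have "complex_of_real w powr (a + of_nat n - 1) = complex_of_real w powr (a - 1) * complex_of_real w powr of_nat n"
        by (simp add: algebra_simps flip: powr_add)
      also have "complex_of_real w powr of_nat n = of_real w ^ n"
        using that by (simp add: powr_nat')
      finally show ?thesis by (simp add: W_def)
      qed
    qed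
  qed
  have part: "((\<lambda>w. W w * (\<Sum>n<k. d n * of_real w ^ n)) has_integral (\<Sum>n<k. d n * Beta_moment (a + of_nat n) b (\<lambda>_. 1))) {0<..<1}" for k
    unfolding sum_distrib_left by (intro has_integral_sum mono) auto
  have "(\<lambda>k. integral {0<..<1} (\<lambda>w. W w * (\<Sum>n<k. d n * of_real w ^ n)))
      \<longlonglongrightarrow> integral {0<..<1} (\<lambda>w. W w * (\<Sum>n. d n * of_real w ^ n))"
  proof (rule dominated_convergence(2))
    show "(\<lambda>w. W w * (\<Sum>n<k. d n * of_real w ^ n)) integrable_on {0<..<1}" for k
      using part by (auto simp: integrable_on_def)
    show "(\<lambda>w. M * (w powr (Re a - 1) * (1 - w) powr ((Re b - s) - 1))) integrable_on {0<..<1}"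
      by (rule integrable_on_mult_right[OF Beta_real_integrable]) (use a s in auto)
    show "norm (W w * (\<Sum>n<k. d n * of_real w ^ n)) \<le> M * (w powr (Re a - 1) * (1 - w) powr ((Re b - s) - 1))"
      if w: "w \<in> {0<..<1}" for w k
    proof -
      have nW: "norm (W w) = w powr (Re a - 1) * (1 - w) powr (Re b - 1)"
        unfolding W_def norm_Beta_integrand[OF w] by simp
      have "norm (\<Sum>n<k. d n * of_real w ^ n) \<le> (\<Sum>n<k. norm (d n) * w ^ n)"
        using w by (intro order_trans[OF norm_sum]) (simp add: norm_mult norm_power)
      also have "\<dots> \<le> (\<Sum>n. norm (d n) * w ^ n)"
        using sm[of w] w by (intro sum_le_suminf) auto
      also have "\<dots> \<le> M * (1 - w) powr (- s)"
        using power_series_bound(2)[OF s(1) d, of w] w by auto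
      finally have "norm (W w * (\<Sum>n<k. d n * of_real w ^ n)) \<le>
          (w powr (Re a - 1) * (1 - w) powr (Re b - 1)) * (M * (1 - w) powr (- s))"
        unfolding norm_mult[of "W w"] nW by (intro mult_mono) auto
      also have "\<dots> = M * (w powr (Re a - 1) * ((1 - w) powr (Re b - 1) * (1 - w) powr (- s)))"
        by (simp add: mult_ac)
      also have "(1 - w) powr (Re b - 1) * (1 - w) powr (- s) = (1 - w) powr ((Re b - s) - 1)"
        by (simp add: algebra_simps flip: powr_add)
      finally show ?thesis .
    qed
    show "(\<lambda>k. W w * (\<Sum>n<k. d n * of_real w ^ n)) \<longlonglongrightarrow> W w * (\<Sum>n. d n * of_real w ^ n)"
      if w: "w \<in> {0<..<1}" for w
    proof -
      have "summable (\<lambda>n. norm (d n * of_real w ^ n))"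
        using sm[of w] w by (simp add: norm_mult norm_power)
      then show ?thesis by (intro tendsto_mult tendsto_const summable_LIMSEQ summable_norm_cancel[where f = "\<lambda>n. d n * of_real w ^ n"])
    qed
  qed
  then show ?thesis
    unfolding sums_def using integral_unique[OF part] by (simp add: Beta_moment_def[of a b] W_def)
qed

lemma Beta_moment_powr:
  assumes "Re a > 0"
  shows "Beta_moment a 1 (\<lambda>_. 1) = 1 / a"
proof -
  have a: "a \<noteq> 0" using assms by auto
  have "((\<lambda>t. complex_of_real t powr (a - 1)) has_integral (of_real 1 powr a / a - of_real 0 powr a / a)) {0..1}"
  proof (rule fundamental_theorem_of_calculus_interior)
    show "continuous_on {0..1} (\<lambda>t. complex_of_real t powr a / a)"
      using assms a by (intro continuous_on_divide continuous_on_powr_complex continuous_intros) auto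
    fix t :: real assume t: "t \<in> {0<..<1}"
    have "((\<lambda>z. z powr a / a) has_field_derivative (complex_of_real t powr (a - 1))) (at (complex_of_real t))"
      using t a by (auto intro!: derivative_eq_intros)
    then show "((\<lambda>t. complex_of_real t powr a / a) has_vector_derivative complex_of_real t powr (a - 1)) (at t)"
      by (rule has_vector_derivative_real_field)
  qed simp
  then have "((\<lambda>t. complex_of_real t powr (a - 1)) has_integral 1 / a) {0<..<1}"
    using a by (simp add: has_integral_Icc_iff_Ioo)
  then have "((\<lambda>t. complex_of_real t powr (a - 1) * of_real (1 - t) powr (1 - 1) * 1) has_integral 1 / a) {0<..<1}"
    by (rule has_integral_eq[rotated]) (simp add: powr_def)
  then show ?thesis unfolding Beta_moment_def by (rule integral_unique)
qed

text \<open>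
  Expanding (1 - w)^(b - 1) in its binomial series and integrating termwise gives Gauss' series at 1 with parameters
  1 - b, a and a + 1.
\<close>
theorem Beta_moment_one:
  assumes a: "Re a > 0" and b: "Re b > 0"
  shows "Beta_moment a b (\<lambda>_. 1) = Gamma a * Gamma b * rGamma (a + b)"
proof -
  \<comment> \<open>Any s in (0, 1) with s \<ge> 1 - Re b would do: the series is integrated against the weight with b = 1.\<close>
  define s where "s = max (1 - Re b) (1/2)"
  have s: "s > 0" "s < 1" "- Re b \<le> s - 1" using b by (auto simp: s_def)
  define d where "d = (\<lambda>n. pochhammer (1 - b) n / fact n)"
  obtain M1 where M1: "M1 > 0" "\<And>n. norm (pochhammer (1 - b) n) \<le> M1 * fact n * real (n + 1) powr (Re (1 - b) - 1)"
    using pochhammer_upper_bound by blast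
  obtain M2 where M2: "M2 > 0" "\<And>n. real (n + 1) powr (s - 1) \<le> M2 * (pochhammer s n / fact n)"
    using power_le_pochhammer[OF s(1)] by blast
  have d: "norm (d n) \<le> (M1 * M2) * (pochhammer s n / fact n)" for n
  proof -
    have "norm (d n) \<le> M1 * real (n + 1) powr (- Re b)"
      using M1(2)[of n] by (simp add: d_def norm_divide field_simps)
    also have "\<dots> \<le> M1 * real (n + 1) powr (s - 1)"
      using M1(1) s(3) by (intro mult_left_mono powr_mono) auto
    also have "\<dots> \<le> M1 * (M2 * (pochhammer s n / fact n))"
      using M1(1) M2(2) by (intro mult_left_mono) auto
    finally show ?thesis by (simp add: mult.assoc)
  qed
  have "(\<lambda>n. d n * Beta_moment (a + of_nat n) 1 (\<lambda>_. 1)) sums Beta_moment a 1 (\<lambda>w. \<Sum>n. d n * of_real w ^ n)"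
    using a s d by (intro power_series_Beta_moment[where s = s and M = "M1 * M2"]) auto
  also have "Beta_moment a 1 (\<lambda>w. \<Sum>n. d n * of_real w ^ n) = Beta_moment a b (\<lambda>_. 1)"
    unfolding Beta_moment_def
  proof (rule integral_cong)
    fix w :: real assume w: "w \<in> {0<..<1}"
    have "(\<Sum>n. d n * of_real w ^ n) = (1 - of_real w) powr (- (1 - b))"
      using binomial_series_complex[of "of_real w" "1 - b"] w by (simp add: sums_iff d_def)
    then show "complex_of_real w powr (a - 1) * of_real (1 - w) powr (1 - 1) * (\<Sum>n. d n * of_real w ^ n) =
        of_real w powr (a - 1) * of_real (1 - w) powr (b - 1) * 1"
      using w by (simp add: powr_def)
  qed
  finally have 1: "(\<lambda>n. rGamma a * (d n * Beta_moment (a + of_nat n) 1 (\<lambda>_. 1))) sums (rGamma a * Beta_moment a b (\<lambda>_. 1))"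
    by (rule sums_mult)
  have "rGamma a * (d n * Beta_moment (a + of_nat n) 1 (\<lambda>_. 1)) =
      pochhammer (1 - b) n * pochhammer a n * rGamma (a + 1 + of_nat n) / fact n" for n
  proof -
    have nz: "a + of_nat n \<noteq> 0" using a by (auto simp: complex_eq_iff)
    have "rGamma a = pochhammer a n * ((a + of_nat n) * rGamma (a + of_nat n + 1))"
      using pochhammer_rGamma[of a n] rGamma_plus1[of "a + of_nat n"] by simp
    moreover have "Beta_moment (a + of_nat n) 1 (\<lambda>_. 1) = 1 / (a + of_nat n)"
      using a by (intro Beta_moment_powr) (simp add: add_pos_nonneg)
    ultimately have "rGamma a * (d n * Beta_moment (a + of_nat n) 1 (\<lambda>_. 1)) =
        (pochhammer a n * rGamma (a + of_nat n + 1) * d n) * ((a + of_nat n) * (1 / (a + of_nat n)))"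
      by (simp only: mult_ac)
    also have "\<dots> = pochhammer a n * rGamma (a + 1 + of_nat n) * d n"
      using nz by (simp add: add_ac)
    finally show ?thesis by (simp add: d_def mult_ac)
  qed
  with 1 have "(\<lambda>n. pochhammer (1 - b) n * pochhammer a n * rGamma (a + 1 + of_nat n) / fact n)
      sums (rGamma a * Beta_moment a b (\<lambda>_. 1))" by simp
  then have "rGamma a * Beta_moment a b (\<lambda>_. 1) = Gauss_sum (1 - b) a (a + 1)"
    by (simp add: Gauss_sum_def sums_iff)
  also have "\<dots> = Gauss_value (1 - b) a (a + 1)"
    using b by (intro Gauss_summation) simp
  also have "\<dots> = Gamma b * rGamma (a + b)"
    by (simp add: Gauss_value_def)
  finally show ?thesis using Re_pos_not_nonpos_Int[OF a]
    by (auto simp: rGamma_inverse_Gamma field_simps Gamma_eq_zero_iff)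
qed


section \<open>Pfaff's transformation\<close>

lemma Chu_Vandermonde:
  fixes b c :: complex
  assumes "c \<notin> \<int>\<^sub>\<le>\<^sub>0"
  shows "(\<Sum>j\<le>n. of_nat (n choose j) * (-1) ^ j * (pochhammer (c - b) j / pochhammer c j)) =
    pochhammer b n / pochhammer c n"
  using assms
proof (induction n arbitrary: c)
  case (Suc n)
  define h where "h = (\<lambda>j. (-1) ^ j * (pochhammer (c - b) j / pochhammer c j))"
  have c0: "c \<noteq> 0" using Suc.prems by auto
  have c1: "c + 1 \<notin> \<int>\<^sub>\<le>\<^sub>0" using Suc.prems by (meson plus_one_in_nonpos_Ints_imp)
  have nz: "pochhammer c n \<noteq> 0" "pochhammer c (Suc n) \<noteq> 0" "pochhammer (c + 1) n \<noteq> 0"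
    using pochhammer_eq_0_imp_nonpos_Int Suc.prems c1 by blast+
  have hS: "h (Suc j) = - ((c - b) / c) * ((-1) ^ j * (pochhammer (c + 1 - b) j / pochhammer (c + 1) j))" for j
  proof -
    have "c + 1 - b = c - b + 1" by simp
    then show ?thesis by (simp only: h_def pochhammer_rec) simp
  qed
  have "(\<Sum>j\<le>Suc n. of_nat (Suc n choose j) * h j) = h 0 + (\<Sum>j\<le>n. of_nat (Suc n choose Suc j) * h (Suc j))"
    by (subst sum.atMost_Suc_shift) simp
  also have "(\<Sum>j\<le>n. of_nat (Suc n choose Suc j) * h (Suc j)) =
      (\<Sum>j\<le>n. of_nat (n choose Suc j) * h (Suc j)) + (\<Sum>j\<le>n. of_nat (n choose j) * h (Suc j))"
    by (simp add: algebra_simps sum.distrib)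
  also have "h 0 + ((\<Sum>j\<le>n. of_nat (n choose Suc j) * h (Suc j)) + (\<Sum>j\<le>n. of_nat (n choose j) * h (Suc j))) =
      (\<Sum>j\<le>Suc n. of_nat (n choose j) * h j) + (\<Sum>j\<le>n. of_nat (n choose j) * h (Suc j))"
    unfolding sum.atMost_Suc_shift[of _ n] by simp
  also have "(\<Sum>j\<le>Suc n. of_nat (n choose j) * h j) = pochhammer b n / pochhammer c n"
    using Suc.IH[OF Suc.prems] by (simp add: h_def mult.assoc)
  also have "(\<Sum>j\<le>n. of_nat (n choose j) * h (Suc j)) = - ((c - b) / c) * (pochhammer b n / pochhammer (c + 1) n)"
    unfolding hS Suc.IH[OF c1, symmetric] sum_distrib_left by (simp add: mult_ac)
  also have "pochhammer b n / pochhammer c n + - ((c - b) / c) * (pochhammer b n / pochhammer (c + 1) n) =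
      pochhammer b (Suc n) / pochhammer c (Suc n)"
  proof -
    have cn: "c + of_nat n \<noteq> 0" using nz(2) by (auto simp: pochhammer_Suc)
    have e: "c * pochhammer (c + 1) n = pochhammer c n * (c + of_nat n)"
      using pochhammer_rec[of c n] pochhammer_Suc[of c n] by simp
    have "- ((c - b) / c) * (pochhammer b n / pochhammer (c + 1) n) = - (c - b) * pochhammer b n / (c * pochhammer (c + 1) n)"
      using c0 nz(3) by (simp add: field_simps)
    also have "\<dots> = - (c - b) * pochhammer b n / (pochhammer c n * (c + of_nat n))" unfolding e ..
    finally have "pochhammer b n / pochhammer c n + - ((c - b) / c) * (pochhammer b n / pochhammer (c + 1) n) =
        pochhammer b n / pochhammer c n + - (c - b) * pochhammer b n / (pochhammer c n * (c + of_nat n))"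
      by simp
    also have "P / Q + - d * P / (Q * X) = P * (X - d) / (Q * X)" if "Q \<noteq> 0" "X \<noteq> 0" for P Q X d :: complex
      using that by (simp add: field_simps)
    note this[OF nz(1) cn, of "pochhammer b n" "c - b"]
    finally show ?thesis by (simp add: pochhammer_Suc add.commute)
  qed
  finally show ?case by (simp add: h_def mult.assoc)
qed simp

lemma hypergeometric_coeff_bound:
  fixes a b c :: complex
  assumes "c \<notin> \<int>\<^sub>\<le>\<^sub>0"
  obtains M where "M > 0" "\<And>k. norm (pochhammer a k * pochhammer b k / (pochhammer c k * fact k))
      \<le> M * real (k + 1) powr (Re (a + b - c) - 1)"
proof -
  obtain M where M: "M > 0" "\<And>k. norm (pochhammer a k * pochhammer b k * rGamma (c + of_nat k) / fact k)
      \<le> M * real (k + 1) powr (Re (a + b - c) - 1)" using Gauss_term_bound by blast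
  have G: "Gamma c \<noteq> 0" using assms by (simp add: Gamma_eq_zero_iff)
  have "pochhammer a k * pochhammer b k / (pochhammer c k * fact k) =
      Gamma c * (pochhammer a k * pochhammer b k * rGamma (c + of_nat k) / fact k)" for k
  proof -
    have "Gamma c * (pochhammer c k * rGamma (c + of_nat k)) = 1"
      unfolding pochhammer_rGamma[of c k, symmetric] using G by (simp add: rGamma_inverse_Gamma)
    then have "1 / pochhammer c k = Gamma c * rGamma (c + of_nat k)"
      by (cases "pochhammer c k = 0") (simp_all add: divide_eq_eq mult_ac)
    moreover have "pochhammer a k * pochhammer b k / (pochhammer c k * fact k) =
        (1 / pochhammer c k) * (pochhammer a k * pochhammer b k / fact k)" by simp
    ultimately show ?thesis by (simp only:) simp
  qed
  then have "norm (pochhammer a k * pochhammer b k / (pochhammer c k * fact k)) \<le>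
      (norm (Gamma c) * M) * real (k + 1) powr (Re (a + b - c) - 1)" for k
    using mult_left_mono[OF M(2)[of k], of "norm (Gamma c)"]
    by (simp only: norm_mult[of "Gamma c"] mult.assoc) simp
  with M G that[of "norm (Gamma c) * M"] show thesis by simp
qed

lemma hypergeometric_summable:
  fixes a b c z :: complex
  assumes "c \<notin> \<int>\<^sub>\<le>\<^sub>0" "norm z < 1"
  shows "summable (\<lambda>k. norm (pochhammer a k * pochhammer b k / pochhammer c k * z ^ k / fact k))"
proof -
  obtain M where M: "\<And>k. norm (pochhammer a k * pochhammer b k / (pochhammer c k * fact k))
      \<le> M * real (k + 1) powr (Re (a + b - c) - 1)" using hypergeometric_coeff_bound[OF assms(1)] by metis
  have "summable (\<lambda>k. norm (pochhammer a k * pochhammer b k / (pochhammer c k * fact k)) * norm z ^ k)"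
    by (rule summable_polynomial_growth[OF M]) (use assms in auto)
  then show ?thesis by (simp add: norm_mult norm_divide norm_power field_simps)
qed

lemma hyp2F1_series_holomorphic:
  assumes "c \<notin> \<int>\<^sub>\<le>\<^sub>0"
  shows "hyp2F1_series a b c holomorphic_on ball 0 1"
proof (rule power_series_holomorphic)
  fix w :: complex assume "w \<in> ball 0 1"
  then have "summable (\<lambda>k. pochhammer a k * pochhammer b k / pochhammer c k * w ^ k / fact k)"
    by (intro summable_norm_cancel[OF hypergeometric_summable[OF assms]]) simp
  then show "(\<lambda>n. pochhammer a n * pochhammer b n / (pochhammer c n * fact n) * (w - 0) ^ n) sums hyp2F1_series a b c w"
    unfolding hyp2F1_series_def by (simp add: sums_iff field_simps)
qed

text \<open>
  Expand each (1 - z)^(-a-j) on the left in powers of z and sum the double series along diagonals; the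
  coefficient of each power of z is then a Chu--Vandermonde sum.
\<close>
lemma Pfaff_near_0:
  fixes a b c z :: complex
  assumes c: "c \<notin> \<int>\<^sub>\<le>\<^sub>0" and z: "norm z < 1 / 3"
  shows "(1 - z) powr (- a) * hyp2F1_series a (c - b) c (z / (z - 1)) = hyp2F1_series a b c z"
proof -
  define r where "r = norm z"
  define q where "q = (\<lambda>j. pochhammer a j * pochhammer (c - b) j / (pochhammer c j * fact j))"
  define e where "e = (\<lambda>j i. q j * (-1) ^ j * (pochhammer (a + of_nat j) i / fact i) * z ^ (j + i))"
  have r: "0 \<le> r" "r < 1 / 3" using z by (auto simp: r_def)
  have z1: "z \<noteq> 1" using z by auto
  have pa: "pochhammer a j * pochhammer (a + of_nat j) (n - j) = pochhammer a n" if "j \<le> n" for j n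
    using pochhammer_product[OF that, of a] by simp
  obtain Ma where Ma: "Ma > 0" "\<And>n. norm (pochhammer a n) \<le> Ma * fact n * real (n + 1) powr (Re a - 1)"
    using pochhammer_upper_bound by blast
  obtain Mq where Mq: "Mq > 0" "\<And>k. norm (pochhammer 1 k * pochhammer (c - b) k / (pochhammer c k * fact k))
      \<le> Mq * real (k + 1) powr (Re (1 + (c - b) - c) - 1)" using hypergeometric_coeff_bound[OF c] by metis
  define p where "p = max 0 (- Re b)"
  have e_le: "norm (e j (n - j)) \<le> (Ma * Mq * real (n + 1) powr (Re a - 1 + p)) * of_nat (n choose j) * r ^ n"
    if "j \<le> n" for j n
  proof -
    have "e j (n - j) = pochhammer a n / (fact j * fact (n - j)) * (pochhammer 1 j * pochhammer (c - b) j / (pochhammer c j * fact j)) * (-1) ^ j * z ^ n"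
      using that pa[OF that] by (simp add: e_def q_def pochhammer_fact[symmetric] field_simps)
    then have "norm (e j (n - j)) = norm (pochhammer a n) / (fact j * fact (n - j)) *
        norm (pochhammer 1 j * pochhammer (c - b) j / (pochhammer c j * fact j)) * r ^ n"
      by (simp only: norm_mult norm_divide norm_power r_def) simp
    also have "\<dots> \<le> (Ma * fact n * real (n + 1) powr (Re a - 1)) / (fact j * fact (n - j)) *
        (Mq * real (n + 1) powr p) * r ^ n"
    proof (intro mult_right_mono mult_mono divide_right_mono Ma)
      have "real (j + 1) powr (Re (1 + (c - b) - c) - 1) \<le> real (j + 1) powr p"
        by (intro powr_mono) (auto simp: p_def)
      also have "\<dots> \<le> real (n + 1) powr p" using that by (intro powr_mono2) (auto simp: p_def)
      finally show "norm (pochhammer 1 j * pochhammer (c - b) j / (pochhammer c j * fact j)) \<le> Mq * real (n + 1) powr p"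
        using Mq by (smt (verit) mult_left_mono)
    qed (use r Ma in auto)
    also have "\<dots> = (Ma * Mq * (real (n + 1) powr (Re a - 1) * real (n + 1) powr p)) * of_nat (n choose j) * r ^ n"
      using binomial_fact[OF that, where 'a = real] by (simp add: field_simps)
    also have "real (n + 1) powr (Re a - 1) * real (n + 1) powr p = real (n + 1) powr (Re a - 1 + p)"
      by (simp flip: powr_add)
    finally show ?thesis .
  qed
  \<comment> \<open>The binomial coefficients of a diagonal add up to 2^n, so 2 r < 1 suffices for absolute convergence.\<close>
  have sum_e: "summable (\<lambda>n. \<Sum>j\<le>n. norm (e j (n - j)))"
  proof -
    have sm: "summable (\<lambda>n. norm (Ma * Mq * real (n + 1) powr (Re a - 1 + p)) * (2 * r) ^ n)"
      using r Ma Mq by (intro summable_polynomial_growth[where M = "Ma * Mq" and p = "Re a - 1 + p"]) auto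
    show ?thesis
    proof (rule summable_comparison_test'[OF sm, of 0])
      fix n
      have "(\<Sum>j\<le>n. norm (e j (n - j))) \<le> (\<Sum>j\<le>n. (Ma * Mq * real (n + 1) powr (Re a - 1 + p)) * of_nat (n choose j) * r ^ n)"
        by (intro sum_mono e_le) auto
      also have "\<dots> = (Ma * Mq * real (n + 1) powr (Re a - 1 + p)) * r ^ n * of_nat (\<Sum>j\<le>n. n choose j)"
        by (simp add: sum_distrib_left sum_distrib_right mult_ac)
      also have "\<dots> = (Ma * Mq * real (n + 1) powr (Re a - 1 + p)) * (2 * r) ^ n"
        by (simp add: choose_row_sum power_mult_distrib)
      finally show "norm (\<Sum>j\<le>n. norm (e j (n - j))) \<le> norm (Ma * Mq * real (n + 1) powr (Re a - 1 + p)) * (2 * r) ^ n"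
        using Ma Mq by (simp add: sum_nonneg abs_mult)
    qed
  qed
  have rows: "(\<Sum>i. e j i) = (1 - z) powr (- a) * (pochhammer a j * pochhammer (c - b) j / pochhammer c j * (z / (z - 1)) ^ j / fact j)" for j
  proof -
    have "(\<lambda>i. q j * (-1) ^ j * z ^ j * (pochhammer (a + of_nat j) i / fact i * z ^ i)) sums
        (q j * (-1) ^ j * z ^ j * (1 - z) powr (- (a + of_nat j)))"
      using z by (intro sums_mult binomial_series_complex) simp
    then have "(\<Sum>i. e j i) = q j * (-1) ^ j * z ^ j * (1 - z) powr (- (a + of_nat j))"
      by (simp add: e_def sums_iff power_add mult_ac)
    also have "(1 - z) powr (- (a + of_nat j)) = (1 - z) powr (- a) / (1 - z) ^ j"
      using z1 by (simp add: powr_diff powr_nat' powr_minus_divide powr_add)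
    also have "q j * (-1) ^ j * z ^ j * ((1 - z) powr (- a) / (1 - z) ^ j) = (1 - z) powr (- a) * (q j * ((- 1) * z / (1 - z)) ^ j)"
      by (simp only: power_divide power_mult_distrib) simp
    also have "(- 1) * z / (1 - z) = z / (z - 1)" using z1 by (simp add: divide_simps) (simp add: algebra_simps)
    finally show ?thesis by (simp add: q_def field_simps)
  qed
  have diag: "(\<Sum>j\<le>n. e j (n - j)) = pochhammer a n * pochhammer b n / pochhammer c n * z ^ n / fact n" for n
  proof -
    have "(\<Sum>j\<le>n. e j (n - j)) = (\<Sum>j\<le>n. (pochhammer a n * z ^ n / fact n) * (of_nat (n choose j) * (-1) ^ j * (pochhammer (c - b) j / pochhammer c j)))"
    proof (intro sum.cong refl)
      fix j assume "j \<in> {..n}"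
      then have j: "j \<le> n" by simp
      show "e j (n - j) = (pochhammer a n * z ^ n / fact n) * (of_nat (n choose j) * (-1) ^ j * (pochhammer (c - b) j / pochhammer c j))"
      proof -
        have bin: "1 / (fact j * fact (n - j)) = complex_of_nat (n choose j) / fact n"
          using binomial_fact[OF j, where 'a = complex] by simp
        have "e j (n - j) = (pochhammer a j * pochhammer (a + of_nat j) (n - j)) * (1 / (fact j * fact (n - j))) *
            (pochhammer (c - b) j / pochhammer c j * (-1) ^ j * z ^ n)"
          using j by (simp add: e_def q_def mult_ac)
        then show ?thesis unfolding pa[OF j] bin by simp
      qed
    qed
    also have "\<dots> = (pochhammer a n * z ^ n / fact n) * (pochhammer b n / pochhammer c n)"
      unfolding sum_distrib_left[symmetric] Chu_Vandermonde[OF c] ..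
    finally show ?thesis by (simp add: field_simps)
  qed
  have "(\<lambda>j. \<Sum>i. e j i) sums (\<Sum>n. \<Sum>j\<le>n. e j (n - j))"
    by (rule double_series_diagonal(2)[OF sum_e])
  then have "(\<lambda>j. (1 - z) powr (- a) * (pochhammer a j * pochhammer (c - b) j / pochhammer c j * (z / (z - 1)) ^ j / fact j))
      sums hyp2F1_series a b c z"
    unfolding rows diag hyp2F1_series_def .
  moreover have "norm (z / (z - 1)) < 1"
  proof -
    have "1 - norm z \<le> norm (z - 1)" using norm_triangle_ineq2[of 1 z] by (simp add: norm_minus_commute)
    then have "norm z < norm (z - 1)" using z by linarith
    then show ?thesis by (simp add: norm_divide divide_simps split: if_splits)
  qed
  then have "(\<lambda>j. (1 - z) powr (- a) * (pochhammer a j * pochhammer (c - b) j / pochhammer c j * (z / (z - 1)) ^ j / fact j))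
      sums ((1 - z) powr (- a) * hyp2F1_series a (c - b) c (z / (z - 1)))"
    unfolding hyp2F1_series_def
    by (rule sums_mult[OF summable_sums[OF summable_norm_cancel[OF hypergeometric_summable[OF c]]]])
  ultimately show ?thesis by (rule sums_unique2[rotated])
qed

lemma norm_moebius_half_plane:
  assumes "Re z < 1 / 2"
  shows "norm (z / (z - 1)) < 1" "z \<noteq> 1"
proof -
  have "norm z ^ 2 < norm (z - 1) ^ 2"
    using assms by (simp add: cmod_power2) (simp add: power2_eq_square algebra_simps)
  then have "norm z < norm (z - 1)" using power2_less_imp_less norm_ge_zero by blast
  then show "norm (z / (z - 1)) < 1" by (simp add: norm_divide divide_simps split: if_splits)
  show "z \<noteq> 1" using assms by auto
qed

text \<open>
  The right-hand side is holomorphic on the half-plane Re z < 1/2, because the Moebius map z / (z - 1) sends it into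
  the unit disc. It agrees with the series near 0, so it is the analytic continuation of the series. Two
  continuations to convex sets containing 0 agree on the intersection, which is connected.
\<close>
theorem hyp2F1_Pfaff:
  assumes c: "c \<notin> \<int>\<^sub>\<le>\<^sub>0" and z: "Re z < 1 / 2"
  shows "hyp2F1 a b c z = (1 - z) powr (- a) * hyp2F1_series a (c - b) c (z / (z - 1))"
proof -
  define S0 where "S0 = {z::complex. Re z < 1 / 2}"
  define F0 where "F0 = (\<lambda>z. (1 - z) powr (- a) * hyp2F1_series a (c - b) c (z / (z - 1)))"
  have S0: "open S0" "convex S0" "0 \<in> S0"
    using open_halfspace_Re_lt[of "1/2"] convex_halfspace_Re_lt[of "1/2"]
    by (simp_all only: S0_def) simp
  have holF0: "F0 holomorphic_on S0"
  proof -
    have "(\<lambda>z. hyp2F1_series a (c - b) c (z / (z - 1))) holomorphic_on S0"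
    proof (rule holomorphic_on_compose_gen[OF _ hyp2F1_series_holomorphic[OF c], unfolded o_def])
      show "(\<lambda>z. z / (z - 1)) holomorphic_on S0"
        by (intro holomorphic_intros) (auto simp: S0_def)
      show "(\<lambda>z. z / (z - 1)) ` S0 \<subseteq> ball 0 1"
        using norm_moebius_half_plane by (auto simp: S0_def)
    qed
    moreover have "(\<lambda>z. (1 - z) powr (- a)) holomorphic_on S0"
      by (intro holomorphic_intros) (auto simp: S0_def complex_nonpos_Reals_iff)
    ultimately show ?thesis unfolding F0_def by (rule holomorphic_on_mult[rotated])
  qed
  have eq: "F1 w = F2 w"
    if "open S1" "convex S1" "0 \<in> S1" "F1 holomorphic_on S1" "open S2" "convex S2" "0 \<in> S2" "F2 holomorphic_on S2"
      "r > 0" "\<And>w. w \<in> S1 \<inter> S2 \<inter> ball 0 r \<Longrightarrow> F1 w = F2 w" "w \<in> S1" "w \<in> S2" for F1 F2 S1 S2 w and r :: real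
  proof (rule analytic_continuation_open[of "S1 \<inter> S2 \<inter> ball 0 r" "S1 \<inter> S2" F1 F2])
    show "S1 \<inter> S2 \<inter> ball 0 r \<noteq> {}" using that by (auto intro!: exI[of _ 0])
    show "connected (S1 \<inter> S2)" using that by (intro convex_connected convex_Int)
  qed (use that in \<open>auto intro: holomorphic_on_subset\<close>)
  have near: "F0 w = hyp2F1_series a b c w" if "w \<in> ball 0 (1/3)" for w
    using that Pfaff_near_0[OF c] by (auto simp: F0_def)
  have disc: "F0 w = hyp2F1_series a b c w" if "w \<in> S0 \<inter> ball 0 1" for w
    by (rule eq[of S0 F0 "ball 0 1" "hyp2F1_series a b c" "1/3"])
       (use that S0 holF0 near hyp2F1_series_holomorphic[OF c] in auto)
  have "hyp2F1 a b c z = F0 z"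
    unfolding hyp2F1_def
  proof (rule the_equality)
    show "\<exists>S F. open S \<and> convex S \<and> 0 \<in> S \<and> z \<in> S \<and> F holomorphic_on S \<and>
        (\<forall>w\<in>S \<inter> ball 0 1. F w = hyp2F1_series a b c w) \<and> F0 z = F z"
      using S0 holF0 disc z by (intro exI[of _ S0] exI[of _ F0]) (auto simp: S0_def)
    fix y assume "\<exists>S F. open S \<and> convex S \<and> 0 \<in> S \<and> z \<in> S \<and> F holomorphic_on S \<and>
        (\<forall>w\<in>S \<inter> ball 0 1. F w = hyp2F1_series a b c w) \<and> y = F z"
    then obtain S F where SF: "open S" "convex S" "0 \<in> S" "z \<in> S" "F holomorphic_on S"
      "\<And>w. w \<in> S \<inter> ball 0 1 \<Longrightarrow> F w = hyp2F1_series a b c w" "y = F z" by blast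
    have "F z = F0 z"
      by (rule eq[of S F S0 F0 1]) (use SF S0 holF0 disc z in \<open>auto simp: S0_def\<close>)
    then show "y = F0 z" using SF by simp
  qed
  then show ?thesis by (simp add: F0_def)
qed


section \<open>The third Appell function as a power series in one variable\<close>

text \<open>
  Coefficient of w^(k+j) after Pfaff's transformation of the k-th inner Gauss function; the index k counts the outer
  series and j the transformed inner one.
\<close>
definition F3_term :: "complex \<Rightarrow> complex \<Rightarrow> complex \<Rightarrow> complex \<Rightarrow> complex \<Rightarrow> nat \<Rightarrow> nat \<Rightarrow> complex" where
  "F3_term A A' B B' C k j =
     pochhammer A k * pochhammer B k / (pochhammer C k * fact k) *
     (pochhammer A' j * pochhammer (C + of_nat k - B') j / (pochhammer (C + of_nat k) j * fact j))"

definition F3_coeff :: "complex \<Rightarrow> complex \<Rightarrow> complex \<Rightarrow> complex \<Rightarrow> complex \<Rightarrow> nat \<Rightarrow> complex" where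
  "F3_coeff A A' B B' C n = (\<Sum>k\<le>n. F3_term A A' B B' C k (n - k))"

text \<open>
  The Appell function F3 (A, A', B, B'; C; w, w / (w - 1)) up to the factor (1 - w)^A' that Pfaff's
  transformation splits off.
\<close>
definition F3_Pfaff :: "complex \<Rightarrow> complex \<Rightarrow> complex \<Rightarrow> complex \<Rightarrow> complex \<Rightarrow> complex \<Rightarrow> complex" where
  "F3_Pfaff A A' B B' C w = (\<Sum>n. F3_coeff A A' B B' C n * w ^ n)"

lemma pochhammer_convolution:
  fixes x y :: real
  shows "(\<Sum>k\<le>n. (pochhammer x k / fact k) * (pochhammer y (n - k) / fact (n - k))) = pochhammer (x + y) n / fact n"
proof -
  have "(\<Sum>k\<le>n. (pochhammer x k / fact k) * (pochhammer y (n - k) / fact (n - k))) =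
      (\<Sum>k\<le>n. of_nat (n choose k) * pochhammer x k * pochhammer y (n - k) / fact n)"
    by (intro sum.cong refl) (simp add: binomial_fact)
  then show ?thesis by (simp add: pochhammer_binomial_sum sum_divide_distrib)
qed

text \<open>
  With the powers of k and n - k exchanged for binomial coefficients of exponents x and y, the
  diagonal sum becomes a convolution of two binomial series. The numbers x and y replace Re (A + B - C + B')
  and Re A' because a binomial series of nonpositive exponent would not dominate the power.
\<close>
lemma F3_term_sum_bound:
  fixes A A' B B' C :: complex and x y :: real
  assumes C: "Re C > 0" and x: "x > 0" "x \<ge> Re (A + B - C + B')" and y: "y > 0" "y \<ge> Re A'"
  obtains M where "M > 0"
    "\<And>n. (\<Sum>k\<le>n. norm (F3_term A A' B B' C k (n - k))) \<le> M * real (n + 1) powr (x + y - Re B' - 1)"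
proof -
  have C': "C \<notin> \<int>\<^sub>\<le>\<^sub>0" using C by (rule Re_pos_not_nonpos_Int)
  obtain Ma where Ma: "Ma > 0" "\<And>n. norm (pochhammer A n) \<le> Ma * fact n * real (n + 1) powr (Re A - 1)"
    using pochhammer_upper_bound by blast
  obtain Mb where Mb: "Mb > 0" "\<And>n. norm (pochhammer B n) \<le> Mb * fact n * real (n + 1) powr (Re B - 1)"
    using pochhammer_upper_bound by blast
  obtain Ma' where Ma': "Ma' > 0" "\<And>n. norm (pochhammer A' n) \<le> Ma' * fact n * real (n + 1) powr (Re A' - 1)"
    using pochhammer_upper_bound by blast
  obtain Mc where Mc: "Mc > 0" "\<And>k n. k \<le> n \<Longrightarrow> norm (pochhammer (C - B' + of_nat k) (n - k)) \<le>
      Mc * (fact n / fact k) * (real (n + 1) powr (Re (C - B') - 1) * real (k + 1) powr (1 - Re (C - B')))"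
    using pochhammer_shift_upper_bound by blast
  obtain m where m: "m > 0" "\<And>n. m * fact n * real (n + 1) powr (Re C - 1) \<le> norm (pochhammer C n)"
    using pochhammer_lower_bound[OF C'] by blast
  obtain Mx where Mx: "Mx > 0" "\<And>n. real (n + 1) powr (x - 1) \<le> Mx * (pochhammer x n / fact n)"
    using power_le_pochhammer[OF x(1)] by blast
  obtain My where My: "My > 0" "\<And>n. real (n + 1) powr (y - 1) \<le> My * (pochhammer y n / fact n)"
    using power_le_pochhammer[OF y(1)] by blast
  have xy: "x + y > 0" using x y by simp
  obtain Ms where Ms: "Ms > 0" "\<And>n. pochhammer (x + y) n / fact n \<le> Ms * real (n + 1) powr (x + y - 1)"
    using pochhammer_le_power[OF xy] by blast
  define K where "K = Ma * Mb * Ma' * Mc / m"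
  have K: "K > 0" using Ma Mb Ma' Mc m by (simp add: K_def)
  have bnd: "norm (F3_term A A' B B' C k (n - k)) \<le>
      K * real (n + 1) powr (- Re B') * ((Mx * (pochhammer x k / fact k)) * (My * (pochhammer y (n - k) / fact (n - k))))"
    if "k \<le> n" for k n
  proof -
    define j where "j = n - k"
    have Cn: "pochhammer C k * pochhammer (C + of_nat k) j = pochhammer C n"
      using pochhammer_product[OF that, of C] by (simp add: j_def)
    have "F3_term A A' B B' C k j = (pochhammer A k * pochhammer B k * pochhammer A' j * pochhammer (C - B' + of_nat k) j) /
        ((pochhammer C k * pochhammer (C + of_nat k) j) * (fact k * fact j))"
      by (simp add: F3_term_def algebra_simps)
    then have "norm (F3_term A A' B B' C k j) =
        (norm (pochhammer A k) * norm (pochhammer B k) * norm (pochhammer A' j) * norm (pochhammer (C - B' + of_nat k) j)) /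
        (norm (pochhammer C n) * (fact k * fact j))"
      unfolding Cn by (simp add: norm_mult norm_divide)
    also have "\<dots> \<le> ((Ma * fact k * real (k + 1) powr (Re A - 1)) * (Mb * fact k * real (k + 1) powr (Re B - 1)) *
        (Ma' * fact j * real (j + 1) powr (Re A' - 1)) *
        (Mc * (fact n / fact k) * (real (n + 1) powr (Re (C - B') - 1) * real (k + 1) powr (1 - Re (C - B'))))) /
        ((m * fact n * real (n + 1) powr (Re C - 1)) * (fact k * fact j))"
      using m Ma(1) Mb(1) Ma'(1) Mc(1) Mc(2)[OF that]
      by (intro frac_le mult_mono Ma Mb Ma' m mult_nonneg_nonneg mult_pos_pos) (auto simp: j_def)
    also have "\<dots> = K * (real (n + 1) powr (Re (C - B') - 1) / real (n + 1) powr (Re C - 1)) *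
        ((real (k + 1) powr (Re A - 1) * real (k + 1) powr (Re B - 1) * real (k + 1) powr (1 - Re (C - B'))) *
        real (j + 1) powr (Re A' - 1))"
      by (simp add: K_def field_simps)
    also have "real (n + 1) powr (Re (C - B') - 1) / real (n + 1) powr (Re C - 1) = real (n + 1) powr (- Re B')"
      by (simp flip: powr_diff)
    also have "real (k + 1) powr (Re A - 1) * real (k + 1) powr (Re B - 1) * real (k + 1) powr (1 - Re (C - B')) =
        real (k + 1) powr (Re (A + B - C + B') - 1)"
      by (simp add: algebra_simps flip: powr_add)
    also have "K * real (n + 1) powr (- Re B') * (real (k + 1) powr (Re (A + B - C + B') - 1) * real (j + 1) powr (Re A' - 1)) \<le>
        K * real (n + 1) powr (- Re B') * ((Mx * (pochhammer x k / fact k)) * (My * (pochhammer y j / fact j)))"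
    proof (intro mult_left_mono mult_mono)
      show "real (k + 1) powr (Re (A + B - C + B') - 1) \<le> Mx * (pochhammer x k / fact k)"
        using x by (intro order_trans[OF _ Mx(2)] powr_mono) auto
      show "real (j + 1) powr (Re A' - 1) \<le> My * (pochhammer y j / fact j)"
        using y by (intro order_trans[OF _ My(2)] powr_mono) auto
    qed (use K Mx(1) pochhammer_pos[OF x(1), of k] in auto)
    finally show ?thesis by (simp add: j_def)
  qed
  have "(\<Sum>k\<le>n. norm (F3_term A A' B B' C k (n - k))) \<le> (K * Mx * My * Ms) * real (n + 1) powr (x + y - Re B' - 1)" for n
  proof -
    have "(\<Sum>k\<le>n. norm (F3_term A A' B B' C k (n - k))) \<le> (\<Sum>k\<le>n. K * real (n + 1) powr (- Re B') *
        ((Mx * (pochhammer x k / fact k)) * (My * (pochhammer y (n - k) / fact (n - k)))))"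
      by (intro sum_mono bnd) auto
    also have "\<dots> = (K * Mx * My) * real (n + 1) powr (- Re B') *
        (\<Sum>k\<le>n. (pochhammer x k / fact k) * (pochhammer y (n - k) / fact (n - k)))"
      unfolding sum_distrib_left by (intro sum.cong refl) (simp only: mult_ac)
    also have "\<dots> \<le> (K * Mx * My) * real (n + 1) powr (- Re B') * (Ms * real (n + 1) powr (x + y - 1))"
      unfolding pochhammer_convolution using K Mx My by (intro mult_left_mono Ms) auto
    also have "\<dots> = (K * Mx * My * Ms) * (real (n + 1) powr (- Re B') * real (n + 1) powr (x + y - 1))"
      by (simp only: mult_ac)
    also have "real (n + 1) powr (- Re B') * real (n + 1) powr (x + y - 1) = real (n + 1) powr (x + y - Re B' - 1)"
      by (simp add: algebra_simps flip: powr_add)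
    finally show ?thesis .
  qed
  with K Mx My Ms that[of "K * Mx * My * Ms"] show thesis by simp
qed

lemma F3_diagonal_summable:
  fixes w :: complex
  assumes "Re C > 0" "norm w < 1"
  shows "summable (\<lambda>n. (\<Sum>k\<le>n. norm (F3_term A A' B B' C k (n - k))) * norm w ^ n)"
proof -
  define x where "x = max 1 (Re (A + B - C + B'))"
  define y where "y = max 1 (Re A')"
  have xy: "x > 0" "x \<ge> Re (A + B - C + B')" "y > 0" "y \<ge> Re A'" by (simp_all add: x_def y_def)
  obtain M where M: "\<And>n. (\<Sum>k\<le>n. norm (F3_term A A' B B' C k (n - k))) \<le> M * real (n + 1) powr (x + y - Re B' - 1)"
    by (rule F3_term_sum_bound[OF assms(1) xy]) blast
  have "summable (\<lambda>n. norm (\<Sum>k\<le>n. norm (F3_term A A' B B' C k (n - k))) * norm w ^ n)"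
    by (rule summable_polynomial_growth[where M = M and p = "x + y - Re B' - 1"])
       (use M assms in \<open>simp_all add: sum_nonneg\<close>)
  then show ?thesis by (simp add: sum_nonneg)
qed

lemma F3_coeff_summable:
  fixes w :: complex
  assumes "Re C > 0" "norm w < 1"
  shows "summable (\<lambda>n. norm (F3_coeff A A' B B' C n) * norm w ^ n)"
    and "summable (\<lambda>n. F3_coeff A A' B B' C n * w ^ n)"
proof -
  show sm: "summable (\<lambda>n. norm (F3_coeff A A' B B' C n) * norm w ^ n)"
  proof (rule summable_comparison_test'[OF F3_diagonal_summable[OF assms, of A A' B B'], of 0])
    fix n
    show "norm (norm (F3_coeff A A' B B' C n) * norm w ^ n) \<le> (\<Sum>k\<le>n. norm (F3_term A A' B B' C k (n - k))) * norm w ^ n"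
      unfolding F3_coeff_def by (simp add: abs_mult mult_right_mono norm_sum)
  qed
  show "summable (\<lambda>n. F3_coeff A A' B B' C n * w ^ n)"
    by (rule summable_norm_cancel) (use sm in \<open>simp add: norm_mult norm_power\<close>)
qed

text \<open>
  The second argument v = 1 - t and the first u = 1 - 1/t satisfy v / (v - 1) = u, so Pfaff's transformation
  makes all inner Gauss functions power series in the variable u of the outer series.
\<close>
theorem appell_F3_eq:
  assumes C: "Re C > 0" and t: "1 < (t::real)"
  shows "appell_F3 A A' B B' C (of_real (1 - 1 / t)) (of_real (1 - t)) =
    of_real t powr (- A') * F3_Pfaff A A' B B' C (of_real (1 - 1 / t))"
proof -
  define w :: complex where "w = of_real (1 - 1 / t)"
  have nw: "norm w = 1 - 1 / t" using t by (simp add: w_def norm_of_real del: of_real_diff of_real_divide)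
  have w1: "norm w < 1" using t nw by simp
  have v: "complex_of_real (1 - t) / (of_real (1 - t) - 1) = w"
    using t by (simp add: w_def field_simps)
  define c where "c = (\<lambda>k j. F3_term A A' B B' C k j * w ^ (k + j))"
  have Ck: "C + of_nat k \<notin> \<int>\<^sub>\<le>\<^sub>0" for k using C by (intro Re_pos_not_nonpos_Int) simp
  have row: "pochhammer A k * pochhammer B k / pochhammer C k * w ^ k / fact k * hyp2F1 A' B' (C + of_nat k) (of_real (1 - t))
      = of_real t powr (- A') * (\<Sum>j. c k j)" for k
  proof -
    have "hyp2F1 A' B' (C + of_nat k) (of_real (1 - t)) =
        (1 - of_real (1 - t)) powr (- A') * hyp2F1_series A' (C + of_nat k - B') (C + of_nat k) w"
      unfolding v[symmetric] by (rule hyp2F1_Pfaff[OF Ck]) (use t in simp)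
    moreover have "summable (\<lambda>j. pochhammer A' j * pochhammer (C + of_nat k - B') j / pochhammer (C + of_nat k) j * w ^ j / fact j)"
      by (rule summable_norm_cancel[OF hypergeometric_summable[OF Ck w1]])
    then have "pochhammer A k * pochhammer B k / pochhammer C k * w ^ k / fact k * hyp2F1_series A' (C + of_nat k - B') (C + of_nat k) w =
        (\<Sum>j. pochhammer A k * pochhammer B k / pochhammer C k * w ^ k / fact k *
          (pochhammer A' j * pochhammer (C + of_nat k - B') j / pochhammer (C + of_nat k) j * w ^ j / fact j))"
      unfolding hyp2F1_series_def by (rule suminf_mult[symmetric])
    moreover have "pochhammer A k * pochhammer B k / pochhammer C k * w ^ k / fact k *
          (pochhammer A' j * pochhammer (C + of_nat k - B') j / pochhammer (C + of_nat k) j * w ^ j / fact j) = c k j" for j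
      by (simp add: c_def F3_term_def power_add mult_ac)
    ultimately show ?thesis by (simp add: mult_ac)
  qed
  have cn: "(\<Sum>k\<le>n. norm (c k (n - k))) = (\<Sum>k\<le>n. norm (F3_term A A' B B' C k (n - k))) * norm w ^ n" for n
    by (simp add: c_def norm_mult norm_power sum_distrib_right)
  have sm: "summable (\<lambda>n. \<Sum>k\<le>n. norm (c k (n - k)))"
    unfolding cn using C w1 by (rule F3_diagonal_summable)
  have "(\<lambda>k. \<Sum>j. c k j) sums (\<Sum>n. \<Sum>k\<le>n. c k (n - k))"
    by (rule double_series_diagonal(2)[OF sm])
  moreover have "(\<Sum>k\<le>n. c k (n - k)) = F3_coeff A A' B B' C n * w ^ n" for n
    by (simp add: c_def F3_coeff_def sum_distrib_right)
  ultimately have "(\<lambda>k. of_real t powr (- A') * (\<Sum>j. c k j)) sums (of_real t powr (- A') * F3_Pfaff A A' B B' C w)"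
    unfolding F3_Pfaff_def by (intro sums_mult) simp
  then have "(\<Sum>k. pochhammer A k * pochhammer B k / pochhammer C k * w ^ k / fact k * hyp2F1 A' B' (C + of_nat k) (of_real (1 - t)))
      = of_real t powr (- A') * F3_Pfaff A A' B B' C w"
    unfolding row by (simp add: sums_iff)
  moreover have "w \<in> \<real>" "0 \<le> Re w" "Re w < 1" using t by (simp_all add: w_def)
  ultimately show ?thesis
    using t unfolding appell_F3_def w_def[symmetric] by simp
qed

text \<open>
  All four terms are multiples of one common expression X, which reduces each summand to the identity
  A' (c - B' + j) = (A' + 1 + j) (c - B' + j) - (c + j) (j + 1) + B' (j + 1).
\<close>
lemma F3_coeff_recurrence:
  assumes C: "Re C > 0"
  shows "F3_coeff A A' B B' C 0 = F3_coeff A (A' + 1) B B' C 0"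
    and "F3_coeff A A' B B' C (Suc n) = F3_coeff A (A' + 1) B B' C (Suc n) - F3_coeff A (A' + 1) B B' C n
      + B' / C * F3_coeff A (A' + 1) B (B' + 1) (C + 1) n"
proof -
  have C0: "C \<noteq> 0" using C by auto
  have nzC: "C + of_nat k \<noteq> 0" for k using C by (auto simp: complex_eq_iff)
  have nz: "pochhammer (C + of_nat k) j \<noteq> 0" "pochhammer (C + 1 + of_nat k) j \<noteq> 0" for k j
    using C by (auto dest!: pochhammer_eq_0_imp_nonpos_Int simp: Re_pos_not_nonpos_Int)
  have zero: "F3_term A A' B B' C k 0 = F3_term A (A' + 1) B B' C k 0" for A' B' C k
    by (simp add: F3_term_def)
  have step: "F3_term A A' B B' C k (Suc j) = F3_term A (A' + 1) B B' C k (Suc j) - F3_term A (A' + 1) B B' C k j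
      + B' / C * F3_term A (A' + 1) B (B' + 1) (C + 1) k j" for k j
  proof -
    define q where "q = pochhammer A k * pochhammer B k / (pochhammer C k * fact k)"
    define c where "c = C + of_nat k"
    define X where "X = pochhammer (A' + 1) j * pochhammer (c - B') j / (pochhammer c (Suc j) * fact (Suc j))"
    have c0: "c \<noteq> 0" "pochhammer c j \<noteq> 0" "pochhammer (c + 1) j \<noteq> 0" "c + of_nat j \<noteq> 0"
      using nzC[of k] nz[of k j] nzC[of "k + j"] by (simp_all add: c_def add_ac)
    have pc: "pochhammer c (Suc j) = pochhammer c j * (c + of_nat j)" "pochhammer c (Suc j) = c * pochhammer (c + 1) j"
      by (rule pochhammer_Suc) (rule pochhammer_rec)
    have 1: "F3_term A A' B B' C k (Suc j) = q * (X * (A' * (c - B' + of_nat j)))"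
      unfolding F3_term_def q_def[symmetric] c_def[symmetric] X_def
      by (simp add: pochhammer_rec[of A' j] pochhammer_Suc[of "c - B'" j])
    have 2: "F3_term A (A' + 1) B B' C k (Suc j) = q * (X * ((A' + 1 + of_nat j) * (c - B' + of_nat j)))"
      unfolding F3_term_def q_def[symmetric] c_def[symmetric] X_def
      by (simp add: pochhammer_Suc[of "A' + 1" j] pochhammer_Suc[of "c - B'" j])
    have 3: "F3_term A (A' + 1) B B' C k j = q * (X * ((c + of_nat j) * of_nat (Suc j)))"
    proof -
      have "N / ((P * Y) * (S * f)) * (Y * S) = N / (P * f)" if "Y \<noteq> 0" "S \<noteq> 0" for N P Y S f :: complex
        using that by simp
      note this[OF c0(4) of_nat_neq_0[of j], of "pochhammer (A' + 1) j * pochhammer (c - B') j" "pochhammer c j" "fact j"]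
      then show ?thesis
        unfolding F3_term_def q_def[symmetric] c_def[symmetric] X_def pc(1) fact_Suc by (simp only:)
    qed
    have q': "pochhammer A k * pochhammer B k / (pochhammer (C + 1) k * fact k) = q * (C / c)"
    proof -
      have "C * pochhammer (C + 1) k = pochhammer C k * c"
        using pochhammer_rec[of C k] pochhammer_Suc[of C k] by (simp add: c_def)
      then have "pochhammer (C + 1) k = pochhammer C k * c / C" using C0 by (simp add: field_simps)
      then show ?thesis using C0 c0(1) by (simp add: q_def)
    qed
    have C1: "C + 1 + of_nat k = c + 1" "c + 1 - (B' + 1) = c - B'" by (simp_all add: c_def)
    have 4: "F3_term A (A' + 1) B (B' + 1) (C + 1) k j = C * (q * (X * of_nat (Suc j)))"
    proof -
      have "q * (C / c) * (N / (P * f)) = C * (q * (N / ((c * P) * (S * f)) * S))" if "S \<noteq> 0" for N P S f :: complex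
        using that by simp
      note this[OF of_nat_neq_0[of j], of "pochhammer (A' + 1) j * pochhammer (c - B') j" "pochhammer (c + 1) j" "fact j"]
      then show ?thesis
        unfolding F3_term_def q' C1 X_def pc(2) fact_Suc by (simp only:)
    qed
    show ?thesis unfolding 1 2 3 4 using C0 by (simp add: field_simps)
  qed
  show "F3_coeff A A' B B' C 0 = F3_coeff A (A' + 1) B B' C 0"
    by (simp add: F3_coeff_def F3_term_def)
  show "F3_coeff A A' B B' C (Suc n) = F3_coeff A (A' + 1) B B' C (Suc n) - F3_coeff A (A' + 1) B B' C n
      + B' / C * F3_coeff A (A' + 1) B (B' + 1) (C + 1) n"
  proof -
    have sh: "(\<Sum>k\<le>Suc n. F3_term A A' B B' C k (Suc n - k)) =
        (\<Sum>k\<le>n. F3_term A A' B B' C k (Suc (n - k))) + F3_term A A' B B' C (Suc n) 0" for A' B' C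
      by (simp add: Suc_diff_le)
    show ?thesis
      unfolding F3_coeff_def sh step zero[of A']
      by (simp only: sum.distrib sum_subtractf sum_distrib_left[symmetric]) (simp only: diff_conv_add_uminus add_ac)
  qed
qed

text \<open>
  A contiguous relation: it expresses the function through functions with A' + 1, and thereby transfers
  statements proved for Re A' > 0 to all A'.
\<close>
lemma F3_Pfaff_recurrence:
  assumes C: "Re C > 0" and w: "norm w < 1"
  shows "F3_Pfaff A A' B B' C w = (1 - w) * F3_Pfaff A (A' + 1) B B' C w
    + B' / C * (w * F3_Pfaff A (A' + 1) B (B' + 1) (C + 1) w)"
proof -
  define d where "d = F3_coeff A A' B B' C"
  define d1 where "d1 = F3_coeff A (A' + 1) B B' C"
  define d2 where "d2 = F3_coeff A (A' + 1) B (B' + 1) (C + 1)"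
  have C1: "Re (C + 1) > 0" using C by simp
  have sm: "summable (\<lambda>n. d n * w ^ n)" "summable (\<lambda>n. d1 n * w ^ n)" "summable (\<lambda>n. d2 n * w ^ n)"
    unfolding d_def d1_def d2_def using C C1 w by (intro F3_coeff_summable; simp)+
  have rec0: "d 0 = d1 0" and rec: "d (Suc n) = d1 (Suc n) - d1 n + B' / C * d2 n" for n
    unfolding d_def d1_def d2_def by (rule F3_coeff_recurrence[OF C])+
  have S: "(\<lambda>n. f n * w ^ n) sums F \<Longrightarrow> (\<lambda>n. f (Suc n) * w ^ Suc n) sums (F - f 0)" for f :: "nat \<Rightarrow> complex" and F
    by (subst sums_Suc_iff) simp
  have D1: "(\<lambda>n. d1 n * w ^ n) sums (\<Sum>n. d1 n * w ^ n)" and D2: "(\<lambda>n. d2 n * w ^ n) sums (\<Sum>n. d2 n * w ^ n)"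
    using sm by (simp_all add: summable_sums)
  have "(\<lambda>n. d1 (Suc n) * w ^ Suc n - w * (d1 n * w ^ n) + (B' / C * w) * (d2 n * w ^ n)) sums
      (((\<Sum>n. d1 n * w ^ n) - d1 0) - w * (\<Sum>n. d1 n * w ^ n) + (B' / C * w) * (\<Sum>n. d2 n * w ^ n))"
    by (rule sums_add[OF sums_diff[OF S[OF D1] sums_mult[OF D1]] sums_mult[OF D2]])
  moreover have "d1 (Suc n) * w ^ Suc n - w * (d1 n * w ^ n) + (B' / C * w) * (d2 n * w ^ n) = d (Suc n) * w ^ Suc n" for n
    unfolding rec by (simp add: algebra_simps)
  ultimately have "(\<lambda>n. d (Suc n) * w ^ Suc n) sums
      (((\<Sum>n. d1 n * w ^ n) - d1 0) - w * (\<Sum>n. d1 n * w ^ n) + (B' / C * w) * (\<Sum>n. d2 n * w ^ n))" by simp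
  moreover have "(\<lambda>n. d (Suc n) * w ^ Suc n) sums ((\<Sum>n. d n * w ^ n) - d 0)"
    by (rule S[OF summable_sums[OF sm(1)]])
  ultimately have "(\<Sum>n. d n * w ^ n) - d 0 =
      ((\<Sum>n. d1 n * w ^ n) - d1 0) - w * (\<Sum>n. d1 n * w ^ n) + (B' / C * w) * (\<Sum>n. d2 n * w ^ n)"
    by (rule sums_unique2[rotated])
  then show ?thesis
    unfolding F3_Pfaff_def d_def[symmetric] d1_def[symmetric] d2_def[symmetric] rec0 by (simp add: algebra_simps)
qed

definition F3_Pfaff_deriv :: "complex \<Rightarrow> complex \<Rightarrow> complex \<Rightarrow> complex \<Rightarrow> complex \<Rightarrow> complex \<Rightarrow> complex" where
  "F3_Pfaff_deriv A A' B B' C w = (\<Sum>n. diffs (F3_coeff A A' B B' C) n * w ^ n)"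

lemma F3_Pfaff_has_derivative:
  assumes "Re C > 0" "norm w < 1"
  shows "(F3_Pfaff A A' B B' C has_field_derivative F3_Pfaff_deriv A A' B B' C w) (at w)"
  unfolding F3_Pfaff_def[abs_def] F3_Pfaff_deriv_def
proof (rule power_series_has_derivative[OF _ assms(2)])
  fix r :: real assume "0 \<le> r" "r < 1"
  then show "summable (\<lambda>n. norm (F3_coeff A A' B B' C n) * r ^ n)"
    using F3_coeff_summable(1)[OF assms(1), of "complex_of_real r"] by simp
qed

lemma F3_Pfaff_continuous: "Re C > 0 \<Longrightarrow> continuous_on (ball 0 1) (F3_Pfaff A A' B B' C)"
  by (intro continuous_at_imp_continuous_on ballI DERIV_isCont[OF F3_Pfaff_has_derivative]) auto

lemma deriv_recurrence_rule:
  fixes f g :: "complex \<Rightarrow> complex"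
  assumes f: "(f has_field_derivative f') (at w)" and g: "(g has_field_derivative g') (at w)"
  shows "((\<lambda>w. (1 - w) * f w + k * (w * g w)) has_field_derivative (1 - w) * f' - f w + k * (w * g' + g w)) (at w)"
proof -
  have 1: "((\<lambda>w. (1 - w) * f w) has_field_derivative (0 - 1) * f w + f' * (1 - w)) (at w)"
    by (intro DERIV_mult DERIV_diff DERIV_const DERIV_ident f)
  have 2: "((\<lambda>w. k * (w * g w)) has_field_derivative k * (1 * g w + g' * w)) (at w)"
    by (intro DERIV_cmult DERIV_mult DERIV_ident g)
  from DERIV_add[OF 1 2] show ?thesis by (simp add: algebra_simps)
qed

lemma F3_Pfaff_deriv_recurrence:
  assumes C: "Re C > 0" and w: "norm w < 1"
  shows "F3_Pfaff_deriv A A' B B' C w = (1 - w) * F3_Pfaff_deriv A (A' + 1) B B' C w - F3_Pfaff A (A' + 1) B B' C w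
    + B' / C * (w * F3_Pfaff_deriv A (A' + 1) B (B' + 1) (C + 1) w + F3_Pfaff A (A' + 1) B (B' + 1) (C + 1) w)"
proof (rule DERIV_unique)
  show "(F3_Pfaff A A' B B' C has_field_derivative F3_Pfaff_deriv A A' B B' C w) (at w)"
    by (rule F3_Pfaff_has_derivative[OF C w])
  have C1: "Re (C + 1) > 0" using C by simp
  have "((\<lambda>w. (1 - w) * F3_Pfaff A (A' + 1) B B' C w + B' / C * (w * F3_Pfaff A (A' + 1) B (B' + 1) (C + 1) w))
    has_field_derivative (1 - w) * F3_Pfaff_deriv A (A' + 1) B B' C w - F3_Pfaff A (A' + 1) B B' C w
    + B' / C * (w * F3_Pfaff_deriv A (A' + 1) B (B' + 1) (C + 1) w + F3_Pfaff A (A' + 1) B (B' + 1) (C + 1) w)) (at w)"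
    by (rule deriv_recurrence_rule[OF F3_Pfaff_has_derivative[OF C w] F3_Pfaff_has_derivative[OF C1 w]])
  moreover have ev: "\<forall>\<^sub>F v in nhds w. (1 - v) * F3_Pfaff A (A' + 1) B B' C v + B' / C * (v * F3_Pfaff A (A' + 1) B (B' + 1) (C + 1) v)
      = F3_Pfaff A A' B B' C v"
  proof -
    have "\<forall>\<^sub>F v in nhds w. v \<in> ball 0 1" using w by (intro eventually_nhds_in_open) auto
    then show ?thesis by eventually_elim (rule F3_Pfaff_recurrence[OF C, symmetric], simp)
  qed
  ultimately show "(F3_Pfaff A A' B B' C has_field_derivative (1 - w) * F3_Pfaff_deriv A (A' + 1) B B' C w - F3_Pfaff A (A' + 1) B B' C w
    + B' / C * (w * F3_Pfaff_deriv A (A' + 1) B (B' + 1) (C + 1) w + F3_Pfaff A (A' + 1) B (B' + 1) (C + 1) w)) (at w)"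
    using DERIV_cong_ev[OF refl ev refl] by blast
qed


section \<open>Growth of the power series at 1\<close>

text \<open>
  For Re A' > 0 the exponent of the convolution can be taken to be Re A' itself, and s is then the
  exponent of the singularity of the function at w = 1. For other A' the absolute values of the terms may add up to
  more than the function itself.
\<close>
lemma F3_coeff_bound:
  fixes A A' B B' C :: complex and s :: real
  assumes C: "Re C > 0" and A': "Re A' > 0"
    and s: "s > 0" "s > Re (A' - B')" "s \<ge> Re (A + A' + B - C)"
  obtains M where "M > 0" "\<And>n. (\<Sum>k\<le>n. norm (F3_term A A' B B' C k (n - k))) \<le> M * (pochhammer s n / fact n)"
proof -
  define x where "x = s - Re A' + Re B'"
  have x: "x > 0" "x \<ge> Re (A + B - C + B')" using s by (simp_all add: x_def)
  obtain M where M: "M > 0"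
    "\<And>n. (\<Sum>k\<le>n. norm (F3_term A A' B B' C k (n - k))) \<le> M * real (n + 1) powr (x + Re A' - Re B' - 1)"
    by (rule F3_term_sum_bound[OF C x A' order_refl]) blast
  obtain K where K: "K > 0" "\<And>n. real (n + 1) powr (s - 1) \<le> K * (pochhammer s n / fact n)"
    using power_le_pochhammer[OF s(1)] by blast
  have "(\<Sum>k\<le>n. norm (F3_term A A' B B' C k (n - k))) \<le> (M * K) * (pochhammer s n / fact n)" for n
  proof -
    have "(\<Sum>k\<le>n. norm (F3_term A A' B B' C k (n - k))) \<le> M * real (n + 1) powr (s - 1)"
      using M(2)[of n] by (simp add: x_def)
    also have "\<dots> \<le> M * (K * (pochhammer s n / fact n))" using M(1) K(2) by (intro mult_left_mono) auto
    finally show ?thesis by (simp only: mult.assoc)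
  qed
  with M K that[of "M * K"] show thesis by simp
qed

text \<open>
  The number s bounds the exponents of the singular parts of F3_Pfaff at w = 1, so that the function is
  O((1 - w)^(-s)) there. The strict inequalities leave room for logarithms.
\<close>
definition F3_growth :: "complex \<Rightarrow> complex \<Rightarrow> complex \<Rightarrow> complex \<Rightarrow> complex \<Rightarrow> real \<Rightarrow> bool" where
  "F3_growth A A' B B' C s \<longleftrightarrow> s > 0 \<and> s > Re (A' - B') \<and> s > Re (A + A' + B - C)"

lemma power_le_powr: "0 < (v::real) \<Longrightarrow> v powr (- s) = v * v powr (- (s + 1))"
  by (simp add: powr_mult_base)

lemma F3_Pfaff_bound_pos:
  assumes C: "Re C > 0" and A': "Re A' > 0" and s: "F3_growth A A' B B' C s"
  shows "\<exists>M>0. \<forall>w. 0 \<le> w \<and> w < 1 \<longrightarrow>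
      norm (F3_Pfaff A A' B B' C (of_real w)) \<le> M * (1 - w) powr (- s) \<and>
      norm (F3_Pfaff_deriv A A' B B' C (of_real w)) \<le> M * (1 - w) powr (- (s + 1))"
proof -
  define d where "d = F3_coeff A A' B B' C"
  have s0: "s > 0" using s by (simp add: F3_growth_def)
  obtain M where M: "M > 0" "\<And>n. (\<Sum>k\<le>n. norm (F3_term A A' B B' C k (n - k))) \<le> M * (pochhammer s n / fact n)"
    using F3_coeff_bound[OF C A', of s B' A B] s by (auto simp: F3_growth_def)
  have d: "norm (d n) \<le> M * (pochhammer s n / fact n)" for n
    unfolding d_def F3_coeff_def using norm_sum M(2) by (rule order_trans)
  have d': "norm (diffs d n) \<le> (M * s) * (pochhammer (s + 1) n / fact n)" for n
  proof -
    have "norm (diffs d n) = real (Suc n) * norm (d (Suc n))"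
      by (simp add: diffs_def norm_mult del: of_nat_Suc)
    also have "\<dots> \<le> real (Suc n) * (M * (pochhammer s (Suc n) / fact (Suc n)))" by (intro mult_left_mono d) auto
    also have "\<dots> = (M * s) * (pochhammer (s + 1) n / fact n)"
      by (simp add: pochhammer_rec del: of_nat_Suc)
    finally show ?thesis .
  qed
  have gen: "norm (\<Sum>n. f n * complex_of_real w ^ n) \<le> L * (1 - w) powr (- r)"
    if "r > 0" "\<And>n. norm (f n) \<le> L * (pochhammer r n / fact n)" "0 \<le> w" "w < 1" for f L r w
  proof -
    note b = power_series_bound[OF that]
    have n: "norm (f n * complex_of_real w ^ n) = norm (f n) * w ^ n" for n
      using that(3) by (simp add: norm_mult norm_power)
    have "norm (\<Sum>n. f n * complex_of_real w ^ n) \<le> (\<Sum>n. norm (f n * complex_of_real w ^ n))"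
      by (rule summable_norm) (use b n in simp)
    with b show ?thesis unfolding n by linarith
  qed
  have P: "norm (F3_Pfaff A A' B B' C (of_real w)) \<le> M * (1 - w) powr (- s)" if "0 \<le> w" "w < 1" for w
    unfolding F3_Pfaff_def d_def[symmetric] by (rule gen[OF s0 d that])
  have P': "norm (F3_Pfaff_deriv A A' B B' C (of_real w)) \<le> (M * s) * (1 - w) powr (- (s + 1))" if "0 \<le> w" "w < 1" for w
    unfolding F3_Pfaff_deriv_def d_def[symmetric] using s0 by (intro gen[OF _ d' that]) simp
  have le: "M * u \<le> max M (M * s) * u" "(M * s) * u \<le> max M (M * s) * u" if "u \<ge> 0" for u
    using that by (auto intro: mult_right_mono)
  show ?thesis
  proof (intro exI[of _ "max M (M * s)"] conjI allI impI)
    fix w :: real assume w: "0 \<le> w \<and> w < 1"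
    show "norm (F3_Pfaff A A' B B' C (of_real w)) \<le> max M (M * s) * (1 - w) powr (- s)"
      by (rule order_trans[OF P le(1)]) (use w in auto)
    show "norm (F3_Pfaff_deriv A A' B B' C (of_real w)) \<le> max M (M * s) * (1 - w) powr (- (s + 1))"
      by (rule order_trans[OF P' le(2)]) (use w in auto)
  qed (use M in simp)
qed

text \<open>
  Induction on a lower bound for Re A' by the contiguous relation. The growth condition is preserved: raising A'
  alone raises s by one, which the factor 1 - w compensates, and raising A', B' and C together leaves s fixed.
\<close>
lemma F3_Pfaff_bound:
  assumes "Re C > 0" "F3_growth A A' B B' C s"
  obtains M where "M > 0"
    "\<And>w. 0 \<le> w \<Longrightarrow> w < 1 \<Longrightarrow> norm (F3_Pfaff A A' B B' C (of_real w)) \<le> M * (1 - w) powr (- s)"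
    "\<And>w. 0 \<le> w \<Longrightarrow> w < 1 \<Longrightarrow> norm (F3_Pfaff_deriv A A' B B' C (of_real w)) \<le> M * (1 - w) powr (- (s + 1))"
proof -
  define Q where "Q = (\<lambda>A' B' C s. \<exists>M>0. \<forall>w. 0 \<le> w \<and> w < 1 \<longrightarrow>
      norm (F3_Pfaff A A' B B' C (of_real w)) \<le> M * (1 - w) powr (- s) \<and>
      norm (F3_Pfaff_deriv A A' B B' C (of_real w)) \<le> M * (1 - w) powr (- (s + 1)))"
  have "Q A' B' C s" if "Re A' > - real m" "Re C > 0" "F3_growth A A' B B' C s" for m A' B' C s
    using that
  proof (induction m arbitrary: A' B' C s)
    case 0
    then show ?case unfolding Q_def by (intro F3_Pfaff_bound_pos) auto
  next
    case (Suc m)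
    have "Q (A' + 1) B' C (s + 1)"
      by (rule Suc.IH) (use Suc.prems in \<open>auto simp: F3_growth_def\<close>)
    then obtain M1 where M1: "M1 > 0"
      "\<And>w. 0 \<le> w \<Longrightarrow> w < 1 \<Longrightarrow> norm (F3_Pfaff A (A' + 1) B B' C (of_real w)) \<le> M1 * (1 - w) powr (- (s + 1))"
      "\<And>w. 0 \<le> w \<Longrightarrow> w < 1 \<Longrightarrow> norm (F3_Pfaff_deriv A (A' + 1) B B' C (of_real w)) \<le> M1 * (1 - w) powr (- (s + 1 + 1))"
      unfolding Q_def by blast
    have "Q (A' + 1) (B' + 1) (C + 1) s"
      by (rule Suc.IH) (use Suc.prems in \<open>auto simp: F3_growth_def\<close>)
    then obtain M2 where M2: "M2 > 0"
      "\<And>w. 0 \<le> w \<Longrightarrow> w < 1 \<Longrightarrow> norm (F3_Pfaff A (A' + 1) B (B' + 1) (C + 1) (of_real w)) \<le> M2 * (1 - w) powr (- s)"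
      "\<And>w. 0 \<le> w \<Longrightarrow> w < 1 \<Longrightarrow> norm (F3_Pfaff_deriv A (A' + 1) B (B' + 1) (C + 1) (of_real w)) \<le> M2 * (1 - w) powr (- (s + 1))"
      unfolding Q_def by blast
    define b where "b = norm (B' / C)"
    have b: "b \<ge> 0" by (simp add: b_def)
    show ?case unfolding Q_def
    proof (intro exI[of _ "2 * M1 + 2 * b * M2"] conjI allI impI)
      fix w :: real assume "0 \<le> w \<and> w < 1"
      then have w: "0 \<le> w" "w < 1" by auto
      define P1 P1' P2 P2' where "P1 = F3_Pfaff A (A' + 1) B B' C (of_real w)"
        and "P1' = F3_Pfaff_deriv A (A' + 1) B B' C (of_real w)"
        and "P2 = F3_Pfaff A (A' + 1) B (B' + 1) (C + 1) (of_real w)"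
        and "P2' = F3_Pfaff_deriv A (A' + 1) B (B' + 1) (C + 1) (of_real w)"
      note Pd = P1_def[symmetric] P1'_def[symmetric] P2_def[symmetric] P2'_def[symmetric]
      note b1 = M1(2,3)[OF w, unfolded Pd] and b2 = M2(2,3)[OF w, unfolded Pd]
      have "1 - complex_of_real w = complex_of_real (1 - w)" by simp
      then have "norm (1 - complex_of_real w) = 1 - w" using w by (simp only: norm_of_real)
      with w have nw: "norm (complex_of_real w) < 1" "norm (complex_of_real w) = w" "norm (1 - complex_of_real w) = 1 - w"
        by simp_all
      have v: "(1 - w) powr (- s) = (1 - w) * (1 - w) powr (- (s + 1))"
        "(1 - w) powr (- (s + 1)) = (1 - w) * (1 - w) powr (- (s + 1 + 1))"
        using w by (intro power_le_powr; simp)+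
      have p: "0 \<le> (1 - w) powr (- s)" "0 \<le> (1 - w) powr (- (s + 1))" by auto
      have mono: "(1 - w) powr (- s) \<le> (1 - w) powr (- (s + 1))"
        unfolding v(1) using w p by (simp add: mult_left_le_one_le)
      have Q1: "norm ((1 - complex_of_real w) * P1) \<le> M1 * (1 - w) powr (- s)"
      proof -
        have "norm ((1 - complex_of_real w) * P1) \<le> (1 - w) * (M1 * (1 - w) powr (- (s + 1)))"
          unfolding norm_mult nw using w by (intro mult_left_mono b1(1)) simp
        then show ?thesis unfolding v(1) by (simp only: mult.left_commute)
      qed
      have Q2: "norm (B' / C * (complex_of_real w * P2)) \<le> b * (M2 * (1 - w) powr (- s))"
        unfolding norm_mult[of "B' / C"] b_def[symmetric]
        using b2(1) w mult_left_le_one_le[of "norm P2" w] b by (intro mult_left_mono) (auto simp: norm_mult)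
      have "norm (F3_Pfaff A A' B B' C (of_real w)) \<le> M1 * (1 - w) powr (- s) + b * (M2 * (1 - w) powr (- s))"
        using norm_triangle_mono[OF Q1 Q2]
        by (subst F3_Pfaff_recurrence[OF Suc.prems(2) nw(1)]) (simp only: Pd)
      also have "\<dots> = (M1 + b * M2) * (1 - w) powr (- s)" by (simp add: algebra_simps)
      also have "\<dots> \<le> (2 * M1 + 2 * b * M2) * (1 - w) powr (- s)"
        using p M1(1) M2(1) b by (intro mult_right_mono) auto
      finally show "norm (F3_Pfaff A A' B B' C (of_real w)) \<le> (2 * M1 + 2 * b * M2) * (1 - w) powr (- s)" .
      have R1: "norm ((1 - complex_of_real w) * P1' - P1) \<le> M1 * (1 - w) powr (- (s + 1)) + M1 * (1 - w) powr (- (s + 1))"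
      proof (rule order_trans[OF norm_triangle_ineq4] add_mono)+
        show "norm ((1 - complex_of_real w) * P1') \<le> M1 * (1 - w) powr (- (s + 1))"
        proof -
          have "norm ((1 - complex_of_real w) * P1') \<le> (1 - w) * (M1 * (1 - w) powr (- (s + 1 + 1)))"
            unfolding norm_mult nw using w by (intro mult_left_mono b1(2)) simp
          then show ?thesis unfolding v(2) by (simp only: mult.left_commute)
        qed
      qed (use b1(1) in simp)
      have R2: "norm (B' / C * (complex_of_real w * P2' + P2)) \<le> b * (2 * M2 * (1 - w) powr (- (s + 1)))"
        unfolding norm_mult[of "B' / C"] b_def[symmetric]
      proof (rule mult_left_mono[OF _ b])
        have "norm (complex_of_real w * P2' + P2) \<le> w * norm P2' + norm P2"
          using w by (intro order_trans[OF norm_triangle_ineq]) (simp add: norm_mult)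
        also have "\<dots> \<le> M2 * (1 - w) powr (- (s + 1)) + M2 * (1 - w) powr (- (s + 1))"
          using b2(2) w mult_left_le_one_le[of "norm P2'" w]
            order_trans[OF b2(1) mult_left_mono[OF mono less_imp_le[OF M2(1)]]] by (intro add_mono) auto
        finally show "norm (complex_of_real w * P2' + P2) \<le> 2 * M2 * (1 - w) powr (- (s + 1))" by simp
      qed
      have "norm (F3_Pfaff_deriv A A' B B' C (of_real w)) \<le>
          (M1 * (1 - w) powr (- (s + 1)) + M1 * (1 - w) powr (- (s + 1))) + b * (2 * M2 * (1 - w) powr (- (s + 1)))"
        using norm_triangle_mono[OF R1 R2]
        by (subst F3_Pfaff_deriv_recurrence[OF Suc.prems(2) nw(1)]) (simp only: Pd)
      then show "norm (F3_Pfaff_deriv A A' B B' C (of_real w)) \<le> (2 * M1 + 2 * b * M2) * (1 - w) powr (- (s + 1))"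
        by (simp add: algebra_simps)
    qed (use M1(1) M2(1) b in \<open>simp add: add_pos_nonneg\<close>)
  qed
  moreover obtain m where "- Re A' < real m" using reals_Archimedean2 by blast
  ultimately have "Q A' B' C s" using assms by (simp add: minus_less_iff)
  then show thesis unfolding Q_def using that by blast
qed


section \<open>Moments of the third Appell function\<close>

definition F3_moment_value :: "complex \<Rightarrow> complex \<Rightarrow> complex \<Rightarrow> complex \<Rightarrow> complex \<Rightarrow> complex \<Rightarrow> complex" where
  "F3_moment_value A A' B B' C z = Gamma C * Gamma z * Gamma (z - A' + B') * Gamma (z - A - A' - B + C) *
     rGamma (z + C - A - A') * rGamma (z + B') * rGamma (z + C - A' - B)"

text \<open>
  The contiguous relation of F3_Pfaff multiplied by the Beta weight: the factor 1 - w raises z and the factor w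
  raises C.
\<close>
lemma F3_moment_value_recurrence:
  assumes C: "Re C > 0" and z: "Re z > 0"
  shows "F3_moment_value A A' B B' C z = F3_moment_value A (A' + 1) B B' C (z + 1) +
    B' / C * F3_moment_value A (A' + 1) B (B' + 1) (C + 1) z"
proof -
  define X where "X = Gamma (z - A' + B') * Gamma (z - A - A' - B + C) * rGamma (z + C - A - A') * rGamma (z + C - A' - B)"
  have C0: "C \<noteq> 0" using C by auto
  have G: "Gamma (C + 1) = C * Gamma C" "Gamma (z + 1) = z * Gamma z"
    using Gamma_plus1 Re_pos_not_nonpos_Int C z by auto
  have R: "rGamma (z + B') = (z + B') * rGamma (z + B' + 1)" by (simp add: rGamma_plus1)
  have 1: "F3_moment_value A A' B B' C z = Gamma C * Gamma z * X * rGamma (z + B')"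
    by (simp add: F3_moment_value_def X_def mult_ac)
  have 2: "F3_moment_value A (A' + 1) B B' C (z + 1) = Gamma C * Gamma (z + 1) * X * rGamma (z + B' + 1)"
  proof -
    have "z + 1 - (A' + 1) + B' = z - A' + B'" "z + 1 - A - (A' + 1) - B + C = z - A - A' - B + C"
      "z + 1 + C - A - (A' + 1) = z + C - A - A'" "z + 1 + B' = z + B' + 1" "z + 1 + C - (A' + 1) - B = z + C - A' - B"
      by simp_all
    then show ?thesis unfolding F3_moment_value_def X_def by (simp only: mult_ac)
  qed
  have 3: "F3_moment_value A (A' + 1) B (B' + 1) (C + 1) z = Gamma (C + 1) * Gamma z * X * rGamma (z + B' + 1)"
  proof -
    have "z - (A' + 1) + (B' + 1) = z - A' + B'" "z - A - (A' + 1) - B + (C + 1) = z - A - A' - B + C"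
      "z + (C + 1) - A - (A' + 1) = z + C - A - A'" "z + (B' + 1) = z + B' + 1" "z + (C + 1) - (A' + 1) - B = z + C - A' - B"
      by simp_all
    then show ?thesis unfolding F3_moment_value_def X_def by (simp only: mult_ac)
  qed
  show ?thesis unfolding 1 2 3 G R using C0 by (simp add: algebra_simps)
qed

lemma F3_Pfaff_real_continuous: "Re C > 0 \<Longrightarrow> continuous_on {0<..<1} (\<lambda>w. F3_Pfaff A A' B B' C (complex_of_real w))"
  by (rule continuous_on_compose2[OF F3_Pfaff_continuous]) (auto intro!: continuous_intros)

lemma F3_moment_integrable:
  assumes C: "Re C > 0" and g: "F3_growth A A' B B' C s" and s: "s < Re z"
  shows "(\<lambda>w. of_real w powr (C - 1) * of_real (1 - w) powr (z - 1) * F3_Pfaff A A' B B' C (of_real w)) absolutely_integrable_on {0<..<1}"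
proof -
  obtain M where "M > 0"
    "\<And>w. 0 \<le> w \<Longrightarrow> w < 1 \<Longrightarrow> norm (F3_Pfaff A A' B B' C (of_real w)) \<le> M * (1 - w) powr (- s)"
    by (rule F3_Pfaff_bound[OF C g]) blast
  then show ?thesis
    by (intro Beta_weighted_integrable[where M = M and r = s] C s F3_Pfaff_real_continuous) auto
qed

lemma Beta_moment_shift:
  "Re a > 0 \<Longrightarrow> Re b > 0 \<Longrightarrow> Beta_moment (a + of_nat n) b (\<lambda>_. 1) = Gamma (a + of_nat n) * Gamma b * rGamma (a + b + of_nat n)"
  using Beta_moment_one[of "a + of_nat n" b] by (simp add: add_ac add_pos_nonneg)

text \<open>
  For fixed k the moments of the terms form Gauss' series at 1 with parameters A', C + k - B' and z + C + k.
\<close>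
lemma F3_row_sum:
  assumes C: "Re C > 0" and z: "Re z > 0" "Re (z - A' + B') > 0"
  shows "(\<Sum>j. F3_term A A' B B' C k j * Beta_moment (C + of_nat (k + j)) z (\<lambda>_. 1)) =
    Gamma C * Gamma z * Gamma (z - A' + B') * rGamma (z + B') *
    (pochhammer A k * pochhammer B k * rGamma (z + C - A' + of_nat k) / fact k)"
proof -
  have CZ: "C \<notin> \<int>\<^sub>\<le>\<^sub>0" using C by (rule Re_pos_not_nonpos_Int)
  define u where "u = (\<lambda>j. pochhammer A' j * pochhammer (C + of_nat k - B') j * rGamma (z + C + of_nat k + of_nat j) / fact j)"
  define K where "K = pochhammer A k * pochhammer B k / fact k * (Gamma C * Gamma z)"
  have t: "F3_term A A' B B' C k j * Beta_moment (C + of_nat (k + j)) z (\<lambda>_. 1) = K * u j" for j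
  proof -
    have nz: "pochhammer C (k + j) \<noteq> 0" using pochhammer_eq_0_imp_nonpos_Int CZ by blast
    have G: "Gamma (C + of_nat (k + j)) = pochhammer C (k + j) * Gamma C"
      using pochhammer_Gamma[OF CZ, of "k + j"] CZ by (simp add: Gamma_eq_zero_iff)
    have b: "Beta_moment (C + of_nat (k + j)) z (\<lambda>_. 1) = pochhammer C (k + j) * Gamma C * Gamma z * rGamma (C + z + of_nat (k + j))"
      unfolding Beta_moment_shift[OF C z(1)] G ..
    have pc: "pochhammer C (k + j) = pochhammer C k * pochhammer (C + of_nat k) j"
      by (simp add: pochhammer_product')
    then have nz': "pochhammer C k \<noteq> 0" "pochhammer (C + of_nat k) j \<noteq> 0" using nz by auto
    have "N / (P * f) * (N' / (Q * g)) * (P * Q * Y) = (N / f) * (N' * Y / g)" if "P \<noteq> 0" "Q \<noteq> 0" for N P f N' Q g Y :: complex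
      using that by simp
    note this[OF nz', of "pochhammer A k * pochhammer B k" "fact k" "pochhammer A' j * pochhammer (C + of_nat k - B') j" "fact j" "Gamma C * Gamma z * rGamma (C + z + of_nat (k + j))"]
    then show ?thesis unfolding F3_term_def b pc u_def K_def by (simp add: mult_ac add_ac)
  qed
  have pos: "Re ((z + C + of_nat k) - A' - (C + of_nat k - B')) > 0" using z by simp
  have sm: "summable u"
    unfolding u_def by (rule summable_norm_cancel[OF Gauss_summable[OF pos]])
  have "(\<Sum>j. F3_term A A' B B' C k j * Beta_moment (C + of_nat (k + j)) z (\<lambda>_. 1)) = K * (\<Sum>j. u j)"
    unfolding t by (rule suminf_mult[OF sm])
  also have "(\<Sum>j. u j) = Gauss_value A' (C + of_nat k - B') (z + C + of_nat k)"
    using Gauss_summation[OF pos] by (simp add: Gauss_sum_def u_def)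
  also have "\<dots> = Gamma (z - A' + B') * rGamma (z + C - A' + of_nat k) * rGamma (z + B')"
    unfolding Gauss_value_def by (simp add: algebra_simps)
  finally show ?thesis by (simp add: K_def mult_ac)
qed

text \<open>
  Termwise integration, then summation over rows and over the row sums, each by Gauss' theorem. The rearrangement
  needs absolute convergence: the absolute values of the terms have the same bound as the coefficients, and the moments
  of w^n are bounded by the moments of real weights.
\<close>
lemma F3_moment_pos:
  assumes C: "Re C > 0" and A': "Re A' > 0" and g: "F3_growth A A' B B' C s" and s: "s < Re z"
  shows "Beta_moment C z (\<lambda>w. F3_Pfaff A A' B B' C (of_real w)) = F3_moment_value A A' B B' C z"
proof -
  have s': "s > 0" "s > Re (A' - B')" "s \<ge> Re (A + A' + B - C)" using g by (auto simp: F3_growth_def)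
  have z: "Re z > 0" "Re (z - A' + B') > 0" "Re (z - A - A' - B + C) > 0" using s g by (auto simp: F3_growth_def)
  obtain M where M: "M > 0" "\<And>n. (\<Sum>k\<le>n. norm (F3_term A A' B B' C k (n - k))) \<le> M * (pochhammer s n / fact n)"
    by (rule F3_coeff_bound[OF C A' s']) blast
  have d: "norm (F3_coeff A A' B B' C n) \<le> M * (pochhammer s n / fact n)" for n
    unfolding F3_coeff_def using norm_sum M(2) by (rule order_trans)
  define I where "I = (\<lambda>n. Beta_moment (C + of_nat n) z (\<lambda>_. 1))"
  define c where "c = (\<lambda>k j. F3_term A A' B B' C k j * I (k + j))"
  have main: "(\<lambda>n. F3_coeff A A' B B' C n * I n) sums Beta_moment C z (\<lambda>w. F3_Pfaff A A' B B' C (of_real w))"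
    unfolding I_def F3_Pfaff_def by (rule power_series_Beta_moment[OF C s'(1) s d])
  have sm: "summable (\<lambda>n. \<Sum>k\<le>n. norm (c k (n - k)))"
  proof -
    define e where "e = (\<lambda>n. complex_of_real (\<Sum>k\<le>n. norm (F3_term A A' B B' C k (n - k))))"
    have ne: "norm (e n) = (\<Sum>k\<le>n. norm (F3_term A A' B B' C k (n - k)))" for n
      by (simp add: e_def sum_nonneg del: of_real_sum)
    have "(\<lambda>n. e n * Beta_moment (of_real (Re C) + of_nat n) (of_real (Re z)) (\<lambda>_. 1)) sums
        Beta_moment (of_real (Re C)) (of_real (Re z)) (\<lambda>w. \<Sum>n. e n * of_real w ^ n)"
      by (rule power_series_Beta_moment[OF _ s'(1)]) (use C s M(2) ne in auto)
    then have sm1: "summable (\<lambda>n. Re (e n * Beta_moment (of_real (Re C) + of_nat n) (of_real (Re z)) (\<lambda>_. 1)))"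
      by (intro summable_Re) (rule sums_summable)
    have le: "norm (I n) \<le> Re (Beta_moment (of_real (Re C) + of_nat n) (of_real (Re z)) (\<lambda>_. 1))"
      and re: "Im (Beta_moment (of_real (Re C) + of_nat n) (of_real (Re z)) (\<lambda>_. 1)) = 0" for n
    proof -
      have ai: "(\<lambda>w. of_real w powr (a - 1) * of_real (1 - w) powr (b - 1) * 1) absolutely_integrable_on {0<..<1}"
        if "Re a > 0" "Re b > 0" for a b :: complex
        using that by (intro Beta_weighted_integrable[where M = 1 and r = 0]) auto
      define h where "h = (\<lambda>w::real. w powr (Re C + real n - 1) * (1 - w) powr (Re z - 1))"
      have hi: "h integrable_on {0<..<1}"
        unfolding h_def by (rule Beta_real_integrable) (use C z in \<open>auto simp: add_pos_nonneg\<close>)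
      have eq: "complex_of_real w powr (of_real (Re C) + of_nat n - 1) * of_real (1 - w) powr (of_real (Re z) - 1) * 1 = of_real (h w)"
        if "w \<in> {0<..<1}" for w
      proof -
        have e: "complex_of_real (Re C) + of_nat n - 1 = of_real (Re C + real n - 1)" "complex_of_real (Re z) - 1 = of_real (Re z - 1)" by simp_all
        show ?thesis unfolding e using that by (simp add: h_def powr_of_real del: of_real_diff of_real_add of_real_1)
      qed
      have B: "Beta_moment (of_real (Re C) + of_nat n) (of_real (Re z)) (\<lambda>_. 1) = of_real (integral {0<..<1} h)"
        unfolding Beta_moment_def
        by (rule trans[OF integral_cong[OF eq] integral_unique[OF has_integral_of_real[OF integrable_integral[OF hi]]]])
      show "Im (Beta_moment (of_real (Re C) + of_nat n) (of_real (Re z)) (\<lambda>_. 1)) = 0" unfolding B by simp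
      show "norm (I n) \<le> Re (Beta_moment (of_real (Re C) + of_nat n) (of_real (Re z)) (\<lambda>_. 1))"
        unfolding B Re_complex_of_real unfolding I_def Beta_moment_def
      proof (rule integral_norm_bound_integral[OF _ hi])
        show "(\<lambda>w. complex_of_real w powr (C + of_nat n - 1) * of_real (1 - w) powr (z - 1) * 1) integrable_on {0<..<1}"
          using C z by (intro set_lebesgue_integral_eq_integral(1) ai) (auto simp: add_pos_nonneg)
        fix w :: real assume w: "w \<in> {0<..<1}"
        show "norm (complex_of_real w powr (C + of_nat n - 1) * of_real (1 - w) powr (z - 1) * 1) \<le> h w"
          unfolding mult_1_right norm_Beta_integrand[OF w] by (simp add: h_def)
      qed
    qed
    show ?thesis
    proof (rule summable_comparison_test'[OF sm1, of 0])
      fix n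
      have "norm (\<Sum>k\<le>n. norm (c k (n - k))) = norm (e n) * norm (I n)"
        by (simp add: c_def norm_mult ne sum_nonneg flip: sum_distrib_right)
      also have "\<dots> \<le> norm (e n) * Re (Beta_moment (of_real (Re C) + of_nat n) (of_real (Re z)) (\<lambda>_. 1))"
        using le by (intro mult_left_mono) auto
      also have "\<dots> = Re (e n * Beta_moment (of_real (Re C) + of_nat n) (of_real (Re z)) (\<lambda>_. 1))"
        unfolding ne by (simp add: re e_def)
      finally show "norm (\<Sum>k\<le>n. norm (c k (n - k))) \<le> Re (e n * Beta_moment (of_real (Re C) + of_nat n) (of_real (Re z)) (\<lambda>_. 1))" .
    qed
  qed
  have diag: "(\<Sum>k\<le>n. c k (n - k)) = F3_coeff A A' B B' C n * I n" for n
    by (simp add: c_def F3_coeff_def sum_distrib_right)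
  define K where "K = Gamma C * Gamma z * Gamma (z - A' + B') * rGamma (z + B')"
  have row: "(\<Sum>j. c k j) = K * (pochhammer A k * pochhammer B k * rGamma (z + C - A' + of_nat k) / fact k)" for k
    unfolding c_def I_def K_def by (rule F3_row_sum[OF C z(1,2)])
  have pos: "Re ((z + C - A') - A - B) > 0" using z(3) by simp
  have "(\<lambda>k. \<Sum>j. c k j) sums Beta_moment C z (\<lambda>w. F3_Pfaff A A' B B' C (of_real w))"
    using double_series_diagonal(2)[OF sm] unfolding diag sums_unique[OF main, symmetric] .
  moreover have "(\<lambda>k. \<Sum>j. c k j) sums (K * Gauss_sum A B (z + C - A'))"
    unfolding row Gauss_sum_def
    by (rule sums_mult[OF summable_sums[OF summable_norm_cancel[OF Gauss_summable[OF pos]]]])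
  ultimately have "Beta_moment C z (\<lambda>w. F3_Pfaff A A' B B' C (of_real w)) = K * Gauss_sum A B (z + C - A')"
    by (rule sums_unique2)
  also have "\<dots> = K * Gauss_value A B (z + C - A')" by (simp only: Gauss_summation[OF pos])
  also have "\<dots> = F3_moment_value A A' B B' C z"
  proof -
    have "z + C - A' - A - B = z - A - A' - B + C" "z + C - A' - A = z + C - A - A'" by simp_all
    then show ?thesis unfolding K_def Gauss_value_def F3_moment_value_def by (simp only: mult_ac)
  qed
  finally show ?thesis .
qed

text \<open>
  Induction on a lower bound for Re A'. Both sides satisfy the contiguous relation, in which the induction
  hypothesis applies to both functions on the right.
\<close>
theorem F3_moment:
  assumes "Re C > 0" "F3_growth A A' B B' C s" "s < Re z"
  shows "Beta_moment C z (\<lambda>w. F3_Pfaff A A' B B' C (of_real w)) = F3_moment_value A A' B B' C z"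
proof -
  have "Beta_moment C z (\<lambda>w. F3_Pfaff A A' B B' C (of_real w)) = F3_moment_value A A' B B' C z"
    if "Re A' > - real m" "Re C > 0" "F3_growth A A' B B' C s" "s < Re z" for m A' B' C s z
    using that
  proof (induction m arbitrary: A' B' C s z)
    case 0
    then show ?case by (intro F3_moment_pos[where s = s]) auto
  next
    case (Suc m)
    define W where "W = (\<lambda>C z w. complex_of_real w powr (C - 1) * complex_of_real (1 - w) powr (z - 1))"
    define P1 where "P1 = (\<lambda>w::real. F3_Pfaff A (A' + 1) B B' C (of_real w))"
    define P2 where "P2 = (\<lambda>w::real. F3_Pfaff A (A' + 1) B (B' + 1) (C + 1) (of_real w))"
    have z: "Re z > 0" using Suc.prems by (auto simp: F3_growth_def)
    have g1: "F3_growth A (A' + 1) B B' C (s + 1)" and g2: "F3_growth A (A' + 1) B (B' + 1) (C + 1) s"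
      using Suc.prems by (auto simp: F3_growth_def)
    have C1: "Re (C + 1) > 0" and sz: "s + 1 < Re (z + 1)" using Suc.prems by auto
    have A1: "Re (A' + 1) > - real m" using Suc.prems(1) by simp
    have i1: "((\<lambda>w. W C (z + 1) w * P1 w) has_integral F3_moment_value A (A' + 1) B B' C (z + 1)) {0<..<1}"
      using Suc.IH[OF A1 Suc.prems(2) g1 sz] F3_moment_integrable[OF Suc.prems(2) g1 sz]
      unfolding Beta_moment_def W_def P1_def
      by (metis (no_types, lifting) set_lebesgue_integral_eq_integral(1) integrable_integral)
    have i2: "((\<lambda>w. W (C + 1) z w * P2 w) has_integral F3_moment_value A (A' + 1) B (B' + 1) (C + 1) z) {0<..<1}"
      using Suc.IH[OF A1 C1 g2 Suc.prems(4)] F3_moment_integrable[OF C1 g2 Suc.prems(4)]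
      unfolding Beta_moment_def W_def P2_def
      by (metis (no_types, lifting) set_lebesgue_integral_eq_integral(1) integrable_integral)
    have "((\<lambda>w. W C (z + 1) w * P1 w + B' / C * (W (C + 1) z w * P2 w)) has_integral
        F3_moment_value A (A' + 1) B B' C (z + 1) + B' / C * F3_moment_value A (A' + 1) B (B' + 1) (C + 1) z) {0<..<1}"
      by (intro has_integral_add i1 has_integral_mult_right i2)
    then have "((\<lambda>w. W C z w * F3_Pfaff A A' B B' C (of_real w)) has_integral F3_moment_value A A' B B' C z) {0<..<1}"
      unfolding F3_moment_value_recurrence[OF Suc.prems(2) z, symmetric]
    proof (rule has_integral_eq[rotated])
      fix w :: real assume w: "w \<in> {0<..<1}"
      have nw: "norm (complex_of_real w) < 1" using w by simp
      have w0: "complex_of_real w \<noteq> 0" and w1: "1 - complex_of_real w \<noteq> 0" using w by auto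
      have p1: "W C (z + 1) w = W C z w * (1 - of_real w)"
        using w1 powr_add[of "complex_of_real (1 - w)" "z - 1" 1] by (simp add: W_def)
      have p2: "W (C + 1) z w = W C z w * of_real w"
        using w0 powr_add[of "complex_of_real w" "C - 1" 1] by (simp add: W_def)
      have "F3_Pfaff A A' B B' C (of_real w) = (1 - of_real w) * P1 w + B' / C * (of_real w * P2 w)"
        unfolding P1_def P2_def by (rule F3_Pfaff_recurrence[OF Suc.prems(2) nw])
      then show "W C (z + 1) w * P1 w + B' / C * (W (C + 1) z w * P2 w) = W C z w * F3_Pfaff A A' B B' C (of_real w)"
        unfolding p1 p2 by (simp only: distrib_left) (simp only: mult_ac)
    qed
    then show ?case unfolding Beta_moment_def W_def by (rule integral_unique)
  qed
  moreover obtain m where "- Re A' < real m" using reals_Archimedean2 by blast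
  ultimately show ?thesis using assms by (simp add: minus_less_iff)
qed


section \<open>Stirling's formula on vertical lines\<close>

lemma Ln_step_error:
  fixes w :: complex and r :: real
  assumes Im: "Im w \<noteq> 0" and r: "r > 0" "\<And>t. 0 \<le> t \<Longrightarrow> t \<le> 1 \<Longrightarrow> r \<le> norm (w + of_real t)"
  shows "norm (Ln (w + 1) - Ln w - 1 / w) \<le> 1 / r\<^sup>2"
proof -
  define f where "f = (\<lambda>\<zeta>. Ln \<zeta> - \<zeta> / w)"
  have w: "w \<noteq> 0" "r \<le> norm w" using Im r(2)[of 0] by auto
  have seg: "\<exists>t. 0 \<le> t \<and> t \<le> 1 \<and> \<zeta> = w + of_real t" if "\<zeta> \<in> closed_segment w (w + 1)" for \<zeta>
    using that by (auto simp: in_segment algebra_simps scaleR_conv_of_real)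
  have "norm (f (w + 1) - f w) \<le> 1 / r\<^sup>2 * norm ((w + 1) - w)"
  proof (rule field_differentiable_bound[of "closed_segment w (w + 1)" f "\<lambda>\<zeta>. 1 / \<zeta> - 1 / w"])
    fix \<zeta> assume "\<zeta> \<in> closed_segment w (w + 1)"
    then obtain t where t: "0 \<le> t" "t \<le> 1" "\<zeta> = w + of_real t" using seg by blast
    have "Im \<zeta> \<noteq> 0" using Im t by simp
    then have n\<zeta>: "\<zeta> \<notin> \<real>\<^sub>\<le>\<^sub>0" "\<zeta> \<noteq> 0" by (auto simp: complex_nonpos_Reals_iff)
    show "(f has_field_derivative 1 / \<zeta> - 1 / w) (at \<zeta> within closed_segment w (w + 1))"
      unfolding f_def using n\<zeta> w by (auto intro!: derivative_eq_intros simp: field_simps)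
    have "norm (1 / \<zeta> - 1 / w) = t / (norm \<zeta> * norm w)"
    proof -
      have "1 / \<zeta> - 1 / w = (w - \<zeta>) / (\<zeta> * w)" using n\<zeta> w by (simp add: field_simps)
      then show ?thesis using t by (simp add: norm_divide norm_mult)
    qed
    also have "\<dots> \<le> 1 / (r * r)"
      using t r w by (intro frac_le mult_mono) (auto simp: t(3))
    finally show "norm (1 / \<zeta> - 1 / w) \<le> 1 / r\<^sup>2" by (simp add: power2_eq_square)
  qed auto
  moreover have "f (w + 1) - f w = Ln (w + 1) - Ln w - 1 / w"
    using w by (simp add: f_def add_divide_distrib)
  ultimately show ?thesis by simp
qed

text \<open>
  The partial sums of the Digamma series are compared with the logarithm step by step; the errors are
  bounded by squared reciprocal distances, whose sum is finite uniformly on the strip.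
\<close>
lemma Re_Digamma_bound:
  fixes R :: real
  assumes "R \<ge> 0"
  obtains K where "K > 0" "\<And>z. \<bar>Re z\<bar> \<le> R \<Longrightarrow> \<bar>Im z\<bar> \<ge> 1 \<Longrightarrow> \<bar>Re (Digamma z) - ln \<bar>Im z\<bar>\<bar> \<le> K"
proof -
  \<comment> \<open>On the strip |Re z| \<le> R with |Im z| \<ge> 1, the squared distance of z + n + t from 0 is at least
    the denominator of b n for 0 \<le> t \<le> 1.\<close>
  define b where "b = (\<lambda>n::nat. 1 / (1 + (max 0 (real n - R))\<^sup>2))"
  have sm: "summable b"
  proof (rule summable_comparison_test_ev)
    have "summable (\<lambda>n. 4 * (1 / real n ^ 2))" by (intro summable_mult inverse_power_summable[of 2, unfolded inverse_eq_divide]) auto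
    then show "summable (\<lambda>n. 4 / real n ^ 2)" by simp
    obtain N :: nat where N: "2 * R + 1 < real N" using reals_Archimedean2 by blast
    show "\<forall>\<^sub>F n in sequentially. norm (b n) \<le> 4 / real n ^ 2"
      using eventually_ge_at_top[of N]
    proof eventually_elim
      case (elim n)
      then have n: "real n / 2 \<le> real n - R" "real n > 0" using N assms by (auto simp: field_simps)
      have "(real n / 2)\<^sup>2 \<le> (real n - R)\<^sup>2" using n by (intro power_mono) auto
      moreover have "max 0 (real n - R) = real n - R" using n by simp
      ultimately have "(real n / 2)\<^sup>2 \<le> 1 + (max 0 (real n - R))\<^sup>2" by (simp only:)
      then have "b n \<le> 1 / (real n / 2)\<^sup>2" unfolding b_def using n by (intro divide_left_mono) (auto intro!: mult_pos_pos add_pos_nonneg)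
      moreover have "b n \<ge> 0" by (simp add: b_def)
      ultimately show ?case by (simp add: power_divide)
    qed
  qed
  have b0: "b n \<ge> 0" for n by (simp add: b_def)
  have B: "(\<Sum>n<m. b n) \<le> suminf b" for m using sm b0 by (intro sum_le_suminf) auto
  have Bpos: "suminf b \<ge> 0" using sm b0 by (rule suminf_nonneg)
  define K where "K = suminf b + R\<^sup>2 + 1"
  have "\<bar>Re (Digamma z) - ln \<bar>Im z\<bar>\<bar> \<le> K" if z: "\<bar>Re z\<bar> \<le> R" "\<bar>Im z\<bar> \<ge> 1" for z
  proof -
    have z0: "z \<noteq> 0" using z by auto
    define e where "e = (\<lambda>n. Ln (z + of_nat n + 1) - Ln (z + of_nat n) - 1 / (z + of_nat n))"
    have e: "norm (e n) \<le> b n" for n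
    proof -
      define r where "r = sqrt (1 + (max 0 (real n - R))\<^sup>2)"
      have r: "r > 0" "r\<^sup>2 = 1 + (max 0 (real n - R))\<^sup>2" by (auto simp: r_def add_pos_nonneg)
      have "norm (Ln (z + of_nat n + 1) - Ln (z + of_nat n) - 1 / (z + of_nat n)) \<le> 1 / r\<^sup>2"
      proof (rule Ln_step_error)
        show "Im (z + of_nat n) \<noteq> 0" using z by auto
        fix t :: real assume t: "0 \<le> t" "t \<le> 1"
        have "max 0 (real n - R) \<le> \<bar>Re z + real n + t\<bar>" using z t by auto
        then have "(max 0 (real n - R))\<^sup>2 \<le> \<bar>Re z + real n + t\<bar>\<^sup>2" by (rule power_mono) simp
        then have "(max 0 (real n - R))\<^sup>2 \<le> (Re z + real n + t)\<^sup>2" by (simp only: power2_abs)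
        moreover have "1 \<le> (Im z)\<^sup>2" using z(2) abs_le_square_iff[of 1 "Im z"] by simp
        ultimately show "r \<le> norm (z + of_nat n + of_real t)"
          by (simp add: r_def cmod_def)
      qed (fact r(1))
      then show ?thesis by (simp add: e_def b_def r(2))
    qed
    have tel: "(\<Sum>n<m. Re (e n)) = ln (norm (z + of_nat m)) - ln (norm z) - Re (\<Sum>n<m. inverse (z + of_nat n))" for m
    proof -
      have nz: "z + of_nat n \<noteq> 0" for n using z by (auto simp: complex_eq_iff)
      have "(\<Sum>n<m. Re (e n)) = (\<Sum>n<m. ln (norm (z + of_nat (Suc n))) - ln (norm (z + of_nat n))) - Re (\<Sum>n<m. inverse (z + of_nat n))"
        using nz nz[of "Suc _"] by (simp add: e_def sum_subtractf inverse_eq_divide add_ac)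
      also have "(\<Sum>n<m. ln (norm (z + of_nat (Suc n))) - ln (norm (z + of_nat n))) = ln (norm (z + of_nat m)) - ln (norm z)"
        using sum_lessThan_telescope[of "\<lambda>n. ln (norm (z + of_nat n))" m] by simp
      finally show ?thesis .
    qed
    have "(\<lambda>m. norm (z / of_nat m + 1)) \<longlonglongrightarrow> norm (0 + 1 :: complex)"
      by (intro tendsto_intros tendsto_divide_0[OF tendsto_const] tendsto_of_nat)
    then have "(\<lambda>m. ln (norm (z / of_nat m + 1))) \<longlonglongrightarrow> ln 1"
      by (intro tendsto_ln) auto
    moreover have "\<forall>\<^sub>F m in sequentially. ln (norm (z / of_nat m + 1)) = ln (norm (z + of_nat m)) - ln (real m)"
      using eventually_gt_at_top[of 0]
    proof eventually_elim
      case (elim m)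
      have "z + of_nat m \<noteq> 0" using z by (auto simp: complex_eq_iff)
      moreover have "z / of_nat m + 1 = (z + of_nat m) / of_nat m" using elim by (simp add: field_simps)
      ultimately show ?case using elim by (simp add: norm_divide ln_div)
    qed
    ultimately have l1: "(\<lambda>m. ln (norm (z + of_nat m)) - ln (real m)) \<longlonglongrightarrow> 0"
      by (auto intro: Lim_transform_eventually)
    have "(\<lambda>m. Re (of_real (ln (real m)) - (\<Sum>n<m. inverse (z + of_nat n)))) \<longlonglongrightarrow> Re (Digamma z)"
      by (intro tendsto_Re Digamma_LIMSEQ z0)
    from tendsto_diff[OF tendsto_add[OF this l1] tendsto_const[of "ln (norm z)"]]
    have "(\<lambda>m. \<Sum>n<m. Re (e n)) \<longlonglongrightarrow> Re (Digamma z) - ln (norm z)"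
      by (simp add: tel algebra_simps)
    moreover have "\<bar>\<Sum>n<m. Re (e n)\<bar> \<le> suminf b" for m
    proof -
      have "\<bar>\<Sum>n<m. Re (e n)\<bar> \<le> (\<Sum>n<m. b n)"
        using e by (intro order_trans[OF sum_abs] sum_mono order_trans[OF abs_Re_le_cmod])
      also have "\<dots> \<le> suminf b" by (rule B)
      finally show ?thesis .
    qed
    ultimately have "\<bar>Re (Digamma z) - ln (norm z)\<bar> \<le> suminf b"
      by (intro tendsto_upperbound[OF tendsto_rabs]) auto
    moreover have "\<bar>ln (norm z) - ln \<bar>Im z\<bar>\<bar> \<le> R\<^sup>2"
    proof -
      have y: "\<bar>Im z\<bar> > 0" using z by simp
      have q: "(Re z / \<bar>Im z\<bar>)\<^sup>2 \<le> R\<^sup>2"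
      proof -
        have "\<bar>Re z / \<bar>Im z\<bar>\<bar> \<le> \<bar>Re z\<bar>" using z(2) by (simp add: divide_le_eq mult_le_cancel_left1)
        then have "\<bar>Re z / \<bar>Im z\<bar>\<bar> \<le> \<bar>R\<bar>" using z(1) assms by linarith
        then show ?thesis by (simp only: abs_le_square_iff)
      qed
      have "norm z / \<bar>Im z\<bar> \<ge> 1" using y abs_Im_le_cmod[of z] by (simp add: divide_simps)
      moreover have "norm z / \<bar>Im z\<bar> \<le> (norm z / \<bar>Im z\<bar>)\<^sup>2" using calculation by (intro self_le_power) auto
      moreover have "(norm z / \<bar>Im z\<bar>)\<^sup>2 = 1 + (Re z / \<bar>Im z\<bar>)\<^sup>2"
        using y by (simp add: power_divide cmod_power2 add_divide_distrib)
      ultimately have "ln (norm z / \<bar>Im z\<bar>) \<ge> 0" "ln (norm z / \<bar>Im z\<bar>) \<le> R\<^sup>2"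
        using ln_le_minus_one[of "norm z / \<bar>Im z\<bar>"] q by auto
      then show ?thesis using y z0 by (simp add: ln_div)
    qed
    ultimately show ?thesis by (simp add: K_def)
  qed
  moreover have "K > 0" using Bpos by (simp add: K_def add_nonneg_pos)
  ultimately show thesis using that by blast
qed

text \<open>
  On Re z = 1/2 the reflection formula gives the square of the absolute value exactly: it is \<pi> / cosh (\<pi> y).
\<close>
lemma Gamma_half_line_bounds:
  fixes y :: real
  shows "exp (- pi * \<bar>y\<bar> / 2) \<le> norm (Gamma (Complex (1/2) y))"
    and "norm (Gamma (Complex (1/2) y)) \<le> 3 * exp (- pi * \<bar>y\<bar> / 2)"
proof -
  define g where "g = norm (Gamma (Complex (1/2) y))"
  define c where "c = (exp (pi * y) + inverse (exp (pi * y))) / 2"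
  define E where "E = exp (pi * \<bar>y\<bar>)"
  have "1 - Complex (1/2) y = cnj (Complex (1/2) y)" by (simp add: complex_eq_iff)
  then have "Gamma (Complex (1/2) y) * cnj (Gamma (Complex (1/2) y)) = of_real pi / sin (of_real pi * Complex (1/2) y)"
    using Gamma_reflection_complex[of "Complex (1/2) y"] by (simp add: cnj_Gamma)
  moreover have "of_real pi * Complex (1/2) y = of_real (pi / 2) + \<i> * of_real (pi * y)"
    by (simp add: complex_eq_iff)
  then have "sin (of_real pi * Complex (1/2) y) = of_real c"
    unfolding c_def cosh_real by (simp only: sin_add sin_of_real cos_of_real sin_pi_half cos_pi_half) simp
  ultimately have "of_real (g\<^sup>2) = complex_of_real (pi / c)"
    by (simp add: g_def complex_mult_cnj cmod_power2 flip: complex_norm_square)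
  then have g2: "g\<^sup>2 = pi / c" using of_real_eq_iff by blast
  have E: "E > 0" by (simp add: E_def)
  have c: "E / 2 \<le> c" "c \<le> E"
  proof -
    have "c = (E + inverse E) / 2" by (cases "y \<ge> 0") (simp_all add: c_def E_def abs_if exp_minus)
    moreover have "inverse E \<le> E" "inverse E > 0" using E by (auto simp: E_def exp_minus[symmetric])
    ultimately show "E / 2 \<le> c" "c \<le> E" by auto
  qed
  have c0: "c > 0" using c E by linarith
  have h: "(exp (- pi * \<bar>y\<bar> / 2))\<^sup>2 = 1 / E"
    by (simp add: E_def exp_minus exp_double[symmetric] field_simps flip: exp_add exp_of_nat_mult)
  have "(exp (- pi * \<bar>y\<bar> / 2))\<^sup>2 \<le> g\<^sup>2"
    unfolding h g2 using c c0 E pi_gt3 by (intro frac_le) auto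
  then show "exp (- pi * \<bar>y\<bar> / 2) \<le> norm (Gamma (Complex (1/2) y))"
    unfolding g_def by (rule power2_le_imp_le) simp
  have "g\<^sup>2 \<le> pi / (E / 2)" unfolding g2 using c c0 E by (intro divide_left_mono) auto
  also have "\<dots> \<le> 9 / E" using E pi_less_4 by (simp add: field_simps)
  also have "\<dots> = (3 * exp (- pi * \<bar>y\<bar> / 2))\<^sup>2" by (simp only: power_mult_distrib h) simp
  finally show "norm (Gamma (Complex (1/2) y)) \<le> 3 * exp (- pi * \<bar>y\<bar> / 2)"
    unfolding g_def by (rule power2_le_imp_le) simp
qed

text \<open>
  On the line Re z = 1/2 the absolute value is known. Moving horizontally from there to x changes its logarithm by the
  integral of Re Digamma, which is ln |y| up to a bounded error.
\<close>
theorem Stirling_vertical: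
  fixes x :: real
  obtains K where "K > 0"
    "\<And>y. \<bar>y\<bar> \<ge> 1 \<Longrightarrow> \<bar>ln (norm (Gamma (Complex x y))) - ((x - 1/2) * ln \<bar>y\<bar> - pi * \<bar>y\<bar> / 2)\<bar> \<le> K"
proof -
  define R where "R = max \<bar>x\<bar> 1"
  obtain K where K: "K > 0" "\<And>z. \<bar>Re z\<bar> \<le> R \<Longrightarrow> \<bar>Im z\<bar> \<ge> 1 \<Longrightarrow> \<bar>Re (Digamma z) - ln \<bar>Im z\<bar>\<bar> \<le> K"
    by (rule Re_Digamma_bound[of R]) (auto simp: R_def)
  have "\<bar>ln (norm (Gamma (Complex x y))) - ((x - 1/2) * ln \<bar>y\<bar> - pi * \<bar>y\<bar> / 2)\<bar> \<le> K * \<bar>x - 1/2\<bar> + ln 3"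
    if y: "\<bar>y\<bar> \<ge> 1" for y
  proof -
    define f where "f = (\<lambda>u. Re (ln_Gamma (Complex u y)) - u * ln \<bar>y\<bar>)"
    have lnG: "Re (ln_Gamma (Complex u y)) = ln (norm (Gamma (Complex u y)))" for u
    proof -
      have "Complex u y \<notin> \<int>\<^sub>\<le>\<^sub>0" using y by (auto elim!: nonpos_Ints_cases simp: complex_eq_iff)
      then show ?thesis by (simp add: Gamma_complex_altdef norm_exp_eq_Re)
    qed
    have "norm (f x - f (1/2)) \<le> K * norm (x - 1/2)"
    proof (rule field_differentiable_bound[of "closed_segment (1/2) x" f "\<lambda>u. Re (Digamma (Complex u y)) - ln \<bar>y\<bar>"])
      fix u assume u: "u \<in> closed_segment (1/2) x"
      have nz: "Complex u y \<notin> \<real>\<^sub>\<le>\<^sub>0" using y by (auto simp: complex_nonpos_Reals_iff)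
      have "((\<lambda>u. Complex u y) has_vector_derivative 1) (at u within closed_segment (1/2) x)"
        unfolding Complex_eq by (auto intro!: derivative_eq_intros)
      from field_vector_diff_chain_within[OF this has_field_derivative_at_within[OF has_field_derivative_ln_Gamma_complex[OF nz]]]
      have "((\<lambda>u. ln_Gamma (Complex u y)) has_vector_derivative Digamma (Complex u y)) (at u within closed_segment (1/2) x)"
        by (simp add: o_def)
      then have "((\<lambda>u. Re (ln_Gamma (Complex u y))) has_field_derivative Re (Digamma (Complex u y))) (at u within closed_segment (1/2) x)"
        unfolding has_real_derivative_iff_has_vector_derivative
        by (rule bounded_linear.has_vector_derivative[OF bounded_linear_Re])
      moreover have "((\<lambda>u. u * ln \<bar>y\<bar>) has_field_derivative ln \<bar>y\<bar>) (at u within closed_segment (1/2) x)"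
        by (auto intro!: derivative_eq_intros)
      ultimately show "(f has_field_derivative Re (Digamma (Complex u y)) - ln \<bar>y\<bar>) (at u within closed_segment (1/2) x)"
        unfolding f_def by (rule DERIV_diff)
      have "\<bar>u\<bar> \<le> R" using u by (auto simp: closed_segment_eq_real_ivl R_def split: if_splits)
      then show "norm (Re (Digamma (Complex u y)) - ln \<bar>y\<bar>) \<le> K"
        using K(2)[of "Complex u y"] y by simp
    qed auto
    then have 1: "\<bar>ln (norm (Gamma (Complex x y))) - ln (norm (Gamma (Complex (1/2) y))) - (x - 1/2) * ln \<bar>y\<bar>\<bar> \<le> K * \<bar>x - 1/2\<bar>"
      by (simp add: f_def lnG algebra_simps)
    have "- pi * \<bar>y\<bar> / 2 \<le> ln (norm (Gamma (Complex (1/2) y)))"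
      using Gamma_half_line_bounds(1)[of y] by (subst ln_ge_iff) (auto intro: less_le_trans[OF exp_gt_zero])
    moreover have "ln (norm (Gamma (Complex (1/2) y))) \<le> ln (3 * exp (- pi * \<bar>y\<bar> / 2))"
      using Gamma_half_line_bounds[of y] less_le_trans[OF exp_gt_zero Gamma_half_line_bounds(1)[of y]] by (intro ln_mono) auto
    then have "ln (norm (Gamma (Complex (1/2) y))) \<le> ln 3 + (- pi * \<bar>y\<bar> / 2)" by (simp add: ln_mult)
    ultimately show ?thesis using 1 by linarith
  qed
  moreover have "K * \<bar>x - 1/2\<bar> + ln 3 > 0" using K(1) ln_gt_zero[of 3] by (intro add_nonneg_pos) auto
  ultimately show thesis using that by blast
qed


section \<open>Growth of powers of the Gamma function along the contour\<close>

lemma nonpos_Ints_Im: "z \<in> \<int>\<^sub>\<le>\<^sub>0 \<Longrightarrow> Im z = 0"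
  by (auto elim!: nonpos_Ints_cases)

text \<open>
  The order of growth on the contour: a power p of 1 + |\<tau>| and an exponential decay at rate q, where
  negative q means growth.
\<close>
definition vertical_growth :: "(real \<Rightarrow> real) \<Rightarrow> real \<Rightarrow> real \<Rightarrow> bool" where
  "vertical_growth u p q \<longleftrightarrow> (\<exists>M>0. \<forall>\<tau>. u \<tau> \<le> M * (1 + \<bar>\<tau>\<bar>) powr p * exp (- q * \<bar>\<tau>\<bar>))"

lemma vertical_growth_one: "vertical_growth (\<lambda>_. 1) 0 0"
  unfolding vertical_growth_def by (intro exI[of _ 1]) (auto simp: add_nonneg_eq_0_iff)

lemma vertical_growth_mult:
  assumes "vertical_growth u p q" "vertical_growth v p' q'" "\<And>\<tau>. u \<tau> \<ge> 0" "\<And>\<tau>. v \<tau> \<ge> 0"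
  shows "vertical_growth (\<lambda>\<tau>. u \<tau> * v \<tau>) (p + p') (q + q')"
proof -
  obtain M M' where M: "M > 0" "\<And>\<tau>. u \<tau> \<le> M * (1 + \<bar>\<tau>\<bar>) powr p * exp (- q * \<bar>\<tau>\<bar>)"
    and M': "M' > 0" "\<And>\<tau>. v \<tau> \<le> M' * (1 + \<bar>\<tau>\<bar>) powr p' * exp (- q' * \<bar>\<tau>\<bar>)"
    using assms(1,2) unfolding vertical_growth_def by blast
  have "u \<tau> * v \<tau> \<le> (M * M') * (1 + \<bar>\<tau>\<bar>) powr (p + p') * exp (- (q + q') * \<bar>\<tau>\<bar>)" for \<tau>
  proof -
    have "u \<tau> * v \<tau> \<le> (M * (1 + \<bar>\<tau>\<bar>) powr p * exp (- q * \<bar>\<tau>\<bar>)) * (M' * (1 + \<bar>\<tau>\<bar>) powr p' * exp (- q' * \<bar>\<tau>\<bar>))"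
      using M M' assms(3,4) by (intro mult_mono) auto
    also have "\<dots> = (M * M') * ((1 + \<bar>\<tau>\<bar>) powr p * (1 + \<bar>\<tau>\<bar>) powr p') * (exp (- q * \<bar>\<tau>\<bar>) * exp (- q' * \<bar>\<tau>\<bar>))"
      by (simp only: mult_ac)
    also have "exp (- q * \<bar>\<tau>\<bar>) * exp (- q' * \<bar>\<tau>\<bar>) = exp (- (q + q') * \<bar>\<tau>\<bar>)"
      by (simp add: algebra_simps flip: exp_add)
    also have "(1 + \<bar>\<tau>\<bar>) powr p * (1 + \<bar>\<tau>\<bar>) powr p' = (1 + \<bar>\<tau>\<bar>) powr (p + p')"
      by (simp flip: powr_add)
    finally show ?thesis .
  qed
  then show ?thesis unfolding vertical_growth_def using M M' by (intro exI[of _ "M * M'"]) auto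
qed

lemma vertical_growth_powr:
  assumes "vertical_growth u p q" "\<And>\<tau>. u \<tau> \<ge> 0" "\<kappa> > 0"
  shows "vertical_growth (\<lambda>\<tau>. u \<tau> powr \<kappa>) (\<kappa> * p) (\<kappa> * q)"
proof -
  obtain M where M: "M > 0" "\<And>\<tau>. u \<tau> \<le> M * (1 + \<bar>\<tau>\<bar>) powr p * exp (- q * \<bar>\<tau>\<bar>)"
    using assms(1) unfolding vertical_growth_def by blast
  have "u \<tau> powr \<kappa> \<le> M powr \<kappa> * (1 + \<bar>\<tau>\<bar>) powr (\<kappa> * p) * exp (- (\<kappa> * q) * \<bar>\<tau>\<bar>)" for \<tau>
  proof -
    have "u \<tau> powr \<kappa> \<le> (M * (1 + \<bar>\<tau>\<bar>) powr p * exp (- q * \<bar>\<tau>\<bar>)) powr \<kappa>"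
      using M assms(2,3) by (intro powr_mono2) auto
    also have "\<dots> = M powr \<kappa> * ((1 + \<bar>\<tau>\<bar>) powr p) powr \<kappa> * (exp (- q * \<bar>\<tau>\<bar>)) powr \<kappa>"
      using M(1) by (simp add: powr_mult)
    also have "(exp (- q * \<bar>\<tau>\<bar>)) powr \<kappa> = exp (- (\<kappa> * q) * \<bar>\<tau>\<bar>)" by (simp add: exp_powr_real mult_ac)
    also have "((1 + \<bar>\<tau>\<bar>) powr p) powr \<kappa> = (1 + \<bar>\<tau>\<bar>) powr (\<kappa> * p)" by (simp add: powr_powr mult.commute)
    finally show ?thesis .
  qed
  then show ?thesis unfolding vertical_growth_def using M by (intro exI[of _ "M powr \<kappa>"]) auto
qed

lemma powr_comparable:
  fixes a b K p :: real
  assumes "a > 0" "b > 0" "K \<ge> 1" "a \<le> K * b" "b \<le> K * a"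
  shows "a powr p \<le> K powr \<bar>p\<bar> * b powr p"
proof (cases "p \<ge> 0")
  case True
  have "a powr p \<le> (K * b) powr p" using assms True by (intro powr_mono2) auto
  then show ?thesis using assms True by (simp add: powr_mult)
next
  case False
  have "a powr p \<le> (b / K) powr p" using assms False by (intro powr_mono2') (auto simp: field_simps)
  also have "\<dots> = K powr \<bar>p\<bar> * b powr p" using assms False by (simp add: powr_divide powr_minus field_simps)
  finally show ?thesis .
qed

text \<open>
  Passes from estimates in terms of the imaginary part i + D \<tau> of the argument of a Gamma function, valid outside a
  compact interval of \<tau>, to estimates in terms of \<tau> valid everywhere.
\<close>
lemma vertical_growthI:
  fixes u :: "real \<Rightarrow> real"
  assumes cont: "continuous_on UNIV u" and D: "D \<noteq> 0"
    and K: "\<And>\<tau>. \<bar>i + D * \<tau>\<bar> \<ge> 1 \<Longrightarrow> u \<tau> \<le> exp (K + p * ln \<bar>i + D * \<tau>\<bar> - r * \<bar>i + D * \<tau>\<bar>)"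
  shows "vertical_growth u p (r * \<bar>D\<bar>)"
proof -
  define L where "L = max 1 (max (\<bar>i\<bar> + \<bar>D\<bar>) (1 + (1 + \<bar>i\<bar>) / \<bar>D\<bar>))"
  have L: "\<bar>i\<bar> + \<bar>D\<bar> \<le> L" "1 + (1 + \<bar>i\<bar>) / \<bar>D\<bar> \<le> L"
    unfolding L_def le_max_iff_disj by simp_all
  define M1 where "M1 = exp K * L powr \<bar>p\<bar> * exp (\<bar>r\<bar> * \<bar>i\<bar>)"
  define T where "T = (1 + \<bar>i\<bar>) / \<bar>D\<bar>"
  define w where "w = (\<lambda>\<tau>::real. (1 + \<bar>\<tau>\<bar>) powr p * exp (- (r * \<bar>D\<bar>) * \<bar>\<tau>\<bar>))"
  have w: "w \<tau> > 0" for \<tau> by (simp add: w_def add_pos_nonneg)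
  have "compact ((\<lambda>\<tau>. u \<tau> / w \<tau>) ` {-T..T})"
  proof (intro compact_continuous_image continuous_on_divide)
    show "continuous_on {- T..T} u" using cont by (rule continuous_on_subset) auto
    show "continuous_on {- T..T} w" unfolding w_def by (intro continuous_intros) (auto simp: add_nonneg_eq_0_iff)
    show "\<forall>\<tau>\<in>{- T..T}. w \<tau> \<noteq> 0" using w less_imp_neq by force
  qed auto
  then have "bounded ((\<lambda>\<tau>. u \<tau> / w \<tau>) ` {-T..T})" by (rule compact_imp_bounded)
  then obtain M2 where "\<forall>x\<in>(\<lambda>\<tau>. u \<tau> / w \<tau>) ` {-T..T}. norm x \<le> M2"
    by (auto simp: bounded_iff)
  then have M2: "\<bar>u \<tau> / w \<tau>\<bar> \<le> M2" if "\<tau> \<in> {-T..T}" for \<tau> using that by auto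
  have M1: "M1 > 0" by (simp add: M1_def L_def)
  have "u \<tau> \<le> (M1 + \<bar>M2\<bar>) * w \<tau>" for \<tau>
  proof (cases "\<bar>i + D * \<tau>\<bar> \<ge> 1")
    case True
    define y where "y = \<bar>i + D * \<tau>\<bar>"
    have y: "y \<ge> 1" using True by (simp add: y_def)
    have yD: "\<bar>y - \<bar>D\<bar> * \<bar>\<tau>\<bar>\<bar> \<le> \<bar>i\<bar>" unfolding y_def by (auto simp: abs_mult[symmetric])
    have "y \<le> (\<bar>i\<bar> + \<bar>D\<bar>) * (1 + \<bar>\<tau>\<bar>)"
      using yD mult_nonneg_nonneg[of "\<bar>i\<bar>" "\<bar>\<tau>\<bar>"] abs_ge_zero[of D]
      unfolding distrib_left distrib_right by linarith
    also have "\<dots> \<le> L * (1 + \<bar>\<tau>\<bar>)" by (intro mult_right_mono L) auto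
    finally have 1: "y \<le> L * (1 + \<bar>\<tau>\<bar>)" .
    have "\<bar>D\<bar> * \<bar>\<tau>\<bar> \<le> y + \<bar>i\<bar>" using yD by linarith
    then have "\<bar>\<tau>\<bar> \<le> (y + \<bar>i\<bar>) / \<bar>D\<bar>" using D by (simp add: field_simps)
    also have "\<dots> \<le> (y + \<bar>i\<bar> * y) / \<bar>D\<bar>" using y D by (intro divide_right_mono) (auto simp: mult_le_cancel_left1)
    finally have "1 + \<bar>\<tau>\<bar> \<le> y + (y + \<bar>i\<bar> * y) / \<bar>D\<bar>" using y by linarith
    also have "\<dots> = (1 + (1 + \<bar>i\<bar>) / \<bar>D\<bar>) * y" by (simp add: field_simps)
    also have "\<dots> \<le> L * y" using y by (intro mult_right_mono L) auto
    finally have 2: "1 + \<bar>\<tau>\<bar> \<le> L * y" .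
    have "u \<tau> \<le> exp (K + p * ln y - r * y)" using K[OF True] by (simp add: y_def)
    also have "\<dots> = exp K * y powr p * exp (- r * y)" using y by (simp add: exp_add exp_diff exp_minus powr_def field_simps)
    also have "\<dots> \<le> exp K * (L powr \<bar>p\<bar> * (1 + \<bar>\<tau>\<bar>) powr p) * (exp (\<bar>r\<bar> * \<bar>i\<bar>) * exp (- (r * \<bar>D\<bar>) * \<bar>\<tau>\<bar>))"
    proof (intro mult_mono mult_left_mono)
      show "y powr p \<le> L powr \<bar>p\<bar> * (1 + \<bar>\<tau>\<bar>) powr p"
        by (rule powr_comparable[OF _ _ _ 1 2]) (use y in \<open>simp_all add: L_def add_pos_nonneg\<close>)
      have "r * (\<bar>D\<bar> * \<bar>\<tau>\<bar> - y) \<le> \<bar>r\<bar> * \<bar>\<bar>D\<bar> * \<bar>\<tau>\<bar> - y\<bar>" by (metis abs_ge_self abs_mult)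
      also have "\<dots> \<le> \<bar>r\<bar> * \<bar>i\<bar>" using yD by (intro mult_left_mono) auto
      finally show "exp (- r * y) \<le> exp (\<bar>r\<bar> * \<bar>i\<bar>) * exp (- (r * \<bar>D\<bar>) * \<bar>\<tau>\<bar>)"
        by (simp add: algebra_simps flip: exp_add)
    qed auto
    also have "\<dots> = M1 * w \<tau>" by (simp add: M1_def w_def)
    also have "\<dots> \<le> (M1 + \<bar>M2\<bar>) * w \<tau>" using w[of \<tau>] by (intro mult_right_mono) auto
    finally show ?thesis .
  next
    case False
    have "\<bar>D * \<tau>\<bar> \<le> 1 + \<bar>i\<bar>" using False by linarith
    then have "\<bar>\<tau>\<bar> \<le> T" using D by (simp add: T_def field_simps abs_mult)
    then have "\<bar>u \<tau> / w \<tau>\<bar> \<le> M2" by (intro M2) auto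
    then have "u \<tau> / w \<tau> \<le> M1 + \<bar>M2\<bar>" using M1 by linarith
    then show ?thesis using w[of \<tau>] by (simp add: field_simps)
  qed
  then show ?thesis unfolding vertical_growth_def w_def using M1
    by (intro exI[of _ "M1 + \<bar>M2\<bar>"]) (auto simp: mult.assoc add_pos_nonneg)
qed

lemma Gamma_vertical_growth:
  fixes c :: complex
  assumes D: "D \<noteq> 0" and poles: "\<And>\<tau>. c + of_real D * (\<i> * of_real \<tau>) \<notin> \<int>\<^sub>\<le>\<^sub>0"
  shows "vertical_growth (\<lambda>\<tau>. norm (Gamma (c + of_real D * (\<i> * of_real \<tau>)))) (Re c - 1/2) (pi / 2 * \<bar>D\<bar>)"
proof -
  obtain K where K: "K > 0"
    "\<And>y. \<bar>y\<bar> \<ge> 1 \<Longrightarrow> \<bar>ln (norm (Gamma (Complex (Re c) y))) - ((Re c - 1/2) * ln \<bar>y\<bar> - pi * \<bar>y\<bar> / 2)\<bar> \<le> K"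
    by (rule Stirling_vertical[where x = "Re c"]) blast
  have c: "c + of_real D * (\<i> * of_real \<tau>) = Complex (Re c) (Im c + D * \<tau>)" for \<tau> by (simp add: complex_eq_iff)
  show ?thesis
  proof (rule vertical_growthI[OF _ D, where K = K and i = "Im c"])
    show "continuous_on UNIV (\<lambda>\<tau>. norm (Gamma (c + of_real D * (\<i> * of_real \<tau>))))"
      using poles by (intro continuous_at_imp_continuous_on ballI continuous_intros)
    fix \<tau> assume y: "\<bar>Im c + D * \<tau>\<bar> \<ge> 1"
    define g where "g = norm (Gamma (c + of_real D * (\<i> * of_real \<tau>)))"
    have "g > 0" using poles by (simp add: g_def Gamma_eq_zero_iff)
    moreover have "ln g \<le> K + (Re c - 1/2) * ln \<bar>Im c + D * \<tau>\<bar> - pi / 2 * \<bar>Im c + D * \<tau>\<bar>"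
      using K(2)[OF y] unfolding g_def c by (simp add: abs_le_iff)
    ultimately show "g \<le> exp (K + (Re c - 1/2) * ln \<bar>Im c + D * \<tau>\<bar> - pi / 2 * \<bar>Im c + D * \<tau>\<bar>)"
      by (metis exp_le_cancel_iff exp_ln)
  qed
qed

lemma rGamma_vertical_growth:
  fixes c :: complex
  assumes D: "D \<noteq> 0"
  shows "vertical_growth (\<lambda>\<tau>. norm (rGamma (c + of_real D * (\<i> * of_real \<tau>)))) (- (Re c - 1/2)) (- (pi / 2) * \<bar>D\<bar>)"
proof -
  obtain K where K: "K > 0"
    "\<And>y. \<bar>y\<bar> \<ge> 1 \<Longrightarrow> \<bar>ln (norm (Gamma (Complex (Re c) y))) - ((Re c - 1/2) * ln \<bar>y\<bar> - pi * \<bar>y\<bar> / 2)\<bar> \<le> K"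
    by (rule Stirling_vertical[where x = "Re c"]) blast
  have c: "c + of_real D * (\<i> * of_real \<tau>) = Complex (Re c) (Im c + D * \<tau>)" for \<tau> by (simp add: complex_eq_iff)
  show ?thesis
  proof (rule vertical_growthI[OF _ D, where K = K and i = "Im c"])
    show "continuous_on UNIV (\<lambda>\<tau>. norm (rGamma (c + of_real D * (\<i> * of_real \<tau>))))"
      by (intro continuous_at_imp_continuous_on ballI isCont_norm isCont_rGamma continuous_intros)
    fix \<tau> assume y: "\<bar>Im c + D * \<tau>\<bar> \<ge> 1"
    define g where "g = norm (Gamma (c + of_real D * (\<i> * of_real \<tau>)))"
    have "c + of_real D * (\<i> * of_real \<tau>) \<notin> \<int>\<^sub>\<le>\<^sub>0"
    proof
      assume "c + of_real D * (\<i> * of_real \<tau>) \<in> \<int>\<^sub>\<le>\<^sub>0"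
      then have "Im (c + of_real D * (\<i> * of_real \<tau>)) = 0" by (rule nonpos_Ints_Im)
      then show False using y by simp
    qed
    then have "g > 0" by (simp add: g_def Gamma_eq_zero_iff)
    moreover have "- ln g \<le> K + - (Re c - 1/2) * ln \<bar>Im c + D * \<tau>\<bar> - - (pi / 2) * \<bar>Im c + D * \<tau>\<bar>"
      using K(2)[OF y] unfolding g_def c by (simp add: abs_le_iff left_diff_distrib)
    ultimately have "inverse g \<le> exp (K + - (Re c - 1/2) * ln \<bar>Im c + D * \<tau>\<bar> - - (pi / 2) * \<bar>Im c + D * \<tau>\<bar>)"
      by (metis exp_le_cancel_iff exp_ln exp_minus)
    then show "norm (rGamma (c + of_real D * (\<i> * of_real \<tau>))) \<le>
        exp (K + - (Re c - 1/2) * ln \<bar>Im c + D * \<tau>\<bar> - - (pi / 2) * \<bar>Im c + D * \<tau>\<bar>)"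
      by (simp add: g_def rGamma_inverse_Gamma norm_inverse)
  qed
qed

lemma gamma_power_branch_log:
  assumes G: "gamma_power_branch G" and D: "D \<noteq> 0" and \<kappa>: "\<kappa> > 0"
  obtains l where "continuous_on {s. Re s = 0 \<and> c + of_real D * s \<notin> \<int>\<^sub>\<le>\<^sub>0} l"
    "\<And>s. Re s = 0 \<Longrightarrow> c + of_real D * s \<notin> \<int>\<^sub>\<le>\<^sub>0 \<Longrightarrow> exp (l s) = Gamma (c + of_real D * s)"
    "\<And>s. Re s = 0 \<Longrightarrow> c + of_real D * s \<notin> \<int>\<^sub>\<le>\<^sub>0 \<Longrightarrow> G c D \<kappa> s = exp (of_real \<kappa> * l s)"
    "\<And>s. Re s = 0 \<Longrightarrow> c + of_real D * s \<in> \<int>\<^sub>\<le>\<^sub>0 \<Longrightarrow> G c D \<kappa> s = 0"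
proof -
  have "\<exists>l. continuous_on {s. Re s = 0 \<and> c + of_real D * s \<notin> \<int>\<^sub>\<le>\<^sub>0} l \<and>
      (\<forall>s. Re s = 0 \<longrightarrow> (if c + of_real D * s \<notin> \<int>\<^sub>\<le>\<^sub>0
        then exp (l s) = Gamma (c + of_real D * s) \<and> G c D \<kappa> s = exp (of_real \<kappa> * l s) else G c D \<kappa> s = 0))"
    by (rule G[unfolded gamma_power_branch_def, rule_format]) (use D \<kappa> in simp)
  then obtain l where l: "continuous_on {s. Re s = 0 \<and> c + of_real D * s \<notin> \<int>\<^sub>\<le>\<^sub>0} l"
      "\<And>s. Re s = 0 \<Longrightarrow> (if c + of_real D * s \<notin> \<int>\<^sub>\<le>\<^sub>0
        then exp (l s) = Gamma (c + of_real D * s) \<and> G c D \<kappa> s = exp (of_real \<kappa> * l s) else G c D \<kappa> s = 0)"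
    by (elim exE conjE) simp
  show thesis
  proof (rule that[OF l(1)])
    fix s :: complex assume "Re s = 0"
    note l(2)[OF this]
    then show "c + of_real D * s \<notin> \<int>\<^sub>\<le>\<^sub>0 \<Longrightarrow> exp (l s) = Gamma (c + of_real D * s)"
      "c + of_real D * s \<notin> \<int>\<^sub>\<le>\<^sub>0 \<Longrightarrow> G c D \<kappa> s = exp (of_real \<kappa> * l s)"
      "c + of_real D * s \<in> \<int>\<^sub>\<le>\<^sub>0 \<Longrightarrow> G c D \<kappa> s = 0"
      by (simp_all split: if_splits)
  qed
qed

text \<open>
  The absolute value does not depend on the chosen logarithm. At a pole both sides are 0, since Gamma takes the
  value 0 there.
\<close>
lemma gamma_power_branch_norm:
  assumes G: "gamma_power_branch G" and D: "D \<noteq> 0" and \<kappa>: "\<kappa> > 0"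
  shows "norm (G c D \<kappa> (\<i> * of_real \<tau>)) = norm (Gamma (c + of_real D * (\<i> * of_real \<tau>))) powr \<kappa>"
proof -
  define s where "s = \<i> * complex_of_real \<tau>"
  have s: "Re s = 0" by (simp add: s_def)
  obtain l where l:
    "c + of_real D * s \<notin> \<int>\<^sub>\<le>\<^sub>0 \<Longrightarrow> exp (l s) = Gamma (c + of_real D * s)"
    "c + of_real D * s \<notin> \<int>\<^sub>\<le>\<^sub>0 \<Longrightarrow> G c D \<kappa> s = exp (of_real \<kappa> * l s)"
    "c + of_real D * s \<in> \<int>\<^sub>\<le>\<^sub>0 \<Longrightarrow> G c D \<kappa> s = 0"
    by (rule gamma_power_branch_log[OF assms, of c]) (use s in blast)
  have "norm (G c D \<kappa> s) = norm (Gamma (c + of_real D * s)) powr \<kappa>"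
  proof (cases "c + of_real D * s \<in> \<int>\<^sub>\<le>\<^sub>0")
    case True
    then show ?thesis using l(3) by (simp add: Gamma_eq_zero_iff[THEN iffD2])
  next
    case False
    show ?thesis unfolding l(2)[OF False] l(1)[OF False, symmetric]
      by (simp add: norm_exp_eq_Re exp_powr_real mult.commute)
  qed
  then show ?thesis by (simp add: s_def)
qed

lemma gamma_power_branch_one:
  assumes G: "gamma_power_branch G" and D: "D \<noteq> 0" and s: "Re s = 0"
  shows "G c D 1 s = Gamma (c + of_real D * s)"
proof -
  obtain l where l:
    "c + of_real D * s \<notin> \<int>\<^sub>\<le>\<^sub>0 \<Longrightarrow> exp (l s) = Gamma (c + of_real D * s)"
    "c + of_real D * s \<notin> \<int>\<^sub>\<le>\<^sub>0 \<Longrightarrow> G c D 1 s = exp (of_real 1 * l s)"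
    "c + of_real D * s \<in> \<int>\<^sub>\<le>\<^sub>0 \<Longrightarrow> G c D 1 s = 0"
    by (rule gamma_power_branch_log[OF G D zero_less_one, of c]) (use s in blast)
  show ?thesis
  proof (cases "c + of_real D * s \<in> \<int>\<^sub>\<le>\<^sub>0")
    case True
    then show ?thesis using l(3) by (simp add: Gamma_eq_zero_iff[THEN iffD2])
  next
    case False
    then show ?thesis using l(1,2) by simp
  qed
qed

lemma gamma_power_branch_measurable:
  assumes G: "gamma_power_branch G" and D: "D \<noteq> 0" and \<kappa>: "\<kappa> > 0"
  shows "(\<lambda>\<tau>. G c D \<kappa> (\<i> * of_real \<tau>)) \<in> borel_measurable borel"
proof -
  obtain l where cl: "continuous_on {s. Re s = 0 \<and> c + of_real D * s \<notin> \<int>\<^sub>\<le>\<^sub>0} l" and l: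
    "\<And>s. Re s = 0 \<Longrightarrow> c + of_real D * s \<notin> \<int>\<^sub>\<le>\<^sub>0 \<Longrightarrow> G c D \<kappa> s = exp (of_real \<kappa> * l s)"
    "\<And>s. Re s = 0 \<Longrightarrow> c + of_real D * s \<in> \<int>\<^sub>\<le>\<^sub>0 \<Longrightarrow> G c D \<kappa> s = 0"
    by (rule gamma_power_branch_log[OF assms, of c]) blast
  define S where "S = {\<tau>::real. c + of_real D * (\<i> * of_real \<tau>) \<notin> \<int>\<^sub>\<le>\<^sub>0}"
  have S: "S \<in> sets borel"
  proof -
    have "\<tau> = - Im c / D" if "c + of_real D * (\<i> * of_real \<tau>) \<in> \<int>\<^sub>\<le>\<^sub>0" for \<tau>
    proof -
      have "Im (c + of_real D * (\<i> * of_real \<tau>)) = 0" using that by (rule nonpos_Ints_Im)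
      then show ?thesis using D by (simp add: field_simps)
    qed
    then have "- S \<subseteq> {- Im c / D}" by (auto simp: S_def)
    then have "finite (- S)" by (rule finite_subset) simp
    then have "closed (- S)" by (rule finite_imp_closed)
    then show ?thesis by (simp add: closed_Compl open_closed borel_open)
  qed
  have "(\<lambda>\<tau>. if \<tau> \<in> S then exp (of_real \<kappa> * l (\<i> * of_real \<tau>)) else 0) \<in> borel_measurable borel"
  proof (rule borel_measurable_continuous_on_if[OF S])
    show "continuous_on S (\<lambda>\<tau>. exp (of_real \<kappa> * l (\<i> * of_real \<tau>)))"
      by (intro continuous_intros continuous_on_compose2[OF cl]) (auto simp: S_def)
  qed auto
  moreover have "(if \<tau> \<in> S then exp (of_real \<kappa> * l (\<i> * of_real \<tau>)) else 0) = G c D \<kappa> (\<i> * of_real \<tau>)" for \<tau>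
    using l[of "\<i> * of_real \<tau>"] by (simp add: S_def)
  ultimately show ?thesis by simp
qed


section \<open>Power weights\<close>

lemma of_real_powr_exp: "r > 0 \<Longrightarrow> complex_of_real r powr p = exp (p * of_real (ln r))"
  by (simp add: powr_def Ln_of_real)

text \<open>
  The substitution t = x / (1 - w), under which 1 - x / t becomes w.
\<close>
lemma moebius_substitution:
  fixes f :: "real \<Rightarrow> 'a::euclidean_space" and x :: real
  assumes x: "x > 0"
  shows "(\<lambda>w. (x / (1 - w)\<^sup>2) *\<^sub>R f (x / (1 - w))) absolutely_integrable_on {0<..<1} \<and>
      integral {0<..<1} (\<lambda>w. (x / (1 - w)\<^sup>2) *\<^sub>R f (x / (1 - w))) = b
    \<longleftrightarrow> f absolutely_integrable_on {x<..} \<and> integral {x<..} f = b"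
proof -
  define g where "g = (\<lambda>w. x / (1 - w))"
  have img: "g ` {0<..<1} = {x<..}"
  proof (intro equalityI subsetI)
    fix t assume "t \<in> g ` {0<..<1}"
    then obtain w where "w \<in> {0<..<1}" "t = x / (1 - w)" by (auto simp: g_def)
    then show "t \<in> {x<..}" using x by (simp add: pos_less_divide_eq)
  next
    fix t assume t: "t \<in> {x<..}"
    then have "1 - x / t \<in> {0<..<1}" "t = g (1 - x / t)" using x by (auto simp: g_def)
    then show "t \<in> g ` {0<..<1}" by blast
  qed
  have "(\<lambda>w. \<bar>x / (1 - w)\<^sup>2\<bar> *\<^sub>R f (g w)) absolutely_integrable_on {0<..<1} \<and>
      integral {0<..<1} (\<lambda>w. \<bar>x / (1 - w)\<^sup>2\<bar> *\<^sub>R f (g w)) = b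
    \<longleftrightarrow> f absolutely_integrable_on (g ` {0<..<1}) \<and> integral (g ` {0<..<1}) f = b"
  proof (rule has_absolute_integral_change_of_variables_real)
    show "inj_on g {0<..<1}" using x by (auto simp: g_def inj_on_def)
    show "(g has_real_derivative x / (1 - w)\<^sup>2) (at w within {0<..<1})" if "w \<in> {0<..<1}" for w
      unfolding g_def using that by (auto intro!: derivative_eq_intros simp: power2_eq_square)
  qed auto
  then show ?thesis unfolding img using x by (simp add: g_def)
qed

lemma absolutely_integrable_imp_set_integrable_lborel:
  fixes f :: "real \<Rightarrow> 'a::euclidean_space"
  assumes "f absolutely_integrable_on S" "S \<in> sets borel" "continuous_on S f"
  shows "set_integrable lborel S f"
  unfolding set_integrable_def
proof (rule iffD1[OF integrable_completion])
  show "(\<lambda>x. indicator S x *\<^sub>R f x) \<in> borel_measurable lborel"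
    using borel_measurable_continuous_on_indicator[OF assms(2,3)] by simp
  show "integrable lebesgue (\<lambda>x. indicator S x *\<^sub>R f x)"
    using assms(1) unfolding set_integrable_def .
qed

text \<open>
  The substitution t = x / (1 - w) turns the weight into a Beta weight with parameters a and b - a.
\<close>
lemma power_weight_integrable:
  fixes x a b :: real
  assumes x: "x > 0" and ab: "0 < a" "a < b"
  shows "set_integrable lborel {x<..} (\<lambda>t. (t - x) powr (a - 1) * t powr (- b))"
proof (rule absolutely_integrable_imp_set_integrable_lborel)
  define f where "f = (\<lambda>t. (t - x) powr (a - 1) * t powr (- b))"
  have eq: "(x / (1 - w)\<^sup>2) *\<^sub>R f (x / (1 - w)) = x powr (a - b) * (w powr (a - 1) * (1 - w) powr ((b - a) - 1))"
    if w: "w \<in> {0<..<1}" for w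
  proof -
    have p: "1 - w > 0" "w > 0" using w by auto
    have l: "ln (x / (1 - w)) = ln x - ln (1 - w)" "ln (x / (1 - w) - x) = ln x + ln w - ln (1 - w)"
    proof -
      have "x / (1 - w) - x = x * w / (1 - w)" using p by (simp add: field_simps)
      then show "ln (x / (1 - w) - x) = ln x + ln w - ln (1 - w)" using p x by (simp add: ln_div ln_mult)
    qed (use p x in \<open>simp add: ln_div\<close>)
    have pos: "x / (1 - w) > 0" "x / (1 - w) - x > 0" using p x by (auto simp: field_simps)
    have pw: "r powr u = exp (u * ln r)" if "r > 0" for r u :: real using that by (simp add: powr_def)
    have j: "x / (1 - w)\<^sup>2 = exp (ln x - 2 * ln (1 - w))"
      using p x by (simp add: exp_diff exp_double)
    have "(x / (1 - w)\<^sup>2) *\<^sub>R f (x / (1 - w)) = exp (ln x - 2 * ln (1 - w) + ((a - 1) * (ln x + ln w - ln (1 - w)) + (- b) * (ln x - ln (1 - w))))"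
      unfolding f_def j real_scaleR_def pw[OF pos(1)] pw[OF pos(2)] l by (simp only: exp_add)
    also have "\<dots> = exp ((a - b) * ln x + ((a - 1) * ln w + ((b - a) - 1) * ln (1 - w)))"
      by (rule arg_cong[where f = exp]) (simp add: algebra_simps)
    also have "\<dots> = x powr (a - b) * (w powr (a - 1) * (1 - w) powr ((b - a) - 1))"
      unfolding pw[OF x] pw[OF p(1)] pw[OF p(2)] by (simp only: exp_add)
    finally show ?thesis .
  qed
  have "set_integrable lborel {0..1} (\<lambda>w. w powr (a - 1) * (1 - w) powr ((b - a) - 1))"
    using ab by (intro integrable_Beta) auto
  then have "set_integrable lborel {0<..<1} (\<lambda>w. w powr (a - 1) * (1 - w) powr ((b - a) - 1))"
    by (rule set_integrable_subset) auto
  then have lb: "integrable lborel (\<lambda>w. indicator {0<..<1} w *\<^sub>R (w powr (a - 1) * (1 - w) powr ((b - a) - 1)))"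
    unfolding set_integrable_def .
  have "(\<lambda>w. w powr (a - 1) * (1 - w) powr ((b - a) - 1)) absolutely_integrable_on {0<..<1}"
    unfolding set_integrable_def by (rule iffD2[OF integrable_completion[OF borel_measurable_integrable[OF lb]] lb])
  then have wi: "(\<lambda>w. x powr (a - b) * (w powr (a - 1) * (1 - w) powr ((b - a) - 1))) absolutely_integrable_on {0<..<1}"
    by (rule set_integrable_mult_right)
  have "(\<lambda>w. (x / (1 - w)\<^sup>2) *\<^sub>R f (x / (1 - w))) absolutely_integrable_on {0<..<1}"
    by (subst set_integrable_cong[OF refl refl eq]) (simp_all only: wi)
  then show "(\<lambda>t. (t - x) powr (a - 1) * t powr (- b)) absolutely_integrable_on {x<..}"
    using moebius_substitution[OF x, of f] unfolding f_def by blast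
  show "continuous_on {x<..} (\<lambda>t. (t - x) powr (a - 1) * t powr (- b))"
    using x by (intro continuous_intros) auto
qed auto

lemma integrable_one_plus_abs_powr:
  fixes p :: real
  assumes "p < -1"
  shows "integrable lborel (\<lambda>\<tau>::real. (1 + \<bar>\<tau>\<bar>) powr p)"
proof -
  define f where "f = (\<lambda>\<tau>::real. indicator {0..} \<tau> *\<^sub>R (1 + \<bar>\<tau>\<bar>) powr p)"
  have "(\<integral>\<^sup>+\<tau>. ennreal ((1 + \<bar>\<tau>\<bar>) powr p) * indicator {0..} \<tau> \<partial>lborel) =
      (\<integral>\<^sup>+\<tau>. ennreal ((1 + max 0 \<tau>) powr p) * indicator {0..} \<tau> \<partial>lborel)"
    by (intro nn_integral_cong) (auto simp: indicator_def max_def)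
  also have "\<dots> = (\<integral>\<^sup>+\<tau>. ennreal ((1 + \<tau>) powr p) * indicator {0..} \<tau> \<partial>lborel)"
    by (intro nn_integral_cong) (auto simp: indicator_def max_def)
  also have "\<dots> = ennreal (0 - (1 + 0) powr (p + 1) / (p + 1))"
  proof (rule nn_integral_FTC_atLeast)
    show "((\<lambda>\<tau>. (1 + \<tau>) powr (p + 1) / (p + 1)) has_real_derivative (1 + \<tau>) powr p) (at \<tau>)" if "0 \<le> \<tau>" for \<tau>
      using that assms by (auto intro!: derivative_eq_intros)
    have "((\<lambda>\<tau>. (1 + \<tau>) powr (p + 1)) \<longlongrightarrow> 0) at_top"
      using assms by (intro tendsto_neg_powr filterlim_tendsto_add_at_top[OF tendsto_const] filterlim_ident) auto
    then show "((\<lambda>\<tau>. (1 + \<tau>) powr (p + 1) / (p + 1)) \<longlongrightarrow> 0) at_top"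
      by (rule tendsto_divide_zero)
  qed auto
  finally have nn: "(\<integral>\<^sup>+\<tau>. ennreal ((1 + \<bar>\<tau>\<bar>) powr p) * indicator {0..} \<tau> \<partial>lborel) < top"
    by simp
  have "ennreal (norm (f \<tau>)) = ennreal ((1 + \<bar>\<tau>\<bar>) powr p) * indicator {0..} \<tau>" for \<tau>
    by (simp add: f_def indicator_def)
  then have "(\<integral>\<^sup>+\<tau>. ennreal (norm (f \<tau>)) \<partial>lborel) < \<infinity>" using nn by simp
  then have "integrable lborel f"
    by (intro integrableI_bounded) (simp add: f_def)
  then have "integrable lborel (\<lambda>\<tau>. f \<tau> + f (0 + (-1) * \<tau>))"
    by (intro Bochner_Integration.integrable_add lborel_integrable_real_affine) auto
  then show ?thesis
    by (rule Bochner_Integration.integrable_bound) (auto simp: f_def indicator_def)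
qed


section \<open>Moments of a kernel with oscillating powers\<close>

text \<open>
  The kernel K has an integrable singularity of type (t - x)^(c-1) at x, is of order t^(q+c-1) at infinity, and
  differentiation costs a factor 1 / (t - x) at most. It is integrated against the oscillating powers of exponent -\<sigma> + \<i>\<mu>\<tau>; the
  condition c + q < Re \<sigma> makes these integrals converge at infinity.
\<close>
locale oscillatory_kernel =
  fixes x c q \<mu> :: real and \<sigma> :: complex and K K' :: "real \<Rightarrow> complex" and M :: real
  assumes x: "x > 0" and c: "0 < c" "c \<le> 1" and q: "c + q < Re \<sigma>" and \<mu>: "\<mu> \<noteq> 0"
    and K_deriv: "\<And>t. t > x \<Longrightarrow> (K has_vector_derivative K' t) (at t)"
    and K'_cont: "continuous_on {x<..} K'"
    and K_bound: "\<And>t. t > x \<Longrightarrow> norm (K t) \<le> M * ((t - x) powr (c - 1) * t powr q)"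
    and K'_bound: "\<And>t. t > x \<Longrightarrow> norm (K' t) \<le> M * ((t - x) powr (c - 2) * t powr q)"
begin

lemma M_nonneg: "M \<ge> 0"
proof -
  have "0 \<le> M * (((x + 1) - x) powr (c - 1) * (x + 1) powr q)"
    using K_bound[of "x + 1"] norm_ge_zero[of "K (x + 1)"] by linarith
  then show ?thesis using x by (simp add: zero_le_mult_iff)
qed

lemma K_cont: "continuous_on {x<..} K"
  using K_deriv by (intro continuous_at_imp_continuous_on) (auto intro: has_vector_derivative_continuous)

text \<open>
  The oscillating power has exponent e \<tau>, and k \<tau> is its product with K. The power E \<tau> is an antiderivative of the
  oscillating power up to the factor e \<tau> + 1. The weight W 0 dominates k \<tau> up to the constant M, and W \<eta> has
  a stronger singularity at x, by the power \<eta>.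
\<close>
definition e :: "real \<Rightarrow> complex" where "e \<tau> = - \<sigma> + \<i> * of_real (\<mu> * \<tau>)"

definition k :: "real \<Rightarrow> real \<Rightarrow> complex" where "k \<tau> t = K t * exp (e \<tau> * of_real (ln t))"

definition E :: "real \<Rightarrow> real \<Rightarrow> complex" where "E \<tau> t = exp ((e \<tau> + 1) * of_real (ln t))"

definition W :: "real \<Rightarrow> real \<Rightarrow> real" where "W \<eta> t = (t - x) powr (c - \<eta> - 1) * t powr (- (Re \<sigma> - q))"

lemma W_nonneg: "W \<eta> t \<ge> 0" by (simp add: W_def)

lemma W_set_integrable: "\<eta> \<ge> 0 \<Longrightarrow> \<eta> < c \<Longrightarrow> set_integrable lborel {x<..} (W \<eta>)"
  unfolding W_def using power_weight_integrable[OF x, of "c - \<eta>" "Re \<sigma> - q"] q by simp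

lemma Re_e [simp]: "Re (e \<tau>) = - Re \<sigma>" by (simp add: e_def)

lemma norm_k: "t > x \<Longrightarrow> norm (k \<tau> t) \<le> M * W 0 t"
proof -
  assume t: "t > x"
  then have t0: "t > 0" using x by simp
  have "norm (k \<tau> t) = norm (K t) * t powr (- Re \<sigma>)"
    using t0 by (simp add: k_def norm_mult norm_exp_eq_Re powr_def)
  also have "\<dots> \<le> M * ((t - x) powr (c - 1) * t powr q) * t powr (- Re \<sigma>)"
    using K_bound[OF t] by (intro mult_right_mono) auto
  also have "\<dots> = M * W 0 t" by (simp add: W_def algebra_simps flip: powr_add)
  finally show ?thesis .
qed

lemma norm_E: "t > 0 \<Longrightarrow> norm (E \<tau> t) = t powr (1 - Re \<sigma>)"
  by (simp add: E_def norm_exp_eq_Re powr_def)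

lemma E_deriv: "t > 0 \<Longrightarrow> (E \<tau> has_vector_derivative (e \<tau> + 1) * exp (e \<tau> * of_real (ln t))) (at t)"
proof -
  assume t: "t > 0"
  have "((\<lambda>t. (e \<tau> + 1) * of_real (ln t)) has_vector_derivative (e \<tau> + 1) * of_real (1 / t)) (at t)"
    using t by (intro has_vector_derivative_mult_right has_vector_derivative_of_real)
      (auto intro!: derivative_eq_intros simp: has_real_derivative_iff_has_vector_derivative[symmetric])
  from field_vector_diff_chain_at[OF this, of exp "E \<tau> t"]
  have "(E \<tau> has_vector_derivative (e \<tau> + 1) * of_real (1 / t) * E \<tau> t) (at t)"
    by (simp add: o_def E_def[abs_def] DERIV_exp)
  moreover have "of_real (1 / t) * E \<tau> t = exp (e \<tau> * of_real (ln t))"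
  proof -
    have "exp (complex_of_real (ln t)) = of_real t" using t by (simp add: exp_of_real)
    then show ?thesis using t by (simp add: E_def distrib_right exp_add)
  qed
  ultimately show ?thesis by (simp only: mult.assoc)
qed

lemma K_measurable [measurable]: "(\<lambda>t. indicator {x<..} t *\<^sub>R K t) \<in> borel_measurable borel"
  using K_cont by (intro borel_measurable_continuous_on_indicator) auto

lemma K'_measurable [measurable]: "(\<lambda>t. indicator {x<..} t *\<^sub>R K' t) \<in> borel_measurable borel"
  using K'_cont by (intro borel_measurable_continuous_on_indicator) auto

lemma indicator_k_measurable_pair:
  assumes [measurable]: "S \<in> sets borel" and S: "S \<subseteq> {x<..}"
  shows "(\<lambda>(\<tau>, t). indicator S t *\<^sub>R k \<tau> t) \<in> borel_measurable (lborel \<Otimes>\<^sub>M lborel)"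
proof -
  have "(\<lambda>(\<tau>, t). indicator S t *\<^sub>R ((indicator {x<..} t *\<^sub>R K t) * exp (e \<tau> * of_real (ln t)))) \<in> borel_measurable (lborel \<Otimes>\<^sub>M lborel)"
    unfolding e_def by measurable
  moreover have "indicator S t *\<^sub>R ((indicator {x<..} t *\<^sub>R K t) * exp (e \<tau> * of_real (ln t))) = indicator S t *\<^sub>R k \<tau> t" for \<tau> t
    using S by (auto simp: indicator_def k_def)
  ultimately show ?thesis by simp
qed

lemma indicator_k_measurable:
  assumes "S \<in> sets borel" "S \<subseteq> {x<..}"
  shows "(\<lambda>t. indicator S t *\<^sub>R k \<tau> t) \<in> borel_measurable lborel"
  using measurable_compose[OF measurable_Pair1' indicator_k_measurable_pair[OF assms], of \<tau>] by simp

lemma k_set_integrable: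
  assumes "S \<in> sets borel" "S \<subseteq> {x<..}"
  shows "set_integrable lborel S (k \<tau>)"
  unfolding set_integrable_def
proof (rule Bochner_Integration.integrable_bound)
  show "integrable lborel (\<lambda>t. M * (indicator {x<..} t *\<^sub>R W 0 t))"
    using W_set_integrable[of 0] c unfolding set_integrable_def by (intro integrable_mult_right) auto
  show "(\<lambda>t. indicator S t *\<^sub>R k \<tau> t) \<in> borel_measurable lborel" by (rule indicator_k_measurable[OF assms])
  show "AE t in lborel. norm (indicator S t *\<^sub>R k \<tau> t) \<le> norm (M * (indicator {x<..} t *\<^sub>R W 0 t))"
  proof (intro AE_I2)
    fix t
    show "norm (indicator S t *\<^sub>R k \<tau> t) \<le> norm (M * (indicator {x<..} t *\<^sub>R W 0 t))"
    proof (cases "t \<in> S")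
      case True
      then have "t > x" using assms by auto
      then show ?thesis using True norm_k[of t \<tau>] by (simp add: M_nonneg W_nonneg)
    qed simp
  qed
qed

definition J :: "real set \<Rightarrow> real \<Rightarrow> complex" where "J S \<tau> = (LINT t:S|lborel. k \<tau> t)"

lemma J_measurable [measurable]:
  assumes "S \<in> sets borel" "S \<subseteq> {x<..}"
  shows "J S \<in> borel_measurable borel"
proof -
  have "(\<lambda>\<tau>. LINT t|lborel. indicator S t *\<^sub>R k \<tau> t) \<in> borel_measurable lborel"
    using indicator_k_measurable_pair[OF assms] by (intro lborel.borel_measurable_lebesgue_integral)
  then show ?thesis by (simp add: J_def[abs_def] set_lebesgue_integral_def)
qed

lemma J_limit:
  assumes S: "\<And>n. S n \<in> sets borel" "\<And>n. S n \<subseteq> {x<..}" "S' \<in> sets borel" "S' \<subseteq> {x<..}"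
    and lim: "AE t in lborel. (\<lambda>n. indicator (S n) t :: real) \<longlonglongrightarrow> indicator S' t"
  shows "(\<lambda>n. J (S n) \<tau>) \<longlonglongrightarrow> J S' \<tau>"
  unfolding J_def set_lebesgue_integral_def
proof (rule integral_dominated_convergence[where w = "\<lambda>t. M * (indicator {x<..} t *\<^sub>R W 0 t)"])
  show "integrable lborel (\<lambda>t. M * (indicator {x<..} t *\<^sub>R W 0 t))"
    using W_set_integrable[of 0] c unfolding set_integrable_def by (intro integrable_mult_right) auto
  show "(\<lambda>t. indicator S' t *\<^sub>R k \<tau> t) \<in> borel_measurable lborel" using S by (intro indicator_k_measurable)
  show "(\<lambda>t. indicator (S n) t *\<^sub>R k \<tau> t) \<in> borel_measurable lborel" for n using S by (intro indicator_k_measurable)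
  show "AE t in lborel. (\<lambda>n. indicator (S n) t *\<^sub>R k \<tau> t) \<longlonglongrightarrow> indicator S' t *\<^sub>R k \<tau> t"
    using lim by eventually_elim (intro tendsto_intros)
  show "AE t in lborel. norm (indicator (S n) t *\<^sub>R k \<tau> t) \<le> M * (indicator {x<..} t *\<^sub>R W 0 t)" for n
  proof (intro AE_I2)
    fix t
    show "norm (indicator (S n) t *\<^sub>R k \<tau> t) \<le> M * (indicator {x<..} t *\<^sub>R W 0 t)"
    proof (cases "t \<in> S n")
      case True
      then have "t > x" using S by auto
      then show ?thesis using True norm_k[of t \<tau>] by simp
    qed (simp add: M_nonneg W_nonneg)
  qed
qed

text \<open>
  Trades the factor e + 1, which is large for large \<tau>, for the derivative of the kernel.
\<close>
lemma J_parts: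
  assumes "x < a" "a \<le> b"
  shows "(e \<tau> + 1) * J {a..b} \<tau> = K b * E \<tau> b - K a * E \<tau> a - (LINT t:{a..b}|lborel. K' t * E \<tau> t)"
proof -
  have sub: "{a..b} \<subseteq> {x<..}" using assms by auto
  have cE: "continuous_on {a..b} (E \<tau>)"
    using assms x by (intro continuous_at_imp_continuous_on ballI has_vector_derivative_continuous[OF E_deriv]) auto
  have cK: "continuous_on {a..b} K" "continuous_on {a..b} K'" using K_cont K'_cont sub continuous_on_subset by blast+
  have ck: "continuous_on {a..b} (\<lambda>t. (e \<tau> + 1) * k \<tau> t)" unfolding k_def
    using assms x by (intro continuous_intros cK) auto
  have ckE: "continuous_on {a..b} (\<lambda>t. K' t * E \<tau> t)" by (intro continuous_intros cK cE)
  have "(LINT t|lborel. indicator {a..b} t *\<^sub>R (K t * ((e \<tau> + 1) * exp (e \<tau> * of_real (ln t))) + K' t * E \<tau> t)) = K b * E \<tau> b - K a * E \<tau> a"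
  proof (rule integral_FTC_atLeastAtMost[OF assms(2)])
    fix t assume "a \<le> t" "t \<le> b"
    then have t: "t > x" "t > 0" using assms x by auto
    show "((\<lambda>t. K t * E \<tau> t) has_vector_derivative K t * ((e \<tau> + 1) * exp (e \<tau> * of_real (ln t))) + K' t * E \<tau> t) (at t within {a..b})"
      by (intro has_vector_derivative_mult has_vector_derivative_at_within[OF K_deriv] has_vector_derivative_at_within[OF E_deriv] t)
  next
    show "continuous_on {a..b} (\<lambda>t. K t * ((e \<tau> + 1) * exp (e \<tau> * of_real (ln t))) + K' t * E \<tau> t)"
      using assms x by (intro continuous_intros cK cE) auto
  qed
  then have "(LINT t:{a..b}|lborel. (e \<tau> + 1) * k \<tau> t + K' t * E \<tau> t) = K b * E \<tau> b - K a * E \<tau> a"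
    by (simp add: set_lebesgue_integral_def k_def mult_ac)
  moreover have "(LINT t:{a..b}|lborel. (e \<tau> + 1) * k \<tau> t + K' t * E \<tau> t) =
      (LINT t:{a..b}|lborel. (e \<tau> + 1) * k \<tau> t) + (LINT t:{a..b}|lborel. K' t * E \<tau> t)"
    by (intro set_integral_add borel_integrable_atLeastAtMost' ck ckE)
  ultimately show ?thesis by (simp add: J_def eq_diff_eq)
qed

lemma J_norm_bound:
  fixes f :: "real \<Rightarrow> complex"
  assumes "S \<in> sets borel" "S \<subseteq> {x<..}" "\<eta> \<ge> 0" "\<eta> < c" "L \<ge> 0"
    and "\<And>t. t \<in> S \<Longrightarrow> norm (f t) \<le> L * W \<eta> t"
  shows "norm (LINT t:S|lborel. f t) \<le> L * (LINT t:{x<..}|lborel. W \<eta> t)"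
proof -
  have i: "integrable lborel (\<lambda>t. L * (indicator {x<..} t *\<^sub>R W \<eta> t))"
    using W_set_integrable[OF assms(3,4)] unfolding set_integrable_def by (rule integrable_mult_right)
  have "norm (LINT t:S|lborel. f t) \<le> (LINT t|lborel. L * (indicator {x<..} t *\<^sub>R W \<eta> t))"
  proof (cases "integrable lborel (\<lambda>t. indicator S t *\<^sub>R f t)")
    case True
    then show ?thesis unfolding set_lebesgue_integral_def
      by (intro Bochner_Integration.integral_norm_bound_integral i) (use assms W_nonneg in \<open>auto simp: indicator_def\<close>)
  next
    case False
    then show ?thesis unfolding set_lebesgue_integral_def not_integrable_integral_eq[OF False]
      using assms(5) W_nonneg by (simp add: integral_nonneg_AE)
  qed
  also have "\<dots> = L * (LINT t:{x<..}|lborel. W \<eta> t)" by (simp add: set_lebesgue_integral_def)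
  finally show ?thesis .
qed

lemma J_split:
  assumes that: "x < a" "a \<le> t"
  shows "J {x<..<t} \<tau> = J {x<..<a} \<tau> + J {a..t} \<tau>"
proof -
  have "J {x<..<t} \<tau> = J ({x<..<a} \<union> {a..t}) \<tau>"
    unfolding J_def set_lebesgue_integral_def
  proof (rule integral_cong_AE)
    have "AE s in lborel. s \<noteq> t" by (rule AE_lborel_singleton)
    then show "AE s in lborel. indicator {x<..<t} s *\<^sub>R k \<tau> s = indicator ({x<..<a} \<union> {a..t}) s *\<^sub>R k \<tau> s"
      by eventually_elim (use that in \<open>auto simp: indicator_def\<close>)
    show "(\<lambda>s. indicator {x<..<t} s *\<^sub>R k \<tau> s) \<in> borel_measurable lborel"
      by (rule indicator_k_measurable) auto
    show "(\<lambda>s. indicator ({x<..<a} \<union> {a..t}) s *\<^sub>R k \<tau> s) \<in> borel_measurable lborel"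
      by (rule indicator_k_measurable) (use that in auto)
  qed
  also have "\<dots> = J {x<..<a} \<tau> + J {a..t} \<tau>"
    unfolding J_def using that by (intro set_integral_Un k_set_integrable) auto
  finally show ?thesis .
qed

text \<open>
  For large |\<tau>| split the range at distance 1 / |\<tau>| from x. On the near part the singularity (t - x)^(c-1) has an
  integral of order |\<tau>|^(-\<eta>), against the factor e + 1 of order |\<tau>|. On the far part integrate by parts, which
  removes e + 1 and leaves the singularity (t - x)^(c-2) of K'; it exceeds the integrable singularity
  (t - x)^(c-\<eta>-1) by (t - x)^(\<eta>-1), which is at most |\<tau>|^(1-\<eta>) there. Uniformity in t is what makes the superposition continuous in t.
\<close>
lemma J_oscillation_bound:
  assumes \<eta>: "0 < \<eta>" "\<eta> < c"
  obtains C where "C > 0" "\<And>t \<tau>. x < t \<Longrightarrow> norm ((e \<tau> + 1) * J {x<..<t} \<tau>) \<le> C * (1 + \<bar>\<tau>\<bar>) powr (1 - \<eta>)"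
proof -
  define I where "I = (\<lambda>\<eta>. LINT t:{x<..}|lborel. W \<eta> t)"
  have I: "I \<eta> \<ge> 0" for \<eta> unfolding I_def set_lebesgue_integral_def using W_nonneg by (simp add: integral_nonneg_AE)
  define C0 where "C0 = norm \<sigma> + 1 + \<bar>\<mu>\<bar>"
  have C0: "C0 > 0" by (simp add: C0_def add_nonneg_pos add_pos_nonneg)
  have ne: "norm (e \<tau> + 1) \<le> C0 * (1 + \<bar>\<tau>\<bar>)" for \<tau>
  proof -
    have "norm (e \<tau> + 1) \<le> norm (- \<sigma>) + norm (\<i> * of_real (\<mu> * \<tau>)) + norm (1::complex)"
      unfolding e_def by (intro order_trans[OF norm_triangle_ineq] add_mono order_refl norm_triangle_ineq)
    also have "\<dots> = norm \<sigma> + \<bar>\<mu>\<bar> * \<bar>\<tau>\<bar> + 1" by (simp add: norm_mult abs_mult)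
    also have "\<dots> \<le> C0 * (1 + \<bar>\<tau>\<bar>)"
      using mult_nonneg_nonneg[of "norm \<sigma>" "\<bar>\<tau>\<bar>"] by (simp add: C0_def algebra_simps)
    finally show ?thesis .
  qed
  define P where "P = x powr (- (Re \<sigma> - q - c)) * (1 + x)"
  have P: "P \<ge> 0" using x by (simp add: P_def)
  \<comment> \<open>A1 serves for |\<tau>| \<le> 1; for larger |\<tau>| the near part contributes A2 and the far part A3.\<close>
  define A1 where "A1 = 2 * C0 * (M * I 0)"
  define A2 where "A2 = 2 * C0 * (M * I \<eta>)"
  define A3 where "A3 = M * P + M * P + M * (I 0 + x * I \<eta>)"
  have A: "A1 \<ge> 0" "A2 \<ge> 0" "A3 \<ge> 0" using C0 M_nonneg I P x by (simp_all add: A1_def A2_def A3_def)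
  have small: "norm ((e \<tau> + 1) * J {x<..<t} \<tau>) \<le> A1" if "x < t" "\<bar>\<tau>\<bar> \<le> 1" for t \<tau>
  proof -
    have "norm (J {x<..<t} \<tau>) \<le> M * I 0"
      unfolding J_def I_def using c M_nonneg norm_k by (intro J_norm_bound) auto
    moreover have "norm (e \<tau> + 1) \<le> 2 * C0" using order_trans[OF ne[of \<tau>] mult_left_mono[of "1 + \<bar>\<tau>\<bar>" 2 C0]] that C0 by simp
    ultimately show ?thesis unfolding norm_mult A1_def using C0 by (intro mult_mono) auto
  qed
  have near: "norm ((e \<tau> + 1) * J {x<..<t} \<tau>) \<le> A2 * \<bar>\<tau>\<bar> powr (1 - \<eta>)" if "x < t" "t \<le> x + 1 / \<bar>\<tau>\<bar>" "\<bar>\<tau>\<bar> \<ge> 1" for t \<tau>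
  proof -
    have "norm (J {x<..<t} \<tau>) \<le> (M * \<bar>\<tau>\<bar> powr (- \<eta>)) * I \<eta>"
      unfolding J_def I_def
    proof (rule J_norm_bound)
      fix s assume "s \<in> {x<..<t}"
      then have s: "s > x" "s - x \<le> 1 / \<bar>\<tau>\<bar>" using that by auto
      have "W 0 s = W \<eta> s * (s - x) powr \<eta>" by (simp add: W_def mult_ac flip: powr_add)
      also have "(s - x) powr \<eta> \<le> (1 / \<bar>\<tau>\<bar>) powr \<eta>" using s \<eta> by (intro powr_mono2) auto
      also have "(1 / \<bar>\<tau>\<bar>) powr \<eta> = \<bar>\<tau>\<bar> powr (- \<eta>)" by (simp add: powr_divide powr_minus field_simps)
      finally have "W 0 s \<le> W \<eta> s * \<bar>\<tau>\<bar> powr (- \<eta>)" by (simp add: mult_left_mono W_nonneg)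
      then have "norm (k \<tau> s) \<le> M * (W \<eta> s * \<bar>\<tau>\<bar> powr (- \<eta>))"
        using norm_k[OF s(1), of \<tau>] M_nonneg by (meson mult_left_mono order_trans)
      then show "norm (k \<tau> s) \<le> M * \<bar>\<tau>\<bar> powr (- \<eta>) * W \<eta> s" by (simp add: mult_ac)
    qed (use \<eta> M_nonneg in auto)
    moreover have "norm (e \<tau> + 1) \<le> C0 * (2 * \<bar>\<tau>\<bar>)"
      using order_trans[OF ne[of \<tau>] mult_left_mono[of "1 + \<bar>\<tau>\<bar>" "2 * \<bar>\<tau>\<bar>" C0]] that C0 by simp
    ultimately have "norm ((e \<tau> + 1) * J {x<..<t} \<tau>) \<le> (C0 * (2 * \<bar>\<tau>\<bar>)) * ((M * \<bar>\<tau>\<bar> powr (- \<eta>)) * I \<eta>)"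
      unfolding norm_mult using C0 by (intro mult_mono) auto
    also have "\<dots> = A2 * (\<bar>\<tau>\<bar> * \<bar>\<tau>\<bar> powr (- \<eta>))" by (simp add: A2_def mult_ac)
    also have "\<bar>\<tau>\<bar> * \<bar>\<tau>\<bar> powr (- \<eta>) = \<bar>\<tau>\<bar> powr (1 - \<eta>)" using that by (simp add: powr_mult_base)
    finally show ?thesis .
  qed
  have far: "norm ((e \<tau> + 1) * J {a..t} \<tau>) \<le> A3 * \<bar>\<tau>\<bar> powr (1 - \<eta>)"
    if "a = x + 1 / \<bar>\<tau>\<bar>" "a \<le> t" "\<bar>\<tau>\<bar> \<ge> 1" for a t \<tau>
  proof -
    have a: "x < a" using that by auto
    have ratio: "s / (s - x) \<le> (1 + x) * \<bar>\<tau>\<bar>" "1 / (s - x) \<le> \<bar>\<tau>\<bar>" "1 \<le> s / (s - x)" if "a \<le> s" for s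
    proof -
      have sx: "s - x \<ge> 1 / \<bar>\<tau>\<bar>" "s - x > 0" using that a \<open>a = x + 1 / \<bar>\<tau>\<bar>\<close> by linarith+
      show i: "1 / (s - x) \<le> \<bar>\<tau>\<bar>" using sx \<open>\<bar>\<tau>\<bar> \<ge> 1\<close> by (simp add: field_simps)
      have "s / (s - x) = 1 + x * (1 / (s - x))" using sx by (simp add: field_simps)
      also have "\<dots> \<le> \<bar>\<tau>\<bar> + x * \<bar>\<tau>\<bar>" using i x \<open>\<bar>\<tau>\<bar> \<ge> 1\<close> by (intro add_mono mult_left_mono) auto
      finally show "s / (s - x) \<le> (1 + x) * \<bar>\<tau>\<bar>" by (simp add: algebra_simps)
      show "1 \<le> s / (s - x)" using sx x by (simp add: field_simps)
    qed
    have bd: "norm (K s * E \<tau> s) \<le> M * P * \<bar>\<tau>\<bar> powr (1 - \<eta>)" if "a \<le> s" for s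
    proof -
      have s: "s > x" "s > 0" using that a x by auto
      have "norm (K s * E \<tau> s) \<le> (M * ((s - x) powr (c - 1) * s powr q)) * s powr (1 - Re \<sigma>)"
        unfolding norm_mult norm_E[OF s(2)] using K_bound[OF s(1)] by (intro mult_right_mono) auto
      also have "\<dots> = M * ((s - x) powr (c - 1) * (s powr q * s powr (1 - Re \<sigma>)))" by (simp only: mult_ac)
      also have "s powr q * s powr (1 - Re \<sigma>) = s powr (1 - c) * s powr (- (Re \<sigma> - q - c))"
        by (simp add: algebra_simps flip: powr_add)
      also have "(s - x) powr (c - 1) * (s powr (1 - c) * s powr (- (Re \<sigma> - q - c))) = (s / (s - x)) powr (1 - c) * s powr (- (Re \<sigma> - q - c))"
        using s powr_minus[of "s - x" "1 - c"] by (simp add: powr_divide field_simps)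
      also have "M * ((s / (s - x)) powr (1 - c) * s powr (- (Re \<sigma> - q - c))) \<le> M * (((1 + x) * \<bar>\<tau>\<bar> powr (1 - \<eta>)) * x powr (- (Re \<sigma> - q - c)))"
      proof (intro mult_left_mono mult_mono M_nonneg)
        have "(s / (s - x)) powr (1 - c) \<le> ((1 + x) * \<bar>\<tau>\<bar>) powr (1 - c)"
          using ratio[OF that] c by (intro powr_mono2) auto
        also have "\<dots> = (1 + x) powr (1 - c) * \<bar>\<tau>\<bar> powr (1 - c)" using x by (simp add: powr_mult)
        also have "\<dots> \<le> (1 + x) powr 1 * \<bar>\<tau>\<bar> powr (1 - \<eta>)"
          using x c \<eta> \<open>\<bar>\<tau>\<bar> \<ge> 1\<close> by (intro mult_mono powr_mono) auto
        finally show "(s / (s - x)) powr (1 - c) \<le> (1 + x) * \<bar>\<tau>\<bar> powr (1 - \<eta>)" using x by simp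
        show "s powr (- (Re \<sigma> - q - c)) \<le> x powr (- (Re \<sigma> - q - c))" using s x q by (intro powr_mono2') auto
      qed (use x in auto)
      finally show ?thesis by (simp add: P_def mult_ac)
    qed
    have "norm (LINT s:{a..t}|lborel. K' s * E \<tau> s) \<le> M * I 0 + (M * x * \<bar>\<tau>\<bar> powr (1 - \<eta>)) * I \<eta>"
    proof -
      have i0: "integrable lborel (\<lambda>s. M * (indicator {x<..} s *\<^sub>R W 0 s))"
        and i1: "integrable lborel (\<lambda>s. (M * x * \<bar>\<tau>\<bar> powr (1 - \<eta>)) * (indicator {x<..} s *\<^sub>R W \<eta> s))"
        using W_set_integrable[of 0] W_set_integrable[of \<eta>] c \<eta> unfolding set_integrable_def by (auto intro!: integrable_mult_right)
      have sub: "{a..t} \<subseteq> {x<..}" using a by auto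
      have cE: "continuous_on {a..t} (E \<tau>)"
        using a x by (intro continuous_at_imp_continuous_on ballI has_vector_derivative_continuous[OF E_deriv]) auto
      have ci: "integrable lborel (\<lambda>s. indicator {a..t} s *\<^sub>R (K' s * E \<tau> s))"
        using borel_integrable_atLeastAtMost'[OF continuous_on_mult[OF continuous_on_subset[OF K'_cont sub] cE]]
        unfolding set_integrable_def .
      have pw: "norm (K' s * E \<tau> s) \<le> M * W 0 s + (M * x * \<bar>\<tau>\<bar> powr (1 - \<eta>)) * W \<eta> s" if "a \<le> s" for s
      proof -
        have s: "s > x" "s > 0" using that a x by auto
        have d2: "(s - x) powr (c - 2) = (s - x) powr (c - 1) / (s - x)"
        proof -
          have "(s - x) powr ((c - 1) - 1) = (s - x) powr (c - 1) / (s - x) powr 1" by (rule powr_diff)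
          moreover have "(c - 1) - 1 = c - 2" "(s - x) powr 1 = s - x" using s by simp_all
          ultimately show ?thesis by (simp only:)
        qed
        have W0: "(s - x) powr (c - 1) * s powr (- (Re \<sigma> - q)) = W 0 s" by (simp add: W_def)
        have "norm (K' s * E \<tau> s) \<le> (M * ((s - x) powr (c - 2) * s powr q)) * s powr (1 - Re \<sigma>)"
          unfolding norm_mult norm_E[OF s(2)] using K'_bound[OF s(1)] by (intro mult_right_mono) auto
        also have "\<dots> = M * ((s - x) powr (c - 2) * (s powr q * s powr (1 - Re \<sigma>)))" by (simp only: mult_ac)
        also note d2
        also have "s powr q * s powr (1 - Re \<sigma>) = s powr (- (Re \<sigma> - q)) * s"
          using s powr_add[of s "- (Re \<sigma> - q)" 1] by (simp add: algebra_simps flip: powr_add)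
        also have "(s - x) powr (c - 1) / (s - x) * (s powr (- (Re \<sigma> - q)) * s) = W 0 s * (1 + x * (1 / (s - x)))"
          unfolding W0[symmetric] using s by (simp add: field_simps)
        also have "\<dots> = W 0 s + x * (W 0 s * (1 / (s - x)))" by (simp add: algebra_simps)
        also have "W 0 s * (1 / (s - x)) = W \<eta> s * (1 / (s - x)) powr (1 - \<eta>)"
        proof -
          have "(s - x) powr (c - 1) / (s - x) = (s - x) powr (c - \<eta> - 1) / (s - x) powr (1 - \<eta>)"
          proof -
            have "(s - x) powr ((c - \<eta> - 1) - (1 - \<eta>)) = (s - x) powr (c - \<eta> - 1) / (s - x) powr (1 - \<eta>)" by (rule powr_diff)
            moreover have "(c - \<eta> - 1) - (1 - \<eta>) = c - 2" by simp
            ultimately show ?thesis using d2 by (simp only:)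
          qed
          moreover have "W 0 s * (1 / (s - x)) = ((s - x) powr (c - 1) / (s - x)) * s powr (- (Re \<sigma> - q))"
            by (simp add: W_def)
          ultimately have "W 0 s * (1 / (s - x)) = ((s - x) powr (c - \<eta> - 1) / (s - x) powr (1 - \<eta>)) * s powr (- (Re \<sigma> - q))"
            by (simp only:)
          then show ?thesis using s by (simp add: W_def powr_divide)
        qed
        also have "M * (W 0 s + x * (W \<eta> s * (1 / (s - x)) powr (1 - \<eta>))) \<le> M * (W 0 s + x * (W \<eta> s * \<bar>\<tau>\<bar> powr (1 - \<eta>)))"
          using ratio(2)[OF that] s x \<eta> c by (intro mult_left_mono add_left_mono powr_mono2 M_nonneg W_nonneg) auto
        finally show ?thesis by (simp add: algebra_simps)
      qed
      have "norm (LINT s:{a..t}|lborel. K' s * E \<tau> s) \<le>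
          (LINT s|lborel. M * (indicator {x<..} s *\<^sub>R W 0 s) + (M * x * \<bar>\<tau>\<bar> powr (1 - \<eta>)) * (indicator {x<..} s *\<^sub>R W \<eta> s))"
        unfolding set_lebesgue_integral_def
      proof (rule Bochner_Integration.integral_norm_bound_integral[OF ci Bochner_Integration.integrable_add[OF i0 i1]])
        fix s
        show "norm (indicator {a..t} s *\<^sub>R (K' s * E \<tau> s)) \<le> M * (indicator {x<..} s *\<^sub>R W 0 s) + (M * x * \<bar>\<tau>\<bar> powr (1 - \<eta>)) * (indicator {x<..} s *\<^sub>R W \<eta> s)"
          using pw[of s] a x M_nonneg W_nonneg by (auto simp: indicator_def)
      qed
      also have "\<dots> = M * I 0 + (M * x * \<bar>\<tau>\<bar> powr (1 - \<eta>)) * I \<eta>"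
        unfolding Bochner_Integration.integral_add[OF i0 i1] by (simp add: I_def set_lebesgue_integral_def)
      finally show ?thesis .
    qed
    also have "\<dots> \<le> M * (I 0 + x * I \<eta>) * \<bar>\<tau>\<bar> powr (1 - \<eta>)"
    proof -
      have "1 \<le> \<bar>\<tau>\<bar> powr (1 - \<eta>)" using that \<eta> c by (intro ge_one_powr_ge_zero) auto
      then have "M * I 0 * 1 \<le> M * I 0 * \<bar>\<tau>\<bar> powr (1 - \<eta>)" using M_nonneg I by (intro mult_left_mono) auto
      then show ?thesis by (simp add: algebra_simps)
    qed
    finally have i: "norm (LINT s:{a..t}|lborel. K' s * E \<tau> s) \<le> M * (I 0 + x * I \<eta>) * \<bar>\<tau>\<bar> powr (1 - \<eta>)" .
    have "norm ((e \<tau> + 1) * J {a..t} \<tau>) \<le> norm (K t * E \<tau> t) + norm (K a * E \<tau> a) + norm (LINT s:{a..t}|lborel. K' s * E \<tau> s)"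
      unfolding J_parts[OF a that(2)] by (intro order_trans[OF norm_triangle_ineq4] add_mono order_refl)
    also have "\<dots> \<le> M * P * \<bar>\<tau>\<bar> powr (1 - \<eta>) + M * P * \<bar>\<tau>\<bar> powr (1 - \<eta>) + M * (I 0 + x * I \<eta>) * \<bar>\<tau>\<bar> powr (1 - \<eta>)"
      using that by (intro add_mono bd i) auto
    also have "\<dots> = A3 * \<bar>\<tau>\<bar> powr (1 - \<eta>)" by (simp add: A3_def algebra_simps)
    finally show ?thesis .
  qed
  define C where "C = A1 + A2 + A3 + 1"
  have "norm ((e \<tau> + 1) * J {x<..<t} \<tau>) \<le> C * (1 + \<bar>\<tau>\<bar>) powr (1 - \<eta>)" if t: "x < t" for t \<tau>
  proof (cases "\<bar>\<tau>\<bar> \<le> 1")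
    case True
    have "1 \<le> (1 + \<bar>\<tau>\<bar>) powr (1 - \<eta>)" using \<eta> c by (intro ge_one_powr_ge_zero) auto
    then have "A1 * 1 \<le> C * (1 + \<bar>\<tau>\<bar>) powr (1 - \<eta>)" using A by (intro mult_mono) (auto simp: C_def)
    then show ?thesis using small[OF t True] by simp
  next
    case False
    then have \<tau>: "\<bar>\<tau>\<bar> \<ge> 1" by simp
    define a where "a = x + 1 / \<bar>\<tau>\<bar>"
    have a: "x < a" using \<tau> by (auto simp: a_def)
    have "norm ((e \<tau> + 1) * J {x<..<t} \<tau>) \<le> (A2 + A3) * \<bar>\<tau>\<bar> powr (1 - \<eta>)"
    proof (cases "t \<le> a")
      case True
      have "A2 * \<bar>\<tau>\<bar> powr (1 - \<eta>) \<le> (A2 + A3) * \<bar>\<tau>\<bar> powr (1 - \<eta>)" using A by (intro mult_right_mono) auto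
      then show ?thesis using near[OF t True[unfolded a_def] \<tau>] by linarith
    next
      case False
      then have at: "a \<le> t" by simp
      have "norm ((e \<tau> + 1) * J {x<..<t} \<tau>) \<le> norm ((e \<tau> + 1) * J {x<..<a} \<tau>) + norm ((e \<tau> + 1) * J {a..t} \<tau>)"
        unfolding J_split[OF a at] distrib_left by (rule norm_triangle_ineq)
      also have "\<dots> \<le> A2 * \<bar>\<tau>\<bar> powr (1 - \<eta>) + A3 * \<bar>\<tau>\<bar> powr (1 - \<eta>)"
        using a \<tau> at by (intro add_mono near far) (auto simp: a_def)
      finally show ?thesis by (simp add: algebra_simps)
    qed
    also have "\<dots> \<le> C * (1 + \<bar>\<tau>\<bar>) powr (1 - \<eta>)"
      using A \<eta> c by (intro mult_mono powr_mono2) (auto simp: C_def)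
    finally show ?thesis .
  qed
  moreover have "C > 0" using A by (simp add: C_def)
  ultimately show thesis using that by blast
qed

end


section \<open>Exchange of the moments with a contour integral\<close>

text \<open>
  The weight h is integrable, since w < -1, but its product with e + 1 need not be, since w \<ge> -2 is
  possible.
\<close>
locale oscillatory_superposition = oscillatory_kernel +
  fixes h :: "real \<Rightarrow> complex" and H w :: real
  assumes h_measurable [measurable]: "h \<in> borel_measurable borel"
    and h_bound: "\<And>\<tau>. norm (h \<tau>) \<le> H * (1 + \<bar>\<tau>\<bar>) powr w"
    and w: "w < c - 2"
begin

definition g :: "real \<Rightarrow> complex" where "g t = (LINT \<tau>|lborel. h \<tau> * E \<tau> t)"

text \<open>
  The integral over S of K against the formal derivative of g, with the two integrations exchanged.
\<close>
definition Phi :: "real set \<Rightarrow> complex" where "Phi S = (LINT \<tau>|lborel. h \<tau> * ((e \<tau> + 1) * J S \<tau>))"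

text \<open>
  The sets over which the moments are bounded uniformly: the integral starts at the singularity x.
\<close>
definition head_interval :: "real set \<Rightarrow> bool" where
  "head_interval S \<longleftrightarrow> S = {x<..} \<or> (\<exists>t\<ge>x. S = {x<..<t})"

lemma head_intervalD: "head_interval S \<Longrightarrow> S \<in> sets borel \<and> S \<subseteq> {x<..}"
  by (auto simp: head_interval_def)

lemma H_nonneg: "H \<ge> 0"
  using order_trans[OF norm_ge_zero h_bound[of 0]] by simp

text \<open>
  As w < c - 2 there is \<eta> with w + 2 < \<eta> < c, so the oscillation bound leaves an integrable power w + 1 - \<eta> < -1.
\<close>
lemma Phi_dominated:
  obtains B where "integrable lborel B"
    "\<And>S \<tau>. head_interval S \<Longrightarrow> norm (h \<tau> * ((e \<tau> + 1) * J S \<tau>)) \<le> B \<tau>"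
proof -
  obtain \<eta> where \<eta>: "max 0 (w + 2) < \<eta>" "\<eta> < c" using dense[of "max 0 (w + 2)" c] w c by auto
  then have \<eta>0: "0 < \<eta>" by simp
  obtain C where C: "C > 0" "\<And>t \<tau>. x < t \<Longrightarrow> norm ((e \<tau> + 1) * J {x<..<t} \<tau>) \<le> C * (1 + \<bar>\<tau>\<bar>) powr (1 - \<eta>)"
    using J_oscillation_bound[OF \<eta>0 \<eta>(2)] by blast
  have bound: "norm ((e \<tau> + 1) * J S \<tau>) \<le> C * (1 + \<bar>\<tau>\<bar>) powr (1 - \<eta>)" if S: "head_interval S" for S \<tau>
  proof -
    from S consider "S = {x<..}" | t where "t \<ge> x" "S = {x<..<t}"
      unfolding head_interval_def by blast
    then consider "S = {x<..}" | t where "t > x" "S = {x<..<t}" | "S = {}"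
    proof cases
      case (2 t)
      then show thesis using that(2)[of t] that(3) by (cases "t = x") auto
    qed (rule that(1))
    then show ?thesis
    proof cases
      case 1
      have "(\<lambda>n. J {x<..<x + 1 + real n} \<tau>) \<longlonglongrightarrow> J {x<..} \<tau>"
      proof (rule J_limit)
        show "AE t in lborel. (\<lambda>n. indicator {x<..<x + 1 + real n} t :: real) \<longlonglongrightarrow> indicator {x<..} t"
        proof (intro AE_I2 tendsto_eventually)
          fix t :: real
          obtain N :: nat where N: "t < real N" using reals_Archimedean2 by blast
          show "\<forall>\<^sub>F n in sequentially. indicator {x<..<x + 1 + real n} t = (indicator {x<..} t :: real)"
            using eventually_ge_at_top[of N] by eventually_elim (use N x in \<open>auto simp: indicator_def\<close>)
        qed
      qed auto
      then have "(\<lambda>n. norm ((e \<tau> + 1) * J {x<..<x + 1 + real n} \<tau>)) \<longlonglongrightarrow> norm ((e \<tau> + 1) * J {x<..} \<tau>)"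
        by (intro tendsto_intros)
      then show ?thesis unfolding 1
        by (rule tendsto_upperbound) (use C(2) in \<open>auto intro!: always_eventually\<close>)
    next
      case 2
      then show ?thesis using C(2) by simp
    next
      case 3
      then show ?thesis using C(1) by (simp add: J_def set_lebesgue_integral_def)
    qed
  qed
  show thesis
  proof (rule that)
    show "integrable lborel (\<lambda>\<tau>. (H * C) * (1 + \<bar>\<tau>\<bar>) powr (w + (1 - \<eta>)))"
      using \<eta> by (intro integrable_mult_right integrable_one_plus_abs_powr) auto
    fix S \<tau> assume S: "head_interval S"
    have "norm (h \<tau> * ((e \<tau> + 1) * J S \<tau>)) \<le> (H * (1 + \<bar>\<tau>\<bar>) powr w) * (C * (1 + \<bar>\<tau>\<bar>) powr (1 - \<eta>))"
      unfolding norm_mult[of "h \<tau>"] using h_bound bound[OF S] H_nonneg by (intro mult_mono) auto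
    also have "\<dots> = (H * C) * ((1 + \<bar>\<tau>\<bar>) powr w * (1 + \<bar>\<tau>\<bar>) powr (1 - \<eta>))" by (simp only: mult_ac)
    also have "(1 + \<bar>\<tau>\<bar>) powr w * (1 + \<bar>\<tau>\<bar>) powr (1 - \<eta>) = (1 + \<bar>\<tau>\<bar>) powr (w + (1 - \<eta>))" by (simp only: powr_add)
    finally show "norm (h \<tau> * ((e \<tau> + 1) * J S \<tau>)) \<le> (H * C) * (1 + \<bar>\<tau>\<bar>) powr (w + (1 - \<eta>))" .
  qed
qed

lemma Phi_integrand_measurable:
  assumes "head_interval S"
  shows "(\<lambda>\<tau>. h \<tau> * ((e \<tau> + 1) * J S \<tau>)) \<in> borel_measurable lborel"
proof -
  note [measurable] = J_measurable[OF conjunct1[OF head_intervalD[OF assms]] conjunct2[OF head_intervalD[OF assms]]]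
  show ?thesis unfolding e_def by measurable
qed

lemma Phi_integrand_integrable:
  assumes "head_interval S"
  shows "integrable lborel (\<lambda>\<tau>. h \<tau> * ((e \<tau> + 1) * J S \<tau>))"
proof -
  obtain B where B: "integrable lborel B" "\<And>S \<tau>. head_interval S \<Longrightarrow> norm (h \<tau> * ((e \<tau> + 1) * J S \<tau>)) \<le> B \<tau>"
    using Phi_dominated by blast
  show ?thesis
    by (rule Bochner_Integration.integrable_bound[OF B(1) Phi_integrand_measurable[OF assms]])
       (use B(2)[OF assms] in \<open>auto intro!: AE_I2 order_trans[OF _ abs_ge_self]\<close>)
qed

lemma Phi_limit:
  assumes S: "\<And>n. head_interval (S n)" "head_interval S'"
    and lim: "AE t in lborel. (\<lambda>n. indicator (S n) t :: real) \<longlonglongrightarrow> indicator S' t"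
  shows "(\<lambda>n. Phi (S n)) \<longlonglongrightarrow> Phi S'"
proof -
  obtain B where B: "integrable lborel B" "\<And>S \<tau>. head_interval S \<Longrightarrow> norm (h \<tau> * ((e \<tau> + 1) * J S \<tau>)) \<le> B \<tau>"
    using Phi_dominated by blast
  show ?thesis unfolding Phi_def
  proof (rule integral_dominated_convergence[OF _ _ B(1)])
    show "AE \<tau> in lborel. (\<lambda>n. h \<tau> * ((e \<tau> + 1) * J (S n) \<tau>)) \<longlonglongrightarrow> h \<tau> * ((e \<tau> + 1) * J S' \<tau>)"
    proof (intro AE_I2 tendsto_mult tendsto_const)
      show "(\<lambda>n. J (S n) \<tau>) \<longlonglongrightarrow> J S' \<tau>" for \<tau>
        by (rule J_limit[OF _ _ _ _ lim]) (use S head_intervalD in auto)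
    qed
  qed (use S B(2) Phi_integrand_measurable in auto)
qed

lemma Phi_continuous: "continuous_on {x..T} (\<lambda>t. Phi {x<..<t})"
proof (rule continuous_on_sequentiallyI)
  fix u a assume u: "\<forall>n. u n \<in> {x..T}" and a: "a \<in> {x..T}" and lim: "u \<longlonglongrightarrow> a"
  show "(\<lambda>n. Phi {x<..<u n}) \<longlonglongrightarrow> Phi {x<..<a}"
  proof (rule Phi_limit)
    have "AE t in lborel. t \<noteq> a" by (rule AE_lborel_singleton)
    then show "AE t in lborel. (\<lambda>n. indicator {x<..<u n} t :: real) \<longlonglongrightarrow> indicator {x<..<a} t"
    proof eventually_elim
      case (elim t)
      show ?case
      proof (rule tendsto_eventually)
        show "\<forall>\<^sub>F n in sequentially. indicator {x<..<u n} t = (indicator {x<..<a} t :: real)"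
        proof (cases "t < a")
          case True
          from order_tendstoD(1)[OF lim True] show ?thesis by eventually_elim (use True in \<open>auto simp: indicator_def\<close>)
        next
          case False
          then have "a < t" using elim by simp
          from order_tendstoD(2)[OF lim this] show ?thesis by eventually_elim (use False in \<open>auto simp: indicator_def\<close>)
        qed
      qed
    qed
  qed (use u a in \<open>auto simp: head_interval_def\<close>)
qed

lemma Phi_at_top: "((\<lambda>t. Phi {x<..<t}) \<longlongrightarrow> Phi {x<..}) at_top"
proof (rule tendsto_at_topI_sequentially)
  fix X :: "nat \<Rightarrow> real" assume X: "filterlim X at_top sequentially"
  have "(\<lambda>n. Phi {x<..<max x (X n)}) \<longlonglongrightarrow> Phi {x<..}"
  proof (rule Phi_limit)
    show "AE t in lborel. (\<lambda>n. indicator {x<..<max x (X n)} t :: real) \<longlonglongrightarrow> indicator {x<..} t"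
    proof (intro AE_I2 tendsto_eventually)
      fix t :: real
      have "\<forall>\<^sub>F n in sequentially. X n > t" using X by (simp add: filterlim_at_top_dense)
      then show "\<forall>\<^sub>F n in sequentially. indicator {x<..<max x (X n)} t = (indicator {x<..} t :: real)"
        by eventually_elim (auto simp: indicator_def)
    qed
  qed (auto simp: head_interval_def intro!: exI[of _ "max x _"])
  moreover have "\<forall>\<^sub>F n in sequentially. X n > x" using X by (simp add: filterlim_at_top_dense)
  then have "\<forall>\<^sub>F n in sequentially. Phi {x<..<max x (X n)} = Phi {x<..<X n}" by eventually_elim (simp add: max_def)
  ultimately show "(\<lambda>n. Phi {x<..<X n}) \<longlonglongrightarrow> Phi {x<..}" by (rule Lim_transform_eventually)
qed

lemma h_integrable: "integrable lborel h"
proof (rule Bochner_Integration.integrable_bound)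
  show "integrable lborel (\<lambda>\<tau>. H * (1 + \<bar>\<tau>\<bar>) powr w)"
    using w c by (intro integrable_mult_right integrable_one_plus_abs_powr) auto
  show "AE \<tau> in lborel. norm (h \<tau>) \<le> norm (H * (1 + \<bar>\<tau>\<bar>) powr w)"
    using h_bound by (auto simp: H_nonneg abs_mult)
qed simp

lemma E_measurable: "E \<tau> \<in> borel_measurable borel" "(\<lambda>\<tau>. E \<tau> t) \<in> borel_measurable borel"
  unfolding E_def[abs_def] e_def by measurable

lemma hE_integrable:
  assumes t: "t > 0"
  shows "integrable lborel (\<lambda>\<tau>. h \<tau> * E \<tau> t)"
proof (rule Bochner_Integration.integrable_bound)
  show "integrable lborel (\<lambda>\<tau>. t powr (1 - Re \<sigma>) *\<^sub>R h \<tau>)" using h_integrable by (rule integrable_scaleR_right)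
  note [measurable] = E_measurable
  show "(\<lambda>\<tau>. h \<tau> * E \<tau> t) \<in> borel_measurable lborel" by simp
  show "AE \<tau> in lborel. norm (h \<tau> * E \<tau> t) \<le> norm (t powr (1 - Re \<sigma>) *\<^sub>R h \<tau>)"
    by (intro AE_I2) (simp add: norm_mult norm_E[OF t])
qed

lemma Phi_parts_Fubini:
  assumes a: "x < a" "a \<le> t"
  shows "integrable lborel (\<lambda>\<tau>. h \<tau> * (LINT s:{a..t}|lborel. K' s * E \<tau> s))"
    and "(LINT \<tau>|lborel. h \<tau> * (LINT s:{a..t}|lborel. K' s * E \<tau> s)) = (LINT s:{a..t}|lborel. K' s * g s)"
proof -
  define f where "f = (\<lambda>\<tau> s. h \<tau> * (indicator {a..t} s *\<^sub>R (K' s * E \<tau> s)))"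
  have sub: "{a..t} \<subseteq> {x<..}" using a by auto
  have pos: "s > 0" if "s \<in> {a..t}" for s using that a x by auto
  have meas: "case_prod f \<in> borel_measurable (lborel \<Otimes>\<^sub>M lborel)"
  proof -
    have "(\<lambda>(\<tau>, s). h \<tau> * (indicator {a..t} s *\<^sub>R ((indicator {x<..} s *\<^sub>R K' s) * E \<tau> s))) \<in> borel_measurable (lborel \<Otimes>\<^sub>M lborel)"
      unfolding E_def e_def by measurable
    moreover have "h \<tau> * (indicator {a..t} s *\<^sub>R ((indicator {x<..} s *\<^sub>R K' s) * E \<tau> s)) = f \<tau> s" for \<tau> s
      using sub by (auto simp: f_def indicator_def)
    ultimately show ?thesis by simp
  qed
  have cE: "continuous_on {a..t} (E \<tau>)" for \<tau>
    using a x by (intro continuous_at_imp_continuous_on ballI has_vector_derivative_continuous[OF E_deriv]) auto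
  have ci: "integrable lborel (\<lambda>s. indicator {a..t} s *\<^sub>R (K' s * E \<tau> s))" for \<tau>
    using borel_integrable_atLeastAtMost'[OF continuous_on_mult[OF continuous_on_subset[OF K'_cont sub] cE]]
    unfolding set_integrable_def .
  have int: "integrable (lborel \<Otimes>\<^sub>M lborel) (case_prod f)"
  proof (rule lborel_pair.Fubini_integrable[OF meas])
    define m where "m = (\<lambda>s. indicator {a..t} s *\<^sub>R (norm (K' s) * s powr (1 - Re \<sigma>)))"
    have "norm (f \<tau> s) = norm (h \<tau>) * m s" for \<tau> s
      using pos by (auto simp: f_def m_def norm_mult norm_E indicator_def)
    then have "(\<lambda>\<tau>. LINT s|lborel. norm (case_prod f (\<tau>, s))) = (\<lambda>\<tau>. norm (h \<tau>) * (LINT s|lborel. m s))" by simp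
    then show "integrable lborel (\<lambda>\<tau>. LINT s|lborel. norm (case_prod f (\<tau>, s)))"
      using h_integrable by simp
    show "AE \<tau> in lborel. integrable lborel (\<lambda>s. case_prod f (\<tau>, s))"
      unfolding f_def case_prod_conv by (intro AE_I2 integrable_mult_right ci)
  qed
  have row: "(LINT s|lborel. f \<tau> s) = h \<tau> * (LINT s:{a..t}|lborel. K' s * E \<tau> s)" for \<tau>
    unfolding f_def set_lebesgue_integral_def by (rule integral_mult_right_zero)
  have col: "(LINT \<tau>|lborel. f \<tau> s) = indicator {a..t} s *\<^sub>R (K' s * g s)" for s
  proof -
    have "f \<tau> s = (indicator {a..t} s *\<^sub>R K' s) * (h \<tau> * E \<tau> s)" for \<tau> by (simp add: f_def mult_ac)
    then show ?thesis by (simp add: g_def)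
  qed
  show "integrable lborel (\<lambda>\<tau>. h \<tau> * (LINT s:{a..t}|lborel. K' s * E \<tau> s))"
    using lborel_pair.integrable_fst[OF int] by (simp add: row)
  show "(LINT \<tau>|lborel. h \<tau> * (LINT s:{a..t}|lborel. K' s * E \<tau> s)) = (LINT s:{a..t}|lborel. K' s * g s)"
    using lborel_pair.Fubini_integral[OF int] by (simp add: row col set_lebesgue_integral_def)
qed

text \<open>
  Away from the singularity the integration by parts in t commutes with the superposition, because only g and no
  derivative of it is involved.
\<close>
lemma Phi_by_parts:
  assumes a: "x < a" "a \<le> t"
  shows "Phi {x<..<t} = Phi {x<..<a} + (K t * g t - K a * g a - (LINT s:{a..t}|lborel. K' s * g s))"
proof -
  have pos: "a > 0" "t > 0" using a x by auto
  have hi: "head_interval {x<..<t}" "head_interval {x<..<a}" using a by (auto simp: head_interval_def intro: exI[of _ t] exI[of _ a])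
  have split: "(e \<tau> + 1) * J {x<..<t} \<tau> = (e \<tau> + 1) * J {x<..<a} \<tau> + (K t * E \<tau> t - K a * E \<tau> a - (LINT s:{a..t}|lborel. K' s * E \<tau> s))" for \<tau>
    using J_split[OF a] J_parts[OF a] by (simp add: distrib_left)
  have i1: "integrable lborel (\<lambda>\<tau>. K t * (h \<tau> * E \<tau> t))" "integrable lborel (\<lambda>\<tau>. K a * (h \<tau> * E \<tau> a))"
    using hE_integrable pos by auto
  have "Phi {x<..<t} = (LINT \<tau>|lborel. h \<tau> * ((e \<tau> + 1) * J {x<..<a} \<tau>) +
      (K t * (h \<tau> * E \<tau> t) - K a * (h \<tau> * E \<tau> a) - h \<tau> * (LINT s:{a..t}|lborel. K' s * E \<tau> s)))"
    unfolding Phi_def split by (intro Bochner_Integration.integral_cong refl) (simp add: algebra_simps)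
  also have "\<dots> = Phi {x<..<a} + (K t * g t - K a * g a - (LINT s:{a..t}|lborel. K' s * g s))"
    using i1 Phi_parts_Fubini[OF a] Phi_integrand_integrable[OF hi(2)] by (simp add: Phi_def g_def)
  finally show ?thesis .
qed

text \<open>
  The function t \<mapsto> Phi {x<..<t} is an antiderivative of K g' on (x, \<infinity>), continuous at x with limit Phi {x<..} at
  infinity. The derivative g' is only assumed to exist, so K g' need not be absolutely integrable, and the
  Henstock--Kurzweil integral is the right notion.
\<close>
theorem has_integral_superposition:
  assumes g': "\<And>t. t > x \<Longrightarrow> (g has_vector_derivative g' t) (at t)"
  shows "((\<lambda>t. K t * g' t) has_integral Phi {x<..}) {x<..}"
proof -
  have deriv: "((\<lambda>t. Phi {x<..<t}) has_vector_derivative K t * g' t) (at t)" if t: "t > x" for t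
  proof -
    define a where "a = (x + t) / 2"
    have a: "x < a" "a < t" using t by (auto simp: a_def)
    have gc: "continuous_on {a..t + 1} g"
      using a by (intro continuous_at_imp_continuous_on ballI has_vector_derivative_continuous[OF g']) auto
    have c: "continuous_on {a..t + 1} (\<lambda>s. K' s * g s)"
      using a by (intro continuous_on_mult gc continuous_on_subset[OF K'_cont]) auto
    have "((\<lambda>u. integral {a..u} (\<lambda>s. K' s * g s)) has_vector_derivative K' t * g t) (at t within {a..t + 1})"
      using a by (intro integral_has_vector_derivative c) auto
    then have I: "((\<lambda>u. integral {a..u} (\<lambda>s. K' s * g s)) has_vector_derivative K' t * g t) (at t)"
      using a by (simp add: at_within_Icc_at)
    have "((\<lambda>u. Phi {x<..<a} + (K u * g u - K a * g a - integral {a..u} (\<lambda>s. K' s * g s))) has_vector_derivative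
        0 + ((K t * g' t + K' t * g t) - 0 - K' t * g t)) (at t)"
      by (intro has_vector_derivative_add has_vector_derivative_diff has_vector_derivative_const
          has_vector_derivative_mult K_deriv[OF t] g'[OF t] I)
    then have "((\<lambda>u. Phi {x<..<a} + (K u * g u - K a * g a - integral {a..u} (\<lambda>s. K' s * g s))) has_vector_derivative K t * g' t) (at t)"
      by simp
    then show ?thesis
    proof (rule has_vector_derivative_transform_within_open[where S = "{a<..<t + 1}"])
      fix u assume u: "u \<in> {a<..<t + 1}"
      have "(LINT s:{a..u}|lborel. K' s * g s) = integral {a..u} (\<lambda>s. K' s * g s)"
        using u by (intro set_borel_integral_eq_integral borel_integrable_atLeastAtMost' continuous_on_subset[OF c]) auto
      then show "Phi {x<..<a} + (K u * g u - K a * g a - integral {a..u} (\<lambda>s. K' s * g s)) = Phi {x<..<u}"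
        using Phi_by_parts[of a u] a u by simp
    qed (use a in auto)
  qed
  have fin: "((\<lambda>t. if t \<in> {x<..} then K t * g' t else 0) has_integral Phi {x<..<T}) {x..T}" if "x \<le> T" for T
  proof -
    have "((\<lambda>t. if t \<in> {x<..} then K t * g' t else 0) has_integral (Phi {x<..<T} - Phi {x<..<x})) {x..T}"
      by (rule fundamental_theorem_of_calculus_interior[OF that Phi_continuous]) (use deriv in auto)
    then show ?thesis by (simp add: Phi_def J_def set_lebesgue_integral_def)
  qed
  show ?thesis
    unfolding has_integral'[of _ _ "{x<..}"]
  proof (intro allI impI)
    fix \<epsilon> :: real assume \<epsilon>: "\<epsilon> > 0"
    have "\<forall>\<^sub>F T in at_top. dist (Phi {x<..<T}) (Phi {x<..}) < \<epsilon>"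
      using Phi_at_top \<epsilon> by (rule tendstoD)
    then obtain T0 where T0: "\<And>T. T \<ge> T0 \<Longrightarrow> dist (Phi {x<..<T}) (Phi {x<..}) < \<epsilon>"
      by (auto simp: eventually_at_top_linorder)
    define B where "B = \<bar>T0\<bar> + x + 1"
    show "\<exists>B>0. \<forall>a b. ball 0 B \<subseteq> cbox a b \<longrightarrow>
        (\<exists>z. ((\<lambda>t. if t \<in> {x<..} then K t * g' t else 0) has_integral z) (cbox a b) \<and> norm (z - Phi {x<..}) < \<epsilon>)"
    proof (intro exI[of _ B] conjI allI impI)
      show "B > 0" using x by (simp add: B_def)
      fix a b :: real assume ab: "ball 0 B \<subseteq> cbox a b"
      have "B > 0" using x by (simp add: B_def)
      have mem: "y \<in> {a..b}" if "\<bar>y\<bar> < B" for y using ab that by (auto simp: subset_iff)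
      have b: "b \<ge> T0" "b > x"
        using mem[of "\<bar>T0\<bar> + x + 1/2"] x by (auto simp: B_def)
      have a: "a \<le> x" using mem[of x] x by (auto simp: B_def)
      have "((\<lambda>t. if t \<in> {x<..} then K t * g' t else 0) has_integral 0) {a..x}"
        by (rule has_integral_is_0) auto
      from has_integral_combine[OF a _ this fin[of b]] b
      have "((\<lambda>t. if t \<in> {x<..} then K t * g' t else 0) has_integral Phi {x<..<b}) {a..b}" by simp
      then show "\<exists>z. ((\<lambda>t. if t \<in> {x<..} then K t * g' t else 0) has_integral z) (cbox a b) \<and> norm (z - Phi {x<..}) < \<epsilon>"
        using T0[OF b(1)] by (intro exI[of _ "Phi {x<..<b}"]) (simp add: dist_norm)
    qed
  qed
qed

end


section \<open>The kernel of the fractional integral\<close>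

text \<open>
  The kernel of the fractional integral without its factor x^A', after Pfaff's transformation; the power of t
  from this transformation joins the factor t^(-A).
\<close>
definition MSM_kernel :: "real \<Rightarrow> complex \<Rightarrow> complex \<Rightarrow> complex \<Rightarrow> complex \<Rightarrow> complex \<Rightarrow> real \<Rightarrow> complex" where
  "MSM_kernel x A A' B B' C t =
     of_real (t - x) powr (C - 1) * of_real t powr (- (A + A')) * F3_Pfaff A A' B B' C (of_real (1 - x / t))"

definition MSM_kernel_deriv :: "real \<Rightarrow> complex \<Rightarrow> complex \<Rightarrow> complex \<Rightarrow> complex \<Rightarrow> complex \<Rightarrow> real \<Rightarrow> complex" where
  "MSM_kernel_deriv x A A' B B' C t =
     (C - 1) * of_real (t - x) powr (C - 2) * of_real t powr (- (A + A')) * F3_Pfaff A A' B B' C (of_real (1 - x / t)) +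
     of_real (t - x) powr (C - 1) *
       (- (A + A') * of_real t powr (- (A + A') - 1) * F3_Pfaff A A' B B' C (of_real (1 - x / t)) +
        of_real t powr (- (A + A')) * (F3_Pfaff_deriv A A' B B' C (of_real (1 - x / t)) * of_real (x / t\<^sup>2)))"

lemma of_real_powr_has_vector_derivative:
  fixes p :: complex
  assumes "t > a"
  shows "((\<lambda>t. of_real (t - a) powr p) has_vector_derivative p * of_real (t - a) powr (p - 1)) (at t)"
proof -
  have "((\<lambda>z. (z - of_real a) powr p) has_field_derivative (p * (of_real t - of_real a) powr (p - 1))) (at (complex_of_real t))"
    using assms by (auto intro!: derivative_eq_intros simp flip: of_real_diff)
  from has_vector_derivative_real_field[OF this] show ?thesis by simp
qed

lemma F3_argument:
  fixes x t :: real
  assumes "0 < x" "x < t"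
  shows "0 \<le> 1 - x / t" "1 - x / t < 1" "norm (complex_of_real (1 - x / t)) < 1"
  using assms by (auto simp: norm_of_real simp del: of_real_diff of_real_divide)

lemma MSM_kernel_has_derivative:
  assumes x: "x > 0" and C: "Re C > 0" and t: "t > x"
  shows "(MSM_kernel x A A' B B' C has_vector_derivative MSM_kernel_deriv x A A' B B' C t) (at t)"
proof -
  have 1: "((\<lambda>t. of_real (t - x) powr (C - 1)) has_vector_derivative (C - 1) * of_real (t - x) powr (C - 1 - 1)) (at t)"
    by (rule of_real_powr_has_vector_derivative[OF t])
  have 2: "((\<lambda>t. of_real t powr (- (A + A'))) has_vector_derivative - (A + A') * of_real t powr (- (A + A') - 1)) (at t)"
    using of_real_powr_has_vector_derivative[of 0 t "- (A + A')"] x t by simp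
  have "((\<lambda>t. 1 - x / t) has_real_derivative x / t\<^sup>2) (at t)"
    using x t
    by (auto intro!: derivative_eq_intros simp: power2_eq_square)
  then have "((\<lambda>t. complex_of_real (1 - x / t)) has_vector_derivative of_real (x / t\<^sup>2)) (at t)"
    by (rule has_vector_derivative_of_real)
  from field_vector_diff_chain_at[OF this F3_Pfaff_has_derivative[OF C F3_argument(3)[OF x t], of A A' B B']]
  have 3: "((\<lambda>t. F3_Pfaff A A' B B' C (of_real (1 - x / t))) has_vector_derivative
      of_real (x / t\<^sup>2) * F3_Pfaff_deriv A A' B B' C (of_real (1 - x / t))) (at t)"
    by (simp add: o_def)
  have "((\<lambda>t. of_real (t - x) powr (C - 1) * (of_real t powr (- (A + A')) * F3_Pfaff A A' B B' C (of_real (1 - x / t)))) has_vector_derivative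
      of_real (t - x) powr (C - 1) * (of_real t powr (- (A + A')) * (of_real (x / t\<^sup>2) * F3_Pfaff_deriv A A' B B' C (of_real (1 - x / t)))
        + (- (A + A') * of_real t powr (- (A + A') - 1)) * F3_Pfaff A A' B B' C (of_real (1 - x / t)))
      + ((C - 1) * of_real (t - x) powr (C - 1 - 1)) * (of_real t powr (- (A + A')) * F3_Pfaff A A' B B' C (of_real (1 - x / t)))) (at t)"
    by (intro has_vector_derivative_mult 1 2 3)
  then show ?thesis
    unfolding MSM_kernel_def[abs_def] MSM_kernel_deriv_def by (simp only: mult.assoc) (simp add: algebra_simps)
qed

lemma F3_Pfaff_deriv_continuous:
  assumes "Re C > 0"
  shows "continuous_on (ball 0 1) (F3_Pfaff_deriv A A' B B' C)"
proof -
  have hol: "F3_Pfaff A A' B B' C holomorphic_on ball 0 1"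
    unfolding holomorphic_on_open[OF open_ball]
  proof (intro ballI exI)
    fix w :: complex assume "w \<in> ball 0 1"
    then show "(F3_Pfaff A A' B B' C has_field_derivative F3_Pfaff_deriv A A' B B' C w) (at w)"
      by (intro F3_Pfaff_has_derivative[OF assms]) simp
  qed
  have "continuous_on (ball 0 1) (deriv (F3_Pfaff A A' B B' C))"
    by (intro holomorphic_on_imp_continuous_on holomorphic_deriv hol) auto
  moreover have eq: "deriv (F3_Pfaff A A' B B' C) w = F3_Pfaff_deriv A A' B B' C w" if "w \<in> ball 0 1" for w
    using that by (intro DERIV_imp_deriv F3_Pfaff_has_derivative[OF assms]) simp
  ultimately show ?thesis by (subst continuous_on_cong[OF refl eq, symmetric]) simp_all
qed

lemma MSM_kernel_deriv_continuous:
  assumes x: "x > 0" and C: "Re C > 0"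
  shows "continuous_on {x<..} (MSM_kernel_deriv x A A' B B' C)"
proof -
  have arg: "continuous_on {x<..} (\<lambda>t. complex_of_real (1 - x / t))" using x by (intro continuous_intros) auto
  have sub: "(\<lambda>t. complex_of_real (1 - x / t)) ` {x<..} \<subseteq> ball 0 1"
    using F3_argument(3)[OF x] by (auto simp del: of_real_diff of_real_divide)
  have P: "continuous_on {x<..} (\<lambda>t. F3_Pfaff A A' B B' C (of_real (1 - x / t)))"
    "continuous_on {x<..} (\<lambda>t. F3_Pfaff_deriv A A' B B' C (of_real (1 - x / t)))"
    by (rule continuous_on_compose2[OF F3_Pfaff_continuous[OF C] arg sub]
        continuous_on_compose2[OF F3_Pfaff_deriv_continuous[OF C] arg sub])+
  have pw: "continuous_on {x<..} (\<lambda>t. complex_of_real (t - x) powr p)" "continuous_on {x<..} (\<lambda>t. complex_of_real t powr p)" for p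
    using x by (auto intro!: continuous_intros simp: complex_nonpos_Reals_iff)
  show ?thesis unfolding MSM_kernel_deriv_def
    using x by (intro continuous_on_add continuous_on_mult continuous_on_const P pw continuous_on_of_real continuous_on_divide continuous_on_power continuous_on_id) auto
qed

text \<open>
  The variable 1 - w of the bounds for F3_Pfaff is x / t, so growth of order s at w = 1 is growth t^s at infinity. Since
  (t - x) / t < 1, the terms of the derivative with a factor 1 / t are bounded by the one with 1 / (t - x).
\<close>
lemma MSM_kernel_bounds:
  assumes x: "x > 0" and C: "Re C > 0" and s: "F3_growth A A' B B' C s"
  obtains M where
    "\<And>t. t > x \<Longrightarrow> norm (MSM_kernel x A A' B B' C t) \<le> M * ((t - x) powr (Re C - 1) * t powr (s - Re (A + A')))"
    "\<And>t. t > x \<Longrightarrow> norm (MSM_kernel_deriv x A A' B B' C t) \<le> M * ((t - x) powr (Re C - 2) * t powr (s - Re (A + A')))"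
proof -
  define a where "a = Re (A + A')"
  define c where "c = Re C"
  obtain M0 where M0: "M0 > 0"
    "\<And>w. 0 \<le> w \<Longrightarrow> w < 1 \<Longrightarrow> norm (F3_Pfaff A A' B B' C (of_real w)) \<le> M0 * (1 - w) powr (- s)"
    "\<And>w. 0 \<le> w \<Longrightarrow> w < 1 \<Longrightarrow> norm (F3_Pfaff_deriv A A' B B' C (of_real w)) \<le> M0 * (1 - w) powr (- (s + 1))"
    by (rule F3_Pfaff_bound[OF C s]) blast
  define N where "N = M0 * x powr (- s)"
  have N: "N > 0" using M0 x by (simp add: N_def)
  define M where "M = (norm (C - 1) + norm (A + A') + 2) * N"
  have M: "N \<le> M" using N by (simp add: M_def mult_le_cancel_right1 add_nonneg_nonneg add.assoc)
  have P: "norm (F3_Pfaff A A' B B' C (of_real (1 - x / t))) \<le> N * t powr s" if t: "t > x" for t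
  proof -
    have "norm (F3_Pfaff A A' B B' C (of_real (1 - x / t))) \<le> M0 * (1 - (1 - x / t)) powr (- s)"
      using F3_argument[OF x t] by (intro M0)
    also have "(1 - (1 - x / t)) powr (- s) = x powr (- s) * t powr s"
      using x t by (simp add: powr_divide powr_minus field_simps)
    finally show ?thesis by (simp add: N_def mult.assoc)
  qed
  have P': "norm (F3_Pfaff_deriv A A' B B' C (of_real (1 - x / t)) * of_real (x / t\<^sup>2)) \<le> N * t powr (s - 1)" if t: "t > x" for t
  proof -
    have t0: "t > 0" using x t by simp
    have "norm (F3_Pfaff_deriv A A' B B' C (of_real (1 - x / t))) \<le> M0 * (1 - (1 - x / t)) powr (- (s + 1))"
      using F3_argument[OF x t] by (intro M0)
    also have "(1 - (1 - x / t)) powr (- (s + 1)) = (x powr (- s) / x) * (t powr s * t)"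
    proof -
      have "(x / t) powr (- (s + 1)) = x powr (- s - 1) / t powr (- s - 1)" using x t0 by (simp add: powr_divide)
      also have "\<dots> = (x powr (- s) / x powr 1) / (1 / (t powr s * t powr 1))"
        by (simp only: powr_diff powr_minus) (simp add: field_simps)
      finally show ?thesis using x t0 by simp
    qed
    finally have "norm (F3_Pfaff_deriv A A' B B' C (of_real (1 - x / t)) * of_real (x / t\<^sup>2)) \<le> M0 * ((x powr (- s) / x) * (t powr s * t)) * (x / t\<^sup>2)"
      unfolding norm_mult using x t0 M0(1) by (intro mult_mono) (auto simp del: of_real_divide of_real_power)
    also have "\<dots> = N * (t powr s / t)" using x t0 by (simp add: N_def power2_eq_square)
    also have "t powr s / t = t powr (s - 1)" using t0 by (simp add: powr_diff)
    finally show ?thesis .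
  qed
  have pn: "norm (complex_of_real (t - x) powr p) = (t - x) powr Re p" "norm (complex_of_real t powr p) = t powr Re p" if "t > x" for t p
    using that x by (simp_all add: norm_powr_real_powr del: of_real_diff)
  show thesis
  proof (rule that)
    fix t assume t: "t > x"
    then have t0: "t > 0" using x by simp
    have "norm (MSM_kernel x A A' B B' C t) \<le> (t - x) powr (c - 1) * t powr (- a) * (N * t powr s)"
      unfolding MSM_kernel_def norm_mult pn[OF t] using P[OF t] by (intro mult_mono) (auto simp: a_def c_def)
    also have "\<dots> = N * ((t - x) powr (c - 1) * t powr (s - a))"
      by (simp add: mult_ac) (simp flip: powr_add)
    also have "\<dots> \<le> M * ((t - x) powr (c - 1) * t powr (s - a))" using M by (intro mult_right_mono) auto
    finally show "norm (MSM_kernel x A A' B B' C t) \<le> M * ((t - x) powr (Re C - 1) * t powr (s - Re (A + A')))"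
      by (simp add: a_def c_def)
    have tx: "(t - x) powr (c - 1) * t powr (s - a - 1) \<le> (t - x) powr (c - 2) * t powr (s - a)"
    proof -
      have "(t - x) powr (c - 1) = (t - x) powr (c - 2) * (t - x)"
        using t powr_add[of "t - x" "c - 2" 1] by simp
      moreover have "t powr (s - a - 1) = t powr (s - a) / t" using t0 powr_diff[of t "s - a" 1] by simp
      ultimately have "(t - x) powr (c - 1) * t powr (s - a - 1) = ((t - x) powr (c - 2) * t powr (s - a)) * ((t - x) / t)" by simp
      also have "\<dots> \<le> ((t - x) powr (c - 2) * t powr (s - a)) * 1"
        using x t0 t by (intro mult_left_mono) (auto simp: field_simps)
      finally show ?thesis by simp
    qed
    have r: "Re (- (A + A')) = - a" "Re (- (A + A') - 1) = - a - 1" "Re (C - 1) = c - 1" "Re (C - 2) = c - 2"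
      by (simp_all add: a_def c_def)
    have e: "t powr (- a) * t powr s = t powr (s - a)" "t powr (- a - 1) * t powr s = t powr (s - a - 1)"
      "t powr (- a) * t powr (s - 1) = t powr (s - a - 1)"
      by (simp_all flip: powr_add add: algebra_simps)
    have T1: "norm ((C - 1) * of_real (t - x) powr (C - 2) * of_real t powr (- (A + A')) * F3_Pfaff A A' B B' C (of_real (1 - x / t)))
        \<le> norm (C - 1) * N * ((t - x) powr (c - 2) * t powr (s - a))"
    proof -
      have "norm ((C - 1) * of_real (t - x) powr (C - 2) * of_real t powr (- (A + A')) * F3_Pfaff A A' B B' C (of_real (1 - x / t)))
        \<le> norm (C - 1) * (t - x) powr (c - 2) * t powr (- a) * (N * t powr s)"
        unfolding norm_mult pn[OF t] r using P[OF t] by (intro mult_left_mono) auto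
      also have "\<dots> = norm (C - 1) * N * ((t - x) powr (c - 2) * (t powr (- a) * t powr s))" by (simp only: mult_ac)
      finally show ?thesis unfolding e .
    qed
    have T2: "norm (of_real (t - x) powr (C - 1) * (- (A + A') * of_real t powr (- (A + A') - 1) * F3_Pfaff A A' B B' C (of_real (1 - x / t))))
        \<le> norm (A + A') * N * ((t - x) powr (c - 2) * t powr (s - a))"
    proof -
      have "norm (of_real (t - x) powr (C - 1) * (- (A + A') * of_real t powr (- (A + A') - 1) * F3_Pfaff A A' B B' C (of_real (1 - x / t))))
        \<le> (t - x) powr (c - 1) * (norm (A + A') * t powr (- a - 1) * (N * t powr s))"
        unfolding norm_mult pn[OF t] r norm_minus_cancel using P[OF t] by (intro mult_left_mono) auto
      also have "\<dots> = norm (A + A') * N * ((t - x) powr (c - 1) * (t powr (- a - 1) * t powr s))" by (simp only: mult_ac)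
      also have "\<dots> \<le> norm (A + A') * N * ((t - x) powr (c - 2) * t powr (s - a))"
        unfolding e using tx N by (intro mult_left_mono) auto
      finally show ?thesis .
    qed
    have T3: "norm (of_real (t - x) powr (C - 1) * (of_real t powr (- (A + A')) * (F3_Pfaff_deriv A A' B B' C (of_real (1 - x / t)) * of_real (x / t\<^sup>2))))
        \<le> N * ((t - x) powr (c - 2) * t powr (s - a))"
    proof -
      have "norm (of_real (t - x) powr (C - 1) * (of_real t powr (- (A + A')) * (F3_Pfaff_deriv A A' B B' C (of_real (1 - x / t)) * of_real (x / t\<^sup>2))))
        \<le> (t - x) powr (c - 1) * (t powr (- a) * (N * t powr (s - 1)))"
        unfolding norm_mult[of "_ powr _"] pn[OF t] r using P'[OF t] by (intro mult_left_mono) auto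
      also have "\<dots> = N * ((t - x) powr (c - 1) * (t powr (- a) * t powr (s - 1)))" by (simp only: mult_ac)
      also have "\<dots> \<le> N * ((t - x) powr (c - 2) * t powr (s - a))"
        unfolding e using tx N by (intro mult_left_mono) auto
      finally show ?thesis .
    qed
    have "norm (MSM_kernel_deriv x A A' B B' C t) \<le> norm (C - 1) * N * ((t - x) powr (c - 2) * t powr (s - a)) +
        (norm (A + A') * N * ((t - x) powr (c - 2) * t powr (s - a)) + N * ((t - x) powr (c - 2) * t powr (s - a)))"
      unfolding MSM_kernel_deriv_def distrib_left[of "of_real (t - x) powr (C - 1)"]
      by (intro norm_triangle_mono T1 T2 T3)
    also have "\<dots> = (norm (C - 1) + norm (A + A') + 1) * N * ((t - x) powr (c - 2) * t powr (s - a))" by (simp add: algebra_simps)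
    also have "\<dots> \<le> M * ((t - x) powr (c - 2) * t powr (s - a))"
      unfolding M_def using N by (intro mult_right_mono) auto
    finally show "norm (MSM_kernel_deriv x A A' B B' C t) \<le> M * ((t - x) powr (Re C - 2) * t powr (s - Re (A + A')))"
      by (simp add: a_def c_def)
  qed
qed

text \<open>
  The substitution t = x / (1 - w) turns the integral into the Beta moment of F3_Pfaff with parameters C and z.
\<close>
theorem MSM_kernel_moment:
  assumes x: "x > 0" and C: "Re C > 0" and s: "F3_growth A A' B B' C s" "s < Re z"
  shows "(LINT t:{x<..}|lborel. MSM_kernel x A A' B B' C t * of_real t powr (- (z + C - A - A'))) =
      of_real x powr (- z) * F3_moment_value A A' B B' C z"
proof -
  define f where "f = (\<lambda>t. MSM_kernel x A A' B B' C t * of_real t powr (- (z + C - A - A')))"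
  define v where "v = (\<lambda>w. of_real w powr (C - 1) * of_real (1 - w) powr (z - 1) * F3_Pfaff A A' B B' C (of_real w))"
  have eq: "(x / (1 - w)\<^sup>2) *\<^sub>R f (x / (1 - w)) = of_real x powr (- z) * v w" if w: "w \<in> {0<..<1}" for w
  proof -
    have p: "1 - w > 0" "w > 0" using w by auto
    have l: "ln (x / (1 - w)) = ln x - ln (1 - w)" "ln (x / (1 - w) - x) = ln x + ln w - ln (1 - w)"
    proof -
      have "x / (1 - w) - x = x * w / (1 - w)" using p by (simp add: field_simps)
      then show "ln (x / (1 - w) - x) = ln x + ln w - ln (1 - w)" using p x by (simp add: ln_div ln_mult)
    qed (use p x in \<open>simp add: ln_div\<close>)
    have pos: "x / (1 - w) > 0" "x / (1 - w) - x > 0" using p x by (auto simp: field_simps)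
    have j: "x / (1 - w)\<^sup>2 = exp (ln x - 2 * ln (1 - w))"
      using p x by (simp add: exp_diff exp_double)
    have arg: "1 - x / (x / (1 - w)) = w" using x p by simp
    define X Y V where "X = complex_of_real (ln x)" and "Y = complex_of_real (ln w)" and "V = complex_of_real (ln (1 - w))"
    have jj: "complex_of_real (x / (1 - w)\<^sup>2) = exp (X - 2 * V)" unfolding j by (simp add: X_def V_def exp_of_real[symmetric])
    have LL: "complex_of_real (ln (x / (1 - w))) = X - V" "complex_of_real (ln (x / (1 - w) - x)) = X + Y - V"
      unfolding l by (simp_all add: X_def Y_def V_def)
    have "(x / (1 - w)\<^sup>2) *\<^sub>R f (x / (1 - w)) =
        exp (X - 2 * V) * (exp ((C - 1) * (X + Y - V)) * exp (- (A + A') * (X - V)) * F3_Pfaff A A' B B' C (of_real w) * exp (- (z + C - A - A') * (X - V)))"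
      unfolding scaleR_conv_of_real jj f_def MSM_kernel_def arg of_real_powr_exp[OF pos(1)] of_real_powr_exp[OF pos(2)] LL ..
    also have "\<dots> = exp (X - 2 * V + ((C - 1) * (X + Y - V) + (- (A + A') * (X - V) + - (z + C - A - A') * (X - V)))) * F3_Pfaff A A' B B' C (of_real w)"
      by (simp only: exp_add mult_ac)
    also have "X - 2 * V + ((C - 1) * (X + Y - V) + (- (A + A') * (X - V) + - (z + C - A - A') * (X - V))) = - z * X + ((C - 1) * Y + (z - 1) * V)"
      by (simp add: algebra_simps)
    also have "exp (- z * X + ((C - 1) * Y + (z - 1) * V)) * F3_Pfaff A A' B B' C (of_real w) = of_real x powr (- z) * v w"
      unfolding v_def of_real_powr_exp[OF x] of_real_powr_exp[OF p(1)] of_real_powr_exp[OF p(2)] X_def Y_def V_def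
      by (simp only: exp_add mult_ac)
    finally show ?thesis .
  qed
  have v: "v absolutely_integrable_on {0<..<1}" unfolding v_def by (rule F3_moment_integrable[OF C s])
  have "integral {0<..<1} v = F3_moment_value A A' B B' C z"
    using F3_moment[OF C s] by (simp add: Beta_moment_def v_def)
  then have int: "integral {0<..<1} (\<lambda>w. of_real x powr (- z) * v w) = of_real x powr (- z) * F3_moment_value A A' B B' C z"
    by simp
  have "(\<lambda>w. of_real x powr (- z) * v w) absolutely_integrable_on {0<..<1}" using v by (rule set_integrable_mult_right)
  then have "(\<lambda>w. (x / (1 - w)\<^sup>2) *\<^sub>R f (x / (1 - w))) absolutely_integrable_on {0<..<1} \<and>
      integral {0<..<1} (\<lambda>w. (x / (1 - w)\<^sup>2) *\<^sub>R f (x / (1 - w))) = of_real x powr (- z) * F3_moment_value A A' B B' C z"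
    unfolding int[symmetric] by (intro conjI iffD2[OF set_integrable_cong[OF refl refl eq]] integral_cong[OF eq])
  then have f: "f absolutely_integrable_on {x<..}" "integral {x<..} f = of_real x powr (- z) * F3_moment_value A A' B B' C z"
    using moebius_substitution[OF x, of f] by blast+
  have "continuous_on {x<..} f" unfolding f_def
  proof (intro continuous_on_mult)
    show "continuous_on {x<..} (MSM_kernel x A A' B B' C)"
      using MSM_kernel_has_derivative[OF x C] by (intro continuous_at_imp_continuous_on ballI has_vector_derivative_continuous) auto
    show "continuous_on {x<..} (\<lambda>t. complex_of_real t powr - (z + C - A - A'))"
      using x by (auto intro!: continuous_intros simp: complex_nonpos_Reals_iff)
  qed
  with f(1) have "set_integrable lborel {x<..} f" by (intro absolutely_integrable_imp_set_integrable_lborel) auto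
  from set_borel_integral_eq_integral(2)[OF this] f(2) show ?thesis by (simp add: f_def)
qed


section \<open>Differentiation under the contour integral\<close>

text \<open>
  The formal derivative is continuous by dominated convergence, and Fubini's theorem shows that its integral is the
  difference of the values of the superposition.
\<close>
lemma power_superposition_has_derivative:
  fixes \<phi> :: "real \<Rightarrow> complex" and b :: complex and \<mu> t :: real
  assumes [measurable]: "\<phi> \<in> borel_measurable borel"
    and int: "integrable lborel (\<lambda>\<tau>. norm (\<phi> \<tau>) * (1 + \<bar>\<tau>\<bar>))"
    and t: "t > 0"
  shows "((\<lambda>t. LINT \<tau>|lborel. \<phi> \<tau> * exp ((b + \<i> * of_real (\<mu> * \<tau>)) * of_real (ln t))) has_vector_derivative
    (LINT \<tau>|lborel. \<phi> \<tau> * ((b + \<i> * of_real (\<mu> * \<tau>)) * exp ((b - 1 + \<i> * of_real (\<mu> * \<tau>)) * of_real (ln t))))) (at t)"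
proof -
  define p where "p = (\<lambda>\<tau>. b + \<i> * of_real (\<mu> * \<tau>))"
  define e where "e = (\<lambda>\<tau> s. p \<tau> * exp ((p \<tau> - 1) * complex_of_real (ln s)))"
  define F where "F = (\<lambda>t. LINT \<tau>|lborel. \<phi> \<tau> * exp (p \<tau> * of_real (ln t)))"
  define F' where "F' = (\<lambda>t. LINT \<tau>|lborel. \<phi> \<tau> * e \<tau> t)"
  define L where "L = norm b + \<bar>\<mu>\<bar>"
  have L: "L \<ge> 0" by (simp add: L_def)
  have p_le: "norm (p \<tau>) \<le> L * (1 + \<bar>\<tau>\<bar>)" for \<tau>
  proof -
    have "norm (p \<tau>) \<le> norm b + \<bar>\<mu>\<bar> * \<bar>\<tau>\<bar>"
      unfolding p_def by (rule order_trans[OF norm_triangle_ineq]) (simp add: norm_mult abs_mult)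
    also have "\<dots> \<le> L * (1 + \<bar>\<tau>\<bar>)" using mult_nonneg_nonneg[of "norm b" "\<bar>\<tau>\<bar>"] by (simp add: L_def algebra_simps)
    finally show ?thesis .
  qed
  have Rep: "Re (p \<tau>) = Re b" for \<tau> by (simp add: p_def)
  have ne: "norm (\<phi> \<tau> * e \<tau> s) \<le> L * s powr (Re b - 1) * (norm (\<phi> \<tau>) * (1 + \<bar>\<tau>\<bar>))" if "s > 0" for \<tau> s
  proof -
    have "norm (\<phi> \<tau> * e \<tau> s) = norm (p \<tau>) * (norm (\<phi> \<tau>) * s powr (Re b - 1))"
      using that by (simp add: e_def norm_mult norm_exp_eq_Re Rep powr_def)
    also have "\<dots> \<le> (L * (1 + \<bar>\<tau>\<bar>)) * (norm (\<phi> \<tau>) * s powr (Re b - 1))" by (intro mult_right_mono p_le) auto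
    finally show ?thesis by (simp add: mult_ac)
  qed
  have meas [measurable]: "(\<lambda>\<tau>. \<phi> \<tau> * e \<tau> s) \<in> borel_measurable borel" for s
    unfolding e_def p_def by measurable
  have i0: "integrable lborel \<phi>"
    by (rule Bochner_Integration.integrable_bound[OF int]) (auto intro!: AE_I2 simp: abs_mult mult_le_cancel_left1)
  have iF: "integrable lborel (\<lambda>\<tau>. \<phi> \<tau> * exp (p \<tau> * of_real (ln s)))" if "s > 0" for s
  proof (rule Bochner_Integration.integrable_bound)
    show "integrable lborel (\<lambda>\<tau>. s powr Re b *\<^sub>R \<phi> \<tau>)" using i0 by (rule integrable_scaleR_right)
    show "(\<lambda>\<tau>. \<phi> \<tau> * exp (p \<tau> * complex_of_real (ln s))) \<in> borel_measurable lborel" unfolding p_def by measurable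
    show "AE \<tau> in lborel. norm (\<phi> \<tau> * exp (p \<tau> * complex_of_real (ln s))) \<le> norm (s powr Re b *\<^sub>R \<phi> \<tau>)"
      using that by (intro AE_I2) (simp add: norm_mult norm_exp_eq_Re Rep powr_def)
  qed
  define a where "a = t / 2"
  have a: "0 < a" "a < t" using t by (auto simp: a_def)
  have cont: "continuous_on {a..t + 1} F'"
  proof (rule continuous_on_sequentiallyI)
    fix u v assume u: "\<forall>n. u n \<in> {a..t + 1}" and v: "v \<in> {a..t + 1}" and lim: "u \<longlonglongrightarrow> v"
    have "compact ((\<lambda>s. s powr (Re b - 1)) ` {a..t + 1})"
      using a by (intro compact_continuous_image continuous_intros) auto
    then have "bdd_above ((\<lambda>s. s powr (Re b - 1)) ` {a..t + 1})"
      by (intro bounded_imp_bdd_above compact_imp_bounded)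
    then obtain Q where "\<forall>y\<in>(\<lambda>s. s powr (Re b - 1)) ` {a..t + 1}. y \<le> Q" unfolding bdd_above_def by (elim exE)
    then have Q: "s powr (Re b - 1) \<le> Q" if "s \<in> {a..t + 1}" for s using that by simp
    show "(\<lambda>n. F' (u n)) \<longlonglongrightarrow> F' v"
      unfolding F'_def
    proof (rule integral_dominated_convergence[where w = "\<lambda>\<tau>. L * Q * (norm (\<phi> \<tau>) * (1 + \<bar>\<tau>\<bar>))"])
      show "integrable lborel (\<lambda>\<tau>. L * Q * (norm (\<phi> \<tau>) * (1 + \<bar>\<tau>\<bar>)))" using int by (rule integrable_mult_right)
      have "v > 0" using v a by simp
      then show "AE \<tau> in lborel. (\<lambda>n. \<phi> \<tau> * e \<tau> (u n)) \<longlonglongrightarrow> \<phi> \<tau> * e \<tau> v"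
        unfolding e_def by (intro AE_I2 tendsto_intros lim) auto
      show "AE \<tau> in lborel. norm (\<phi> \<tau> * e \<tau> (u n)) \<le> L * Q * (norm (\<phi> \<tau>) * (1 + \<bar>\<tau>\<bar>))" for n
      proof (intro AE_I2)
        fix \<tau>
        have un: "u n \<in> {a..t + 1}" "u n > 0" using u a by (auto intro: less_le_trans)
        show "norm (\<phi> \<tau> * e \<tau> (u n)) \<le> L * Q * (norm (\<phi> \<tau>) * (1 + \<bar>\<tau>\<bar>))"
          by (rule order_trans[OF ne[OF un(2)]]) (use Q[OF un(1)] L in \<open>intro mult_right_mono mult_left_mono; simp\<close>)
      qed
    qed auto
  qed
  have FTC: "F u = F a + integral {a..u} F'" if u: "u \<in> {a..t + 1}" for u
  proof -
    define f where "f = (\<lambda>\<tau> s. \<phi> \<tau> * (indicator {a..u} s *\<^sub>R e \<tau> s))"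
    have ce: "continuous_on {a..u} (e \<tau>)" for \<tau>
      unfolding e_def using a by (intro continuous_intros) auto
    have ci: "integrable lborel (\<lambda>s. indicator {a..u} s *\<^sub>R e \<tau> s)" for \<tau>
      using borel_integrable_atLeastAtMost'[OF ce] unfolding set_integrable_def .
    have m: "case_prod f \<in> borel_measurable (lborel \<Otimes>\<^sub>M lborel)"
      unfolding f_def e_def p_def by measurable
    have int2: "integrable (lborel \<Otimes>\<^sub>M lborel) (case_prod f)"
    proof (rule lborel_pair.Fubini_integrable[OF m])
      define r where "r = (LINT s|lborel. indicator {a..u} s *\<^sub>R s powr (Re b - 1))"
      have "norm (f \<tau> s) = (norm (\<phi> \<tau>) * norm (p \<tau>)) * (indicator {a..u} s *\<^sub>R s powr (Re b - 1))" for \<tau> s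
        using a by (auto simp: f_def e_def norm_mult norm_exp_eq_Re Rep powr_def indicator_def)
      then have eq: "(\<lambda>\<tau>. LINT s|lborel. norm (case_prod f (\<tau>, s))) = (\<lambda>\<tau>. (norm (\<phi> \<tau>) * norm (p \<tau>)) * r)"
        by (simp add: r_def)
      have "integrable lborel (\<lambda>\<tau>. norm (\<phi> \<tau>) * norm (p \<tau>))"
      proof (rule Bochner_Integration.integrable_bound)
        show "integrable lborel (\<lambda>\<tau>. L * (norm (\<phi> \<tau>) * (1 + \<bar>\<tau>\<bar>)))" using int by (rule integrable_mult_right)
        show "(\<lambda>\<tau>. norm (\<phi> \<tau>) * norm (p \<tau>)) \<in> borel_measurable lborel" unfolding p_def by measurable
        show "AE \<tau> in lborel. norm (norm (\<phi> \<tau>) * norm (p \<tau>)) \<le> norm (L * (norm (\<phi> \<tau>) * (1 + \<bar>\<tau>\<bar>)))"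
        proof (intro AE_I2)
          fix \<tau>
          have "norm (\<phi> \<tau>) * norm (p \<tau>) \<le> norm (\<phi> \<tau>) * (L * (1 + \<bar>\<tau>\<bar>))" by (intro mult_left_mono p_le) auto
          then show "norm (norm (\<phi> \<tau>) * norm (p \<tau>)) \<le> norm (L * (norm (\<phi> \<tau>) * (1 + \<bar>\<tau>\<bar>)))"
            using L by (simp add: abs_mult mult_ac)
        qed
      qed
      then show "integrable lborel (\<lambda>\<tau>. LINT s|lborel. norm (case_prod f (\<tau>, s)))"
        unfolding eq by (rule integrable_mult_left)
      show "AE \<tau> in lborel. integrable lborel (\<lambda>s. case_prod f (\<tau>, s))"
        unfolding f_def case_prod_conv by (intro AE_I2 integrable_mult_right ci)
    qed
    have row: "(LINT s|lborel. f \<tau> s) = \<phi> \<tau> * exp (p \<tau> * of_real (ln u)) - \<phi> \<tau> * exp (p \<tau> * of_real (ln a))" for \<tau>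
    proof -
      have "(LINT s|lborel. indicator {a..u} s *\<^sub>R e \<tau> s) = exp (p \<tau> * of_real (ln u)) - exp (p \<tau> * of_real (ln a))"
      proof (rule integral_FTC_atLeastAtMost[OF _ _ ce])
        fix s assume "a \<le> s" "s \<le> u"
        then have s: "s > 0" using a by simp
        have "((\<lambda>s. p \<tau> * of_real (ln s)) has_vector_derivative p \<tau> * of_real (1 / s)) (at s)"
          using s by (intro has_vector_derivative_mult_right has_vector_derivative_of_real)
            (auto intro!: derivative_eq_intros simp: has_real_derivative_iff_has_vector_derivative[symmetric])
        from field_vector_diff_chain_at[OF this, of exp "exp (p \<tau> * of_real (ln s))"]
        have d: "((\<lambda>s. exp (p \<tau> * of_real (ln s))) has_vector_derivative p \<tau> * of_real (1 / s) * exp (p \<tau> * of_real (ln s))) (at s)"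
          by (simp add: o_def DERIV_exp)
        have "exp (complex_of_real (ln s)) = of_real s" using s by (simp add: exp_of_real)
        then have "of_real (1 / s) * exp (p \<tau> * of_real (ln s)) = exp ((p \<tau> - 1) * complex_of_real (ln s))"
          using s by (simp add: left_diff_distrib exp_diff)
        then have "p \<tau> * of_real (1 / s) * exp (p \<tau> * of_real (ln s)) = e \<tau> s" by (simp only: e_def mult.assoc)
        with d show "((\<lambda>s. exp (p \<tau> * of_real (ln s))) has_vector_derivative e \<tau> s) (at s within {a..u})"
          by (auto intro: has_vector_derivative_at_within)
      qed (use u in auto)
      moreover have "(LINT s|lborel. f \<tau> s) = \<phi> \<tau> * (LINT s|lborel. indicator {a..u} s *\<^sub>R e \<tau> s)"
        unfolding f_def by (rule integral_mult_right_zero)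
      ultimately show ?thesis by (simp only: right_diff_distrib)
    qed
    have col: "(LINT \<tau>|lborel. f \<tau> s) = indicator {a..u} s *\<^sub>R F' s" for s
    proof -
      have "f \<tau> s = indicator {a..u} s *\<^sub>R (\<phi> \<tau> * e \<tau> s)" for \<tau> by (simp add: f_def)
      then show ?thesis by (simp add: F'_def)
    qed
    have "(LINT s:{a..u}|lborel. F' s) = (LINT s|lborel. LINT \<tau>|lborel. f \<tau> s)"
      by (simp add: col set_lebesgue_integral_def)
    also have "\<dots> = (LINT \<tau>|lborel. LINT s|lborel. f \<tau> s)" by (rule lborel_pair.Fubini_integral[OF int2])
    also have "\<dots> = F u - F a"
      unfolding row F_def using iF a u by (intro Bochner_Integration.integral_diff) auto
    finally have "(LINT s:{a..u}|lborel. F' s) = F u - F a" .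
    moreover have "(LINT s:{a..u}|lborel. F' s) = integral {a..u} F'"
      using u by (intro set_borel_integral_eq_integral borel_integrable_atLeastAtMost' continuous_on_subset[OF cont]) auto
    ultimately show ?thesis by simp
  qed
  have "((\<lambda>u. integral {a..u} F') has_vector_derivative F' t) (at t within {a..t + 1})"
    using a by (intro integral_has_vector_derivative cont) auto
  then have "((\<lambda>u. integral {a..u} F') has_vector_derivative F' t) (at t)"
    using a by (simp add: at_within_Icc_at)
  from has_vector_derivative_add[OF has_vector_derivative_const this]
  have "((\<lambda>u. F a + integral {a..u} F') has_vector_derivative F' t) (at t)" by simp
  then have "(F has_vector_derivative F' t) (at t)"
  proof (rule has_vector_derivative_transform_within_open[where S = "{a<..<t + 1}"])
    show "F a + integral {a..u} F' = F u" if "u \<in> {a<..<t + 1}" for u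
      using that by (intro FTC[symmetric]) simp
  qed (use a in auto)
  moreover have "p \<tau> - 1 = b - 1 + \<i> * of_real (\<mu> * \<tau>)" for \<tau> by (simp add: p_def)
  then have "F' t = (LINT \<tau>|lborel. \<phi> \<tau> * (p \<tau> * exp ((b - 1 + \<i> * of_real (\<mu> * \<tau>)) * of_real (ln t))))"
    unfolding F'_def e_def by (simp only:)
  ultimately show ?thesis unfolding F_def p_def by (simp only:)
qed

lemma pochhammer_vertical_bound:
  fixes \<rho> :: complex and \<mu> :: real
  obtains K where "K > 0" "\<And>\<tau>. norm (pochhammer (\<rho> - \<i> * of_real (\<mu> * \<tau>)) k) \<le> K * (1 + \<bar>\<tau>\<bar>) powr real k"
proof -
  define L where "L = norm \<rho> + \<bar>\<mu>\<bar> + real k + 1"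
  have L: "L > 0" by (simp add: L_def add_nonneg_pos)
  have "norm (pochhammer (\<rho> - \<i> * of_real (\<mu> * \<tau>)) k) \<le> L ^ k * (1 + \<bar>\<tau>\<bar>) powr real k" for \<tau>
  proof -
    have "norm (pochhammer (\<rho> - \<i> * of_real (\<mu> * \<tau>)) k) = (\<Prod>j<k. norm (\<rho> - \<i> * of_real (\<mu> * \<tau>) + of_nat j))"
      by (simp add: pochhammer_prod prod_norm atLeast0LessThan)
    also have "\<dots> \<le> (\<Prod>j<k. L * (1 + \<bar>\<tau>\<bar>))"
    proof (intro prod_mono conjI)
      fix j assume j: "j \<in> {..<k}"
      have "norm (\<rho> - \<i> * of_real (\<mu> * \<tau>) + of_nat j) \<le> norm \<rho> + norm (\<i> * of_real (\<mu> * \<tau>)) + norm (of_nat j :: complex)"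
        by (intro order_trans[OF norm_triangle_ineq] add_mono order_refl norm_triangle_ineq4)
      also have "\<dots> = norm \<rho> + \<bar>\<mu>\<bar> * \<bar>\<tau>\<bar> + real j" by (simp add: norm_mult abs_mult)
      also have "\<dots> \<le> L * (1 + \<bar>\<tau>\<bar>)"
      proof -
        have "real j \<le> real k" using j by simp
        then show ?thesis
          using mult_nonneg_nonneg[OF norm_ge_zero abs_ge_zero, of \<rho> \<tau>] mult_nonneg_nonneg[OF of_nat_0_le_iff abs_ge_zero, of k \<tau>]
            abs_ge_zero[of \<mu>] abs_ge_zero[of \<tau>] unfolding L_def distrib_left distrib_right by linarith
      qed
      finally show "norm (\<rho> - \<i> * of_real (\<mu> * \<tau>) + of_nat j) \<le> L * (1 + \<bar>\<tau>\<bar>)" .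
    qed auto
    also have "\<dots> = L ^ k * (1 + \<bar>\<tau>\<bar>) powr real k"
      by (simp add: power_mult_distrib powr_realpow add_pos_nonneg)
    finally show ?thesis .
  qed
  with L that[of "L ^ k"] show thesis by simp
qed

text \<open>
  The k-th formal derivative in t of the superposition of the powers t powr (-\<rho> + \<i>\<mu>\<tau>) with weight \<psi>.
\<close>
definition power_superposition :: "(real \<Rightarrow> complex) \<Rightarrow> complex \<Rightarrow> real \<Rightarrow> nat \<Rightarrow> real \<Rightarrow> complex" where
  "power_superposition \<psi> \<rho> \<mu> k t = (LINT \<tau>|lborel. (\<psi> \<tau> * ((-1) ^ k * pochhammer (\<rho> - \<i> * of_real (\<mu> * \<tau>)) k)) *
    exp ((- \<rho> - of_nat k + \<i> * of_real (\<mu> * \<tau>)) * of_real (ln t)))"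

lemma power_superposition_weight:
  fixes \<psi> :: "real \<Rightarrow> complex" and \<rho> :: complex
  assumes [measurable]: "\<psi> \<in> borel_measurable borel"
    and bound: "\<And>\<tau>. norm (\<psi> \<tau>) \<le> H * (1 + \<bar>\<tau>\<bar>) powr w"
  obtains K where
    "(\<lambda>\<tau>. \<psi> \<tau> * ((-1) ^ k * pochhammer (\<rho> - \<i> * of_real (\<mu> * \<tau>)) k)) \<in> borel_measurable borel"
    "\<And>\<tau>. norm (\<psi> \<tau> * ((-1) ^ k * pochhammer (\<rho> - \<i> * of_real (\<mu> * \<tau>)) k)) \<le> K * (1 + \<bar>\<tau>\<bar>) powr (w + real k)"
proof -
  have H: "H \<ge> 0" using order_trans[OF norm_ge_zero bound[of 0]] by simp
  obtain K where K: "K > 0" "\<And>\<tau>. norm (pochhammer (\<rho> - \<i> * of_real (\<mu> * \<tau>)) k) \<le> K * (1 + \<bar>\<tau>\<bar>) powr real k"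
    using pochhammer_vertical_bound by blast
  show thesis
  proof (rule that)
    have "continuous_on UNIV (\<lambda>\<tau>. pochhammer (\<rho> - \<i> * of_real (\<mu> * \<tau>)) k)"
      unfolding pochhammer_prod by (intro continuous_intros)
    then have [measurable]: "(\<lambda>\<tau>. pochhammer (\<rho> - \<i> * of_real (\<mu> * \<tau>)) k) \<in> borel_measurable borel"
      by (rule borel_measurable_continuous_onI)
    show "(\<lambda>\<tau>. \<psi> \<tau> * ((-1) ^ k * pochhammer (\<rho> - \<i> * of_real (\<mu> * \<tau>)) k)) \<in> borel_measurable borel"
      by measurable
    fix \<tau> :: real
    have "norm (\<psi> \<tau> * ((-1) ^ k * pochhammer (\<rho> - \<i> * of_real (\<mu> * \<tau>)) k)) =
        norm (\<psi> \<tau>) * norm (pochhammer (\<rho> - \<i> * of_real (\<mu> * \<tau>)) k)" by (simp add: norm_mult norm_power)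
    also have "\<dots> \<le> (H * (1 + \<bar>\<tau>\<bar>) powr w) * (K * (1 + \<bar>\<tau>\<bar>) powr real k)"
      using H by (intro mult_mono bound K) auto
    also have "\<dots> = H * K * ((1 + \<bar>\<tau>\<bar>) powr w * (1 + \<bar>\<tau>\<bar>) powr real k)" by (simp only: mult_ac)
    also have "(1 + \<bar>\<tau>\<bar>) powr w * (1 + \<bar>\<tau>\<bar>) powr real k = (1 + \<bar>\<tau>\<bar>) powr (w + real k)" by (simp only: powr_add)
    finally show "norm (\<psi> \<tau> * ((-1) ^ k * pochhammer (\<rho> - \<i> * of_real (\<mu> * \<tau>)) k)) \<le> H * K * (1 + \<bar>\<tau>\<bar>) powr (w + real k)" .
  qed
qed

lemma power_superposition_deriv:
  fixes \<psi> :: "real \<Rightarrow> complex" and \<rho> :: complex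
  assumes \<psi>: "\<psi> \<in> borel_measurable borel"
    and bound: "\<And>\<tau>. norm (\<psi> \<tau>) \<le> H * (1 + \<bar>\<tau>\<bar>) powr w"
    and w: "w + real (Suc k) < -1" and t: "t > 0"
  shows "(power_superposition \<psi> \<rho> \<mu> k has_vector_derivative power_superposition \<psi> \<rho> \<mu> (Suc k) t) (at t)"
proof -
  define \<phi> where "\<phi> = (\<lambda>\<tau>. \<psi> \<tau> * ((-1) ^ k * pochhammer (\<rho> - \<i> * of_real (\<mu> * \<tau>)) k))"
  define D where "D = (LINT \<tau>|lborel. \<phi> \<tau> * ((- \<rho> - of_nat k + \<i> * of_real (\<mu> * \<tau>)) * exp ((- \<rho> - of_nat k - 1 + \<i> * of_real (\<mu> * \<tau>)) * complex_of_real (ln t))))"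
  obtain K where m [measurable]: "\<phi> \<in> borel_measurable borel" and K: "\<And>\<tau>. norm (\<phi> \<tau>) \<le> K * (1 + \<bar>\<tau>\<bar>) powr (w + real k)"
    unfolding \<phi>_def by (rule power_superposition_weight[OF \<psi> bound]) blast
  have int: "integrable lborel (\<lambda>\<tau>. norm (\<phi> \<tau>) * (1 + \<bar>\<tau>\<bar>))"
  proof (rule Bochner_Integration.integrable_bound)
    show "integrable lborel (\<lambda>\<tau>. K * (1 + \<bar>\<tau>\<bar>) powr (w + real (Suc k)))"
      using w by (intro integrable_mult_right integrable_one_plus_abs_powr)
    show "AE \<tau> in lborel. norm (norm (\<phi> \<tau>) * (1 + \<bar>\<tau>\<bar>)) \<le> norm (K * (1 + \<bar>\<tau>\<bar>) powr (w + real (Suc k)))"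
    proof (intro AE_I2)
      fix \<tau> :: real
      have "norm (norm (\<phi> \<tau>) * (1 + \<bar>\<tau>\<bar>)) \<le> (K * (1 + \<bar>\<tau>\<bar>) powr (w + real k)) * (1 + \<bar>\<tau>\<bar>) powr 1"
        using K[of \<tau>] by (simp add: mult_right_mono abs_mult)
      also have "\<dots> = K * ((1 + \<bar>\<tau>\<bar>) powr (w + real k) * (1 + \<bar>\<tau>\<bar>) powr 1)" by (simp only: mult.assoc)
      also have "(1 + \<bar>\<tau>\<bar>) powr (w + real k) * (1 + \<bar>\<tau>\<bar>) powr 1 = (1 + \<bar>\<tau>\<bar>) powr (w + real (Suc k))"
      proof -
        have "w + real (Suc k) = (w + real k) + 1" by simp
        then show ?thesis by (simp only: powr_add)
      qed
      also have "K * (1 + \<bar>\<tau>\<bar>) powr (w + real (Suc k)) \<le> norm (K * (1 + \<bar>\<tau>\<bar>) powr (w + real (Suc k)))"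
        unfolding real_norm_def by (rule abs_ge_self)
      finally show "norm (norm (\<phi> \<tau>) * (1 + \<bar>\<tau>\<bar>)) \<le> norm (K * (1 + \<bar>\<tau>\<bar>) powr (w + real (Suc k)))" .
    qed
  qed auto
  have "(power_superposition \<psi> \<rho> \<mu> k has_vector_derivative D) (at t)"
    unfolding power_superposition_def[abs_def] \<phi>_def[symmetric] D_def
    using power_superposition_has_derivative[OF m int t, of "- \<rho> - of_nat k" \<mu>] unfolding \<phi>_def by simp
  also have "D = (LINT \<tau>|lborel. (\<psi> \<tau> * ((-1) ^ Suc k * pochhammer (\<rho> - \<i> * of_real (\<mu> * \<tau>)) (Suc k))) *
    exp ((- \<rho> - of_nat (Suc k) + \<i> * of_real (\<mu> * \<tau>)) * of_real (ln t)))"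
    unfolding D_def
  proof (intro Bochner_Integration.integral_cong refl)
    fix \<tau>
    define u where "u = \<rho> - \<i> * complex_of_real (\<mu> * \<tau>)"
    have 1: "- \<rho> - of_nat k + \<i> * of_real (\<mu> * \<tau>) = - (u + of_nat k)"
      "- \<rho> - of_nat (Suc k) + \<i> * of_real (\<mu> * \<tau>) = - \<rho> - of_nat k - 1 + \<i> * of_real (\<mu> * \<tau>)"
      by (simp_all add: u_def)
    show "\<phi> \<tau> * ((- \<rho> - of_nat k + \<i> * of_real (\<mu> * \<tau>)) * exp ((- \<rho> - of_nat k - 1 + \<i> * of_real (\<mu> * \<tau>)) * complex_of_real (ln t))) =
      \<psi> \<tau> * ((-1) ^ Suc k * pochhammer (\<rho> - \<i> * of_real (\<mu> * \<tau>)) (Suc k)) *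
      exp ((- \<rho> - of_nat (Suc k) + \<i> * of_real (\<mu> * \<tau>)) * of_real (ln t))"
      unfolding 1 \<phi>_def u_def[symmetric] pochhammer_Suc power_Suc
      by (simp only: mult_minus_left mult_minus_right mult_1_left mult_ac)
  qed
  also have "(LINT \<tau>|lborel. (\<psi> \<tau> * ((-1) ^ Suc k * pochhammer (\<rho> - \<i> * of_real (\<mu> * \<tau>)) (Suc k))) *
    exp ((- \<rho> - of_nat (Suc k) + \<i> * of_real (\<mu> * \<tau>)) * of_real (ln t))) = power_superposition \<psi> \<rho> \<mu> (Suc k) t"
    by (simp only: power_superposition_def)
  finally show ?thesis .
qed

lemma nth_derivative_superposition:
  fixes \<psi> :: "real \<Rightarrow> complex" and \<rho> :: complex and f :: "real \<Rightarrow> complex"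
  assumes \<psi>: "\<psi> \<in> borel_measurable borel"
    and bound: "\<And>\<tau>. norm (\<psi> \<tau>) \<le> H * (1 + \<bar>\<tau>\<bar>) powr w"
    and f: "\<And>t. t > 0 \<Longrightarrow> f t = power_superposition \<psi> \<rho> \<mu> 0 t"
    and "w + real k < -1" "t > 0"
  shows "nth_derivative k f t = power_superposition \<psi> \<rho> \<mu> k t"
  using assms(4,5)
proof (induction k arbitrary: t)
  case 0
  then show ?case using f by (simp add: nth_derivative_def)
next
  case (Suc k)
  have IH: "nth_derivative k f s = power_superposition \<psi> \<rho> \<mu> k s" if "s > 0" for s
    using Suc.prems that by (intro Suc.IH) auto
  have "(nth_derivative k f has_vector_derivative power_superposition \<psi> \<rho> \<mu> (Suc k) t) (at t)"
    by (rule has_vector_derivative_transform_within_open[OF power_superposition_deriv[OF \<psi> bound Suc.prems], where S = "{0<..}"])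
       (use IH Suc.prems in auto)
  then show ?case
    by (simp add: nth_derivative_def vector_derivative_at)
qed


section \<open>Growth of the integrand of the I-function\<close>

lemma vertical_growth_prod_list:
  assumes "\<And>b B \<kappa>. (b, B, \<kappa>) \<in> set xs \<Longrightarrow> vertical_growth (\<lambda>\<tau>. norm (F b B \<kappa> \<tau> :: complex)) (p b B \<kappa>) (q b B \<kappa>)"
  shows "vertical_growth (\<lambda>\<tau>. norm (\<Prod>(b, B, \<kappa>)\<leftarrow>xs. F b B \<kappa> \<tau>)) (\<Sum>(b, B, \<kappa>)\<leftarrow>xs. p b B \<kappa>) (\<Sum>(b, B, \<kappa>)\<leftarrow>xs. q b B \<kappa>)"
  using assms
proof (induction xs)
  case Nil
  then show ?case using vertical_growth_one by simp
next
  case (Cons y ys)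
  obtain b B \<kappa> where y: "y = (b, B, \<kappa>)" by (cases y)
  have "vertical_growth (\<lambda>\<tau>. norm (F b B \<kappa> \<tau>) * norm (\<Prod>(b, B, \<kappa>)\<leftarrow>ys. F b B \<kappa> \<tau>))
      (p b B \<kappa> + (\<Sum>(b, B, \<kappa>)\<leftarrow>ys. p b B \<kappa>)) (q b B \<kappa> + (\<Sum>(b, B, \<kappa>)\<leftarrow>ys. q b B \<kappa>))"
    using Cons y by (intro vertical_growth_mult Cons.IH) auto
  then show ?case by (simp add: y norm_mult)
qed

lemma gamma_factor_growth:
  assumes G: "gamma_power_branch G" and D: "D \<noteq> 0" and \<kappa>: "\<kappa> > 0"
    and poles: "\<And>\<tau>. c + of_real D * (\<i> * of_real \<tau>) \<notin> \<int>\<^sub>\<le>\<^sub>0"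
  shows "vertical_growth (\<lambda>\<tau>. norm (G c D \<kappa> (\<i> * of_real \<tau>))) (\<kappa> * (Re c - 1/2)) (\<kappa> * (pi / 2 * \<bar>D\<bar>))"
  unfolding gamma_power_branch_norm[OF G D \<kappa>]
  by (intro vertical_growth_powr Gamma_vertical_growth D \<kappa> poles) auto

lemma gamma_factor_inverse_growth:
  assumes G: "gamma_power_branch G" and D: "D \<noteq> 0" and \<kappa>: "\<kappa> > 0"
  shows "vertical_growth (\<lambda>\<tau>. norm (inverse (G c D \<kappa> (\<i> * of_real \<tau>)))) (\<kappa> * (- (Re c - 1/2))) (\<kappa> * (- (pi / 2) * \<bar>D\<bar>))"
proof -
  have "norm (inverse (G c D \<kappa> (\<i> * of_real \<tau>))) = norm (rGamma (c + of_real D * (\<i> * of_real \<tau>))) powr \<kappa>" for \<tau>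
    by (simp add: norm_inverse gamma_power_branch_norm[OF G D \<kappa>] rGamma_inverse_Gamma inverse_powr)
  then show ?thesis
    using vertical_growth_powr[OF rGamma_vertical_growth[OF D, of c] _ \<kappa>] by simp
qed

lemma sum_list_take_drop:
  fixes h :: "'b \<Rightarrow> 'a::comm_monoid_add"
  shows "(\<Sum>x\<leftarrow>take k xs. h x) + (\<Sum>x\<leftarrow>drop k xs. h x) = (\<Sum>x\<leftarrow>xs. h x)"
  by (metis append_take_drop_id map_append sum_list_append)

text \<open>
  Each Gamma factor contributes its exponent and rate from Stirling's formula, with sign according to numerator or
  denominator; the sums of these contributions are the parameters of absolute convergence.
\<close>
lemma I_kernel_growth:
  assumes G: "gamma_power_branch G" and par: "I_parameters m n up lo"
  shows "vertical_growth (\<lambda>\<tau>. norm (I_kernel G m n up lo (\<i> * of_real \<tau>))) (I_Omega up lo) (pi / 2 * I_Delta m n up lo)"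
proof -
  have pos: "A > 0" "\<kappa> > 0" if "(a, A, \<kappa>) \<in> set up" for a A \<kappa>
    using par that by (auto simp: I_parameters_def)
  have pos': "B > 0" "\<kappa> > 0" if "(b, B, \<kappa>) \<in> set lo" for b B \<kappa>
    using par that by (auto simp: I_parameters_def)
  have g1: "vertical_growth (\<lambda>\<tau>. norm (\<Prod>(b, B, \<kappa>)\<leftarrow>take m lo. G b B \<kappa> (\<i> * of_real \<tau>)))
      (\<Sum>(b, B, \<kappa>)\<leftarrow>take m lo. \<kappa> * (Re b - 1/2)) (\<Sum>(b, B, \<kappa>)\<leftarrow>take m lo. \<kappa> * (pi / 2 * \<bar>B\<bar>))"
  proof (rule vertical_growth_prod_list)
    fix b B \<kappa> assume m: "(b, B, \<kappa>) \<in> set (take m lo)"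
    show "vertical_growth (\<lambda>\<tau>. norm (G b B \<kappa> (\<i> * of_real \<tau>))) (\<kappa> * (Re b - 1/2)) (\<kappa> * (pi / 2 * \<bar>B\<bar>))"
    proof (rule gamma_factor_growth[OF G])
      show "B \<noteq> 0" "\<kappa> > 0" using pos'[OF in_set_takeD[OF m]] by auto
      have "\<forall>s. b + of_real B * s \<in> \<int>\<^sub>\<le>\<^sub>0 \<longrightarrow> Re s < 0" using par m unfolding I_parameters_def by fast
      then show "b + of_real B * (\<i> * of_real \<tau>) \<notin> \<int>\<^sub>\<le>\<^sub>0" for \<tau> by fastforce
    qed
  qed
  have g2: "vertical_growth (\<lambda>\<tau>. norm (\<Prod>(a, A, \<kappa>)\<leftarrow>take n up. G (1 - a) (- A) \<kappa> (\<i> * of_real \<tau>)))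
      (\<Sum>(a, A, \<kappa>)\<leftarrow>take n up. \<kappa> * (Re (1 - a) - 1/2)) (\<Sum>(a, A, \<kappa>)\<leftarrow>take n up. \<kappa> * (pi / 2 * \<bar>- A\<bar>))"
  proof (rule vertical_growth_prod_list)
    fix a A \<kappa> assume m: "(a, A, \<kappa>) \<in> set (take n up)"
    show "vertical_growth (\<lambda>\<tau>. norm (G (1 - a) (- A) \<kappa> (\<i> * of_real \<tau>))) (\<kappa> * (Re (1 - a) - 1/2)) (\<kappa> * (pi / 2 * \<bar>- A\<bar>))"
    proof (rule gamma_factor_growth[OF G])
      show "- A \<noteq> 0" "\<kappa> > 0" using pos[OF in_set_takeD[OF m]] by auto
      have "\<forall>s. 1 - a - of_real A * s \<in> \<int>\<^sub>\<le>\<^sub>0 \<longrightarrow> Re s > 0" using par m unfolding I_parameters_def by fast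
      then show "1 - a + of_real (- A) * (\<i> * of_real \<tau>) \<notin> \<int>\<^sub>\<le>\<^sub>0" for \<tau> by fastforce
    qed
  qed
  have g3: "vertical_growth (\<lambda>\<tau>. norm (\<Prod>(b, B, \<kappa>)\<leftarrow>drop m lo. inverse (G (1 - b) (- B) \<kappa> (\<i> * of_real \<tau>))))
      (\<Sum>(b, B, \<kappa>)\<leftarrow>drop m lo. \<kappa> * (- (Re (1 - b) - 1/2))) (\<Sum>(b, B, \<kappa>)\<leftarrow>drop m lo. \<kappa> * (- (pi / 2) * \<bar>- B\<bar>))"
    by (intro vertical_growth_prod_list gamma_factor_inverse_growth G) (use pos' in \<open>fastforce dest: in_set_dropD\<close>)+
  have g4: "vertical_growth (\<lambda>\<tau>. norm (\<Prod>(a, A, \<kappa>)\<leftarrow>drop n up. inverse (G a A \<kappa> (\<i> * of_real \<tau>))))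
      (\<Sum>(a, A, \<kappa>)\<leftarrow>drop n up. \<kappa> * (- (Re a - 1/2))) (\<Sum>(a, A, \<kappa>)\<leftarrow>drop n up. \<kappa> * (- (pi / 2) * \<bar>A\<bar>))"
    by (intro vertical_growth_prod_list gamma_factor_inverse_growth G) (use pos in \<open>fastforce dest: in_set_dropD\<close>)+
  have ker: "norm (I_kernel G m n up lo s) =
      norm (\<Prod>(b, B, \<kappa>)\<leftarrow>take m lo. G b B \<kappa> s) * norm (\<Prod>(a, A, \<kappa>)\<leftarrow>take n up. G (1 - a) (- A) \<kappa> s) *
      (norm (\<Prod>(b, B, \<kappa>)\<leftarrow>drop m lo. inverse (G (1 - b) (- B) \<kappa> s)) * norm (\<Prod>(a, A, \<kappa>)\<leftarrow>drop n up. inverse (G a A \<kappa> s)))" for s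
  proof -
    have inv: "(\<Prod>(b, B, \<kappa>)\<leftarrow>xs. inverse (F b B \<kappa>)) = inverse (\<Prod>(b, B, \<kappa>)\<leftarrow>xs. F b B \<kappa> :: complex)" for xs :: "triple list" and F
      by (induction xs) auto
    show ?thesis unfolding I_kernel_def inv
      by (simp only: norm_mult norm_divide norm_inverse divide_inverse inverse_mult_distrib)
  qed
  have "vertical_growth (\<lambda>\<tau>. norm (I_kernel G m n up lo (\<i> * of_real \<tau>)))
      ((\<Sum>(b, B, \<kappa>)\<leftarrow>take m lo. \<kappa> * (Re b - 1/2)) + (\<Sum>(a, A, \<kappa>)\<leftarrow>take n up. \<kappa> * (Re (1 - a) - 1/2)) +
       ((\<Sum>(b, B, \<kappa>)\<leftarrow>drop m lo. \<kappa> * (- (Re (1 - b) - 1/2))) + (\<Sum>(a, A, \<kappa>)\<leftarrow>drop n up. \<kappa> * (- (Re a - 1/2)))))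
      ((\<Sum>(b, B, \<kappa>)\<leftarrow>take m lo. \<kappa> * (pi / 2 * \<bar>B\<bar>)) + (\<Sum>(a, A, \<kappa>)\<leftarrow>take n up. \<kappa> * (pi / 2 * \<bar>- A\<bar>)) +
       ((\<Sum>(b, B, \<kappa>)\<leftarrow>drop m lo. \<kappa> * (- (pi / 2) * \<bar>- B\<bar>)) + (\<Sum>(a, A, \<kappa>)\<leftarrow>drop n up. \<kappa> * (- (pi / 2) * \<bar>A\<bar>))))"
    unfolding ker by (intro vertical_growth_mult g1 g2 g3 g4) auto
  moreover have "(\<Sum>(b, B, \<kappa>)\<leftarrow>take m lo. \<kappa> * (Re b - 1/2)) + (\<Sum>(a, A, \<kappa>)\<leftarrow>take n up. \<kappa> * (Re (1 - a) - 1/2)) +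
       ((\<Sum>(b, B, \<kappa>)\<leftarrow>drop m lo. \<kappa> * (- (Re (1 - b) - 1/2))) + (\<Sum>(a, A, \<kappa>)\<leftarrow>drop n up. \<kappa> * (- (Re a - 1/2)))) = I_Omega up lo"
  proof -
    have 1: "(\<Sum>(b, B, \<kappa>)\<leftarrow>xs. \<kappa> * (Re b - 1/2)) = - (\<Sum>(b, B, \<kappa>)\<leftarrow>xs. (1/2 - Re b) * \<kappa>)"
      "(\<Sum>(b, B, \<kappa>)\<leftarrow>xs. \<kappa> * (- (Re (1 - b) - 1/2))) = - (\<Sum>(b, B, \<kappa>)\<leftarrow>xs. (1/2 - Re b) * \<kappa>)"
      "(\<Sum>(b, B, \<kappa>)\<leftarrow>xs. \<kappa> * (Re (1 - b) - 1/2)) = (\<Sum>(b, B, \<kappa>)\<leftarrow>xs. (1/2 - Re b) * \<kappa>)"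
      "(\<Sum>(b, B, \<kappa>)\<leftarrow>xs. \<kappa> * (- (Re b - 1/2))) = (\<Sum>(b, B, \<kappa>)\<leftarrow>xs. (1/2 - Re b) * \<kappa>)" for xs :: "triple list"
      by (induction xs) (auto simp: algebra_simps)
    show ?thesis
      unfolding 1 I_Omega_def sum_list_take_drop[where k = m and xs = lo, symmetric]
      sum_list_take_drop[where k = n and xs = up, symmetric] by simp
  qed
  moreover have "(\<Sum>(b, B, \<kappa>)\<leftarrow>take m lo. \<kappa> * (pi / 2 * \<bar>B\<bar>)) + (\<Sum>(a, A, \<kappa>)\<leftarrow>take n up. \<kappa> * (pi / 2 * \<bar>- A\<bar>)) +
       ((\<Sum>(b, B, \<kappa>)\<leftarrow>drop m lo. \<kappa> * (- (pi / 2) * \<bar>- B\<bar>)) + (\<Sum>(a, A, \<kappa>)\<leftarrow>drop n up. \<kappa> * (- (pi / 2) * \<bar>A\<bar>)))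
       = pi / 2 * I_Delta m n up lo"
  proof -
    have 1: "(\<Sum>(b, B, \<kappa>)\<leftarrow>xs. \<kappa> * (pi / 2 * \<bar>B\<bar>)) = pi / 2 * (\<Sum>(b, B, \<kappa>)\<leftarrow>xs. \<kappa> * B)"
      "(\<Sum>(b, B, \<kappa>)\<leftarrow>xs. \<kappa> * (pi / 2 * \<bar>- B\<bar>)) = pi / 2 * (\<Sum>(b, B, \<kappa>)\<leftarrow>xs. \<kappa> * B)"
      "(\<Sum>(b, B, \<kappa>)\<leftarrow>xs. \<kappa> * (- (pi / 2) * \<bar>- B\<bar>)) = - (pi / 2) * (\<Sum>(b, B, \<kappa>)\<leftarrow>xs. \<kappa> * B)"
      "(\<Sum>(b, B, \<kappa>)\<leftarrow>xs. \<kappa> * (- (pi / 2) * \<bar>B\<bar>)) = - (pi / 2) * (\<Sum>(b, B, \<kappa>)\<leftarrow>xs. \<kappa> * B)"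
      if "\<And>b B \<kappa>. (b, B, \<kappa>) \<in> set xs \<Longrightarrow> B > 0" for xs :: "triple list"
      using that by (induction xs) (fastforce simp: algebra_simps)+
    have s: "\<And>b B \<kappa>. (b, B, \<kappa>) \<in> set (take m lo) \<Longrightarrow> B > 0" "\<And>b B \<kappa>. (b, B, \<kappa>) \<in> set (drop m lo) \<Longrightarrow> B > 0"
      "\<And>b B \<kappa>. (b, B, \<kappa>) \<in> set (take n up) \<Longrightarrow> B > 0" "\<And>b B \<kappa>. (b, B, \<kappa>) \<in> set (drop n up) \<Longrightarrow> B > 0"
      using pos pos' by (fastforce dest: in_set_takeD in_set_dropD)+
    have "(\<Sum>(b, B, \<kappa>)\<leftarrow>take m lo. \<kappa> * (pi / 2 * \<bar>B\<bar>)) = pi / 2 * (\<Sum>(b, B, \<kappa>)\<leftarrow>take m lo. \<kappa> * B)"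
      by (rule 1(1)) (rule s(1))
    moreover have "(\<Sum>(a, A, \<kappa>)\<leftarrow>take n up. \<kappa> * (pi / 2 * \<bar>- A\<bar>)) = pi / 2 * (\<Sum>(a, A, \<kappa>)\<leftarrow>take n up. \<kappa> * A)"
      by (rule 1(2)) (rule s(3))
    moreover have "(\<Sum>(b, B, \<kappa>)\<leftarrow>drop m lo. \<kappa> * (- (pi / 2) * \<bar>- B\<bar>)) = - (pi / 2) * (\<Sum>(b, B, \<kappa>)\<leftarrow>drop m lo. \<kappa> * B)"
      by (rule 1(3)) (rule s(2))
    moreover have "(\<Sum>(a, A, \<kappa>)\<leftarrow>drop n up. \<kappa> * (- (pi / 2) * \<bar>A\<bar>)) = - (pi / 2) * (\<Sum>(a, A, \<kappa>)\<leftarrow>drop n up. \<kappa> * A)"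
      by (rule 1(4)) (rule s(4))
    ultimately show ?thesis unfolding I_Delta_def by (simp only: right_diff_distrib distrib_left mult_minus_left)
  qed
  ultimately show ?thesis by (simp only:)
qed

lemma measurable_prod_list:
  assumes "\<And>b B \<kappa>. (b, B, \<kappa>) \<in> set ys \<Longrightarrow> (\<lambda>\<tau>. F b B \<kappa> \<tau>) \<in> borel_measurable borel"
  shows "(\<lambda>\<tau>::real. \<Prod>(b, B, \<kappa>)\<leftarrow>ys. F b B \<kappa> \<tau> :: complex) \<in> borel_measurable borel"
  using assms
proof (induction ys)
  case (Cons y ys)
  obtain b B \<kappa> where y: "y = (b, B, \<kappa>)" by (cases y)
  have "(\<lambda>\<tau>. F b B \<kappa> \<tau> * (\<Prod>(b, B, \<kappa>)\<leftarrow>ys. F b B \<kappa> \<tau>)) \<in> borel_measurable borel"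
    using Cons y by (intro borel_measurable_times) auto
  then show ?case by (simp add: y)
qed simp

lemma I_kernel_measurable:
  assumes G: "gamma_power_branch G" and par: "I_parameters m n up lo"
  shows "(\<lambda>\<tau>. I_kernel G m n up lo (\<i> * of_real \<tau>)) \<in> borel_measurable borel"
proof -
  have pos: "A > 0" "\<kappa> > 0" if "(a, A, \<kappa>) \<in> set up" for a A \<kappa>
    using par that by (auto simp: I_parameters_def)
  have pos': "B > 0" "\<kappa> > 0" if "(b, B, \<kappa>) \<in> set lo" for b B \<kappa>
    using par that by (auto simp: I_parameters_def)
  have "(\<lambda>\<tau>. \<Prod>(b, B, \<kappa>)\<leftarrow>take m lo. G b B \<kappa> (\<i> * of_real \<tau>)) \<in> borel_measurable borel"
    by (intro measurable_prod_list gamma_power_branch_measurable G) (use pos' in \<open>fastforce dest: in_set_takeD\<close>)+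
  moreover have "(\<lambda>\<tau>. \<Prod>(b, B, \<kappa>)\<leftarrow>drop m lo. G (1 - b) (- B) \<kappa> (\<i> * of_real \<tau>)) \<in> borel_measurable borel"
    by (intro measurable_prod_list gamma_power_branch_measurable G) (use pos' in \<open>fastforce dest: in_set_dropD\<close>)+
  moreover have "(\<lambda>\<tau>. \<Prod>(a, A, \<kappa>)\<leftarrow>take n up. G (1 - a) (- A) \<kappa> (\<i> * of_real \<tau>)) \<in> borel_measurable borel"
    by (intro measurable_prod_list gamma_power_branch_measurable G) (use pos in \<open>fastforce dest: in_set_takeD\<close>)+
  moreover have "(\<lambda>\<tau>. \<Prod>(a, A, \<kappa>)\<leftarrow>drop n up. G a A \<kappa> (\<i> * of_real \<tau>)) \<in> borel_measurable borel"
    by (intro measurable_prod_list gamma_power_branch_measurable G) (use pos in \<open>fastforce dest: in_set_dropD\<close>)+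
  ultimately show ?thesis unfolding I_kernel_def by (intro borel_measurable_divide borel_measurable_times)
qed

lemma polynomial_exponential_bound:
  fixes r \<delta> w :: real
  assumes "\<delta> > 0"
  obtains K where "K > 0" "\<And>u. u \<ge> 0 \<Longrightarrow> (1 + u) powr r * exp (- \<delta> * u) \<le> K * (1 + u) powr w"
proof -
  define d where "d = max 1 (r - w)"
  define \<epsilon> where "\<epsilon> = \<delta> / d"
  have d: "d > 0" "r \<le> w + d" by (auto simp: d_def)
  have \<epsilon>: "\<epsilon> > 0" using assms d by (simp add: \<epsilon>_def)
  define K where "K = exp \<delta> / \<epsilon> powr d"
  have "(1 + u) powr r * exp (- \<delta> * u) \<le> K * (1 + u) powr w" if u: "u \<ge> 0" for u
  proof -
    have "\<epsilon> * (1 + u) \<le> exp (\<epsilon> * (1 + u))" using exp_ge_add_one_self[of "\<epsilon> * (1 + u)"] by linarith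
    then have "(\<epsilon> * (1 + u)) powr d \<le> exp (\<epsilon> * (1 + u)) powr d" using \<epsilon> u d by (intro powr_mono2) auto
    also have "exp (\<epsilon> * (1 + u)) powr d = exp (\<delta> * (1 + u))" using d by (simp add: exp_powr_real \<epsilon>_def)
    also have "\<dots> = exp \<delta> * exp (\<delta> * u)" by (simp add: distrib_left exp_add)
    also have "(\<epsilon> * (1 + u)) powr d = \<epsilon> powr d * (1 + u) powr d" using \<epsilon> u by (simp only: powr_mult)
    finally have "\<epsilon> powr d * (1 + u) powr d \<le> exp \<delta> * exp (\<delta> * u)" .
    then have "(1 + u) powr d * exp (- \<delta> * u) \<le> K"
      using \<epsilon> by (simp add: K_def field_simps exp_minus)
    note K = this
    have "(1 + u) powr r \<le> (1 + u) powr w * (1 + u) powr d"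
      using u d by (simp add: powr_mono flip: powr_add)
    then have "(1 + u) powr r * exp (- \<delta> * u) \<le> ((1 + u) powr w * (1 + u) powr d) * exp (- \<delta> * u)" by (rule mult_right_mono) simp
    also have "\<dots> = (1 + u) powr w * ((1 + u) powr d * exp (- \<delta> * u))" by (simp only: mult.assoc)
    also have "\<dots> \<le> (1 + u) powr w * K" using K by (rule mult_left_mono) simp
    finally show ?thesis by (simp only: mult.commute)
  qed
  moreover have "K > 0" using \<epsilon> by (simp add: K_def)
  ultimately show thesis using that by blast
qed

text \<open>
  The integrand of the I-function at a. Replacing a by a t^(-\<mu>) multiplies it by an oscillating power of t.
\<close>
definition I_integrand :: "branch_selector \<Rightarrow> nat \<Rightarrow> nat \<Rightarrow> triple list \<Rightarrow> triple list \<Rightarrow> real \<Rightarrow> complex \<Rightarrow> real \<Rightarrow> complex" where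
  "I_integrand G m n up lo \<theta> a \<tau> = I_kernel G m n up lo (\<i> * of_real \<tau>) *
     exp (- (\<i> * of_real \<tau>) * (of_real (ln (norm a)) + \<i> * of_real \<theta>))"

lemma I_integrand_measurable:
  assumes "gamma_power_branch G" "I_parameters m n up lo"
  shows "I_integrand G m n up lo \<theta> a \<in> borel_measurable borel"
proof -
  note [measurable] = I_kernel_measurable[OF assms]
  show ?thesis unfolding I_integrand_def[abs_def] by measurable
qed

text \<open>
  The argument \<theta> contributes exp (\<theta> \<tau>). If it does not use up the decay of the kernel, every power is admissible
  as a bound.
\<close>
lemma I_integrand_bound:
  assumes G: "gamma_power_branch G" and par: "I_parameters m n up lo"
    and w: "\<bar>\<theta>\<bar> < pi / 2 * I_Delta m n up lo \<or> (\<bar>\<theta>\<bar> = pi / 2 * I_Delta m n up lo \<and> I_Omega up lo \<le> w)"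
  obtains H where "\<And>\<tau>. norm (I_integrand G m n up lo \<theta> a \<tau>) \<le> H * (1 + \<bar>\<tau>\<bar>) powr w"
proof -
  define \<Omega> \<Delta> where "\<Omega> = I_Omega up lo" and "\<Delta> = I_Delta m n up lo"
  obtain M where M: "M > 0"
    "\<And>\<tau>. norm (I_kernel G m n up lo (\<i> * of_real \<tau>)) \<le> M * (1 + \<bar>\<tau>\<bar>) powr \<Omega> * exp (- (pi / 2 * \<Delta>) * \<bar>\<tau>\<bar>)"
    using I_kernel_growth[OF G par] unfolding vertical_growth_def \<Omega>_def \<Delta>_def by blast
  define \<delta> where "\<delta> = pi / 2 * \<Delta> - \<bar>\<theta>\<bar>"
  have b: "norm (I_integrand G m n up lo \<theta> a \<tau>) \<le> M * ((1 + \<bar>\<tau>\<bar>) powr \<Omega> * exp (- \<delta> * \<bar>\<tau>\<bar>))" for \<tau>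
  proof -
    have "\<theta> * \<tau> \<le> \<bar>\<theta>\<bar> * \<bar>\<tau>\<bar>" by (metis abs_ge_self abs_mult)
    then have "norm (exp (- (\<i> * of_real \<tau>) * (of_real (ln (norm a)) + \<i> * of_real \<theta>))) \<le> exp (\<bar>\<theta>\<bar> * \<bar>\<tau>\<bar>)"
      by (simp add: norm_exp_eq_Re algebra_simps)
    then have "norm (I_integrand G m n up lo \<theta> a \<tau>) \<le> (M * (1 + \<bar>\<tau>\<bar>) powr \<Omega> * exp (- (pi / 2 * \<Delta>) * \<bar>\<tau>\<bar>)) * exp (\<bar>\<theta>\<bar> * \<bar>\<tau>\<bar>)"
      unfolding I_integrand_def norm_mult using M by (intro mult_mono) auto
    also have "\<dots> = M * ((1 + \<bar>\<tau>\<bar>) powr \<Omega> * (exp (- (pi / 2 * \<Delta>) * \<bar>\<tau>\<bar>) * exp (\<bar>\<theta>\<bar> * \<bar>\<tau>\<bar>)))" by (simp only: mult.assoc)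
    also have "exp (- (pi / 2 * \<Delta>) * \<bar>\<tau>\<bar>) * exp (\<bar>\<theta>\<bar> * \<bar>\<tau>\<bar>) = exp (- \<delta> * \<bar>\<tau>\<bar>)"
      by (simp add: \<delta>_def algebra_simps flip: exp_add)
    finally show ?thesis .
  qed
  show thesis
  proof (cases "\<bar>\<theta>\<bar> < pi / 2 * \<Delta>")
    case True
    then have "\<delta> > 0" by (simp add: \<delta>_def)
    from polynomial_exponential_bound[OF this, of \<Omega> w] obtain K where
      K: "\<And>u. u \<ge> 0 \<Longrightarrow> (1 + u) powr \<Omega> * exp (- \<delta> * u) \<le> K * (1 + u) powr w" by blast
    show thesis
    proof (rule that[of "M * K"])
      fix \<tau>
      have "norm (I_integrand G m n up lo \<theta> a \<tau>) \<le> M * (K * (1 + \<bar>\<tau>\<bar>) powr w)"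
        using b[of \<tau>] mult_left_mono[OF K[OF abs_ge_zero[of \<tau>]] less_imp_le[OF M(1)]] by linarith
      then show "norm (I_integrand G m n up lo \<theta> a \<tau>) \<le> M * K * (1 + \<bar>\<tau>\<bar>) powr w" by (simp only: mult.assoc)
    qed
  next
    case False
    then have "\<delta> = 0" "\<Omega> \<le> w" using w by (auto simp: \<delta>_def \<Delta>_def \<Omega>_def)
    show thesis
    proof (rule that[of M])
      fix \<tau>
      have "M * (1 + \<bar>\<tau>\<bar>) powr \<Omega> \<le> M * (1 + \<bar>\<tau>\<bar>) powr w"
        using \<open>\<Omega> \<le> w\<close> M(1) by (intro mult_left_mono powr_mono) auto
      then show "norm (I_integrand G m n up lo \<theta> a \<tau>) \<le> M * (1 + \<bar>\<tau>\<bar>) powr w"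
        using b[of \<tau>] \<open>\<delta> = 0\<close> by simp
    qed
  qed
qed

lemma I_function_power:
  assumes a: "a \<noteq> 0" and t: "t > 0"
  shows "I_function G m n up lo \<theta> (a * of_real (t powr (- \<mu>))) =
    1 / (2 * of_real pi) * (LINT \<tau>|lborel. I_integrand G m n up lo \<theta> a \<tau> * exp (\<i> * of_real (\<mu> * \<tau>) * of_real (ln t)))"
proof -
  have l: "ln (norm (a * of_real (t powr (- \<mu>)))) = ln (norm a) - \<mu> * ln t"
    using a t by (simp add: norm_mult ln_mult ln_powr)
  have eq: "I_kernel G m n up lo (\<i> * of_real \<tau>) * exp (- (\<i> * of_real \<tau>) * (of_real (ln (norm (a * of_real (t powr (- \<mu>))))) + \<i> * of_real \<theta>)) * \<i>
      = (I_integrand G m n up lo \<theta> a \<tau> * exp (\<i> * of_real (\<mu> * \<tau>) * of_real (ln t))) * \<i>" for \<tau>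
  proof -
    have "- (\<i> * of_real \<tau>) * (of_real (ln (norm a) - \<mu> * ln t) + \<i> * of_real \<theta>) =
        - (\<i> * of_real \<tau>) * (of_real (ln (norm a)) + \<i> * of_real \<theta>) + \<i> * of_real (\<mu> * \<tau>) * of_real (ln t)"
      by (simp add: algebra_simps)
    then show ?thesis unfolding l I_integrand_def by (simp only: exp_add mult.assoc)
  qed
  show ?thesis unfolding I_function_def eq by simp
qed


section \<open>The fractional derivative of the I-function\<close>

text \<open>
  The additional triples have exponent 1, for which the branch is Gamma itself. The three upper ones are put in
  front, hence into the numerator, and the three lower ones at the end, hence into the denominator.
\<close>
lemma I_kernel_extend:
  fixes \<mu> :: real and c1 c2 c3 d1 d2 d3 :: complex
  assumes G: "gamma_power_branch G" and \<mu>: "\<mu> > 0" and s: "Re s = 0" and m: "m \<le> length lo"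
    and U: "U = [(1 - c1, \<mu>, 1), (1 - c2, \<mu>, 1), (1 - c3, \<mu>, 1)] @ up"
    and L: "L = lo @ [(1 - d1, \<mu>, 1), (1 - d2, \<mu>, 1), (1 - d3, \<mu>, 1)]"
  shows "I_kernel G m (n + 3) U L s = I_kernel G m n up lo s *
    (Gamma (c1 - of_real \<mu> * s) * Gamma (c2 - of_real \<mu> * s) * Gamma (c3 - of_real \<mu> * s) *
     (rGamma (d1 - of_real \<mu> * s) * rGamma (d2 - of_real \<mu> * s) * rGamma (d3 - of_real \<mu> * s)))"
proof -
  have g: "G (1 - (1 - c)) (- \<mu>) 1 s = Gamma (c - of_real \<mu> * s)" for c
    using gamma_power_branch_one[OF G _ s, of "- \<mu>" "1 - (1 - c)"] \<mu> by simp
  have l: "take (n + 3) U = [(1 - c1, \<mu>, 1), (1 - c2, \<mu>, 1), (1 - c3, \<mu>, 1)] @ take n up"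
    "drop (n + 3) U = drop n up" "take m L = take m lo"
    "drop m L = drop m lo @ [(1 - d1, \<mu>, 1), (1 - d2, \<mu>, 1), (1 - d3, \<mu>, 1)]"
    using m by (simp_all add: U L numeral_3_eq_3)
  have lists: "(\<Prod>(a, A, \<kappa>)\<leftarrow>take (n + 3) U. G (1 - a) (- A) \<kappa> s) =
      (Gamma (c1 - of_real \<mu> * s) * Gamma (c2 - of_real \<mu> * s) * Gamma (c3 - of_real \<mu> * s)) * (\<Prod>(a, A, \<kappa>)\<leftarrow>take n up. G (1 - a) (- A) \<kappa> s)"
    "(\<Prod>(b, B, \<kappa>)\<leftarrow>drop m L. G (1 - b) (- B) \<kappa> s) = (\<Prod>(b, B, \<kappa>)\<leftarrow>drop m lo. G (1 - b) (- B) \<kappa> s) *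
      (Gamma (d1 - of_real \<mu> * s) * Gamma (d2 - of_real \<mu> * s) * Gamma (d3 - of_real \<mu> * s))"
    unfolding l map_append prod_list.append list.map prod_list.Cons prod_list.Nil case_prod_conv g by (simp_all only: mult_ac mult_1_right mult_1_left)
  show ?thesis
    unfolding I_kernel_def lists l(2,3) rGamma_inverse_Gamma
    by (simp only: divide_inverse inverse_mult_distrib mult_ac)
qed

text \<open>
  Pfaff's transformation with t / x in place of t; the factor (t / x)^(-A') is split between x and t.
\<close>
lemma MSM_integrand_eq:
  fixes x t :: real
  assumes "0 < x" "x < t" "Re C > 0"
  shows "of_real (t - x) powr (C - 1) * of_real t powr (- A) * appell_F3 A A' B B' C (of_real (1 - x / t)) (of_real (1 - t / x)) =
    of_real x powr A' * MSM_kernel x A A' B B' C t"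
proof -
  have T: "1 < t / x" "1 / (t / x) = x / t" using assms by (auto simp: field_simps)
  have "appell_F3 A A' B B' C (of_real (1 - x / t)) (of_real (1 - t / x)) =
      of_real (t / x) powr (- A') * F3_Pfaff A A' B B' C (of_real (1 - x / t))"
    using appell_F3_eq[OF assms(3) T(1)] unfolding T(2) .
  moreover have "of_real (t / x) powr (- A') = of_real x powr A' * complex_of_real t powr (- A')"
  proof -
    have "t / x > 0" "t > 0" using assms by auto
    then show ?thesis using assms
      by (simp only: of_real_powr_exp ln_div) (simp add: algebra_simps flip: exp_add)
  qed
  moreover have "complex_of_real t powr (- (A + A')) = of_real t powr (- A) * of_real t powr (- A')"
    by (simp flip: powr_add)
  ultimately show ?thesis unfolding MSM_kernel_def by (simp only: mult_ac)
qed

theorem theorem5p2: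
  fixes \<alpha> \<alpha>' \<beta> \<beta>' \<gamma> \<rho> a :: complex
    and \<mu> \<theta> x :: real
    and m n N :: nat
    and up lo :: "triple list"
    and G :: branch_selector
    and f :: "real \<Rightarrow> complex"
  assumes "Re \<gamma> > 0"
    and "N = Caputo_order \<gamma>"
    and "a \<noteq> 0" and "a = of_real (norm a) * cis \<theta>"
    and "\<mu> > 0"
    and "Re \<rho> + real N > Max {Re (-\<beta>'), Re (\<alpha>' + \<beta> - \<gamma>), Re (\<alpha> + \<alpha>' - \<gamma>) + real N}"
    and "gamma_power_branch G"
    and "I_parameters m n up lo"
    and U: "U = [(1 - \<beta>' - \<rho> - of_nat N, \<mu>, 1),
                 (1 + \<alpha> + \<alpha>' - \<gamma> - \<rho>, \<mu>, 1),
                 (1 + \<alpha>' + \<beta> - \<gamma> - \<rho> - of_nat N, \<mu>, 1)] @ up"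
    and L: "L = lo @ [(1 - \<rho>, \<mu>, 1),
                 (1 + \<alpha>' - \<beta>' - \<rho> - of_nat N, \<mu>, 1),
                 (1 + \<alpha> + \<alpha>' + \<beta> - \<gamma> - \<rho> - of_nat N, \<mu>, 1)]"
    and "I_convergent m n up lo \<theta>"
    and "I_convergent m (n + 3) U L \<theta>"
    and f: "f = (\<lambda>t. of_real t powr (-\<rho>) *
                   I_function G m n up lo \<theta> (a * of_real (t powr (-\<mu>))))"
    and "\<bar>\<theta>\<bar> = pi / 2 * I_Delta m n up lo \<Longrightarrow> times_differentiable N f"
    and "x > 0"
  shows "MSM_Caputo_right_derivative \<alpha> \<alpha>' \<beta> \<beta>' \<gamma> f x =
           of_real x powr (\<alpha> + \<alpha>' - \<gamma> - \<rho>) *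
           I_function G m (n + 3) U L \<theta> (a * of_real (x powr (-\<mu>)))"
proof -
  note G = assms(7) and par = assms(8) and x = assms(15) and \<mu> = assms(5) and a0 = assms(3)
  have N: "Re \<gamma> < real N" "real N \<le> Re \<gamma> + 1" "N \<ge> 1"
    using assms(1) unfolding assms(2) Caputo_order_def by linarith+
  define N1 where "N1 = N - 1"
  have N1: "N = Suc N1" using N(3) by (simp add: N1_def)
  have conds: "- Re \<beta>' < Re \<rho> + real N" "Re (\<alpha>' + \<beta> - \<gamma>) < Re \<rho> + real N" "Re (\<alpha> + \<alpha>' - \<gamma>) < Re \<rho>"
    using assms(6) by auto
  \<comment> \<open>The parameters of the fractional integral by which the operator is defined.\<close>
  define A A' B B' C where "A = - \<alpha>'" and "A' = - \<alpha>" and "B = - \<beta>'" and "B' = - \<beta> + of_nat N" and "C = - \<gamma> + of_nat N"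
  note defs = A_def A'_def B_def B'_def C_def
  have C: "Re C > 0" "Re C \<le> 1" using N by (simp_all add: C_def)
  define z0 where "z0 = \<rho> + \<gamma> - \<alpha> - \<alpha>'"
  \<comment> \<open>The growth order s of the kernel must stay below Re z for the moments at z = z0 - \<i>\<mu>\<tau>; the three
    conditions of the hypothesis on \<rho> say exactly that there is room for such an s.\<close>
  define lb where "lb = max 0 (max (Re (A' - B')) (Re (A + A' + B - C)))"
  have "lb < Re z0" using conds by (simp add: lb_def z0_def defs)
  then obtain s where s: "lb < s" "s < Re z0" using dense by blast
  have growth: "F3_growth A A' B B' C s" using s(1) by (auto simp: F3_growth_def lb_def)

  have par_m: "m \<le> length lo" using par by (simp add: I_parameters_def)
  have Omega: "I_Omega U L = I_Omega up lo + Re \<gamma>"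
    unfolding U L I_Omega_def by (simp add: algebra_simps)
  have Delta: "I_Delta m (n + 3) U L = I_Delta m n up lo"
    using par_m unfolding U L I_Delta_def by (simp add: numeral_3_eq_3)
  define interior where "interior \<longleftrightarrow> \<bar>\<theta>\<bar> < pi / 2 * I_Delta m n up lo"
  have boundary: "\<bar>\<theta>\<bar> = pi / 2 * I_Delta m n up lo" "I_Omega up lo < - 1 - Re \<gamma>" if "\<not> interior"
    using assms(11,12) that unfolding I_convergent_def Omega Delta interior_def Let_def by auto
  \<comment> \<open>In the interior case the decay is exponential and any exponent may be chosen; this one admits N derivatives.\<close>
  define w where "w = (if interior then - 2 - real N else I_Omega up lo)"
  have w: "w < - 1 - Re \<gamma>" using boundary(2) N by (simp add: w_def)
  obtain H where H: "\<And>\<tau>. norm (I_integrand G m n up lo \<theta> a \<tau>) \<le> H * (1 + \<bar>\<tau>\<bar>) powr w"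
    by (rule I_integrand_bound[OF G par, of \<theta> w a]) (use boundary(1) in \<open>auto simp: w_def interior_def\<close>)

  define \<psi> where "\<psi> = (\<lambda>\<tau>. 1 / (2 * of_real pi) * I_integrand G m n up lo \<theta> a \<tau>)"
  have \<psi>_meas [measurable]: "\<psi> \<in> borel_measurable borel"
    unfolding \<psi>_def using I_integrand_measurable[OF G par] by measurable
  have \<psi>_bound: "norm (\<psi> \<tau>) \<le> H * (1 + \<bar>\<tau>\<bar>) powr w" for \<tau>
  proof -
    have "norm (\<psi> \<tau>) = (1 / (2 * pi)) * norm (I_integrand G m n up lo \<theta> a \<tau>)" by (simp add: \<psi>_def norm_mult norm_divide)
    also have "\<dots> \<le> 1 * norm (I_integrand G m n up lo \<theta> a \<tau>)"
      using pi_gt3 by (intro mult_right_mono) (auto simp: field_simps)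
    finally show ?thesis using H[of \<tau>] by simp
  qed
  have f_eq: "f t = power_superposition \<psi> \<rho> \<mu> 0 t" if t: "t > 0" for t
  proof -
    have "f t = (LINT \<tau>|lborel. exp (- \<rho> * of_real (ln t)) * (1 / (2 * of_real pi) * (I_integrand G m n up lo \<theta> a \<tau> * exp (\<i> * of_real (\<mu> * \<tau>) * of_real (ln t)))))"
      unfolding f I_function_power[OF a0 t] of_real_powr_exp[OF t] integral_mult_right_zero ..
    also have "\<dots> = power_superposition \<psi> \<rho> \<mu> 0 t"
      unfolding power_superposition_def \<psi>_def
    proof (intro Bochner_Integration.integral_cong refl)
      fix \<tau>
      have "(- \<rho> - of_nat 0 + \<i> * of_real (\<mu> * \<tau>)) * of_real (ln t) = - \<rho> * of_real (ln t) + \<i> * of_real (\<mu> * \<tau>) * of_real (ln t)"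
        by (simp add: algebra_simps)
      then have "exp ((- \<rho> - of_nat 0 + \<i> * of_real (\<mu> * \<tau>)) * of_real (ln t)) = exp (- \<rho> * of_real (ln t)) * exp (\<i> * of_real (\<mu> * \<tau>) * of_real (ln t))"
        by (simp only: exp_add)
      then show "exp (- \<rho> * of_real (ln t)) * (1 / (2 * of_real pi) * (I_integrand G m n up lo \<theta> a \<tau> * exp (\<i> * of_real (\<mu> * \<tau>) * of_real (ln t)))) =
        1 / (2 * of_real pi) * I_integrand G m n up lo \<theta> a \<tau> * ((-1) ^ 0 * pochhammer (\<rho> - \<i> * of_real (\<mu> * \<tau>)) 0) *
        exp ((- \<rho> - of_nat 0 + \<i> * of_real (\<mu> * \<tau>)) * of_real (ln t))"
        by (simp only: power_0 pochhammer_0 mult_1_right mult_1_left mult_ac)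
    qed
    finally show ?thesis .
  qed
  have nth: "nth_derivative N1 f t = power_superposition \<psi> \<rho> \<mu> N1 t" if "t > 0" for t
    using w N N1 that by (intro nth_derivative_superposition[OF \<psi>_meas \<psi>_bound f_eq]) auto
  \<comment> \<open>In the interior case the N-th differentiation can be carried out under the integral; on the boundary the
    existence of the N-th derivative is part of the hypotheses.\<close>
  have diff: "nth_derivative N1 f differentiable (at t)" if t: "t > 0" for t
  proof (cases interior)
    case True
    then have "w + real (Suc N1) < -1" using N1 by (simp add: w_def)
    from power_superposition_deriv[OF \<psi>_meas \<psi>_bound this t, of \<rho> \<mu>]
    have "(nth_derivative N1 f has_vector_derivative power_superposition \<psi> \<rho> \<mu> (Suc N1) t) (at t)"
      by (rule has_vector_derivative_transform_within_open[where S = "{0<..}"]) (use nth t in auto)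
    then show ?thesis by (rule differentiableI_vector)
  next
    case False
    then show ?thesis using assms(14)[OF boundary(1)] t N1 by (auto simp: times_differentiable_def)
  qed
  have deriv: "(power_superposition \<psi> \<rho> \<mu> N1 has_vector_derivative nth_derivative N f t) (at t)" if t: "t > 0" for t
  proof -
    have "(nth_derivative N1 f has_vector_derivative vector_derivative (nth_derivative N1 f) (at t)) (at t)"
      using diff[OF t] by (simp add: vector_derivative_works)
    then have "(power_superposition \<psi> \<rho> \<mu> N1 has_vector_derivative vector_derivative (nth_derivative N1 f) (at t)) (at t)"
      by (rule has_vector_derivative_transform_within_open[where S = "{0<..}"]) (use nth t in auto)
    moreover have "nth_derivative N f t = vector_derivative (nth_derivative N1 f) (at t)"
      by (simp add: N1 nth_derivative_def)
    ultimately show ?thesis by simp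
  qed

  define h where "h = (\<lambda>\<tau>. \<psi> \<tau> * ((-1) ^ N1 * pochhammer (\<rho> - \<i> * of_real (\<mu> * \<tau>)) N1))"
  obtain H1 where h: "h \<in> borel_measurable borel" "\<And>\<tau>. norm (h \<tau>) \<le> H1 * (1 + \<bar>\<tau>\<bar>) powr (w + real N1)"
    unfolding h_def by (rule power_superposition_weight[OF \<psi>_meas \<psi>_bound]) blast
  define \<sigma> where "\<sigma> = \<rho> + of_nat N"
  define q where "q = s - Re (A + A')"
  define K where "K = MSM_kernel x A A' B B' C"
  define K' where "K' = MSM_kernel_deriv x A A' B B' C"
  obtain M where M:
    "\<And>t. t > x \<Longrightarrow> norm (K t) \<le> M * ((t - x) powr (Re C - 1) * t powr q)"
    "\<And>t. t > x \<Longrightarrow> norm (K' t) \<le> M * ((t - x) powr (Re C - 2) * t powr q)"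
    unfolding K_def K'_def q_def by (rule MSM_kernel_bounds[OF x C(1) growth]) blast
  interpret O: oscillatory_superposition x "Re C" q \<mu> \<sigma> K K' M h H1 "w + real N1"
  proof
    show "Re C + q < Re \<sigma>" using s(2) by (simp add: q_def \<sigma>_def z0_def defs)
    show "w + real N1 < Re C - 2" using w N1 by (simp add: C_def)
    show "(K has_vector_derivative K' t) (at t)" if "x < t" for t
      unfolding K_def K'_def using MSM_kernel_has_derivative[OF x C(1) that] .
    show "continuous_on {x<..} K'" unfolding K'_def by (rule MSM_kernel_deriv_continuous[OF x C(1)])
  qed (use x C \<mu> M h in auto)
  have Og: "O.g t = power_superposition \<psi> \<rho> \<mu> N1 t" for t
    unfolding O.g_def O.E_def O.e_def power_superposition_def unfolding h_def \<sigma>_def N1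
    by (intro Bochner_Integration.integral_cong refl) (simp add: algebra_simps)
  have Oderiv: "(O.g has_vector_derivative nth_derivative N f t) (at t)" if "t > x" for t
    using deriv[of t] that x by (simp add: Og[abs_def])
  have HK: "((\<lambda>t. K t * nth_derivative N f t) has_integral O.Phi {x<..}) {x<..}"
    by (rule O.has_integral_superposition[OF Oderiv])

  have "((\<lambda>t. of_real x powr A' * (K t * nth_derivative N f t)) has_integral of_real x powr A' * O.Phi {x<..}) {x<..}"
    by (rule has_integral_mult_right[OF HK])
  then have "((\<lambda>t. of_real (t - x) powr (C - 1) * of_real t powr (- A) *
      appell_F3 A A' B B' C (of_real (1 - x / t)) (of_real (1 - t / x)) * nth_derivative N f t) has_integral
      of_real x powr A' * O.Phi {x<..}) {x<..}"
    by (rule has_integral_eq[rotated]) (simp only: greaterThan_iff MSM_integrand_eq[OF x _ C(1)] K_def mult.assoc[symmetric])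
  then have I: "MSM_right_integral A A' B B' C (nth_derivative N f) x =
      of_real x powr (- A') / Gamma C * (of_real x powr A' * O.Phi {x<..})"
    unfolding MSM_right_integral_def by (simp only: integral_unique)
  have "complex_of_real x powr (- A') * of_real x powr A' = 1"
    using x by (simp add: powr_minus)
  then have "MSM_right_integral A A' B B' C (nth_derivative N f) x = O.Phi {x<..} / Gamma C"
    unfolding I by (metis (no_types, lifting) mult.assoc mult.commute mult_1 times_divide_eq_left)
  then have lhs: "MSM_Caputo_right_derivative \<alpha> \<alpha>' \<beta> \<beta>' \<gamma> f x = (-1) ^ N / Gamma C * O.Phi {x<..}"
    unfolding MSM_Caputo_right_derivative_def Let_def assms(2)[symmetric] defs[symmetric] by simp

  \<comment> \<open>For each \<tau>, the multipliers of the N-th derivative and of the fractional integral combine to the six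
    additional Gamma factors. The Pochhammer symbol turns Gamma (\<rho> + N - \<i>\<mu>\<tau>) in the denominator into
    Gamma (\<rho> - \<i>\<mu>\<tau>).\<close>
  have point: "(-1) ^ N / Gamma C * (h \<tau> * ((O.e \<tau> + 1) * O.J {x<..} \<tau>)) =
      of_real x powr (\<alpha> + \<alpha>' - \<gamma> - \<rho>) * (1 / (2 * of_real pi) *
        (I_integrand G m (n + 3) U L \<theta> a \<tau> * exp (\<i> * of_real (\<mu> * \<tau>) * of_real (ln x))))" for \<tau>
  proof -
    define i\<mu> where "i\<mu> = \<i> * complex_of_real (\<mu> * \<tau>)"
    define z where "z = z0 - i\<mu>"
    have sz: "s < Re z" using s(2) by (simp add: z_def i\<mu>_def)
    have e: "O.e \<tau> = - (z + C - A - A')" unfolding O.e_def by (simp add: z_def z0_def i\<mu>_def \<sigma>_def defs)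
    have "O.J {x<..} \<tau> = (LINT t:{x<..}|lborel. MSM_kernel x A A' B B' C t * of_real t powr (- (z + C - A - A')))"
      unfolding O.J_def O.k_def e unfolding K_def using x
      by (intro set_lebesgue_integral_cong) (auto simp: of_real_powr_exp)
    then have J: "O.J {x<..} \<tau> = of_real x powr (- z) * F3_moment_value A A' B B' C z"
      using MSM_kernel_moment[OF x C(1) growth sz] by simp
    have e1: "O.e \<tau> + 1 = - (\<rho> - i\<mu> + of_nat N1)"
      unfolding O.e_def by (simp add: \<sigma>_def N1 i\<mu>_def)
    have GC: "Gamma C \<noteq> 0" using Re_pos_not_nonpos_Int[OF C(1)] by (simp add: Gamma_eq_zero_iff)
    have poch: "(-1) ^ N * (h \<tau> * (O.e \<tau> + 1)) = \<psi> \<tau> * pochhammer (\<rho> - i\<mu>) N"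
    proof -
      have "(-1) ^ Suc N1 * (u * ((-1) ^ N1 * v) * - r) = u * (v * r)" for u v r :: complex
        by (simp add: mult_ac flip: power_add mult_2)
      then show ?thesis unfolding h_def e1 i\<mu>_def[symmetric] N1 pochhammer_Suc .
    qed
    have args: "z + C - A - A' = \<rho> - i\<mu> + of_nat N" "z = \<gamma> + \<rho> - \<alpha> - \<alpha>' - i\<mu>" "z - A' + B' = \<gamma> + \<rho> + of_nat N - \<alpha>' - \<beta> - i\<mu>"
      "z - A - A' - B + C = \<beta>' + \<rho> + of_nat N - i\<mu>" "z + B' = \<gamma> + \<rho> + of_nat N - \<alpha> - \<alpha>' - \<beta> - i\<mu>"
      "z + C - A' - B = \<beta>' + \<rho> + of_nat N - \<alpha>' - i\<mu>"
      by (simp_all add: z_def z0_def defs)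
    define R where "R = Gamma (\<beta>' + \<rho> + of_nat N - i\<mu>) * Gamma (\<gamma> + \<rho> - \<alpha> - \<alpha>' - i\<mu>) * Gamma (\<gamma> + \<rho> + of_nat N - \<alpha>' - \<beta> - i\<mu>) *
      (rGamma (\<rho> - i\<mu>) * rGamma (\<beta>' + \<rho> + of_nat N - \<alpha>' - i\<mu>) * rGamma (\<gamma> + \<rho> + of_nat N - \<alpha> - \<alpha>' - \<beta> - i\<mu>))"
    have mom: "pochhammer (\<rho> - i\<mu>) N * F3_moment_value A A' B B' C z = Gamma C * R"
    proof -
      have "F3_moment_value A A' B B' C z = Gamma C * Gamma z * Gamma (z - A' + B') * Gamma (z - A - A' - B + C) *
         rGamma (\<rho> - i\<mu> + of_nat N) * rGamma (z + B') * rGamma (z + C - A' - B)"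
        unfolding F3_moment_value_def args(1) ..
      then have "pochhammer (\<rho> - i\<mu>) N * F3_moment_value A A' B B' C z = Gamma C * Gamma z * Gamma (z - A' + B') * Gamma (z - A - A' - B + C) *
         (pochhammer (\<rho> - i\<mu>) N * rGamma (\<rho> - i\<mu> + of_nat N)) * rGamma (z + B') * rGamma (z + C - A' - B)"
        by (simp only: mult_ac)
      then show ?thesis
        unfolding pochhammer_rGamma[symmetric] args(3-6) unfolding args(2) R_def by (simp only: mult_ac)
    qed
    have ker: "I_kernel G m (n + 3) U L (\<i> * of_real \<tau>) = I_kernel G m n up lo (\<i> * of_real \<tau>) * R"
    proof -
      have i: "complex_of_real \<mu> * (\<i> * of_real \<tau>) = i\<mu>" by (simp add: i\<mu>_def)
      have "I_kernel G m (n + 3) U L (\<i> * of_real \<tau>) = I_kernel G m n up lo (\<i> * of_real \<tau>) *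
        (Gamma (\<beta>' + \<rho> + of_nat N - of_real \<mu> * (\<i> * of_real \<tau>)) * Gamma (\<gamma> + \<rho> - \<alpha> - \<alpha>' - of_real \<mu> * (\<i> * of_real \<tau>)) *
         Gamma (\<gamma> + \<rho> + of_nat N - \<alpha>' - \<beta> - of_real \<mu> * (\<i> * of_real \<tau>)) *
         (rGamma (\<rho> - of_real \<mu> * (\<i> * of_real \<tau>)) * rGamma (\<beta>' + \<rho> + of_nat N - \<alpha>' - of_real \<mu> * (\<i> * of_real \<tau>)) *
          rGamma (\<gamma> + \<rho> + of_nat N - \<alpha> - \<alpha>' - \<beta> - of_real \<mu> * (\<i> * of_real \<tau>))))"
        by (rule I_kernel_extend[OF G \<mu> _ par_m]) (simp_all add: U L algebra_simps)
      then show ?thesis unfolding i R_def .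
    qed
    have "(-1) ^ N / Gamma C * (h \<tau> * ((O.e \<tau> + 1) * O.J {x<..} \<tau>)) =
        (1 / Gamma C) * ((-1) ^ N * (h \<tau> * (O.e \<tau> + 1))) * (of_real x powr (- z) * F3_moment_value A A' B B' C z)"
      unfolding J by (simp add: mult_ac)
    also have "\<dots> = (1 / Gamma C) * (\<psi> \<tau> * of_real x powr (- z)) * (pochhammer (\<rho> - i\<mu>) N * F3_moment_value A A' B B' C z)"
      unfolding poch by (simp only: mult_ac)
    also have "\<dots> = \<psi> \<tau> * of_real x powr (- z) * R" unfolding mom using GC by simp
    also have "of_real x powr (- z) = of_real x powr (\<alpha> + \<alpha>' - \<gamma> - \<rho>) * exp (i\<mu> * of_real (ln x))"
    proof -
      have "- z = (\<alpha> + \<alpha>' - \<gamma> - \<rho>) + i\<mu>" by (simp add: z_def z0_def)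
      then show ?thesis by (simp only: powr_add) (simp only: of_real_powr_exp[OF x])
    qed
    finally show ?thesis
      unfolding \<psi>_def I_integrand_def ker i\<mu>_def[symmetric] by (simp only: mult_ac)
  qed
  have "(-1) ^ N / Gamma C * O.Phi {x<..} = (LINT \<tau>|lborel. (-1) ^ N / Gamma C * (h \<tau> * ((O.e \<tau> + 1) * O.J {x<..} \<tau>)))"
    unfolding O.Phi_def integral_mult_right_zero ..
  also have "\<dots> = of_real x powr (\<alpha> + \<alpha>' - \<gamma> - \<rho>) * I_function G m (n + 3) U L \<theta> (a * of_real (x powr (-\<mu>)))"
    unfolding point I_function_power[OF a0 x] integral_mult_right_zero ..
  finally show ?thesis unfolding lhs .
qed

end
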